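(* Let $0<p<1$ and $0<q\le2$. Then $(H^{p,q},BMOA)=(H^p)^*=(H^{p,\infty},\mathcal{B})$.
   Context: $\mathbb{D}$ is the open unit disk, $\mathbb{T}$ its boundary, $m$ normalized Lebesgue measure on $\mathbb{T}$, $H(\mathbb{D})$ the analytic functions on $\mathbb{D}$, $H^p$ the usual Hardy space on $\mathbb{D}$. $W$ is the space of complex sequences indexed by $\mathbb{N}_0=\{0,1,2,\dots\}$; $f(z)=\sum a_nz^n\in H(\mathbb{D})$ is identified with $\{a_n\}\in W$. For vector subspaces $E,X$ of $W$, $(E,X)=\{\lambda\in W:\{\lambda_nw_n\}\in X\text{ for all }w\in E\}$. $(H^p)^*$ is the space of continuous linear functionals on $H^p$, regarded as a subspace of $W$ by identifying $\varphi\in(H^p)^*$ with the sequence $\{\varphi(u_n)\}$, $u_n(z)=z^n$. Hardy-Lorentz spaces: for measurable $f$ on $\mathbb{T}$ let $\lambda_f(s)=m(\{|f|>s\})$, $f^*(s)=\inf\{t\ge0:\lambda_f(t)\le s\}$, $\|f\|_{p,q}=(\int_0^1[f^*(s)s^{1/p}]^q\frac{ds}{s})^{1/q}$ for $0<q<\infty$ and $\|f\|_{p,\infty}=\sup_{s>0}f^*(s)s^{1/p}$. The Smirnov class $N^+$ consists of $f\in H(\mathbb{D})$ in the Nevanlinna class with $\lim_{r\to1^-}\int_{\mathbb{T}}\log^+|f(rz)|\,dm=\int_{\mathbb{T}}\log^+|f|\,dm$, where $f$ on $\mathbb{T}$ is the nontangential boundary function. $H^{p,q}$ is the set of $f\in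 N^+$ with $\|f\|_{p,q}<\infty$ for the boundary function. $BMOA$ is the space of $f\in H^1$ whose boundary function satisfies $\sup_I m(I)^{-1}\int_I|f-f_I|\,dm<\infty$, the supremum over subintervals (arcs) $I\subset\mathbb{T}$, with $f_I=m(I)^{-1}\int_If\,dm$. The Bloch space is $\mathcal{B}=\{f\in H(\mathbb{D}):\sup_{z\in\mathbb{D}}(1-|z|)|f^{[1]}(z)|<\infty\}$, where $f^{[1]}(z)=\sum(n+1)a_nz^n$ for $f=\sum a_nz^n$. *)

theory Defs
  imports "HOL-Complex_Analysis.Complex_Analysis" "HOL-Probability.Probability"
begin

text \<open>
  Elements of \<open>H(D)\<close> are total functions \<open>complex \<Rightarrow> complex\<close> holomorphic on \<open>ball 0 1\<close>; their values
  outside the open disk are arbitrary and no definition below depends on them. The space \<open>W\<close> is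
  the type \<open>nat \<Rightarrow> complex\<close>.
\<close>

definition H_disk :: "(complex \<Rightarrow> complex) set" where
  "H_disk = {f. f holomorphic_on ball 0 1}"

definition taylor_seq :: "(complex \<Rightarrow> complex) \<Rightarrow> nat \<Rightarrow> complex" where
  "taylor_seq f = fps_nth (fps_expansion f 0)"

definition seq_space :: "(complex \<Rightarrow> complex) set \<Rightarrow> (nat \<Rightarrow> complex) set" where
  "seq_space E = taylor_seq ` E"

definition multipliers :: "(nat \<Rightarrow> complex) set \<Rightarrow> (nat \<Rightarrow> complex) set \<Rightarrow> (nat \<Rightarrow> complex) set" where
  "multipliers E X = {l. \<forall>w\<in>E. (\<lambda>n. l n * w n) \<in> X}"

definition circle_measure :: "complex measure" where
  "circle_measure =
     completion (distr (uniform_measure lborel {0..<2*pi}) (restrict_space borel (sphere 0 1)) cis)"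

subsection \<open>Boundary functions\<close>

definition stolz_region :: "real \<Rightarrow> complex \<Rightarrow> complex set" where
  "stolz_region \<alpha> \<zeta> = {z \<in> ball 0 1. cmod (\<zeta> - z) < \<alpha> * (1 - cmod z)}"

definition has_nontangential_limit :: "(complex \<Rightarrow> complex) \<Rightarrow> complex \<Rightarrow> complex \<Rightarrow> bool" where
  "has_nontangential_limit f \<zeta> L \<longleftrightarrow> (\<forall>\<alpha>>1. (f \<longlongrightarrow> L) (at \<zeta> within stolz_region \<alpha> \<zeta>))"

text \<open>
  The value 0 is used where the nontangential limit fails to exist; for functions in the
  Nevanlinna class this happens only on a null set.
\<close>
definition boundary_fun :: "(complex \<Rightarrow> complex) \<Rightarrow> complex \<Rightarrow> complex" where
  "boundary_fun f \<zeta> =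
     (if \<exists>L. has_nontangential_limit f \<zeta> L then THE L. has_nontangential_limit f \<zeta> L else 0)"

subsection \<open>Hardy spaces and their duals\<close>

definition hardy_mean :: "real \<Rightarrow> (complex \<Rightarrow> complex) \<Rightarrow> real \<Rightarrow> real" where
  "hardy_mean p f r = (LINT \<zeta>|circle_measure. cmod (f (of_real r * \<zeta>)) powr p)"

definition hardy :: "real \<Rightarrow> (complex \<Rightarrow> complex) set" where
  "hardy p = {f \<in> H_disk. bdd_above (hardy_mean p f ` {0..<1})}"

definition hardy_norm :: "real \<Rightarrow> (complex \<Rightarrow> complex) \<Rightarrow> real" where
  "hardy_norm p f = (SUP r\<in>{0..<1}. hardy_mean p f r) powr (1 / p)"

text \<open>
  Continuity forces a functional to agree on functions that coincide on the disk, as their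
  difference has norm 0.
\<close>
definition hardy_functional :: "real \<Rightarrow> ((complex \<Rightarrow> complex) \<Rightarrow> complex) \<Rightarrow> bool" where
  "hardy_functional p \<phi> \<longleftrightarrow>
     (\<forall>f\<in>hardy p. \<forall>g\<in>hardy p. \<phi> (\<lambda>z. f z + g z) = \<phi> f + \<phi> g) \<and>
     (\<forall>c. \<forall>f\<in>hardy p. \<phi> (\<lambda>z. c * f z) = c * \<phi> f) \<and>
     (\<forall>f\<in>hardy p. \<forall>\<epsilon>>0. \<exists>\<delta>>0. \<forall>g\<in>hardy p.
        hardy_norm p (\<lambda>z. g z - f z) < \<delta> \<longrightarrow> cmod (\<phi> g - \<phi> f) < \<epsilon>)"

definition hardy_dual :: "real \<Rightarrow> (nat \<Rightarrow> complex) set" where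
  "hardy_dual p = {(\<lambda>n. \<phi> (\<lambda>z. z ^ n)) | \<phi>. hardy_functional p \<phi>}"

subsection \<open>Hardy--Lorentz spaces\<close>

definition distribution_fun :: "(complex \<Rightarrow> complex) \<Rightarrow> real \<Rightarrow> real" where
  "distribution_fun f t = measure circle_measure {\<zeta> \<in> sphere 0 1. t < cmod (f \<zeta>)}"

definition rearrangement :: "(complex \<Rightarrow> complex) \<Rightarrow> real \<Rightarrow> real" where
  "rearrangement f s = Inf {t. 0 \<le> t \<and> distribution_fun f t \<le> s}"

definition lorentz_norm :: "real \<Rightarrow> ereal \<Rightarrow> (complex \<Rightarrow> complex) \<Rightarrow> ennreal" where
  "lorentz_norm p q f =
     (if q = \<infinity> then (SUP s\<in>{0<..}. ennreal (rearrangement f s * s powr (1 / p)))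
      else let r = real_of_ereal q;
               I = (\<integral>\<^sup>+ s\<in>{0<..<1}. ennreal ((rearrangement f s * s powr (1 / p)) powr r / s) \<partial>lborel)
           in if I = \<infinity> then \<infinity> else ennreal (enn2real I powr (1 / r)))"

definition log_plus :: "real \<Rightarrow> real" where
  "log_plus x = ln (max 1 x)"

definition nevanlinna_mean :: "(complex \<Rightarrow> complex) \<Rightarrow> real \<Rightarrow> real" where
  "nevanlinna_mean f r = (LINT \<zeta>|circle_measure. log_plus (cmod (f (of_real r * \<zeta>))))"

definition nevanlinna :: "(complex \<Rightarrow> complex) set" where
  "nevanlinna = {f \<in> H_disk. bdd_above (nevanlinna_mean f ` {0..<1})}"

definition smirnov :: "(complex \<Rightarrow> complex) set" where
  "smirnov = {f \<in> nevanlinna.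
     (nevanlinna_mean f \<longlongrightarrow> (LINT \<zeta>|circle_measure. log_plus (cmod (boundary_fun f \<zeta>)))) (at_left 1)}"

definition hardy_lorentz :: "real \<Rightarrow> ereal \<Rightarrow> (complex \<Rightarrow> complex) set" where
  "hardy_lorentz p q = {f \<in> smirnov. lorentz_norm p q (boundary_fun f) < \<infinity>}"

subsection \<open>BMOA and the Bloch space\<close>

text \<open>
  Including or excluding endpoints changes an arc by a null set only, so closed arcs suffice.
\<close>
definition arcs :: "complex set set" where
  "arcs = {cis ` {a..b} | a b. a < b \<and> b \<le> a + 2 * pi}"

definition arc_mean :: "complex set \<Rightarrow> (complex \<Rightarrow> complex) \<Rightarrow> complex" where
  "arc_mean I f = (LINT \<zeta>:I|circle_measure. f \<zeta>) / of_real (measure circle_measure I)"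

definition arc_oscillation :: "complex set \<Rightarrow> (complex \<Rightarrow> complex) \<Rightarrow> real" where
  "arc_oscillation I f =
     (LINT \<zeta>:I|circle_measure. cmod (f \<zeta> - arc_mean I f)) / measure circle_measure I"

definition BMOA :: "(complex \<Rightarrow> complex) set" where
  "BMOA = {f \<in> hardy 1. bdd_above ((\<lambda>I. arc_oscillation I (boundary_fun f)) ` arcs)}"

definition frac_deriv1 :: "(complex \<Rightarrow> complex) \<Rightarrow> complex \<Rightarrow> complex" where
  "frac_deriv1 f z = (\<Sum>n. of_nat (n + 1) * taylor_seq f n * z ^ n)"

definition bloch :: "(complex \<Rightarrow> complex) set" where
  "bloch = {f \<in> H_disk. bdd_above ((\<lambda>z. (1 - cmod z) * cmod (frac_deriv1 f z)) ` ball 0 1)}"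

end

theory Submission
 imports Defs
begin

text \<open>
 Fix \<open>m \<ge> 2 / p\<close>. All three sequence spaces coincide with the class of those \<open>l\<close> for which the fractional
 derivative \<open>G w = (\<Sum>n. (n + 1) * (n + m choose m) * l n * w ^ n)\<close> is \<open>O((1 - cmod w) powr (1/p - m - 2))\<close>.

 If \<open>l\<close> is in this class, the Hadamard product formula bounds the derivative of a multiplied function by the
 integral means of \<open>f\<close> and \<open>G\<close>. A Smirnov function has \<open>cmod f powr t\<close> dominated by the Poisson integral of its
 boundary values for every \<open>t > 0\<close>, so its means are controlled by the dyadic values of its rearrangement,
 convolved with a geometric kernel. Bounded, square summable and summable dyadic values lead
 to the Bloch space, to BMOA (through the square integrability of the maximal derivative), and to the bounded
 functional on \<open>H\<^sup>p\<close> that integrates the derivative of the multiplied function along the radius \<open>{0..1}\<close>.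

 Conversely \<open>G w\<close> is the value of a functional at a function of the expected \<open>H\<^sup>p\<close> norm. For multipliers, BMOA
 lies in the Bloch space, and if \<open>G\<close> grew too fast along a sequence, a gliding hump, a rapidly lacunary
 sum of functions \<open>(1 - r * z) powr (- m - 1)\<close>, would lie in every \<open>H\<^sup>p\<^sup>,\<^sup>q\<close> but not be mapped into the Bloch space.
\<close>

text \<open>Since \<open>p < 1\<close>, a function of a Hardy-Lorentz class need not have integrable
  boundary values, so no Cauchy or Poisson formula recovers it. The substitute is the domination of
  \<open>cmod f powr (p/2)\<close>: this exponent is strictly below \<open>p\<close>, so the
  boundary data are integrable even under a weak type bound. Dyadic values are convolved twice, once
  on the way to integral means and once when integrating along a radius. The condition
  \<open>q <= 2\<close> enters through the inclusion of \<open>l^q\<close> in \<open>l^2\<close>,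
  and \<open>p < 1\<close> through the decay of the kernel and the summability of \<open>l^p\<close>
  sequences. The weight of \<open>G\<close> splits: \<open>n + 1\<close> belongs to
  \<open>frac_deriv1\<close>, and the binomials are the Taylor coefficients of
  \<open>(1 - z) powr (- m - 1)\<close>. Thus functionals applied to kernels and multipliers applied
  to humps lead to the same \<open>G\<close>. The size of \<open>m\<close> gives
  \<open>(m + 2)*p >= 2\<close> and \<open>m + 1 > 1/p\<close>. Boundary values rest on an
  \<open>L^2\<close> maximal theorem; it comes from a bootstrap with the semigroup property of the
  Poisson kernel instead of a covering argument.\<close>

notation circle_measure (\<open>\<T>\<close>)

abbreviation circle_mean (binder \<open>MEAN \<close> 10) where "circle_mean \<equiv> integral\<^sup>L \<T>"
abbreviation circle_nn (binder \<open>NN \<close> 10) where "circle_nn \<equiv> nn_integral \<T>"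

abbreviation hol where "hol f \<equiv> f holomorphic_on ball 0 1"

notation LIMSEQ (infix \<open>---->\<close> 60)

section \<open>The circle measure\<close>

lemma measurable_cis_restrict:
 "cis \<in> measurable borel (restrict_space borel (sphere 0 1))"
 by (intro measurable_restrict_space2 borel_measurable_continuous_onI continuous_intros) auto

lemma circle_measure_density:
 "\<T> = completion (distr (density lborel (%t. ennreal (indicator {0..<2*pi} t/(2*pi))))
  (restrict_space borel (sphere 0 1)) cis)"
proof -
 have "uniform_measure lborel {0..<2*pi} = density lborel (%t. ennreal (indicator {0..<2*pi} t/(2*pi)))"
  unfolding uniform_measure_def
  by (rule density_cong) (auto split: split_indicator simp: divide_ennreal[symmetric] simp flip: ennreal_1)
 thus ?thesis by (simp add: circle_measure_def)
qed

lemma space_circle [simp]: "space \<T> = sphere 0 1"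
 by (simp add: circle_measure_def space_restrict_space)

lemma measurable_circle_restrict:
 assumes "g \<in> measurable (restrict_space borel (sphere 0 1)) N"
 shows "g \<in> measurable \<T> N"
 unfolding circle_measure_def
 by (rule measurable_completion) (use assms in "simp cong: measurable_cong_sets")

lemma measurable_circle_ident [measurable]: "(%x. x) \<in> borel_measurable \<T>"
 by (rule measurable_circle_restrict) (simp add: measurable_restrict_space1)

lemma circle_measurable:
 fixes g :: "complex => 'b::topological_space"
 assumes "continuous_on (sphere 0 1) g"
 shows "g \<in> borel_measurable \<T>"
 by (rule measurable_circle_restrict) (rule borel_measurable_continuous_on_restrict[OF assms])

lemma sets_circle_open:
 assumes "open U" shows "U \<inter> sphere 0 1 \<in> sets \<T>"
proof -
 have "(%x. x) -` U \<inter> space \<T> \<in> sets \<T>"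
  by (rule measurable_sets[OF measurable_circle_ident]) (use assms in auto)
 thus ?thesis by simp
qed

lemma nn_integral_circle:
 assumes [measurable]: "g \<in> borel_measurable (restrict_space borel (sphere 0 1))"
 shows "(NN x. g x) = (\<integral>\<^sup>+t. ennreal (indicator {0..<2*pi} t/(2*pi))*g (cis t) \<partial>lborel)"
proof -
 note measurable_cis_restrict[measurable]
 have "(NN x. g x) = (\<integral>\<^sup>+t. g (cis t) \<partial>density lborel (%t. ennreal (indicator {0..<2*pi} t/(2*pi))))"
  unfolding circle_measure_density nn_integral_completion
  by (subst nn_integral_distr) (auto simp: measurable_cong_sets[OF sets_density refl])
 also have "... = (\<integral>\<^sup>+t. ennreal (indicator {0..<2*pi} t/(2*pi))*g (cis t) \<partial>lborel)"
  by (subst nn_integral_density) auto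
 finally show ?thesis .
qed

interpretation circle: prob_space \<T>
proof
 have "emeasure \<T> (space \<T>) = (NN x. 1)"
  by simp
 also have "... = (\<integral>\<^sup>+t. ennreal (indicator {0..<2*pi} t/(2*pi))*1 \<partial>lborel)"
  by (rule nn_integral_circle) auto
 also have "... = (\<integral>\<^sup>+t. ennreal (1/(2*pi))*indicator {0..<2*pi} t \<partial>lborel)"
  by (rule nn_integral_cong) (auto split: split_indicator)
 also have "... = ennreal (1/(2*pi))*ennreal (2*pi)"
  by (subst nn_integral_cmult_indicator) auto
 also have "... = 1" by (simp flip: ennreal_mult' )
 finally show "emeasure \<T> (space \<T>) = 1" .
qed

lemma emeasure_circle:
 assumes "A \<in> sets (restrict_space borel (sphere 0 1))"
 shows "emeasure \<T> A = (\<integral>\<^sup>+t. ennreal (indicator {0..<2*pi} t/(2*pi))*indicator A (cis t) \<partial>lborel)"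
proof -
 have "A \<in> sets \<T>" using assms unfolding circle_measure_def by auto
 hence "emeasure \<T> A = (NN x. indicator A x)" by simp
 also have "... = (\<integral>\<^sup>+t. ennreal (indicator {0..<2*pi} t/(2*pi))*indicator A (cis t) \<partial>lborel)"
  by (rule nn_integral_circle) (use assms in auto)
 finally show ?thesis .
qed

lemma integral_circle:
 fixes g :: "complex => 'b::{banach,second_countable_topology}"
 assumes [measurable]: "g \<in> borel_measurable (restrict_space borel (sphere 0 1))"
 shows "(MEAN x. g x) = (LINT t|lborel. (indicator {0..<2*pi} t/(2*pi)) *\<^sub>R g (cis t))"
proof -
 note measurable_cis_restrict[measurable]
 have "(MEAN x. g x) = (LINT t|density lborel (%t. ennreal (indicator {0..<2*pi} t/(2*pi))). g (cis t))"
  unfolding circle_measure_density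
  by (subst integral_completion)
   (auto simp: integral_distr measurable_cong_sets[OF sets_density refl])
 also have "... = (LINT t|lborel. (indicator {0..<2*pi} t/(2*pi)) *\<^sub>R g (cis t))"
  by (rule integral_density) auto
 finally show ?thesis .
qed

lemma circle_integrable:
 fixes g :: "complex => 'b::{banach,second_countable_topology}"
 assumes "continuous_on (sphere 0 1) g"
 shows "integrable \<T> g"
proof -
 have "compact (g ` sphere 0 1)"
  by (rule compact_continuous_image[OF assms]) auto
 then obtain B where B: "\<And>x. x \<in> sphere 0 1 ==> norm (g x) <= B"
  using compact_imp_bounded bounded_iff by (metis image_eqI)
 show ?thesis
  by (rule circle.integrable_const_bound[of _ B])
   (use B circle_measurable[OF assms] in auto)
qed

lemma integral_circle_continuous:
 fixes g :: "complex => complex"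
 assumes "continuous_on (sphere 0 1) g"
 shows "((%t. g (cis t)) has_integral (2*pi*(MEAN x. g x))) {0..2*pi}"
proof -
 have cont: "continuous_on {0..2*pi} (%t. g (cis t))"
  by (rule continuous_on_compose2[OF assms]) (auto intro!: continuous_intros)
 have int: "set_integrable lborel {0..2*pi} (%t. g (cis t))"
  unfolding set_integrable_def by (rule borel_integrable_compact) (use cont in auto)
 have "(MEAN x. g x) = (LINT t|lborel. (indicator {0..<2*pi} t/(2*pi)) *\<^sub>R g (cis t))"
  by (rule integral_circle) (rule borel_measurable_continuous_on_restrict[OF assms])
 also have "... = (LINT t|lborel. (1/(2*pi)) *\<^sub>R (indicator {0..<2*pi} t *\<^sub>R g (cis t)))"
  by (rule Bochner_Integration.integral_cong) auto
 also have "... = (1/(2*pi)) *\<^sub>R (LINT t|lborel. (indicator {0..<2*pi} t *\<^sub>R g (cis t)))"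
  by (rule integral_scaleR_right)
 also have "(LINT t|lborel. (indicator {0..<2*pi} t *\<^sub>R g (cis t))) = (LINT t:{0..2*pi}|lborel. g (cis t))"
  unfolding set_lebesgue_integral_def
 proof (rule integral_cong_AE)
  show "(%t. indicator {0..2*pi} t *\<^sub>R g (cis t)) \<in> borel_measurable lborel"
   using int unfolding set_integrable_def by (rule borel_measurable_integrable)
  \<comment> \<open>The half-open interval of the measure and the closed one of
    \<open>has_integral\<close> differ in one point; measurability is inherited by cutting the
    closed version with an indicator.\<close>
  have "(%t. indicator {0..<2*pi} t *\<^sub>R (indicator {0..2*pi} t *\<^sub>R g (cis t))) \<in> borel_measurable lborel"
   using int unfolding set_integrable_def by (intro borel_measurable_scaleR borel_measurable_integrable) auto
  also have "(%t. indicator {0..<2*pi} t *\<^sub>R (indicator {0..2*pi} t *\<^sub>R g (cis t))) = (%t. indicator {0..<2*pi} t *\<^sub>R g (cis t))"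
   by (auto simp: fun_eq_iff split: split_indicator)
  finally show "(%t. indicator {0..<2*pi} t *\<^sub>R g (cis t)) \<in> borel_measurable lborel" .
  show "AE t in lborel. indicator {0..<2*pi} t *\<^sub>R g (cis t) = indicator {0..2*pi} t *\<^sub>R g (cis t)"
   using AE_lborel_singleton[of "2*pi"] by eventually_elim (auto split: split_indicator)
 qed
 also have "... = integral {0..2*pi} (%t. g (cis t))"
  by (rule set_borel_integral_eq_integral(2)[OF int])
 finally have "2*pi*(MEAN x. g x) = integral {0..2*pi} (%t. g (cis t))"
  by (simp add: scaleR_conv_of_real)
 thus ?thesis using integrable_continuous_interval[OF cont] by (simp add: has_integral_integral)
qed

text \<open>On the circle path \<open>du = \<i> * u dt\<close>, which produces the factor
  \<open>x\<close>; the constant \<open>2*pi\<close> is absorbed by the normalisation.\<close>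

lemma circle_cauchy:
 assumes "continuous_on (cball 0 1) f" "hol f" "cmod w < 1"
 shows "(MEAN x. f x*x/(x - w)) = f w"
proof -
 have "((%u. f u/(u-w)) has_contour_integral (2 * of_real pi * \<i>*f w)) (circlepath 0 1)"
  using Cauchy_integral_circlepath[of 0 1 f w] assms by simp
 hence 1: "((%t. f (cis t)/(cis t - w) * \<i>*cis t) has_integral (2 * of_real pi * \<i>*f w)) {0..2*pi}"
  unfolding circlepath_def by (subst (asm) has_contour_integral_part_circlepath_iff) auto
 have "continuous_on (sphere 0 1) (%x. f x*x/(x - w))"
  using assms by (auto intro!: continuous_intros intro: continuous_on_subset)
 from has_integral_mult_right[OF integral_circle_continuous[OF this], of \<i>] 
 have 2: "((%t. f (cis t)/(cis t - w) * \<i>*cis t) has_integral (\<i>*(2*pi*(MEAN x. f x*x/(x - w))))) {0..2*pi}"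
  by (simp add: mult_ac)
 from has_integral_unique[OF 1 2] show ?thesis by simp
qed

lemma circle_mean_value:
 assumes "continuous_on (cball 0 1) f" "hol f"
 shows "(MEAN x. f x) = f 0"
proof -
 have "(MEAN x. f x) = (MEAN x. f x*x/(x - 0))"
  by (rule Bochner_Integration.integral_cong) auto
 thus ?thesis using circle_cauchy[OF assms, of 0] by simp
qed

lemma cnj_circle: "cmod x = 1 ==> cnj x = inverse x"
 by (metis divide_conv_cnj inverse_eq_divide mult_1)

lemma circle_orthogonal:
 "(MEAN y. y^n*cnj y^k) = (if n = k then 1 else 0)"
proof -
 have A: "(MEAN y. y^n*cnj y^k) = (if n = k then 1 else 0)" if "k <= n" for n k
 proof -
  have "x^n*cnj x^k = x^(n - k)" if "cmod x = 1" for x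
  proof -
   have "x \<noteq> 0" using that by auto
   thus ?thesis using \<open>k <= n\<close> that by (simp add: cnj_circle power_diff power_inverse divide_inverse)
  qed
  hence "(MEAN y. y^n*cnj y^k) = (MEAN y. y^(n-k))"
   by (intro Bochner_Integration.integral_cong) auto
  also have "... = 0^(n-k)"
   by (rule circle_mean_value) (auto intro!: continuous_intros holomorphic_intros)
  finally show ?thesis using that by auto
 qed
 show ?thesis
 proof (cases "k <= n")
  case False
  have "(MEAN y. y^n*cnj y^k) = (MEAN y. cnj (y^k*cnj y^n))"
   by (simp add: mult.commute)
  also have "... = cnj (MEAN y. y^k*cnj y^n)"
   by (rule Bochner_Integration.integral_cnj)
  finally show ?thesis using A[of n k] False by simp
 qed (rule A)
qed

lemma emeasure_circle_cis:
 assumes "A \<in> sets borel" "\<And>t. t \<in> {0..<2*pi} ==> cis t \<in> S \<longleftrightarrow> t \<in> A" "A \<subseteq> {0..<2*pi}"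
  "S \<in> sets (restrict_space borel (sphere 0 1))"
 shows "emeasure \<T> S = emeasure lborel A/ennreal (2*pi)"
proof -
 have "emeasure \<T> S = (\<integral>\<^sup>+t. ennreal (1/(2*pi))*indicator A t \<partial>lborel)"
  unfolding emeasure_circle[OF assms(4)]
  by (rule nn_integral_cong) (use assms(2,3) in "auto split: split_indicator")
 also have "... = ennreal (1/(2*pi))*emeasure lborel A"
  using assms by (subst nn_integral_cmult_indicator) auto
 also have "... = emeasure lborel A/ennreal (2*pi)"
  unfolding divide_ennreal_def by (subst inverse_ennreal) (auto simp: inverse_eq_divide mult.commute)
 finally show ?thesis .
qed

lemma cis_eq_iff_int: "cis a = cis b \<longleftrightarrow> (\<exists>k::int. a = b + 2*pi*k)"
proof -
 have "cis a = cis b \<longleftrightarrow> exp (\<i>*a) = exp (\<i>*b)"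
  by (simp add: cis_conv_exp)
 also have "... \<longleftrightarrow> (\<exists>k::int. \<i>*a = \<i>*b + of_int (2*k)*pi * \<i>)"
  by (simp add: exp_eq)
 also have "(%k::int. \<i>*a = \<i>*b + of_int (2*k)*pi * \<i>) = (%k. a = b + 2*pi*k)"
 proof
  fix k :: int
  have "\<i>*a = \<i>*b + of_int (2*k)*pi * \<i> \<longleftrightarrow> \<i>*complex_of_real a = \<i>*complex_of_real (b + 2*pi*k)"
   by (simp add: algebra_simps)
  also have "... \<longleftrightarrow> a = b + 2*pi*k" by (simp only: mult_cancel_left of_real_eq_iff) simp
  finally show "(\<i>*a = \<i>*b + of_int (2*k)*pi * \<i>) = (a = b + 2*pi*k)" .
 qed
 finally show ?thesis .
qed

lemma measure_circle_arc:
 assumes "a <= b" "b <= a + 2*pi"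
 shows "cis ` {a..b} \<in> sets \<T>" "measure \<T> (cis ` {a..b}) = (b - a)/(2*pi)"
proof -
 define k where "k = \<lfloor>a/(2*pi)\<rfloor>"
 define a0 where "a0 = a - 2*pi*k"
 define b0 where "b0 = b - 2*pi*k"
 have "2*pi*k <= a" "a < 2*pi*(k+1)"
  using floor_divide_lower[of "2*pi" a] floor_divide_upper[of "2*pi" a] unfolding k_def
  by (auto simp: mult.commute)
 hence a0: "0 <= a0" "a0 < 2*pi" by (auto simp: a0_def algebra_simps)
 have b0: "a0 <= b0" "b0 <= a0 + 2*pi" using assms by (auto simp: a0_def b0_def)
 have "compact (cis ` {a..b})" by (rule compact_continuous_image) (auto intro!: continuous_intros)
 hence "closed (cis ` {a..b})" by (rule compact_imp_closed)
 hence S: "cis ` {a..b} \<in> sets (restrict_space borel (sphere 0 1))"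
  by (subst sets_restrict_space_iff) auto
 thus "cis ` {a..b} \<in> sets \<T>" unfolding circle_measure_def by auto
 \<comment> \<open>The angles in \<open>{0..<2*pi}\<close> that belong to the arc. The arc may run
   past angle 0, and then there are two pieces.\<close>
 define A where "A = (if b0 < 2*pi then {a0..b0} else {a0..<2*pi} \<union> {0..b0-2*pi})"
 have mem: "cis t \<in> cis ` {a..b} \<longleftrightarrow> t \<in> A" if t: "t \<in> {0..<2*pi}" for t
 proof
  assume "cis t \<in> cis ` {a..b}"
  then obtain s where s: "s \<in> {a..b}" "cis s = cis t" by auto
  then obtain j :: int where j: "s = t + 2*pi*j" by (auto simp: cis_eq_iff_int)
  have "s - 2*pi*k = t + 2*pi*(j-k)" using j by (simp add: algebra_simps)
  hence r: "a0 <= t + 2*pi*(j-k)" "t + 2*pi*(j-k) <= b0" using s by (auto simp: a0_def b0_def)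
  define x where "x = 2*pi*real_of_int (j-k)"
  have r': "a0 <= t + x" "t + x <= b0" using r by (simp_all add: x_def)
  have "x > 2*pi*(-1)" "x < 2*pi*2" using r' a0 b0 t[unfolded atLeastLessThan_iff] by linarith+
  hence "real_of_int (j - k) > -1" "real_of_int (j - k) < 2"
   using mult_less_cancel_left_pos[of "2*pi" "-1" "real_of_int (j-k)"] mult_less_cancel_left_pos[of "2*pi" "real_of_int (j-k)" 2]
   by (simp_all add: x_def)
  hence "j - k = 0 \<or> j - k = 1" by linarith
  hence "x = 0 \<or> x = 2*pi" by (auto simp: x_def)
  thus "t \<in> A" using r' t a0 b0 by (auto simp: A_def)
 next
  assume "t \<in> A"
  hence "t \<in> {a0..b0} \<or> t + 2*pi \<in> {a0..b0}" using a0 b0 t by (auto simp: A_def split: if_splits)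
  hence "\<exists>s\<in>{a..b}. cis s = cis t"
  proof
   assume "t \<in> {a0..b0}"
   thus ?thesis by (intro bexI[of _ "t + 2*pi*k"]) (auto simp: cis_eq_iff_int a0_def b0_def)
  next
   assume "t + 2*pi \<in> {a0..b0}"
   thus ?thesis
    by (intro bexI[of _ "t + 2*pi*(k+1)"]) (auto simp: cis_eq_iff_int a0_def b0_def algebra_simps intro!: exI[of _ "k+1"])
  qed
  thus "cis t \<in> cis ` {a..b}" by (metis image_eqI)
 qed
 have A: "A \<in> sets borel" "A \<subseteq> {0..<2*pi}" using a0 b0 by (auto simp: A_def)
 have "emeasure lborel A = ennreal (b0 - a0)"
 proof (cases "b0 < 2*pi")
  case False
  define c where "c = b0 - 2*pi"
  have c: "0 <= c" "c <= a0" using False b0 by (auto simp: c_def)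
  \<comment> \<open>Dropping the endpoint \<open>c\<close> keeps the two pieces disjoint even for
    the full circle, where \<open>c = a0\<close>.\<close>
  have "emeasure lborel A = emeasure lborel ({a0..<2*pi} \<union> {0..<c})"
  proof (rule emeasure_eq_AE)
   show "AE x in lborel. (x \<in> A) = (x \<in> {a0..<2*pi} \<union> {0..<c})"
    using AE_lborel_singleton[of c] by eventually_elim (use False c in "auto simp: A_def c_def")
  qed (use A in auto)
  also have "... = emeasure lborel {a0..<2*pi} + emeasure lborel {0..<c}"
   by (rule plus_emeasure[symmetric]) (use c in auto)
  also have "... = ennreal (b0 - a0)" using a0 c by (simp add: c_def flip: ennreal_plus)
  finally show ?thesis .
 qed (use b0 in "simp add: A_def")
 hence "emeasure \<T> (cis ` {a..b}) = ennreal (b0 - a0)/ennreal (2*pi)"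
  using emeasure_circle_cis[OF A(1) mem A(2) S] by simp
 also have "... = ennreal ((b0 - a0)/(2*pi))" using b0 by (simp add: divide_ennreal)
 finally show "measure \<T> (cis ` {a..b}) = (b - a)/(2*pi)"
  using b0 by (simp add: measure_def a0_def b0_def)
qed

section \<open>Poisson and Schwarz integrals\<close>

text \<open>The Poisson kernel of the unit disk.\<close>

definition pk :: "complex => complex => real" where
 "pk z \<xi> = (1 - (cmod z)^2)/(cmod (\<xi> - z))^2"

definition poisson :: "(complex => real) => complex => real" where
 "poisson u z = (LINT \<xi>|\<T>. pk z \<xi>*u \<xi>)"

definition schwarz :: "(complex => real) => complex => complex" where
 "schwarz u z = (LINT \<xi>|\<T>. (\<xi> + z)/(\<xi> - z) * of_real (u \<xi>))"

lemma measurable_pk [measurable (raw)]: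
 assumes [measurable]: "f \<in> borel_measurable M" "g \<in> borel_measurable M"
 shows "(%x. pk (f x) (g x)) \<in> borel_measurable M"
 unfolding pk_def by measurable

lemma circle_ne: "cmod z < 1 ==> cmod x = 1 ==> x \<noteq> z" by auto

lemma circle_dist_ge: "cmod x = 1 ==> 1 - cmod z <= cmod (x - z)"
 by (metis norm_triangle_ineq2)

lemma pk_nonneg: "cmod z <= 1 ==> 0 <= pk z x"
 unfolding pk_def by (auto intro!: divide_nonneg_nonneg power_le_one)

lemma pk_pos: "cmod z < 1 ==> cmod x = 1 ==> 0 < pk z x"
 unfolding pk_def by (rule divide_pos_pos) (auto simp: abs_square_less_1)

lemma one_minus_sq_le: "0 <= x ==> x <= 1 ==> 1 - x^2 <= 2*(1 - x)" for x :: real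
 using mult_right_mono[of "1 + x" 2 "1 - x"] by (simp add: power2_eq_square algebra_simps)

lemma one_minus_sq_ge: "0 <= x ==> x <= 1 ==> 1 - x <= 1 - x^2" for x :: real
 using mult_right_mono[of 1 "1 + x" "1 - x"] by (simp add: power2_eq_square algebra_simps)

lemma pk_le:
 assumes "cmod z < 1" "cmod x = 1"
 shows "pk z x <= 2/(1 - cmod z)"
proof -
 have "pk z x <= 2*(1 - cmod z)/(1 - cmod z)^2"
  unfolding pk_def
  by (rule frac_le) (use assms circle_dist_ge[OF assms(2), of z] one_minus_sq_le[of "cmod z"] in "auto intro!: power_mono")
 also have "... = 2/(1 - cmod z)" using assms unfolding power2_eq_square by (subst mult_divide_mult_cancel_right) auto
 finally show ?thesis .
qed

lemma continuous_pk: "cmod z < 1 ==> continuous_on (sphere 0 1) (pk z)"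
 unfolding pk_def by (intro continuous_intros) auto

text \<open>The first summand is the Cauchy kernel. The second is analytic in \<open>x\<close> and
  vanishes at \<open>x = 0\<close>, so it contributes nothing against an analytic function; hence
  \<open>poisson_holomorphic\<close>.\<close>

lemma pk_split:
 assumes "cmod z < 1" "cmod x = 1"
 shows "complex_of_real (pk z x) = x/(x - z) + cnj z*x/(1 - cnj z*x)"
proof -
 have x0: "x \<noteq> 0" "x - z \<noteq> 0" using assms by auto
 have n1: "1 - cnj z*x = x*cnj (x - z)"
  using x0 assms by (simp add: cnj_circle algebra_simps)
 have n2: "1 - cnj z*x \<noteq> 0" using x0 by (simp add: n1)
 have "x/(x - z) + cnj z*x/(1 - cnj z*x) = x*(1 - z*cnj z)/((x - z)*(1 - cnj z*x))"
  using x0 n2 by (simp add: add_frac_eq algebra_simps)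
 also have "... = (1 - z*cnj z)/((x - z)*cnj (x - z))"
  using x0 by (simp add: n1)
 also have "... = complex_of_real (pk z x)"
  by (simp only: complex_norm_square[symmetric] pk_def of_real_divide of_real_diff of_real_1)
 finally show ?thesis by simp
qed

text \<open>The first form, analytic in \<open>z\<close>, turns Poisson integrals into real parts of
  Schwarz integrals. The second is analytic in \<open>x\<close>, so a kernel can itself be treated
  as boundary data.\<close>

lemma pk_Re:
 assumes "cmod z < 1" "cmod x = 1"
 shows "pk z x = Re ((x + z)/(x - z))" "pk z x = Re ((1 + cnj z*x)/(1 - cnj z*x))"
proof -
 have x0: "x \<noteq> 0" "x - z \<noteq> 0" using assms by auto
 have n1: "1 - cnj z*x = x*cnj (x - z)" and n3: "1 + cnj z*x = x*cnj (x + z)"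
  using x0 assms by (simp_all add: cnj_circle algebra_simps)
 have "(x + z)/(x - z) = (x + z)*cnj (x - z)/((x - z)*cnj (x - z))" using x0 by simp
 also have "... = (x + z)*cnj (x - z)/of_real ((cmod (x - z))^2)"
  by (simp only: complex_norm_square)
 also have "Re ... = Re ((x + z)*cnj (x - z))/(cmod (x - z))^2"
  by (rule Re_divide_of_real)
 also have "(x + z)*cnj (x - z) = x*cnj x - z*cnj z + (z*cnj x - cnj (z*cnj x))"
  by (simp add: algebra_simps)
 also have "Re ... = Re (x*cnj x) - Re (z*cnj z)" by (simp only: plus_complex.simps minus_complex.simps complex_cnj) simp
 also have "Re (x*cnj x) = 1" using assms(2) by (simp only: complex_norm_square[symmetric] Re_complex_of_real) simp
 also have "Re (z*cnj z) = (cmod z)^2" by (simp only: complex_norm_square[symmetric] Re_complex_of_real)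
 finally show *: "pk z x = Re ((x + z)/(x - z))" by (simp add: pk_def)
 have "(1 + cnj z*x)/(1 - cnj z*x) = cnj ((x + z)/(x - z))"
  using x0 by (simp add: n1 n3)
 thus "pk z x = Re ((1 + cnj z*x)/(1 - cnj z*x))" unfolding * by (simp only: cnj.simps)
qed

lemma one_minus_cnj_ne: "cmod z < 1 ==> cmod x <= 1 ==> 1 - cnj z*x \<noteq> 0"
 using mult_left_le[of "cmod x" "cmod z"]
 by (metis complex_mod_cnj dual_order.strict_trans2 eq_iff_diff_eq_0 norm_ge_zero norm_mult norm_one order_less_irrefl)

section \<open>Reproducing property and elementary estimates of the Poisson integral\<close>

lemma poisson_holomorphic:
 assumes "continuous_on (cball 0 1) f" "hol f" "cmod z < 1"
 shows "(MEAN x. of_real (pk z x)*f x) = f z"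
proof -
 have cs: "continuous_on (sphere 0 1) f" by (rule continuous_on_subset[OF assms(1)]) auto
 have i1: "integrable \<T> (%x. f x*x/(x - z))"
  by (rule circle_integrable) (use assms cs in "auto intro!: continuous_intros")
 have c2: "continuous_on (cball 0 1) (%x. f x*(cnj z*x/(1 - cnj z*x)))"
  using assms one_minus_cnj_ne[of z] by (auto intro!: continuous_intros)
 have i2: "integrable \<T> (%x. f x*(cnj z*x/(1 - cnj z*x)))"
  by (rule circle_integrable) (rule continuous_on_subset[OF c2], auto)
 have "(MEAN x. of_real (pk z x)*f x) =
  (MEAN x. f x*x/(x - z) + f x*(cnj z*x/(1 - cnj z*x)))"
  by (rule Bochner_Integration.integral_cong) (use assms pk_split in "auto simp: algebra_simps")
 also have "... = (MEAN x. f x*x/(x - z)) + (MEAN x. f x*(cnj z*x/(1 - cnj z*x)))"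
  by (rule Bochner_Integration.integral_add[OF i1 i2])
 also have "(MEAN x. f x*x/(x - z)) = f z" by (rule circle_cauchy[OF assms])
 also have "(MEAN x. f x*(cnj z*x/(1 - cnj z*x))) = 0"
  using one_minus_cnj_ne[OF assms(3)]
  by (subst circle_mean_value[OF c2]) (use assms in "auto intro!: holomorphic_intros")
 finally show ?thesis by simp
qed

lemma poisson_Re:
 assumes "continuous_on (cball 0 1) f" "hol f" "cmod z < 1"
 shows "poisson (%x. Re (f x)) z = Re (f z)"
proof -
 have cs: "continuous_on (sphere 0 1) f" by (rule continuous_on_subset[OF assms(1)]) auto
 have "integrable \<T> (%x. of_real (pk z x)*f x)"
  by (rule circle_integrable) (use cs continuous_pk[OF assms(3)] in "auto intro!: continuous_intros")
 from integral_Re[OF this] show ?thesis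
  by (simp add: poisson_holomorphic[OF assms] poisson_def)
qed

lemma poisson_const: "cmod z < 1 ==> poisson (%_. c) z = c"
 using poisson_Re[of "%_. of_real c" z] by simp

lemma integrable_pk: "cmod z < 1 ==> integrable \<T> (pk z)"
 by (rule circle_integrable[OF continuous_pk])

lemma integral_pk: "cmod z < 1 ==> (MEAN x. pk z x) = 1"
 using poisson_const[of z 1] by (simp add: poisson_def)

lemma integrable_pk_mult:
 assumes "cmod z < 1" "integrable \<T> u"
 shows "integrable \<T> (%x. pk z x*u x)"
proof (rule Bochner_Integration.integrable_bound)
 show "integrable \<T> (%x. 2/(1 - cmod z)*u x)" using assms by auto
 show "(%x. pk z x*u x) \<in> borel_measurable \<T>"
  using assms by (auto intro!: borel_measurable_times circle_measurable[OF continuous_pk])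
 show "AE x in \<T>. norm (pk z x*u x) <= norm (2/(1 - cmod z)*u x)"
 proof (rule AE_I2)
  fix x assume "x \<in> space \<T>"
  hence "\<bar>pk z x\<bar> <= \<bar>2/(1 - cmod z)\<bar>" using pk_le[of z x] pk_nonneg[of z x] assms by auto
  thus "norm (pk z x*u x) <= norm (2/(1 - cmod z)*u x)"
   unfolding real_norm_def abs_mult by (rule mult_right_mono) auto
 qed
qed

lemma poisson_mono:
 assumes "cmod z < 1" "integrable \<T> u" "integrable \<T> v"
  "\<And>x. cmod x = 1 ==> u x <= v x"
 shows "poisson u z <= poisson v z"
 unfolding poisson_def
 by (intro integral_mono integrable_pk_mult) (use assms in "auto intro!: mult_left_mono pk_nonneg")

lemma poisson_add:
 assumes "cmod z < 1" "integrable \<T> u" "integrable \<T> v"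
 shows "poisson (%x. u x + v x) z = poisson u z + poisson v z"
 unfolding poisson_def using integrable_pk_mult[OF assms(1,2)] integrable_pk_mult[OF assms(1,3)]
 by (simp add: algebra_simps)

lemma poisson_cmult: "poisson (%x. c*u x) z = c*poisson u z"
 unfolding poisson_def by (simp add: mult.left_commute)

lemma poisson_nonneg:
 assumes "cmod z < 1" "\<And>x. cmod x = 1 ==> 0 <= u x"
 shows "0 <= poisson u z"
 unfolding poisson_def by (rule integral_nonneg_AE) (use assms in "auto intro!: AE_I2 mult_nonneg_nonneg pk_nonneg")

text \<open>One kernel is the real part of a function analytic in \<open>x\<close>, and integration
  against the other evaluates that function at \<open>z\<close>.\<close>

lemma pk_semigroup:
 assumes "cmod z < 1" "cmod w < 1"
 shows "(MEAN x. pk z x*pk w x) = (1 - (cmod z*cmod w)^2)/(cmod (1 - cnj w*z))^2"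
proof -
 let ?g = "%x. (1 + cnj w*x)/(1 - cnj w*x)"
 have "(MEAN x. pk z x*pk w x) = poisson (%x. Re (?g x)) z"
  unfolding poisson_def
  by (rule Bochner_Integration.integral_cong) (use assms pk_Re(2)[of w] in auto)
 also have "... = Re (?g z)"
  by (rule poisson_Re) (use assms one_minus_cnj_ne[of w] in "auto intro!: continuous_intros holomorphic_intros")
 also have "?g z = (1 + cnj w*z)*cnj (1 - cnj w*z)/of_real ((cmod (1 - cnj w*z))^2)"
 proof -
  have "cnj (1 - cnj w*z) \<noteq> 0" using one_minus_cnj_ne[of w z] assms by (metis complex_cnj_zero_iff order_less_imp_le)
  thus ?thesis unfolding complex_norm_square by (subst mult_divide_mult_cancel_right) auto
 qed
 also have "Re ... = Re ((1 + cnj w*z)*cnj (1 - cnj w*z))/(cmod (1 - cnj w*z))^2"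
  by (rule Re_divide_of_real)
 also have "Re ((1 + cnj w*z)*cnj (1 - cnj w*z)) = 1 - (cmod (cnj w*z))^2"
  unfolding cmod_power2 by (simp add: algebra_simps power2_eq_square)
 also have "cmod (cnj w*z) = cmod z*cmod w" by (simp add: norm_mult)
 finally show ?thesis .
qed

text \<open>The composition is a Poisson kernel of radius \<open>r * s\<close>. For the smaller
  radius, say \<open>r\<close>, numerator and denominator change by factors 4 and 1/4, hence 16. The
  sum on the right removes the need to know which radius is smaller.\<close>

lemma pk_semigroup_le:
 assumes "0 <= r" "r < 1" "0 <= s" "s < 1" "cmod a = 1" "cmod b = 1"
 shows "(MEAN v. pk (of_real r*a) v * pk (of_real s*b) v)
     <= 16*(pk (of_real r*a) b + pk (of_real s*b) a)"
proof -
 have key: "(1 - (r * s)^2)/(cmod (1 - of_real (r * s)*w))^2 <= 16*((1 - r^2)/(cmod (1 - of_real r*w))^2)"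
  if "0 <= r" "r <= s" "s < 1" "cmod w = 1" for r s w
 proof -
  let ?a = "cmod (1 - of_real (r * s)*w)"
  have rs: "0 <= r * s" "r * s <= r" using that by (auto intro: mult_left_le)
  have a1: "1 - r * s <= ?a" using norm_triangle_ineq2[of 1 "of_real (r * s)*w"] that rs by (simp add: norm_mult)
  have "1 - of_real r*w = (1 - of_real (r * s)*w) - of_real (r*(1 - s))*w" by (simp add: algebra_simps)
  also have "cmod ... <= ?a + r*(1 - s)"
   using norm_triangle_ineq4[of "1 - of_real (r * s)*w" "of_real (r*(1 - s))*w"] that
   by (simp only: norm_mult norm_of_real) simp
  also have "r*(1 - s) <= 1 - r * s" using that by (simp add: algebra_simps)
  finally have b: "cmod (1 - of_real r*w) <= 2*?a" using a1 by simp
  have rp: "1 - r <= cmod (1 - of_real r*w)" using norm_triangle_ineq2[of 1 "of_real r*w"] that by (simp add: norm_mult)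
  have "1 - (r * s)^2 <= 2*(1 - r * s)" by (rule one_minus_sq_le) (use that rs in auto)
  also have "1 - r * s = (1 - r) + r*(1 - s)" by (simp add: algebra_simps)
  also have "r*(1 - s) <= 1*(1 - r)" by (rule mult_mono) (use that in auto)
  also have "(1 - r) + 1*(1 - r) <= 2*(1 - r^2)" using one_minus_sq_ge[of r] that by simp
  finally have n: "1 - (r * s)^2 <= 4*(1 - r^2)" by simp
  have "(1 - (r * s)^2) / ?a^2 <= 4*(1 - r^2)/(cmod (1 - of_real r*w)/2)^2"
   by (rule frac_le) (use n b rp that in "auto intro!: power_mono zero_less_power power_le_one")
  thus ?thesis by (simp add: power_divide)
 qed
 have ab: "cmod (cnj b*a) = 1" "cmod (cnj a*b) = 1" using assms by (simp_all add: norm_mult)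
 have c0: "cmod (1 - of_real t*(cnj y*x)) = cmod (y - of_real t*x)" if "cmod y = 1" for t x y
 proof -
  have "y - of_real t*x = y*(1 - of_real t*(cnj y*x))" using that by (cases "y = 0") (auto simp: cnj_circle right_diff_distrib mult.left_commute)
  thus ?thesis using that by (simp add: norm_mult)
 qed
 have p1: "(1 - r^2)/(cmod (1 - of_real r*(cnj b*a)))^2 = pk (of_real r*a) b"
  using assms c0[of b r a] by (simp add: pk_def norm_mult)
 have p2: "(1 - s^2)/(cmod (1 - of_real s*(cnj a*b)))^2 = pk (of_real s*b) a"
  using assms c0[of a s b] by (simp add: pk_def norm_mult)
 have eq: "(MEAN v. pk (of_real r*a) v * pk (of_real s*b) v)
   = (1 - (r * s)^2)/(cmod (1 - of_real (r * s)*(cnj b*a)))^2"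
  using assms by (subst pk_semigroup) (auto simp: norm_mult mult_ac)
 have sw: "cmod (1 - of_real (r * s)*(cnj b*a)) = cmod (1 - of_real (s*r)*(cnj a*b))"
  using complex_mod_cnj[of "1 - of_real (r * s)*(cnj b*a)"] by (simp add: mult_ac)
 have nn: "0 <= pk (of_real r*a) b" "0 <= pk (of_real s*b) a"
  using assms by (auto intro!: pk_nonneg simp: norm_mult)
 show ?thesis
 proof (cases "r <= s")
  case True
  show ?thesis unfolding eq using key[OF assms(1) True assms(4) ab(1)] nn unfolding p1 by simp
 next
  case False
  have "(MEAN v. pk (of_real r*a) v * pk (of_real s*b) v)
   = (1 - (s*r)^2)/(cmod (1 - of_real (s*r)*(cnj a*b)))^2"
   unfolding eq sw by (simp add: mult.commute)
  also have "... <= 16*pk (of_real s*b) a"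
   using key[of s r "cnj a*b"] False assms ab unfolding p2 by simp
  finally show ?thesis using nn by simp
 qed
qed

text \<open>A Harnack comparison. Since \<open>1 - cmod z <= cmod (x - z)\<close>, moving from
  \<open>z\<close> to \<open>w\<close> changes the distance to \<open>x\<close> by a factor at most
  \<open>1 + A\<close>; the numerators differ by a factor at most 4.\<close>

lemma pk_compare:
 assumes "cmod z < 1" "cmod w < 1" "cmod x = 1" "0 <= A" "cmod (z - w) <= A*(1 - cmod z)" "1 - cmod z <= 2*(1 - cmod w)"
 shows "pk z x <= 4*(1 + A)^2*pk w x"
proof -
 have d: "1 - cmod z <= cmod (x - z)" by (rule circle_dist_ge[OF assms(3)])
 have "cmod (x - w) <= cmod (x - z) + cmod (z - w)" using norm_triangle_ineq[of "x - z" "z - w"] by simp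
 also have "cmod (z - w) <= A*cmod (x - z)" using assms d by (meson mult_left_mono order_trans)
 finally have b: "cmod (x - w) <= (1 + A)*cmod (x - z)" by (simp add: algebra_simps)
 have p: "0 < cmod (x - w)" using circle_ne assms by auto
 have "1 - (cmod z)^2 <= 2*(1 - cmod z)" by (rule one_minus_sq_le) (use assms in auto)
 also have "... <= 4*(1 - (cmod w)^2)" using one_minus_sq_ge[of "cmod w"] assms by simp
 finally have n: "1 - (cmod z)^2 <= 4*(1 - (cmod w)^2)" .
 have "pk z x <= 4*(1 - (cmod w)^2)/(cmod (x - w)/(1 + A))^2"
  unfolding pk_def
 proof (rule frac_le)
  show "(cmod (x - w)/(1 + A))^2 <= (cmod (x - z))^2"
   by (rule power_mono) (use b assms in "auto simp: divide_le_eq mult.commute")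
 qed (use n p assms in "auto intro!: power_le_one divide_pos_pos zero_less_power")
 also have "... = 4*(1 + A)^2*pk w x" by (simp only: pk_def power_divide) (simp add: field_simps)
 finally show ?thesis .
qed

section \<open>The Schwarz integral\<close>

lemma schwarz_kernel_sums:
 fixes w :: complex
 assumes "cmod w < 1"
 shows "(%n. (if n = 0 then 1 else 2)*w^n) sums ((1 + w)/(1 - w))"
proof -
 have "(%n. 2*w^n - (if n = 0 then 1 else 0)) sums (2*(1/(1 - w)) - 1)"
  by (intro sums_diff sums_mult geometric_sums sums_If_finite_set'[where A="{0}", simplified]) (use assms in auto)
 moreover have "(%n. 2*w^n - (if n = 0 then 1 else 0)) = (%n. (if n = 0 then 1 else 2)*w^n)"
  by auto
 moreover have "w \<noteq> 1" using assms by auto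
 hence "2*(1/(1 - w)) - 1 = (1 + w)/(1 - w)"
  by (simp add: field_simps)
 ultimately show ?thesis by simp
qed

text \<open>Analyticity of the Schwarz integral is read off this power series, without
  differentiation under the integral.\<close>

lemma schwarz_sums:
 assumes u: "integrable \<T> u" and z: "cmod z < 1"
 shows "(%n. (if n = 0 then 1 else 2)*(MEAN y. cnj y^n * of_real (u y))*z^n) sums schwarz u z"
proof -
 define f where "f n y = (if n = 0 then 1 else 2)*(z*cnj y)^n*complex_of_real (u y)" for n y
 have int0: "integrable \<T> (%y. cnj y^n*complex_of_real (u y))" for n
 proof (rule Bochner_Integration.integrable_bound[OF u])
  have "(%y. cnj y) \<in> borel_measurable \<T>"
   by (intro circle_measurable continuous_intros)
  thus "(%y. cnj y^n*complex_of_real (u y)) \<in> borel_measurable \<T>"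
   using u by (auto intro!: borel_measurable_times borel_measurable_power)
 qed (auto simp: norm_mult norm_power)
 have feq: "f n = (%y. (if n = 0 then 1 else 2)*z^n*(cnj y^n*complex_of_real (u y)))" for n
  by (auto simp: f_def power_mult_distrib fun_eq_iff)
 have int: "integrable \<T> (f n)" for n
  unfolding feq by (intro integrable_mult_right int0)
 have nf: "norm (f n y) <= 2*cmod z^n * \<bar>u y\<bar>" if "cmod y = 1" for n y
  using that by (auto simp: f_def norm_mult norm_power intro!: mult_right_mono)
 have gs: "summable (%n. 2*cmod z^n*c)" for c
  using z by (intro summable_mult summable_mult2 summable_geometric) auto
 have "(%i. integral\<^sup>L \<T> (f i)) sums (MEAN y. (\<Sum>i. f i y))"
 proof (rule sums_integral[OF int])
  show "AE y in \<T>. summable (%i. norm (f i y))"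
   by (rule AE_I2) (rule summable_comparison_test'[OF gs], use nf in auto)
  show "summable (%i. MEAN y. norm (f i y))"
  proof (rule summable_comparison_test'[OF gs[of "MEAN y. \<bar>u y\<bar>"], of 0])
   fix n
   have "(MEAN y. norm (f n y)) <= (MEAN y. 2*cmod z^n * \<bar>u y\<bar>)"
    by (rule integral_mono) (use int u nf in auto)
   thus "norm (MEAN y. norm (f n y)) <= 2*cmod z^n*(MEAN y. \<bar>u y\<bar>)"
    by simp
  qed
 qed
 also have "(MEAN y. (\<Sum>i. f i y)) = schwarz u z"
  unfolding schwarz_def
 proof (rule Bochner_Integration.integral_cong)
  fix y assume "y \<in> space \<T>"
  hence x: "cmod y = 1" by simp
  have "(%i. f i y) sums ((1 + z*cnj y)/(1 - z*cnj y) * of_real (u y))"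
   unfolding f_def by (intro sums_mult2 schwarz_kernel_sums) (use x z in "auto simp: norm_mult")
  moreover have "(1 + z*cnj y)/(1 - z*cnj y) = (y + z)/(y - z)"
  proof -
   have "y \<noteq> 0" using x by auto
   hence "1 + z*cnj y = (y + z)/y" "1 - z*cnj y = (y - z)/y"
    using x by (auto simp: cnj_circle field_simps)
   thus ?thesis using \<open>y \<noteq> 0\<close> by simp
  qed
  ultimately show "(\<Sum>i. f i y) = (y + z)/(y - z) * of_real (u y)" by (simp add: sums_iff)
 qed simp
 also have "(%i. integral\<^sup>L \<T> (f i)) = (%i. (if i = 0 then 1 else 2)*(MEAN y. cnj y^i * of_real (u y))*z^i)"
  unfolding feq integral_mult_right_zero by (simp only: mult_ac)
 finally show ?thesis .
qed

lemma holomorphic_schwarz: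
 assumes "integrable \<T> u"
 shows "hol (schwarz u)"
 by (rule power_series_holomorphic[where a = "%n. (if n = 0 then 1 else 2)*(MEAN x. cnj x^n * of_real (u x))"])
  (use schwarz_sums[OF assms] in simp)

lemma Re_schwarz:
 assumes "integrable \<T> u" "cmod z < 1"
 shows "Re (schwarz u z) = poisson u z"
proof -
 have "integrable \<T> (%y. (y + z)/(y - z)*complex_of_real (u y))"
 proof (rule Bochner_Integration.integrable_bound)
  show "integrable \<T> (%y. 2/(1 - cmod z)*u y)" using assms by auto
  have "(%y. (y + z)/(y - z)) \<in> borel_measurable \<T>"
   by (rule circle_measurable) (use assms in "auto intro!: continuous_intros")
  thus "(%y. (y + z)/(y - z)*complex_of_real (u y)) \<in> borel_measurable \<T>"
   using assms by auto
  show "AE y in \<T>. norm ((y + z)/(y - z)*complex_of_real (u y)) <= norm (2/(1 - cmod z)*u y)"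
  proof (rule AE_I2)
   fix y assume "y \<in> space \<T>"
   hence x: "cmod y = 1" by simp
   have "cmod (y + z)/cmod (y - z) <= 2/(1 - cmod z)"
    by (rule frac_le) (use x assms circle_dist_ge[OF x, of z] norm_triangle_ineq[of y z] in auto)
   also have "... = \<bar>2/(1 - cmod z)\<bar>" using assms by simp
   finally show "norm ((y + z)/(y - z)*complex_of_real (u y)) <= norm (2/(1 - cmod z)*u y)"
    by (simp only: norm_mult norm_divide real_norm_def norm_of_real abs_mult) (rule mult_right_mono, auto)
  qed
 qed
 hence "Re (schwarz u z) = (MEAN y. Re ((y + z)/(y - z)*complex_of_real (u y)))"
  unfolding schwarz_def by (rule integral_Re[symmetric])
 also have "... = poisson u z" unfolding poisson_def
 proof (rule Bochner_Integration.integral_cong)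
  fix x assume "x \<in> space \<T>"
  thus "Re ((x + z)/(x - z)*complex_of_real (u x)) = pk z x*u x"
   using pk_Re(1)[of z x] assms by (simp del: times_divide_eq_left)
 qed simp
 finally show ?thesis .
qed

section \<open>Boundary continuity; subharmonicity of logarithms and powers\<close>

lemma poisson_tendsto:
 assumes cont: "continuous_on (sphere 0 1) u" and w: "cmod w = 1"
 shows "(poisson u \<longlongrightarrow> u w) (at w within ball 0 1)"
 unfolding tendsto_iff
proof (intro allI impI)
 fix e :: real assume e: "e > 0"
 have u: "integrable \<T> u" by (rule circle_integrable[OF cont])
 have "compact (u ` sphere 0 1)" by (rule compact_continuous_image[OF cont]) auto
 then obtain B where B: "\<And>x. x \<in> sphere 0 1 ==> \<bar>u x\<bar> <= B"
  using compact_imp_bounded bounded_iff by (metis image_eqI real_norm_def)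
 have B0: "0 <= B" using B[of 1] by auto
 obtain n where n: "n > 0" "\<And>y. cmod y = 1 ==> dist y w < n ==> \<bar>u y - u w\<bar> < e/2"
  using cont[unfolded continuous_on_iff, rule_format, of w "e/2"] w e by (auto simp: dist_real_def)
 define K where "K = 2*B*(2/n)^2"
 have K0: "K \<ge> 0" using B0 by (simp add: K_def)
 define d where "d = min (n/2) (e/(4*(K + 1)))"
 have d: "d > 0" using n e K0 by (auto simp: d_def)
 have bound: "\<bar>poisson u z - u w\<bar> < e" if z: "cmod z < 1" "dist z w < d" for z
 proof -
  \<comment> \<open>Near \<open>w\<close> the oscillation of \<open>u\<close> is below
    \<open>e/2\<close>; elsewhere the kernel is of the order of \<open>1 - (cmod z)^2\<close>, and
    \<open>K\<close> collects the constants.\<close>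
  have pt: "pk z y*u y - pk z y*u w <= e/2*pk z y + K*(1 - (cmod z)^2) \<and>
       pk z y*u w - pk z y*u y <= e/2*pk z y + K*(1 - (cmod z)^2)" if x: "cmod y = 1" for y
  proof -
   have p: "0 < pk z y" using pk_pos z x by auto
   have z2: "0 <= 1 - (cmod z)^2" using z by (simp add: power_le_one)
   have "pk z y * \<bar>u y - u w\<bar> <= e/2*pk z y + K*(1 - (cmod z)^2)"
   proof (cases "dist y w < n")
    case True
    have "pk z y * \<bar>u y - u w\<bar> <= pk z y*(e/2)" using n(2)[OF x True] p by (intro mult_left_mono) auto
    thus ?thesis using K0 z2 by (simp add: mult.commute add_increasing2)
   next
    case False
    have "n/2 <= cmod (y - z)"
    proof -
     have "n <= dist y z + dist z w" using False dist_triangle[of y w z] by simp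
     thus ?thesis using z(2) unfolding d_def dist_norm by linarith
    qed
    hence "pk z y <= (1 - (cmod z)^2)/(n/2)^2"
     unfolding pk_def using n z2 by (intro frac_le power_mono) auto
    moreover have "\<bar>u y - u w\<bar> <= 2*B" using B[of y] B[of w] x w by auto
    ultimately have "pk z y * \<bar>u y - u w\<bar> <= (1 - (cmod z)^2)/(n/2)^2*(2*B)"
     using z2 by (intro mult_mono) auto
    also have "... = K*(1 - (cmod z)^2)" by (simp add: K_def power_divide field_simps)
    finally show ?thesis using p e by (simp add: add_increasing)
   qed
   moreover have "pk z y*u y - pk z y*u w <= pk z y * \<bar>u y - u w\<bar>" "pk z y*u w - pk z y*u y <= pk z y * \<bar>u y - u w\<bar>"
    using p unfolding right_diff_distrib[symmetric] by (auto intro!: mult_left_mono)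
   ultimately show ?thesis by linarith
  qed
  have i1: "integrable \<T> (%y. pk z y*u y)" by (rule integrable_pk_mult[OF z(1) u])
  have i2: "integrable \<T> (%y. pk z y*u w)" using integrable_pk[OF z(1)] by auto
  have i3: "integrable \<T> (%y. e/2*pk z y + K*(1 - (cmod z)^2))" using integrable_pk[OF z(1)] by auto
  have "poisson u z - u w = (MEAN y. pk z y*u y - pk z y*u w)"
   unfolding poisson_def using i1 i2 by (simp add: integral_pk[OF z(1)])
  also have "... <= (MEAN y. e/2*pk z y + K*(1 - (cmod z)^2))"
   by (rule integral_mono) (use i1 i2 i3 pt in auto)
  also have I: "... = e/2 + K*(1 - (cmod z)^2)"
   using integrable_pk[OF z(1)] integral_pk[OF z(1)] circle.prob_space by simp
  finally have 1: "poisson u z - u w <= e/2 + K*(1 - (cmod z)^2)" .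
  have "u w - poisson u z = (MEAN y. pk z y*u w - pk z y*u y)"
   unfolding poisson_def using i1 i2 by (simp add: integral_pk[OF z(1)])
  also have "... <= (MEAN y. e/2*pk z y + K*(1 - (cmod z)^2))"
   by (rule integral_mono) (use i1 i2 i3 pt in auto)
  also note I
  finally have 2: "u w - poisson u z <= e/2 + K*(1 - (cmod z)^2)" .
  have "1 - (cmod z)^2 <= 2*(1 - cmod z)" by (rule one_minus_sq_le) (use z in auto)
  also have "1 - cmod z <= dist z w" using circle_dist_ge[OF w, of z] by (simp add: dist_norm norm_minus_commute)
  also have "dist z w < e/(4*(K + 1))" using z(2) by (simp add: d_def)
  also have "2*(e/(4*(K + 1))) = e/(2*(K + 1))" using K0 by (simp add: field_simps)
  finally have "1 - (cmod z)^2 < e/(2*(K + 1))" by simp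
  hence "K*(1 - (cmod z)^2) <= K*(e/(2*(K+1)))" using K0 by (intro mult_left_mono) auto
  also have "... < e/2" using K0 e by (simp add: field_simps)
  finally show ?thesis using 1 2 by linarith
 qed
 show "\<forall>\<^sub>F z in at w within ball 0 1. dist (poisson u z) (u w) < e"
  unfolding eventually_at dist_real_def using bound d by auto
qed

lemma continuous_poisson_extension:
 assumes cont: "continuous_on (sphere 0 1) u"
 shows "continuous_on (cball 0 1) (%x. if cmod x < 1 then poisson u x else u x)" (is "continuous_on _ ?U")
 unfolding continuous_on_def
proof
 fix x :: complex assume x: "x \<in> cball 0 1"
 have u: "integrable \<T> u" by (rule circle_integrable[OF cont])
 show "(?U \<longlongrightarrow> ?U x) (at x within cball 0 1)"
 proof (cases "cmod x < 1")
  case True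
  have "isCont (schwarz u) x"
   using holomorphic_on_imp_continuous_on[OF holomorphic_schwarz[OF u]] True
   by (simp add: continuous_on_eq_continuous_at)
  hence "((%x. Re (schwarz u x)) \<longlongrightarrow> poisson u x) (at x)"
   using Re_schwarz[OF u True] tendsto_Re by (force simp: isCont_def)
  moreover have "\<forall>\<^sub>F y in at x. Re (schwarz u y) = ?U y"
  proof -
   have "\<forall>\<^sub>F y in at x. y \<in> ball 0 1" by (rule eventually_at_in_open') (use True in auto)
   thus ?thesis by eventually_elim (use Re_schwarz[OF u] in auto)
  qed
  ultimately have "(?U \<longlongrightarrow> poisson u x) (at x)" by (rule Lim_transform_eventually)
  thus ?thesis using True by (auto intro: tendsto_within_subset)
 next
  case False
  hence x1: "cmod x = 1" using x by auto
  have "(?U \<longlongrightarrow> u x) (at x within ball 0 1 \<union> sphere 0 1)"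
   unfolding Lim_within_Un
  proof
   show "(?U \<longlongrightarrow> u x) (at x within ball 0 1)"
    by (rule Lim_transform_eventually[OF poisson_tendsto[OF cont x1]]) (auto simp: eventually_at_filter)
   have "(u \<longlongrightarrow> u x) (at x within sphere 0 1)"
    using cont x1 by (auto simp: continuous_on_def)
   thus "(?U \<longlongrightarrow> u x) (at x within sphere 0 1)"
    by (rule Lim_transform_eventually) (auto simp: eventually_at_filter)
  qed
  moreover have "ball 0 1 \<union> sphere 0 1 = cball (0::complex) 1" by auto
  ultimately show ?thesis using False by simp
 qed
qed

text \<open>The function \<open>f * exp (- schwarz (ln P))\<close> has modulus at most 1 on the circle.\<close>
lemma log_subharmonic:
 assumes cf: "continuous_on (cball 0 1) f" and hf: "hol f" and z: "cmod z < 1"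
  and cp: "continuous_on (sphere 0 1) P" and pp: "\<And>w. cmod w = 1 ==> 0 < P w" and le: "\<And>w. cmod w = 1 ==> cmod (f w) <= P w"
 shows "cmod (f z) <= exp (poisson (%w. ln (P w)) z)"
proof -
 define u where "u = (%w. ln (P w))"
 have cu: "continuous_on (sphere 0 1) u" unfolding u_def using cp pp by (intro continuous_intros) force+
 have iu: "integrable \<T> u" by (rule circle_integrable[OF cu])
 define U where "U = (%x. if cmod x < 1 then poisson u x else u x)"
 have cU: "continuous_on (cball 0 1) U" unfolding U_def by (rule continuous_poisson_extension[OF cu])
 \<comment> \<open>The Schwarz integral need not extend continuously to the circle, but its real
   part does, so the modulus \<open>B\<close> of \<open>g\<close> is continuous on the closed disk.
   Uniform continuity carries \<open>B <= 1\<close> to circles of radius \<open>R < 1\<close>, where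
   the maximum principle applies to \<open>g\<close>.\<close>
 define B where "B x = cmod (f x)*exp (- U x)" for x
 have cB: "continuous_on (cball 0 1) B" unfolding B_def using cf cU by (intro continuous_intros)
 hence ucB: "uniformly_continuous_on (cball 0 1) B" by (rule compact_uniformly_continuous) auto
 have B1: "B x <= 1" if "cmod x = 1" for x
 proof -
  have "B x = cmod (f x)/P x" using that pp[OF that] by (simp add: B_def U_def u_def exp_minus field_simps)
  thus ?thesis using le[OF that] pp[OF that] by simp
 qed
 define g where "g x = f x*exp (- schwarz u x)" for x
 have hg: "hol g" unfolding g_def using hf holomorphic_schwarz[OF iu] by (intro holomorphic_intros)
 have Bg: "B x = cmod (g x)" if "cmod x < 1" for x
  using that Re_schwarz[OF iu that] by (simp add: B_def g_def U_def norm_mult)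
 have "B z <= 1 + e" if e: "e > 0" for e
 proof -
  obtain d where d: "d > 0" "\<And>x y. x \<in> cball 0 1 ==> y \<in> cball 0 1 ==> dist x y < d ==> dist (B x) (B y) < e"
   using ucB e unfolding uniformly_continuous_on_def by metis
  obtain m where "cmod z <= m" "1 - d <= m" "m < 1"
   using z d(1) by (intro that[of "max (cmod z) (1 - d)"]) auto
  define R where "R = (1 + m)/2"
  have R: "cmod z < R" "R < 1" "1 - R < d" "0 < R"
   using z d(1) norm_ge_zero[of z] \<open>cmod z <= m\<close> \<open>1 - d <= m\<close> \<open>m < 1\<close> order_trans[OF norm_ge_zero \<open>cmod z <= m\<close>] unfolding R_def by (simp_all add: field_simps)
  have "cmod (g z) <= 1 + e"
  proof (rule maximum_modulus_frontier[of g "cball 0 R"])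
   show "g holomorphic_on interior (cball 0 R)" by (rule holomorphic_on_subset[OF hg]) (use R in auto)
   show "continuous_on (closure (cball 0 R)) g"
    by (rule holomorphic_on_imp_continuous_on, rule holomorphic_on_subset[OF hg]) (use R in auto)
   show "bounded (cball (0::complex) R)" by simp
   show "z \<in> cball 0 R" using R by simp
   fix x :: complex assume "x \<in> frontier (cball 0 R)"
   hence x: "cmod x = R" using R by (simp add: frontier_cball)
   define y where "y = x/of_real R"
   have y: "cmod y = 1" using x R by (simp add: y_def norm_divide)
   have "x = of_real R*y" using R by (simp add: y_def)
   hence "x - y = - of_real (1 - R)*y" by (simp add: algebra_simps)
   hence "dist x y = 1 - R" using y R by (simp only: dist_norm norm_mult norm_minus_cancel norm_of_real) simp
   hence "dist (B x) (B y) < e" using d(2)[of x y] x y R by simp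
   thus "cmod (g x) <= 1 + e" using B1[OF y] Bg[of x] x R by (auto simp: dist_real_def)
  qed
  thus ?thesis using Bg[OF z] by simp
 qed
 hence "B z <= 1" by (rule field_le_epsilon)
 hence "cmod (f z) <= exp (U z)" by (simp add: B_def exp_minus field_simps)
 thus ?thesis using z by (simp add: U_def u_def)
qed

text \<open>The tangent line of \<open>exp\<close> at the mean \<open>b\<close> lies below
  \<open>exp\<close>, and its Poisson integral is \<open>exp b\<close>.\<close>

lemma poisson_jensen_exp:
 assumes "cmod z < 1" "integrable \<T> l" "integrable \<T> (%x. exp (l x))"
 shows "exp (poisson l z) <= poisson (%x. exp (l x)) z"
proof -
 define b where "b = poisson l z"
 have "poisson (%x. exp b*(1 - b) + exp b*l x) z <= poisson (%x. exp (l x)) z"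
 proof (rule poisson_mono)
  fix x
  have "1 + (l x - b) <= exp (l x - b)" by (rule exp_ge_add_one_self)
  hence "exp b*(1 + (l x - b)) <= exp b*exp (l x - b)" by simp
  thus "exp b*(1 - b) + exp b*l x <= exp (l x)" by (simp add: algebra_simps flip: exp_add)
 qed (use assms in auto)
 also have "poisson (%x. exp b*(1 - b) + exp b*l x) z = exp b"
  using assms by (subst poisson_add) (auto simp: poisson_const poisson_cmult algebra_simps simp flip: b_def)
 finally show ?thesis by (simp add: b_def)
qed

lemma powr_subharmonic:
 assumes cf: "continuous_on (cball 0 1) f" and hf: "hol f" and z: "cmod z < 1" and s: "0 < s"
 shows "cmod (f z) powr s <= poisson (%x. cmod (f x) powr s) z"
proof (rule field_le_epsilon)
 fix e :: real assume e: "e > 0"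
 define \<epsilon> where "\<epsilon> = e powr (1/s)"
 have \<epsilon>: "\<epsilon> > 0" "\<epsilon> powr s = e" using e s by (auto simp: \<epsilon>_def powr_powr)
 \<comment> \<open>The cut from below keeps the logarithm continuous at zeros of \<open>f\<close>
   and costs at most \<open>\<epsilon> powr s = e\<close>.\<close>
 define P where "P x = max (cmod (f x)) \<epsilon>" for x
 have cs: "continuous_on (sphere 0 1) f" by (rule continuous_on_subset[OF cf]) auto
 have c\<psi>: "continuous_on (sphere 0 1) P" unfolding P_def using cs by (intro continuous_intros)
 have \<psi>0: "P x > 0" for x using \<epsilon> by (simp add: P_def)
 have cl: "continuous_on (sphere 0 1) (%x. s*ln (P x))" using c\<psi> \<psi>0 by (intro continuous_intros) (auto simp: less_imp_neq[symmetric])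
 have il: "integrable \<T> (%x. s*ln (P x))" by (rule circle_integrable[OF cl])
 have ie: "integrable \<T> (%x. exp (s*ln (P x)))"
  by (rule circle_integrable) (rule continuous_on_exp[OF cl])
 have "cmod (f z) <= exp (poisson (%x. ln (P x)) z)"
  by (rule log_subharmonic[OF cf hf z c\<psi> \<psi>0]) (auto simp: P_def)
 hence "cmod (f z) powr s <= exp (poisson (%x. ln (P x)) z) powr s"
  using s by (intro powr_mono2) auto
 also have "... = exp (poisson (%x. s*ln (P x)) z)"
  by (simp add: powr_def poisson_cmult)
 also have "... <= poisson (%x. exp (s*ln (P x))) z"
  by (rule poisson_jensen_exp[OF z il ie])
 also have "... <= poisson (%x. cmod (f x) powr s + e) z"
 proof (rule poisson_mono[OF z ie])
  show "integrable \<T> (%x. cmod (f x) powr s + e)"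
   using cs s by (intro circle_integrable continuous_intros continuous_on_powr') auto
  fix x :: complex
  have "exp (s*ln (P x)) = P x powr s" using \<psi>0[of x] by (simp add: powr_def)
  also have "... <= cmod (f x) powr s + \<epsilon> powr s" by (auto simp: P_def max_def)
  finally show "exp (s*ln (P x)) <= cmod (f x) powr s + e" by (simp add: \<epsilon>)
 qed
 also have "... = poisson (%x. cmod (f x) powr s) z + e"
  using cs s by (subst poisson_add) (auto simp: poisson_const z intro!: circle_integrable continuous_intros continuous_on_powr')
 finally show "cmod (f z) powr s <= poisson (%x. cmod (f x) powr s) z + e" .
qed

section \<open>The nontangential maximal function\<close>

definition PN :: "(complex => ennreal) => complex => ennreal" where
 "PN u z = (\<integral>\<^sup>+\<xi>. ennreal (pk z \<xi>)*u \<xi> \<partial>\<T>)"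

definition rad :: "nat => real" where "rad j = 1 - (1/2)^j"

text \<open>Restricting to finitely many radii makes the maximum attained and gives it a finite, if
  large, operator bound, from which the bootstrap can start.\<close>

definition maxN :: "nat => (complex => ennreal) => complex => ennreal" where
 "maxN n u \<zeta> = Max ((%j. PN u (of_real (rad j) * \<zeta>)) ` {..n})"

lemma rad: "0 <= rad j" "rad j < 1" "1 - rad j = (1/2)^j"
 by (auto simp: rad_def power_le_one)

lemma rad_circle: "cmod u = 1 ==> cmod (of_real (rad j)*u) < 1" "cmod u = 1 ==> cmod (of_real (rad j)*u) = rad j"
 using rad[of j] by (auto simp: norm_mult)

lemma measurable_PN [measurable (raw)]:
 assumes [measurable]: "u \<in> borel_measurable \<T>" "f \<in> borel_measurable M"
 shows "(%x. PN u (f x)) \<in> borel_measurable M"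
 unfolding PN_def by measurable

lemma measurable_maxN [measurable]:
 assumes [measurable]: "u \<in> borel_measurable \<T>"
 shows "maxN n u \<in> borel_measurable \<T>"
proof -
 have "(%z. Max ((%j. PN u (of_real (rad j)*z)) ` {..n})) \<in> borel_measurable \<T>"
  by (rule borel_measurable_Max) auto
 thus ?thesis by (simp add: maxN_def[abs_def])
qed

lemma PN_le:
 assumes "cmod z < 1" "u \<in> borel_measurable \<T>"
 shows "PN u z <= ennreal (2/(1 - cmod z))*(NN x. u x)"
proof -
 have "PN u z <= (NN x. ennreal (2/(1 - cmod z))*u x)"
  unfolding PN_def by (rule nn_integral_mono) (use assms pk_le in "auto intro!: mult_right_mono ennreal_leI")
 thus ?thesis using assms by (simp add: nn_integral_cmult)
qed

lemma nn_integral_sq_circle: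
 assumes "u \<in> borel_measurable \<T>"
 shows "(NN x. u x)^2 <= (NN x. (u x)^2)"
 using Cauchy_Schwarz_nn_integral[of u \<T> "%_. 1"] assms
 by (simp add: circle.emeasure_space_1[simplified])

text \<open>Any finite constant will do here, even one that grows with \<open>n\<close>:
  \<open>maxN_L2\<close> only needs a nonempty set of admissible constants.\<close>

lemma maxN_crude:
 assumes [measurable]: "u \<in> borel_measurable \<T>"
 shows "(NN z. (maxN n u z)^2) <= ennreal ((2*2^n)^2)*(NN x. (u x)^2)"
proof -
 let ?I = "\<integral>\<^sup>+x. u x \<partial>\<T>"
 have "maxN n u z <= ennreal (2*2^n)*?I" if "cmod z = 1" for z
  unfolding maxN_def
 proof (subst Max_le_iff, simp, simp, safe)
  fix j assume j: "j <= n"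
  have "PN u (of_real (rad j)*z) <= ennreal (2/(1 - rad j))*?I"
   using PN_le[of "of_real (rad j)*z" u] rad_circle[OF that] by simp
  also have "2/(1 - rad j) = 2*2^j" by (simp add: rad power_divide)
  also have "ennreal (2*2^j)*?I <= ennreal (2*2^n)*?I"
   using j by (intro mult_right_mono ennreal_leI) (auto intro!: power_increasing)
  finally show "PN u (of_real (rad j)*z) <= ennreal (2*2^n)*?I" .
 qed
 hence "(NN z. (maxN n u z)^2) <= (NN z. (ennreal (2*2^n)*?I)^2)"
  by (intro nn_integral_mono power_mono) auto
 also have "... = (ennreal (2*2^n)*?I)^2" by (simp add: circle.emeasure_space_1[simplified])
 also have "... = ennreal ((2*2^n)^2)*?I^2" by (simp only: power_mult_distrib ennreal_power[symmetric]) (simp add: ennreal_power)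
 also have "... <= ennreal ((2*2^n)^2)*(NN x. (u x)^2)"
  by (intro mult_left_mono nn_integral_sq_circle) auto
 finally show ?thesis .
qed

lemma nn_pk_semigroup:
 assumes "cmod a = 1" "cmod b = 1"
 shows "(NN x. ennreal (pk (of_real (rad i)*a) x)*ennreal (pk (of_real (rad j)*b) x))
  <= 16*(ennreal (pk (of_real (rad i)*a) b) + ennreal (pk (of_real (rad j)*b) a))"
proof -
 let ?p = "pk (of_real (rad i)*a)" and ?q = "pk (of_real (rad j)*b)"
 have nn: "0 <= ?p x" "0 <= ?q x" for x
  using rad_circle(1)[OF assms(1), of i] rad_circle(1)[OF assms(2), of j] by (auto intro!: pk_nonneg)
 have "(NN x. ennreal (?p x)*ennreal (?q x)) = (NN x. ennreal (?p x*?q x))"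
  by (simp add: ennreal_mult' nn)
 also have "... = ennreal (MEAN x. ?p x*?q x)"
  by (rule nn_integral_eq_integral)
   (use rad_circle(1)[OF assms(1), of i] rad_circle(1)[OF assms(2), of j] in "auto intro!: integrable_pk_mult integrable_pk AE_I2 mult_nonneg_nonneg nn")
 also have "... <= ennreal (16*(?p b + ?q a))"
  by (intro ennreal_leI pk_semigroup_le) (use assms rad in auto)
 also have "... = 16*(ennreal (?p b) + ennreal (?q a))"
  using nn by (simp add: ennreal_mult' ennreal_plus)
 finally show ?thesis .
qed

text \<open>Linearising the maximum, the adjoint operator squared is controlled by the operator itself
 through the semigroup property, so a bound with constant \<open>A\<close> improves to \<open>32 * sqrt A\<close>.\<close>
lemma maxN_improve:
 assumes A: "0 < A" and bd: "\<And>u. u \<in> borel_measurable \<T> ==>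
   (NN z. (maxN n u z)^2) <= ennreal A*(NN t. (u t)^2)"
  and [measurable]: "u \<in> borel_measurable \<T>"
 shows "(NN z. (maxN n u z)^2) <= ennreal (32 * sqrt A)*(NN t. (u t)^2)"
proof (cases "(NN t. (u t)^2) = \<infinity>")
 case True
 thus ?thesis using A by (simp add: ennreal_mult_top)
next
 case False
 define m where "m = maxN n u"
 have [measurable]: "m \<in> borel_measurable \<T>" by (simp add: m_def)
 \<comment> \<open>Linearisation. The first index attaining the maximum is a measurable choice, so
   \<open>maxN n u z\<close> becomes \<open>PN u (R z)\<close>, which is linear in
   \<open>u\<close>.\<close>
 define J where "J z = (LEAST j. j <= n \<and> PN u (of_real (rad j)*z) = m z)" for z
 have J: "J z <= n \<and> PN u (of_real (rad (J z))*z) = m z" for z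
 proof -
  have "m z \<in> (%j. PN u (of_real (rad j)*z)) ` {..n}" unfolding m_def maxN_def by (rule Max_in) auto
  hence "\<exists>j. j <= n \<and> PN u (of_real (rad j)*z) = m z" by auto
  thus ?thesis unfolding J_def by (rule LeastI_ex)
 qed
 have [measurable]: "J \<in> measurable \<T> (count_space UNIV)"
  unfolding J_def[abs_def] by measurable
 define R where "R z = of_real (rad (J z))*z" for z :: complex
 have [measurable]: "R \<in> borel_measurable \<T>" unfolding R_def[abs_def] by measurable
 have PNle: "PN v (R z) <= maxN n v z" for v z
  unfolding maxN_def R_def using J[of z] by (intro Max_ge) auto
 have mR: "m z = PN u (R z)" for z using J[of z] by (simp add: R_def)
 \<comment> \<open>The adjoint of the linearised operator, applied to \<open>m\<close>.\<close>
 define w where "w t = (NN z. m z*ennreal (pk (R z) t))" for t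
 have [measurable]: "w \<in> borel_measurable \<T>" unfolding w_def[abs_def] by measurable
 interpret P: pair_sigma_finite \<T> \<T> ..
 have 1: "(NN z. (m z)^2) = (NN t. u t*w t)"
 proof -
  have "(NN z. (m z)^2) = (NN z. (NN t. m z*(ennreal (pk (R z) t)*u t)))"
   unfolding power2_eq_square by (subst (2) mR) (simp add: PN_def nn_integral_cmult)
  also have "... = (NN t. (NN z. m z*(ennreal (pk (R z) t)*u t)))"
   by (rule P.Fubini') measurable
  also have "... = (NN t. u t*w t)"
   unfolding w_def by (subst nn_integral_cmult[symmetric]) (auto simp: mult_ac)
  finally show ?thesis .
 qed
 define I where "I = (NN z. m z*maxN n m z)"
 \<comment> \<open>The square of \<open>w\<close> integrates two kernels against each other. The
   semigroup bound replaces them by two single kernels; by symmetry in \<open>a\<close> and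
   \<open>b\<close> both give the operator applied to \<open>m\<close>, hence
   \<open>16 + 16\<close>.\<close>
 have 2: "(NN t. (w t)^2) <= 32*I"
 proof -
  let ?k = "%z t. ennreal (pk (R z) t)"
  have "(NN t. (w t)^2) = (NN t. (NN a. (NN b. (m a*m b)*(?k a t*?k b t))))"
  proof (rule nn_integral_cong)
   fix t
   have "(w t)^2 = (NN a. m a*?k a t*w t)"
    by (subst nn_integral_multc) (auto simp: w_def power2_eq_square)
   also have "... = (NN a. (NN b. m a*?k a t*(m b*?k b t)))"
    unfolding w_def by (subst nn_integral_cmult) auto
   finally show "(w t)^2 = (NN a. (NN b. (m a*m b)*(?k a t*?k b t)))"
    by (simp add: mult_ac)
  qed
  also have "... = (NN a. (NN t. (NN b. (m a*m b)*(?k a t*?k b t))))"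
   by (rule P.Fubini') measurable
  also have "... = (NN a. (NN b. (NN t. (m a*m b)*(?k a t*?k b t))))"
   by (intro nn_integral_cong P.Fubini') measurable
  also have "... <= (NN a. (NN b. (m a*m b)*(16*(?k a b + ?k b a))))"
  proof (intro nn_integral_mono)
   fix a b assume "a \<in> space \<T>" "b \<in> space \<T>"
   hence "(NN t. ?k a t*?k b t) <= 16*(?k a b + ?k b a)"
    unfolding R_def by (intro nn_pk_semigroup) auto
   thus "(NN t. (m a*m b)*(?k a t*?k b t)) <= (m a*m b)*(16*(?k a b + ?k b a))"
    by (subst nn_integral_cmult) (simp_all add: mult_left_mono)
  qed
  also have "... = (NN a. (NN b. (m a*m b)*(16*?k a b) + (m a*m b)*(16*?k b a)))"
   by (simp add: distrib_left mult_ac)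
  also have "... = (NN a. (NN b. (m a*m b)*(16*?k a b))) +
          (NN a. (NN b. (m a*m b)*(16*?k b a)))"
   by (subst nn_integral_add[symmetric]) (auto intro!: nn_integral_cong nn_integral_add)
  also have "(NN a. (NN b. (m a*m b)*(16*?k b a))) =
   (NN b. (NN a. (m a*m b)*(16*?k b a)))"
   by (rule P.Fubini') measurable
  also have "... = (NN a. (NN b. (m a*m b)*(16*?k a b)))"
   by (simp add: mult_ac)
  also have "(NN a. (NN b. (m a*m b)*(16*?k a b))) =
    (NN a. 16*(m a*PN m (R a)))"
  proof (rule nn_integral_cong)
   fix a
   have "(NN b. (m a*m b)*(16*?k a b)) = (NN b. 16*m a*(?k a b*m b))"
    by (simp add: mult_ac)
   also have "... = 16*m a*(NN b. ?k a b*m b)"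
    by (rule nn_integral_cmult) measurable
   finally show "(NN b. (m a*m b)*(16*?k a b)) = 16*(m a*PN m (R a))"
    by (simp only: PN_def mult.assoc)
  qed
  also have "... <= 16*I"
   unfolding I_def by (subst nn_integral_cmult[symmetric]) (auto intro!: nn_integral_mono mult_left_mono PNle)
  finally have "(NN t. (w t)^2) <= 16*I + 16*I" by (meson add_mono order_trans order_refl)
  thus ?thesis by (simp flip: distrib_right)
 qed
 obtain y where y: "0 <= y" "(NN t. (u t)^2) = ennreal y"
  using False by (cases "\<integral>\<^sup>+t. (u t)^2 \<partial>\<T>") auto
 \<comment> \<open>Finiteness of this integral is what permits cancelling \<open>x\<close> at the
   end.\<close>
 have "(NN z. (m z)^2) <= ennreal (A*y)"
  using bd[of u] A y by (simp add: m_def ennreal_mult')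
 then obtain x where x: "0 <= x" "(NN z. (m z)^2) = ennreal x"
  by (cases "\<integral>\<^sup>+z. (m z)^2 \<partial>\<T>") (auto simp: top_unique)
 \<comment> \<open>The assumed bound is applied to \<open>m\<close> itself; this is where the square
   root of \<open>A\<close> appears.\<close>
 have "I^2 <= ennreal x*(NN z. (maxN n m z)^2)"
  unfolding I_def x(2)[symmetric] by (rule Cauchy_Schwarz_nn_integral) auto
 also have "... <= ennreal x*(ennreal A*ennreal x)"
  unfolding x(2)[symmetric] by (intro mult_left_mono bd) auto
 also have "... = ennreal (A*x^2)" using A x by (simp add: ennreal_mult'[symmetric] power2_eq_square mult_ac)
 finally have I2: "I^2 <= ennreal (A*x^2)" .
 then obtain i where i: "0 <= i" "I = ennreal i"
  by (cases I) (auto simp: top_unique ennreal_top_eq_mult_iff power2_eq_square)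
 have "i^2 <= A*x^2" using I2 A i by (simp add: ennreal_power)
 hence "sqrt (i^2) <= sqrt (A*x^2)" by (rule real_sqrt_le_mono)
 hence ii: "i <= sqrt A*x" using i x by (simp add: real_sqrt_mult)
 have "(ennreal x)^2 <= ennreal y*(NN t. (w t)^2)"
  unfolding x(2)[symmetric] y(2)[symmetric] 1 by (rule Cauchy_Schwarz_nn_integral) auto
 also have "... <= ennreal y*(32*ennreal i)" using 2 by (intro mult_left_mono) (auto simp: i)
 also have "... = ennreal (y*(32*i))" using y i by (simp add: ennreal_mult')
 finally have "x^2 <= y*(32*i)" using x y i by (simp add: ennreal_power)
 also have "... <= y*(32*(sqrt A*x))" using ii y by (intro mult_left_mono) auto
 finally have "x*x <= (32 * sqrt A*y)*x" by (simp add: power2_eq_square mult_ac)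
 hence "x <= 32 * sqrt A*y" using x y A by (cases "x = 0") auto
 thus ?thesis using x y A by (simp add: m_def ennreal_mult'[symmetric])
qed

text \<open>The admissible constants are stable under \<open>A \<mapsto> 32 * sqrt A\<close>, whose
  positive fixed point is 1024. So some admissible constant lies below 1025, independently of
  \<open>n\<close>.\<close>

lemma maxN_L2:
 assumes "u \<in> borel_measurable \<T>"
 shows "(NN z. (maxN n u z)^2) <= ennreal 1025*(NN x. (u x)^2)"
proof -
 define S where "S = {A::real. 0 < A \<and> (\<forall>u \<in> borel_measurable \<T>.
   (NN z. (maxN n u z)^2) <= ennreal A*(NN x. (u x)^2))}"
 have ne: "S \<noteq> {}" using maxN_crude[of _ n] unfolding S_def by (auto intro!: exI[of _ "(2*2^n)^2"])
 have bb: "bdd_below S" unfolding S_def by (rule bdd_belowI[of _ 0]) auto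
 have st: "32 * sqrt A \<in> S" if "A \<in> S" for A
  using that maxN_improve[of A n] unfolding S_def by auto
 have "\<exists>A\<in>S. A < 1025"
 proof (rule ccontr)
  assume "\<not> ?thesis"
  hence ge: "A \<ge> 1025" if "A \<in> S" for A using that by (meson not_less)
  define a where "a = Inf S"
  have a: "a \<ge> 1025" unfolding a_def by (rule cInf_greatest[OF ne]) (rule ge)
  have "a < a^2/1024" using a by (simp add: power2_eq_square)
  then obtain A where A: "A \<in> S" "A < a^2/1024" unfolding a_def using cInf_lessD[OF ne] by blast
  have "sqrt A < sqrt (a^2/1024)" using A by simp
  also have "sqrt (a^2/1024) = a/32" using a by (simp add: real_sqrt_divide)
  finally have "32 * sqrt A < a" by simp
  moreover have "a <= 32 * sqrt A" unfolding a_def by (rule cInf_lower[OF st[OF A(1)] bb])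
  ultimately show False by simp
 qed
 then obtain A where A: "A \<in> S" "A < 1025" by auto
 have "(NN z. (maxN n u z)^2) <= ennreal A*(NN x. (u x)^2)"
  using A assms by (auto simp: S_def)
 also have "... <= ennreal 1025*(NN x. (u x)^2)"
  using A by (intro mult_right_mono ennreal_leI) auto
 finally show ?thesis .
qed

definition maxP :: "(complex => ennreal) => complex => ennreal" where
 "maxP u \<zeta> = (SUP n. maxN n u \<zeta>)"

lemma measurable_maxP [measurable]:
 assumes [measurable]: "u \<in> borel_measurable \<T>"
 shows "maxP u \<in> borel_measurable \<T>"
 unfolding maxP_def[abs_def] by measurable

lemma PN_le_maxP: "PN u (of_real (rad j)*z) <= maxP u z"
 unfolding maxP_def by (rule SUP_upper2[of j]) (auto simp: maxN_def intro!: Max_ge)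

lemma maxP_L2:
 assumes [measurable]: "u \<in> borel_measurable \<T>"
 shows "(NN z. (maxP u z)^2) <= ennreal 1025*(NN y. (u y)^2)"
proof -
 have inc: "incseq (%n. maxN n u z)" for z
  unfolding maxN_def by (intro incseq_SucI Max_mono) auto
 have nz: "\<not> (x = 0 \<and> x = \<infinity> \<or> x = \<infinity> \<and> x = 0)" for x :: ennreal by auto
 have sq: "(maxP u z)^2 = (SUP n. (maxN n u z)^2)" for z
  unfolding maxP_def power2_eq_square
  by (rule LIMSEQ_unique[OF tendsto_mult_ennreal[OF LIMSEQ_SUP[OF inc] LIMSEQ_SUP[OF inc] nz] LIMSEQ_SUP])
   (use inc in "auto simp: incseq_def intro!: mult_mono")
 have "(NN z. (maxP u z)^2) = (SUP n. \<integral>\<^sup>+z. (maxN n u z)^2 \<partial>\<T>)"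
  unfolding sq by (rule nn_integral_monotone_convergence_SUP) (use inc in "auto simp: incseq_def le_fun_def intro!: power_mono")
 also have "... <= ennreal 1025*(NN y. (u y)^2)"
  by (rule SUP_least) (rule maxN_L2, simp)
 finally show ?thesis .
qed

section \<open>Power series on the disk\<close>

lemma hol_sums:
 assumes "hol f" "cmod z < 1"
 shows "(%n. taylor_seq f n*z^n) sums f z"
 using holomorphic_power_series[OF assms(1), of z] assms(2)
 by (simp add: taylor_seq_def fps_expansion_def)

lemma abs_summable_disk:
 fixes a :: "nat => complex"
 assumes "\<And>z. cmod z < 1 ==> summable (%n. a n*z^n)" "0 <= r" "r < 1"
 shows "summable (%n. cmod (a n)*r^n)"
proof -
 have "summable (%n. a n * of_real ((r + 1)/2)^n)" by (rule assms(1)) (use assms in auto)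
 hence "summable (%n. norm (a n * of_real r^n))"
  by (rule powser_insidea) (use assms in auto)
 thus ?thesis using assms by (simp add: norm_mult norm_power)
qed

lemma hol_abs_summable:
 assumes "hol f" "0 <= r" "r < 1"
 shows "summable (%n. cmod (taylor_seq f n)*r^n)"
 by (rule abs_summable_disk) (use hol_sums[OF assms(1)] assms in "auto simp: sums_iff")

lemma taylor_seq_unique:
 assumes "\<And>z. cmod z < 1 ==> (%n. a n*z^n) sums f z"
 shows "taylor_seq f = a"
proof -
 have "\<forall>\<^sub>F u in nhds 0. u \<in> ball (0::complex) 1" by (rule eventually_nhds_in_open) auto
 hence "\<forall>\<^sub>F u in nhds 0. (%n. fps_nth (Abs_fps a) n*u^n) sums f u"
  by eventually_elim (use assms in auto)
 hence "f has_fps_expansion Abs_fps a" by (rule has_fps_expansionI)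
 hence "fps_expansion f 0 = Abs_fps a" by (rule fps_expansion_eqI)
 thus ?thesis by (simp add: taylor_seq_def fun_eq_iff)
qed

lemma power_series_disk:
 fixes a :: "nat => complex"
 assumes "\<And>z. cmod z < 1 ==> summable (%n. a n*z^n)"
 shows "hol (%z. \<Sum>n. a n*z^n)" "taylor_seq (%z. \<Sum>n. a n*z^n) = a"
proof -
 have *: "(%n. a n*z^n) sums (\<Sum>n. a n*z^n)" if "cmod z < 1" for z
  by (rule summable_sums[OF assms[OF that]])
 show "hol (%z. \<Sum>n. a n*z^n)"
  by (rule power_series_holomorphic[where a = a]) (use * in simp)
 show "taylor_seq (%z. \<Sum>n. a n*z^n) = a" by (rule taylor_seq_unique[OF *])
qed

lemma dilate_holomorphic:
 assumes "hol f" "0 <= r" "r < 1"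
 shows "continuous_on (cball 0 1) (%z. f (of_real r*z))" "hol (%z. f (of_real r*z))"
  "continuous_on (sphere 0 1) (%z. f (of_real r*z))"
proof -
 have l: "r*cmod z < 1" if "cmod z <= 1" for z :: complex
  using that assms mult_left_mono[of "cmod z" 1 r] by simp
 show 1: "continuous_on (cball 0 1) (%z. f (of_real r*z))"
  by (rule continuous_on_compose2[OF holomorphic_on_imp_continuous_on[OF assms(1)]])
   (use assms l in "auto intro!: continuous_intros simp: norm_mult")
 show "hol (%z. f (of_real r*z))"
 proof -
  have "(%z. of_real r*z) ` ball 0 1 \<subseteq> ball (0::complex) 1" using assms l by (auto simp: norm_mult)
  moreover have "(%z. of_real r*z) holomorphic_on ball (0::complex) 1" by (intro holomorphic_intros)
  ultimately show ?thesis using holomorphic_on_compose_gen[OF _ assms(1), of "%z. of_real r*z" "ball 0 1"] by (simp add: o_def)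
 qed
 show "continuous_on (sphere 0 1) (%z. f (of_real r*z))"
  by (rule continuous_on_subset[OF 1]) auto
qed

text \<open>The one interchange of series and integral behind the coefficient formula, Parseval's
  identity and the Hadamard product bound.\<close>

lemma termwise_integral:
 assumes f: "hol f" and r: "0 <= r" "r < 1" and v: "integrable \<T> v"
 shows "(%n. taylor_seq f n * of_real r^n*(MEAN u. u^n * v u)) sums (MEAN u. f (of_real r*u) * v u)"
proof -
 define F where "F n u = (taylor_seq f n * of_real r^n)*(u^n * v u)" for n u
 have i0: "integrable \<T> (%u. u^n * v u)" for n
  by (rule Bochner_Integration.integrable_bound[OF v])
   (use v in "auto simp: norm_mult norm_power intro!: borel_measurable_times borel_measurable_power")
 have int: "integrable \<T> (F n)" for n
  unfolding F_def by (intro integrable_mult_right i0)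
 have nF: "norm (F n u) = cmod (taylor_seq f n)*r^n*cmod (v u)" if "cmod u = 1" for n u
  using that r by (simp add: F_def norm_mult norm_power)
 have gs: "summable (%n. cmod (taylor_seq f n)*r^n*c)" for c
  by (intro summable_mult2 hol_abs_summable f r)
 have "(%i. integral\<^sup>L \<T> (F i)) sums (MEAN u. (\<Sum>i. F i u))"
 proof (rule sums_integral[OF int])
  show "AE u in \<T>. summable (%i. norm (F i u))"
   by (rule AE_I2) (use nF gs in auto)
  have "(MEAN u. norm (F n u)) = cmod (taylor_seq f n)*r^n*(MEAN u. cmod (v u))" for n
   unfolding integral_mult_right_zero[symmetric]
   by (rule Bochner_Integration.integral_cong) (use nF in auto)
  thus "summable (%i. MEAN u. norm (F i u))" using gs by simp
 qed
 also have "(MEAN u. (\<Sum>i. F i u)) = (MEAN u. f (of_real r*u) * v u)"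
 proof (rule Bochner_Integration.integral_cong)
  fix u assume "u \<in> space \<T>"
  hence "cmod (of_real r*u) < 1" using r by (simp add: norm_mult)
  from sums_mult2[OF hol_sums[OF f this], of "v u"] show "(\<Sum>i. F i u) = f (of_real r*u) * v u"
   by (simp add: F_def sums_iff power_mult_distrib mult_ac)
 qed simp
 also have "(%i. integral\<^sup>L \<T> (F i)) = (%n. taylor_seq f n * of_real r^n*(MEAN u. u^n * v u))"
  unfolding F_def integral_mult_right_zero ..
 finally show ?thesis .
qed

lemma coeff_integral:
 assumes f: "hol f" and r: "0 <= r" "r < 1"
 shows "(MEAN u. f (of_real r*u)*cnj u^n) = taylor_seq f n * of_real r^n"
proof -
 have "integrable \<T> (%u. cnj u^n)" by (intro circle_integrable continuous_intros)
 from termwise_integral[OF f r this]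
 have 1: "(%k. taylor_seq f k * of_real r^k*(if k = n then 1 else 0)) sums (MEAN u. f (of_real r*u)*cnj u^n)"
  by (simp add: circle_orthogonal)
 have 2: "(%k. taylor_seq f k * of_real r^k*(if k = n then 1 else 0)) = (%k. if k = n then taylor_seq f k * of_real r^k else 0)"
  by (rule ext) simp
 show ?thesis by (rule sums_unique2[OF 1]) (unfold 2, rule sums_single)
qed

lemma parseval:
 assumes f: "hol f" and r: "0 <= r" "r < 1"
 shows "(%n. (cmod (taylor_seq f n))^2*r^(2*n)) sums (MEAN u. (cmod (f (of_real r*u)))^2)"
proof -
 have c: "continuous_on (sphere 0 1) (%u. f (of_real r*u))" by (rule dilate_holomorphic[OF f r])
 have "integrable \<T> (%u. cnj (f (of_real r*u)))" by (intro circle_integrable continuous_intros c)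
 from termwise_integral[OF f r this]
 have 1: "(%n. taylor_seq f n * of_real r^n*(MEAN u. u^n*cnj (f (of_real r*u)))) sums (MEAN u. f (of_real r*u)*cnj (f (of_real r*u)))" .
 have 2: "(MEAN u. u^n*cnj (f (of_real r*u))) = cnj (taylor_seq f n * of_real r^n)" for n
  unfolding coeff_integral[OF f r, symmetric] Bochner_Integration.integral_cnj[symmetric] by (simp add: mult.commute)
 have 3: "taylor_seq f n * of_real r^n*cnj (taylor_seq f n * of_real r^n) = of_real ((cmod (taylor_seq f n))^2*r^(2*n))" for n
  unfolding complex_norm_square[symmetric] using r by (simp add: norm_mult norm_power power_mult_distrib power_mult[symmetric] mult.commute)
 have 4: "(MEAN u. f (of_real r*u)*cnj (f (of_real r*u))) = of_real (MEAN u. (cmod (f (of_real r*u)))^2)"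
  unfolding complex_norm_square[symmetric] by (rule integral_complex_of_real)
 show ?thesis using 1 unfolding 2 3 4 sums_of_real_iff .
qed

text \<open>The variance of \<open>cmod (g u)\<close> is nonnegative.\<close>

lemma circle_L1_L2:
 fixes g :: "complex => complex"
 assumes "continuous_on (sphere 0 1) g"
 shows "(MEAN u. cmod (g u)) <= sqrt (MEAN u. (cmod (g u))^2)"
proof -
 have i: "integrable \<T> (%u. cmod (g u))" "integrable \<T> (%u. (cmod (g u))^2)"
  using assms by (auto intro!: circle_integrable continuous_intros)
 have "0 <= circle.variance (%u. cmod (g u))" by (rule circle.variance_positive)
 also have "... = (MEAN u. (cmod (g u))^2) - (MEAN u. cmod (g u))^2"
  by (rule circle.variance_eq[OF i])
 finally show ?thesis by (intro real_le_rsqrt) simp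
qed

section \<open>Nontangential limits\<close>

lemma stolz_subset: "stolz_region A u \<subseteq> ball 0 1" by (auto simp: stolz_region_def)

lemma stolz_nontrivial:
 assumes "1 < A" "cmod u = 1"
 shows "at u within stolz_region A u \<noteq> bot"
proof -
 have "u islimpt stolz_region A u"
  unfolding islimpt_approachable
 proof (intro allI impI)
  fix e :: real assume e: "e > 0"
  define t where "t = min (1/2) (e/2)"
  have t: "0 < t" "t < 1" "t < e" using e by (auto simp: t_def min_def)
  define z where "z = of_real (1 - t)*u"
  have nz: "cmod z = 1 - t" using t assms by (simp only: z_def norm_mult norm_of_real) simp
  have "u - z = of_real t*u" by (simp add: z_def algebra_simps)
  hence d: "cmod (u - z) = t" using t assms by (simp add: norm_mult)
  have "t < A*t" using assms t by simp
  hence "z \<in> stolz_region A u" using nz d t by (simp add: stolz_region_def)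
  moreover have "z \<noteq> u" using d t by auto
  moreover have "dist z u < e" using d t by (simp add: dist_norm norm_minus_commute)
  ultimately show "\<exists>x'\<in>stolz_region A u. x' \<noteq> u \<and> dist x' u < e" by blast
 qed
 thus ?thesis by (simp add: trivial_limit_within)
qed

lemma boundary_fun_eqI:
 assumes L: "has_nontangential_limit f u L" and u: "cmod u = 1"
 shows "boundary_fun f u = L"
proof -
 have nt: "(f \<longlongrightarrow> L') (at u within stolz_region 2 u)" if "has_nontangential_limit f u L'" for L'
  using that unfolding has_nontangential_limit_def by simp
 have "at u within stolz_region 2 u \<noteq> bot" by (rule stolz_nontrivial) (simp_all add: u)
 from tendsto_unique[OF this nt nt[OF L]]
 have "(THE L. has_nontangential_limit f u L) = L" by (intro the_equality[where P = "has_nontangential_limit f u"] L)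
 moreover have "\<exists>L. has_nontangential_limit f u L" using L by (rule exI)
 ultimately show ?thesis unfolding boundary_fun_def by (simp only: if_True)
qed

text \<open>The factor of \<open>pk_compare\<close> for distance parameter
  \<open>2 + \<alpha>\<close>, squared because \<open>H1_maximal\<close> works with square
  roots.\<close>

definition nt_const :: "real => real" where "nt_const \<alpha> = (4*(3 + \<alpha>)^2)^2"

text \<open>The square root of \<open>cmod h\<close> is subharmonic and bounded in
  \<open>L^2\<close>, so the \<open>L^2\<close> maximal theorem applies to it and the square of its
  maximal function is bounded in \<open>L^1\<close>. As \<open>h\<close> has no boundary values yet,
  this is done for dilations; \<open>H\<close> is the lower limit, integrated with Fatou's
  lemma.\<close>

lemma H1_maximal:
 assumes h: "hol h"
  and K: "\<And>r. 0 <= r ==> r < 1 ==> (MEAN y. cmod (h (of_real r*y))) <= K"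
 obtains H where "H \<in> borel_measurable \<T>" "(NN y. H y) <= ennreal (1025*K)"
  "\<And>A y z. 1 < A ==> cmod y = 1 ==> z \<in> stolz_region A y ==> ennreal (cmod (h z)) <= ennreal (nt_const A)*H y"
proof -
 define u where "u n v = ennreal (cmod (h (of_real (rad n) * v)) powr (1/2))" for n v
 have c0: "continuous_on (sphere 0 1) (%v. cmod (h (of_real (rad n) * v)))" for n
  by (rule continuous_on_norm[OF dilate_holomorphic(3)[OF h rad(1,2)]])
 have c: "continuous_on (sphere 0 1) (%v. cmod (h (of_real (rad n) * v)) powr (1/2))" for n
  by (rule continuous_on_powr'[OF c0 continuous_on_const]) auto
 have [measurable]: "u n \<in> borel_measurable \<T>" for n
  unfolding u_def[abs_def] by (rule measurable_compose[OF circle_measurable[OF c] measurable_ennreal])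
 define H where "H y = liminf (%n. (maxP (u n) y)^2)" for y
 have [measurable]: "H \<in> borel_measurable \<T>" unfolding H_def[abs_def] by measurable
 have u2: "(NN v. (u n v)^2) <= ennreal K" for n
 proof -
  have sq: "(u n v)^2 = ennreal (cmod (h (of_real (rad n) * v)))" for v
   unfolding u_def by (subst ennreal_power) (auto simp: powr_half_sqrt)
  have "(NN v. (u n v)^2) = ennreal (MEAN v. cmod (h (of_real (rad n) * v)))"
   unfolding sq
   by (rule nn_integral_eq_integral[OF circle_integrable[OF c0]]) auto
  also have "... <= ennreal K" by (intro ennreal_leI K rad)
  finally show ?thesis .
 qed
 have "(NN y. H y) <= liminf (%n. \<integral>\<^sup>+y. (maxP (u n) y)^2 \<partial>\<T>)"
  unfolding H_def by (rule nn_integral_liminf) measurable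
 also have "... <= liminf (%n. ennreal 1025*ennreal K)"
 proof (intro Liminf_mono always_eventually allI)
  fix n
  have "(NN y. (maxP (u n) y)^2) <= ennreal 1025*(NN v. (u n v)^2)"
   by (rule maxP_L2) measurable
  also have "... <= ennreal 1025*ennreal K" by (intro mult_left_mono u2) simp
  finally show "(NN y. (maxP (u n) y)^2) <= ennreal 1025*ennreal K" .
 qed
 also have "... = ennreal (1025*K)" by (simp add: Liminf_const ennreal_mult')
 finally have 1: "(NN y. H y) <= ennreal (1025*K)" .
 have 2: "ennreal (cmod (h z)) <= ennreal (nt_const A)*H y"
  if A: "1 < A" and y: "cmod y = 1" and z: "z \<in> stolz_region A y" for A y z
 proof -
  have z1: "cmod z < 1" and z2: "cmod (y - z) < A*(1 - cmod z)" using z by (auto simp: stolz_region_def)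
  have "(%j. (1/2::real)^j) ----> 0" by (rule LIMSEQ_realpow_zero) auto
  from order_tendstoD(2)[OF this, of "1 - cmod z"] z1
  have ex: "\<exists>j. (1/2)^j < 1 - cmod z" by (meson diff_gt_0_iff_gt eventually_sequentially order_refl)
  \<comment> \<open>The dyadic radius just beyond \<open>cmod z\<close>: the radial point
    \<open>w\<close> is then within \<open>(2 + A)*(1 - cmod z)\<close> of \<open>z\<close>, as
    \<open>pk_compare\<close> requires.\<close>
  define j where "j = (LEAST j. (1/2)^j < 1 - cmod z)"
  have j1: "(1/2)^j < 1 - cmod z" unfolding j_def by (rule LeastI_ex[OF ex])
  have "j \<noteq> 0" using j1 by (intro notI) simp
  hence j2: "1 - cmod z <= (1/2)^(j-1)" 
   using not_less_Least[of "j-1" "%j. (1/2)^j < 1 - cmod z", folded j_def] by simp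
  define w where "w = of_real (rad j)*y"
  have w: "cmod w < 1" "cmod w = rad j" unfolding w_def using rad_circle[OF y] by auto
  have "y - w = of_real (1 - rad j)*y" by (simp add: w_def algebra_simps)
  hence dw: "cmod (y - w) = (1/2)^j" using y rad[of j] by (simp only: norm_mult norm_of_real)
  have "cmod (z - w) <= cmod (y - z) + cmod (y - w)"
   using norm_triangle_ineq4[of "y - w" "y - z"] by simp
  hence zw: "cmod (z - w) <= (2 + A)*(1 - cmod z)" using z1 z2 dw j1 by (simp add: algebra_simps)
  have "(1/2::real)^(j-1) = 2*(1/2)^j" using \<open>j \<noteq> 0\<close> by (cases j) auto
  hence hz: "1 - cmod z <= 2*(1 - cmod w)" using j2 w rad[of j] by simp
  have cmp: "pk z v <= 4*(3 + A)^2*pk w v" if "cmod v = 1" for v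
  proof -
   have e: "1 + (2 + A) = 3 + A" by simp
   show ?thesis using pk_compare[OF z1 w(1) that _ zw hz, unfolded e] A by simp
  qed
  have main: "ennreal (cmod (h (of_real (rad n)*z))) <= ennreal (nt_const A)*(maxP (u n) y)^2" for n
  proof -
   let ?s = "cmod (h (of_real (rad n)*z)) powr (1/2)"
   have "?s <= poisson (%v. cmod (h (of_real (rad n) * v)) powr (1/2)) z"
    by (rule powr_subharmonic[OF _ _ z1]) (auto intro!: dilate_holomorphic h rad)
   hence "ennreal ?s <= ennreal (poisson (%v. cmod (h (of_real (rad n) * v)) powr (1/2)) z)" by (rule ennreal_leI)
   also have "... = (NN v. ennreal (pk z v * cmod (h (of_real (rad n) * v)) powr (1/2)))"
    unfolding poisson_def
    by (rule nn_integral_eq_integral[symmetric, OF integrable_pk_mult[OF z1 circle_integrable[OF c]]])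
     (use z1 in "auto intro!: AE_I2 mult_nonneg_nonneg pk_nonneg")
   also have "... <= (NN v. ennreal (4*(3 + A)^2)*(ennreal (pk w v)*u n v))"
   proof (rule nn_integral_mono)
    fix v assume "v \<in> space \<T>"
    hence "pk z v * cmod (h (of_real (rad n) * v)) powr (1/2) <= 4*(3 + A)^2*pk w v * cmod (h (of_real (rad n) * v)) powr (1/2)"
     by (intro mult_right_mono cmp) auto
    thus "ennreal (pk z v * cmod (h (of_real (rad n) * v)) powr (1/2)) <= ennreal (4*(3 + A)^2)*(ennreal (pk w v)*u n v)"
     unfolding u_def using w(1) by (simp add: ennreal_mult'[symmetric] pk_nonneg ennreal_leI mult.assoc)
   qed
   also have "... = ennreal (4*(3 + A)^2)*PN (u n) w"
    unfolding PN_def by (rule nn_integral_cmult) measurable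
   also have "... <= ennreal (4*(3 + A)^2)*maxP (u n) y"
    unfolding w_def by (intro mult_left_mono PN_le_maxP) auto
   finally have "(ennreal ?s)^2 <= (ennreal (4*(3 + A)^2)*maxP (u n) y)^2" by (rule power_mono) auto
   moreover have "(ennreal ?s)^2 = ennreal (cmod (h (of_real (rad n)*z)))"
    by (subst ennreal_power) (auto simp: powr_half_sqrt)
   ultimately show ?thesis by (simp add: power_mult_distrib ennreal_power nt_const_def)
  qed
  have "(%n. of_real (rad n)*z) ----> of_real (1 - 0)*z"
   unfolding rad_def by (intro tendsto_intros LIMSEQ_realpow_zero) auto
  moreover have "isCont h z"
   using holomorphic_on_imp_continuous_on[OF h] z1 by (simp add: continuous_on_eq_continuous_at)
  ultimately have "(%n. h (of_real (rad n)*z)) ----> h z" by (intro isCont_tendsto_compose[of z h]) simp_all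
  hence lim: "(%n. ennreal (cmod (h (of_real (rad n)*z)))) ----> ennreal (cmod (h z))" by (intro tendsto_intros)
  have "ennreal (cmod (h z)) = liminf (%n. ennreal (cmod (h (of_real (rad n)*z))))"
   using lim_imp_Liminf[OF sequentially_bot lim] by simp
  also have "... <= liminf (%n. ennreal (nt_const A)*(maxP (u n) y)^2)"
   by (intro Liminf_mono always_eventually allI main)
  also have "... = ennreal (nt_const A)*H y"
  proof -
   have "continuous_on UNIV (%x. ennreal (nt_const A)*x)" by (rule ennreal_continuous_on_cmult) auto
   thus ?thesis unfolding H_def
    by (rule Liminf_compose_continuous_mono) (auto simp: mono_def intro!: mult_left_mono)
  qed
  finally show ?thesis .
 qed
 show ?thesis
 proof (rule that)
  show "H \<in> borel_measurable \<T>" by measurable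
 qed (fact 1, fact 2)
qed

lemma radial_stolz:
 assumes "cmod u = 1" "0 <= r" "r < 1" "1 < A"
 shows "of_real r*u \<in> stolz_region A u"
proof -
 have n: "cmod (of_real r*u) = r" using assms by (simp add: norm_mult)
 have "u - of_real r*u = of_real (1 - r)*u" by (simp add: algebra_simps)
 hence "cmod (u - of_real r*u) = 1 - r" using assms by (simp only: norm_mult norm_of_real) simp
 thus ?thesis using n assms by (simp add: stolz_region_def)
qed

lemma rad_tendsto: "rad ----> 1"
 unfolding rad_def[abs_def] using tendsto_diff[OF tendsto_const LIMSEQ_realpow_zero[of "1/2"], of 1] by simp

lemma nt_limit_radial:
 assumes "has_nontangential_limit f u L" "cmod u = 1"
 shows "(%j. f (of_real (rad j)*u)) ----> L"
proof -
 have "(f \<longlongrightarrow> L) (at u within stolz_region 2 u)" using assms by (auto simp: has_nontangential_limit_def)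
 moreover have "filterlim (%j. of_real (rad j)*u) (at u within stolz_region 2 u) sequentially"
  unfolding filterlim_at
 proof
  show "\<forall>\<^sub>F j in sequentially. of_real (rad j)*u \<in> stolz_region 2 u \<and> of_real (rad j)*u \<noteq> u"
  proof (intro always_eventually allI conjI)
   fix j
   show "of_real (rad j)*u \<in> stolz_region 2 u" by (rule radial_stolz) (use assms rad in auto)
   show "of_real (rad j)*u \<noteq> u" using rad_circle(1)[OF assms(2), of j] assms(2) by auto
  qed
  have "(%j. of_real (rad j)*u) ----> of_real 1*u" by (intro tendsto_intros rad_tendsto)
  thus "(%j. of_real (rad j)*u) ----> u" by simp
 qed
 ultimately show ?thesis by (rule filterlim_compose)
qed

section \<open>Measurability of the boundary function\<close>

definition nt_cauchy_set :: "(complex => complex) => nat => nat => nat => complex set" where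
 "nt_cauchy_set f m n k = {\<zeta> \<in> sphere 0 1. \<forall>z \<in> stolz_region (of_nat (m+2)) \<zeta>. \<forall>z' \<in> stolz_region (of_nat (m+2)) \<zeta>.
  1 - 1/Suc k < cmod z \<longrightarrow> 1 - 1/Suc k < cmod z' \<longrightarrow> cmod (f z - f z') <= 1/Suc n}"

text \<open>A pair \<open>z\<close>, \<open>z'\<close> violating the Cauchy estimate lies in the
  Stolz regions of an open set of points \<open>u\<close>, so the complement is relatively open
  although the pairs are uncountably many.\<close>

lemma nt_cauchy_set_measurable: "nt_cauchy_set f m n k \<in> sets \<T>"
proof -
 define Z where "Z = {(z, z'). cmod z < 1 \<and> cmod z' < 1 \<and> 1 - 1/Suc k < cmod z \<and> 1 - 1/Suc k < cmod z' \<and> \<not> cmod (f z - f z') <= 1/Suc n}"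
 define U where "U = (\<Union>(z,z')\<in>Z. {u. cmod (u - z) < real (m+2)*(1 - cmod z)} \<inter> {u. cmod (u - z') < real (m+2)*(1 - cmod z')})"
 have "open U" unfolding U_def by (intro open_UN ballI) (auto intro!: open_Int open_Collect_less continuous_intros)
 hence "space \<T> - U \<inter> sphere 0 1 \<in> sets \<T>" by (intro sets.compl_sets sets_circle_open)
 also have "space \<T> - U \<inter> sphere 0 1 = nt_cauchy_set f m n k"
  unfolding nt_cauchy_set_def U_def Z_def stolz_region_def by (auto simp del: of_nat_add of_nat_Suc)
 finally show ?thesis .
qed

text \<open>Integer apertures suffice because Stolz regions grow with the aperture. The radial
  points lie in all of them, so their limit is the candidate for every aperture at once.\<close>

lemma nt_limit_iff_cauchy:
 assumes u: "cmod u = 1"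
 shows "(\<exists>L. has_nontangential_limit f u L) \<longleftrightarrow> (\<forall>m n. \<exists>k. u \<in> nt_cauchy_set f m n k)"
proof
 assume "\<exists>L. has_nontangential_limit f u L"
 then obtain L where L: "has_nontangential_limit f u L" ..
 show "\<forall>m n. \<exists>k. u \<in> nt_cauchy_set f m n k"
 proof (intro allI)
  fix m n :: nat
  have "(f \<longlongrightarrow> L) (at u within stolz_region (of_nat (m+2)) u)" using L by (auto simp: has_nontangential_limit_def)
  from tendstoD[OF this, of "1/(2*Suc n)"]
  obtain d where d: "d > 0" "\<And>z. z \<in> stolz_region (of_nat (m+2)) u ==> z \<noteq> u ==> dist z u < d ==> dist (f z) L < 1/(2*Suc n)"
   unfolding eventually_at by auto
  obtain k where k: "1/Suc k < d/(m+2)" using d nat_approx_posE[of "d/(m+2)"] by auto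
  have near: "dist (f z) L < 1/(2*Suc n)" if z: "z \<in> stolz_region (of_nat (m+2)) u" and zk: "1 - 1/Suc k < cmod z" for z
  proof (rule d(2)[OF z])
   show "z \<noteq> u" using z u by (auto simp: stolz_region_def)
   have "dist z u < real (m+2)*(1 - cmod z)" using z by (auto simp: stolz_region_def dist_norm norm_minus_commute)
   also have "... <= real (m+2)*(1/Suc k)" using zk by (intro mult_left_mono) auto
   also have "... < d" using k by (simp add: field_simps)
   finally show "dist z u < d" .
  qed
  have "cmod (f z - f z') <= 1/Suc n" if "z \<in> stolz_region (of_nat (m+2)) u" "z' \<in> stolz_region (of_nat (m+2)) u"
   "1 - 1/Suc k < cmod z" "1 - 1/Suc k < cmod z'" for z z'
  proof -
   have "dist (f z) (f z') < 1/(2*Suc n) + 1/(2*Suc n)"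
    using dist_triangle_less_add[of "f z" L _ "f z'"] near[of z] near[of z'] that by blast
   also have "... = 1/Suc n" by (simp add: field_simps)
   finally show ?thesis by (simp add: dist_norm)
  qed
  thus "\<exists>k. u \<in> nt_cauchy_set f m n k" using u unfolding nt_cauchy_set_def by (intro exI[of _ k]) simp
 qed
next
 assume A: "\<forall>m n. \<exists>k. u \<in> nt_cauchy_set f m n k"
 let ?w = "%j. of_real (rad j)*u"
 have ws: "?w j \<in> stolz_region (of_nat (m+2)) u" for j m
  by (rule radial_stolz) (use u rad in auto)
 have wl: "\<exists>N. \<forall>j\<ge>N. 1 - 1/Suc k < cmod (?w j)" for k
 proof -
  have "\<forall>\<^sub>F j in sequentially. 1 - 1/Suc k < rad j" by (rule order_tendstoD(1)[OF rad_tendsto]) simp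
  thus ?thesis using rad_circle(2)[OF u] by (simp add: eventually_sequentially)
 qed
 have "Cauchy (%j. f (?w j))"
 proof (rule metric_CauchyI)
  fix e :: real assume "e > 0"
  then obtain n where n: "1/Suc n < e" using nat_approx_posE by blast
  obtain k where k: "u \<in> nt_cauchy_set f 0 n k" using A by blast
  obtain N where N: "\<forall>j\<ge>N. 1 - 1/Suc k < cmod (?w j)" using wl by blast
  have "dist (f (?w i)) (f (?w j)) < e" if "i \<ge> N" "j \<ge> N" for i j
  proof -
   have "cmod (f (?w i) - f (?w j)) <= 1/Suc n" using k N that ws[of _ 0] unfolding nt_cauchy_set_def by blast
   thus ?thesis using n by (simp add: dist_norm)
  qed
  thus "\<exists>M. \<forall>m\<ge>M. \<forall>n\<ge>M. dist (f (?w m)) (f (?w n)) < e" by blast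
 qed
 then obtain L where L: "(%j. f (?w j)) ----> L" using Cauchy_convergent convergent_def by blast
 have "has_nontangential_limit f u L"
  unfolding has_nontangential_limit_def
 proof (intro allI impI tendstoI)
  fix a e :: real assume a: "1 < a" and e: "0 < e"
  obtain m :: nat where m: "a <= real m" using real_arch_simple by blast
  obtain n where n: "1/Suc n < e" using nat_approx_posE e by blast
  obtain k where k: "u \<in> nt_cauchy_set f m n k" using A by blast
  obtain N where N: "\<forall>j\<ge>N. 1 - 1/Suc k < cmod (?w j)" using wl by blast
  have "\<forall>\<^sub>F z in at u within stolz_region a u. z \<in> stolz_region a u" by (simp add: eventually_at_filter)
  moreover have "\<forall>\<^sub>F z in at u within stolz_region a u. 1 - 1/Suc k < cmod z"
  proof (rule order_tendstoD(1))
   show "(cmod \<longlongrightarrow> cmod u) (at u within stolz_region a u)" by (intro tendsto_intros)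
  qed (simp add: u)
  ultimately show "\<forall>\<^sub>F z in at u within stolz_region a u. dist (f z) L < e"
  proof eventually_elim
   case (elim z)
   have "a*(1 - cmod z) <= real (m+2)*(1 - cmod z)" using m elim(1) by (intro mult_right_mono) (auto simp: stolz_region_def)
   hence zs: "z \<in> stolz_region (of_nat (m+2)) u" using elim(1) unfolding stolz_region_def mem_Collect_eq by linarith
   have "(%j. cmod (f z - f (?w j))) ----> cmod (f z - L)" by (intro tendsto_intros L)
   moreover have "\<exists>N. \<forall>j\<ge>N. cmod (f z - f (?w j)) <= 1/Suc n"
    using k N zs elim(2) ws[of _ m] unfolding nt_cauchy_set_def by blast
   ultimately have "cmod (f z - L) <= 1/Suc n" by (rule LIMSEQ_le_const2)
   thus ?case using n by (simp add: dist_norm)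
  qed
 qed
 thus "\<exists>L. has_nontangential_limit f u L" ..
qed

lemma nt_limit_set_measurable: "{u \<in> sphere 0 1. \<exists>L. has_nontangential_limit f u L} \<in> sets \<T>"
proof -
 have "{u \<in> sphere 0 1. \<exists>L. has_nontangential_limit f u L} = (\<Inter>m. \<Inter>n. \<Union>k. nt_cauchy_set f m n k)"
  using nt_limit_iff_cauchy[of _ f] by (auto simp: nt_cauchy_set_def) blast
 also have "... \<in> sets \<T>"
  by (intro sets.countable_INT sets.countable_UN image_subsetI nt_cauchy_set_measurable) auto
 finally show ?thesis .
qed

lemma measurable_boundary_fun:
 assumes f: "hol f"
 shows "boundary_fun f \<in> borel_measurable \<T>"
proof -
 let ?E = "{u \<in> sphere 0 1. \<exists>L. has_nontangential_limit f u L}"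
 let ?g = "%u. if u \<in> ?E then lim (%j. f (of_real (rad j)*u)) else 0"
 have [measurable]: "?E \<in> sets \<T>" by (rule nt_limit_set_measurable)
 have [measurable]: "(%u. f (of_real (rad j)*u)) \<in> borel_measurable \<T>" for j
  by (intro circle_measurable dilate_holomorphic[OF f] rad)
 have "?g \<in> borel_measurable \<T>" by measurable
 also have "?g \<in> borel_measurable \<T> \<longleftrightarrow> boundary_fun f \<in> borel_measurable \<T>"
 proof (rule measurable_cong)
  fix u assume "u \<in> space \<T>"
  hence u: "cmod u = 1" by simp
  show "?g u = boundary_fun f u"
  proof (cases "\<exists>L. has_nontangential_limit f u L")
   case True
   then obtain L where "has_nontangential_limit f u L" ..
   from boundary_fun_eqI[OF this u] limI[OF nt_limit_radial[OF this u]] show ?thesis using True u by simp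
  next
   case False
   hence "u \<notin> ?E" by blast
   thus ?thesis using False unfolding boundary_fun_def by (simp only: if_False)
  qed
 qed
 finally show ?thesis .
qed

text \<open>Dilations are continuous up to the boundary, and the maximal function of the difference is
 small, so the oscillation of \<open>h\<close> at almost every boundary point vanishes.\<close>
lemma nt_limit_criterion:
 assumes h: "hol h"
  and ap: "\<And>e. e > 0 ==> \<exists>R. 0 <= R \<and> R < 1 \<and>
   (\<forall>r. 0 <= r \<and> r < 1 \<longrightarrow> (MEAN u. cmod (h (of_real r*u) - h (of_real R*(of_real r*u)))) <= e)"
 shows "AE u in \<T>. \<exists>L. has_nontangential_limit h u L"
proof -
 \<comment> \<open>With accuracies \<open>(1/2)^k\<close> the maximal functions of the differences
   have summable integrals, so they tend to 0 at almost every point.\<close>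
 have "\<forall>k. \<exists>R. 0 <= R \<and> R < 1 \<and> (\<forall>r. 0 <= r \<and> r < 1 \<longrightarrow>
   (MEAN u. cmod (h (of_real r*u) - h (of_real R*(of_real r*u)))) <= (1/2)^k)"
  by (rule allI, rule ap) simp
 from choice[OF this] obtain R where \<rho>0: "\<forall>k. 0 <= R k \<and> R k < 1 \<and> (\<forall>r. 0 <= r \<and> r < 1 \<longrightarrow>
   (MEAN u. cmod (h (of_real r*u) - h (of_real (R k)*(of_real r*u)))) <= (1/2)^k)" ..
 have R: "0 <= R k" "R k < 1"
  "0 <= r ==> r < 1 ==> (MEAN u. cmod (h (of_real r*u) - h (of_real (R k)*(of_real r*u)))) <= (1/2)^k" for k r
  using \<rho>0 by blast+
 define g where "g k z = h z - h (of_real (R k)*z)" for k z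
 have g: "hol (g k)" for k
  unfolding g_def using h R by (intro holomorphic_intros dilate_holomorphic) auto
 have "\<exists>H. H \<in> borel_measurable \<T> \<and> (NN u. H u) <= ennreal (1025*(1/2)^k) \<and>
  (\<forall>a u z. 1 < a \<longrightarrow> cmod u = 1 \<longrightarrow> z \<in> stolz_region a u \<longrightarrow> ennreal (cmod (g k z)) <= ennreal (nt_const a)*H u)" for k
 proof -
  have le: "(MEAN u. cmod (g k (of_real r*u))) <= (1/2)^k" if "0 <= r" "r < 1" for r
   unfolding g_def by (rule R(3)[OF that])
  show ?thesis
  proof (rule H1_maximal[OF g[of k] le])
   fix H assume "H \<in> borel_measurable \<T>" "(NN u. H u) <= ennreal (1025*(1/2)^k)"
    "\<And>a u z. 1 < a ==> cmod u = 1 ==> z \<in> stolz_region a u ==> ennreal (cmod (g k z)) <= ennreal (nt_const a)*H u"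
   thus ?thesis by (intro exI[of _ H]) blast
  qed
 qed
 then obtain H where [measurable]: "\<And>k. H k \<in> borel_measurable \<T>"
  and H2: "\<And>k. (NN u. H k u) <= ennreal (1025*(1/2)^k)"
  and H3: "\<And>k a u z. 1 < a ==> cmod u = 1 ==> z \<in> stolz_region a u ==> ennreal (cmod (g k z)) <= ennreal (nt_const a)*H k u"
  by metis
 have "(NN u. (\<Sum>k. H k u)) = (\<Sum>k. \<integral>\<^sup>+u. H k u \<partial>\<T>)" by (rule nn_integral_suminf) measurable
 also have "... <= (\<Sum>k. ennreal (1025*(1/2)^k))" by (intro suminf_le H2 summableI)
 also have "... < \<infinity>"
 proof -
  have "(%k. 1025*(1/2::real)^k) sums (1025*(1/(1 - 1/2)))" by (intro sums_mult geometric_sums) simp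
  hence "(\<Sum>k. ennreal (1025*(1/2)^k)) = ennreal (1025*(1/(1 - 1/2)))" by (rule suminf_ennreal_eq[rotated]) simp
  thus ?thesis by (simp only: ennreal_less_top infinity_ennreal_def)
 qed
 finally have "(NN u. (\<Sum>k. H k u)) \<noteq> \<infinity>" by simp
 hence "AE u in \<T>. (\<Sum>k. H k u) \<noteq> \<infinity>" by (intro nn_integral_PInf_AE) measurable
 moreover have "AE u in \<T>. cmod u = 1" by (rule AE_I2) simp
 ultimately show ?thesis
 proof eventually_elim
  case (elim u)
  note u = elim(2)
  have fin: "H k u \<noteq> \<infinity>" for k
   using elim(1) ennreal_suminf_lessD[of "%k. H k u" \<top> k] by (auto simp: less_top)
  define H' where "H' k = enn2real (H k u)" for k
  have H': "H k u = ennreal (H' k)" "0 <= H' k" for k using fin[of k] by (simp_all add: H'_def less_top)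
  have "summable H'" by (rule summable_suminf_not_top) (use elim H' in auto)
  hence lim0: "H' ----> 0" by (rule summable_LIMSEQ_zero)
  have nt: "cmod (g k z) <= nt_const a*H' k" if "1 < a" "z \<in> stolz_region a u" for k a z
   using H3[OF that(1) u that(2), of k] H'[of k] by (simp add: ennreal_mult'[symmetric] nt_const_def)
  define l where "l k = h (of_real (R k)*u)" for k
  \<comment> \<open>In a Stolz region \<open>h\<close> differs from its \<open>k\<close>-th dilation
    by at most \<open>nt_const a * H' k\<close>, and that dilation is continuous at \<open>u\<close>
    with value \<open>l k\<close>.\<close>
  have A: "\<exists>N. \<forall>k\<ge>N. \<forall>\<^sub>F z in at u within stolz_region a u. dist (h z) (l k) < e" if a: "1 < a" and e: "0 < e" for a e
  proof -
   have "(%k. nt_const a*H' k) ----> nt_const a*0" by (intro tendsto_intros lim0)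
   hence "\<forall>\<^sub>F k in sequentially. nt_const a*H' k < e/2" by (rule order_tendstoD(2)) (use e in auto)
   then obtain N where N: "\<And>k. k \<ge> N ==> nt_const a*H' k < e/2" by (auto simp: eventually_sequentially)
   have "\<forall>\<^sub>F z in at u within stolz_region a u. dist (h z) (l k) < e" if k: "k \<ge> N" for k
   proof -
    have "continuous (at u within cball 0 1) (%z. h (of_real (R k)*z))"
     using dilate_holomorphic(1)[OF h R(1,2)[of k]] u by (auto simp: continuous_on_eq_continuous_within)
    hence "((%z. h (of_real (R k)*z)) \<longlongrightarrow> l k) (at u within cball 0 1)" by (simp add: continuous_within l_def)
    hence "((%z. h (of_real (R k)*z)) \<longlongrightarrow> l k) (at u within stolz_region a u)"
     by (rule tendsto_within_subset) (use stolz_subset ball_subset_cball in blast)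
    hence "\<forall>\<^sub>F z in at u within stolz_region a u. dist (h (of_real (R k)*z)) (l k) < e/2" using e by (intro tendstoD) auto
    moreover have "\<forall>\<^sub>F z in at u within stolz_region a u. z \<in> stolz_region a u" by (simp add: eventually_at_filter)
    ultimately show ?thesis
    proof eventually_elim
     case (elim z)
     have "dist (h z) (h (of_real (R k)*z)) < e/2" using nt[OF a elim(2), of k] N[OF k] by (simp add: dist_norm g_def)
     thus ?case using elim(1) dist_triangle[of "h z" "l k" "h (of_real (R k)*z)"] by linarith
    qed
   qed
   thus ?thesis by blast
  qed
  have "Cauchy l"
  proof (rule metric_CauchyI)
   fix e :: real assume e: "e > 0"
   obtain N where N: "\<And>k. k \<ge> N ==> \<forall>\<^sub>F z in at u within stolz_region 2 u. dist (h z) (l k) < e/2"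
    using A[of 2 "e/2"] e by auto
   have "dist (l i) (l j) < e" if "i \<ge> N" "j \<ge> N" for i j
   proof -
    have "\<forall>\<^sub>F z in at u within stolz_region 2 u. dist (l i) (l j) < e"
     using N[OF that(1)] N[OF that(2)]
    proof eventually_elim
     case (elim z)
     thus ?case using dist_triangle3[of "l i" "l j" "h z"] by simp
    qed
    thus ?thesis using stolz_nontrivial[of 2 u] u by (simp add: eventually_const_iff)
   qed
   thus "\<exists>M. \<forall>m\<ge>M. \<forall>n\<ge>M. dist (l m) (l n) < e" by blast
  qed
  then obtain L where L: "l ----> L" using Cauchy_convergent convergent_def by blast
  have "has_nontangential_limit h u L"
   unfolding has_nontangential_limit_def
  proof (intro allI impI tendstoI)
   fix a e :: real assume a: "1 < a" and e: "0 < e"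
   obtain N where N: "\<And>k. k \<ge> N ==> \<forall>\<^sub>F z in at u within stolz_region a u. dist (h z) (l k) < e/2"
    using A[OF a, of "e/2"] e by auto
   obtain M where M: "\<And>k. k \<ge> M ==> dist (l k) L < e/2" using L e metric_LIMSEQ_D[of l L "e/2"] by auto
   have "\<forall>\<^sub>F z in at u within stolz_region a u. dist (h z) (l (max M N)) < e/2" by (rule N) simp
   thus "\<forall>\<^sub>F z in at u within stolz_region a u. dist (h z) L < e"
   proof eventually_elim
    case (elim z)
    thus ?case using M[of "max M N"] dist_triangle[of "h z" L "l (max M N)"] by simp
   qed
  qed
  thus ?case ..
 qed
qed

text \<open>The difference of \<open>h\<close> and its dilation by \<open>R\<close> has its
  \<open>n\<close>-th coefficient multiplied by \<open>1 - R^n\<close>; Tannery's theorem makes the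
  square sum small for \<open>R\<close> near 1.\<close>

lemma H2_nt_limit:
 assumes h: "hol h" and s: "summable (%n. (cmod (taylor_seq h n))^2)"
 shows "AE u in \<T>. \<exists>L. has_nontangential_limit h u L"
proof (rule nt_limit_criterion[OF h])
 fix e :: real assume e: "e > 0"
 let ?a = "%n. (cmod (taylor_seq h n))^2"
 have r1: "(1 - rad k^n)^2 <= 1" for k n
  using rad[of k] by (intro power_le_one) (auto simp: power_le_one)
 have "(%k. \<Sum>n. ?a n*(1 - rad k^n)^2) ----> (\<Sum>n. ?a n*(1 - 1^n)^2)"
 proof (rule tannerys_theorem[THEN conjunct2, THEN conjunct2])
  show "(%k. ?a n*(1 - rad k^n)^2) ----> ?a n*(1 - 1^n)^2" for n by (intro tendsto_intros rad_tendsto)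
  show "\<forall>\<^sub>F (n, k) in at_top \<times>\<^sub>F sequentially. norm (?a n*(1 - rad k^n)^2) <= ?a n"
   using r1 by (intro always_eventually) (auto simp: abs_mult intro!: mult_left_le)
 qed (use s in auto)
 hence "\<forall>\<^sub>F k in sequentially. (\<Sum>n. ?a n*(1 - rad k^n)^2) < e^2" using e by (intro order_tendstoD(2)) auto
 then obtain k where k: "(\<Sum>n. ?a n*(1 - rad k^n)^2) < e^2" by (auto simp: eventually_sequentially)
 define R where "R = rad k"
 have R: "0 <= R" "R < 1" using rad by (auto simp: R_def)
 have sm: "summable (%n. ?a n*(1 - R^n)^2)"
  by (rule summable_comparison_test'[OF s, of 0]) (use R in "auto intro!: mult_left_le simp: power_le_one abs_mult")
 define g where "g z = h z - h (of_real R*z)" for z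
 have g: "hol g" unfolding g_def using h R by (intro holomorphic_intros dilate_holomorphic) auto
 have tg: "taylor_seq g = (%n. taylor_seq h n * of_real (1 - R^n))"
 proof (rule taylor_seq_unique)
  fix z :: complex assume z: "cmod z < 1"
  have "cmod (of_real R*z) < 1" using z R mult_right_mono[of R 1 "cmod z"] by (simp add: norm_mult)
  from sums_diff[OF hol_sums[OF h z] hol_sums[OF h this]]
  show "(%n. taylor_seq h n * of_real (1 - R^n)*z^n) sums g z"
   by (simp add: g_def algebra_simps power_mult_distrib)
 qed
 have "(MEAN u. cmod (g (of_real r*u))) <= e" if r: "0 <= r" "r < 1" for r
 proof -
  have "(MEAN u. (cmod (g (of_real r*u)))^2) = (\<Sum>n. (cmod (taylor_seq g n))^2*r^(2*n))"
   using parseval[OF g r] by (simp add: sums_iff)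
  also have "... <= (\<Sum>n. ?a n*(1 - R^n)^2)"
  proof (rule suminf_le)
   show "(cmod (taylor_seq g n))^2*r^(2*n) <= ?a n*(1 - R^n)^2" for n
   proof -
    have "(cmod (taylor_seq g n))^2 = ?a n*(1 - R^n)^2" unfolding tg norm_mult norm_of_real by (simp add: power_mult_distrib)
    thus ?thesis using r by (simp add: mult_left_le power_le_one)
   qed
  qed (use sm parseval[OF g r] in "auto simp: sums_iff")
  also have "... < e^2" using k by (simp add: R_def)
  finally have "sqrt (MEAN u. (cmod (g (of_real r*u)))^2) <= sqrt (e^2)" by (intro real_sqrt_le_mono) simp
  thus ?thesis using circle_L1_L2[OF dilate_holomorphic(3)[OF g r]] e by simp
 qed
 thus "\<exists>R. 0 <= R \<and> R < 1 \<and> (\<forall>r. 0 <= r \<and> r < 1 \<longrightarrow> (MEAN u. cmod (h (of_real r*u) - h (of_real R*(of_real r*u)))) <= e)"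
  using R unfolding g_def by (intro exI[of _ R]) auto
qed

lemma H2_summable:
 assumes h: "hol h"
  and K: "\<And>r. 0 <= r ==> r < 1 ==> (MEAN u. (cmod (h (of_real r*u)))^2) <= K"
 shows "summable (%n. (cmod (taylor_seq h n))^2)"
proof (rule bounded_imp_summable)
 fix N
 have "(%k. \<Sum>n\<le>N. (cmod (taylor_seq h n))^2*rad k^(2*n)) ----> (\<Sum>n\<le>N. (cmod (taylor_seq h n))^2*1^(2*n))"
  by (intro tendsto_intros rad_tendsto)
 moreover have "(\<Sum>n\<le>N. (cmod (taylor_seq h n))^2*rad k^(2*n)) <= K" for k
 proof -
  have "(\<Sum>n\<le>N. (cmod (taylor_seq h n))^2*rad k^(2*n)) <= (\<Sum>n. (cmod (taylor_seq h n))^2*rad k^(2*n))"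
   by (rule sum_le_suminf) (use parseval[OF h rad(1,2)[of k]] rad[of k] in "auto simp: sums_iff")
  also have "... <= K" using parseval[OF h rad(1,2)[of k]] K[OF rad(1,2)[of k]] by (simp add: sums_iff)
  finally show ?thesis .
 qed
 ultimately show "(\<Sum>n\<le>N. (cmod (taylor_seq h n))^2) <= K" using LIMSEQ_le_const2 by fastforce
qed auto

lemma bounded_nt_limit:
 assumes h: "hol h" and B: "\<And>z. cmod z < 1 ==> cmod (h z) <= B"
 shows "AE u in \<T>. \<exists>L. has_nontangential_limit h u L"
proof (rule H2_nt_limit[OF h H2_summable[OF h]])
 fix r :: real assume r: "0 <= r" "r < 1"
 have "(MEAN u. (cmod (h (of_real r*u)))^2) <= (MEAN u. B^2)"
 proof (rule integral_mono)
  show "integrable \<T> (%u. (cmod (h (of_real r*u)))^2)"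
   by (intro circle_integrable continuous_intros dilate_holomorphic[OF h r])
  show "(cmod (h (of_real r*u)))^2 <= B^2" if "u \<in> space \<T>" for u
   using that r by (intro power_mono B) (auto simp: norm_mult)
 qed simp
 thus "(MEAN u. (cmod (h (of_real r*u)))^2) <= B^2" using circle.prob_space by simp
qed

section \<open>Boundary values of functions in the Hardy space with exponent 1\<close>

lemma hardy1D:
 assumes "h \<in> hardy 1"
 shows "hol h"
  and "\<exists>K. \<forall>r. 0 <= r \<longrightarrow> r < 1 \<longrightarrow> (MEAN u. cmod (h (of_real r*u))) <= K"
proof -
 show "hol h" using assms by (simp add: hardy_def H_disk_def)
 have "bdd_above (hardy_mean 1 h ` {0..<1})" using assms by (simp add: hardy_def)
 then obtain K where "\<forall>x\<in>hardy_mean 1 h ` {0..<1}. x <= K" unfolding bdd_above_def by blast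
 thus "\<exists>K. \<forall>r. 0 <= r \<longrightarrow> r < 1 \<longrightarrow> (MEAN u. cmod (h (of_real r*u))) <= K"
  by (intro exI[of _ K]) (auto simp: hardy_mean_def)
qed

lemma hardy1I:
 assumes "hol h"
  and "\<And>r. 0 <= r ==> r < 1 ==> (MEAN u. cmod (h (of_real r*u))) <= K"
 shows "h \<in> hardy 1"
proof -
 have "bdd_above (hardy_mean 1 h ` {0..<1})"
  by (rule bdd_aboveI[of _ K]) (use assms(2) in "auto simp: hardy_mean_def")
 thus ?thesis using assms(1) by (simp add: hardy_def H_disk_def)
qed

text \<open>All radial values at \<open>u\<close> are controlled by the maximal function for
  aperture 2, which is integrable; where it is infinite, a null set, nothing is claimed.\<close>

lemma hardy1_dominated:
 assumes "h \<in> hardy 1"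
 obtains v where "integrable \<T> v" "\<And>u. 0 <= v u"
  "AE u in \<T>. \<forall>r. 0 <= r \<longrightarrow> r < 1 \<longrightarrow> cmod (h (of_real r*u)) <= v u"
proof -
 note h = hardy1D(1)[OF assms]
 obtain K where K: "\<And>r. 0 <= r ==> r < 1 ==> (MEAN u. cmod (h (of_real r*u))) <= K"
  using hardy1D(2)[OF assms] by blast
 obtain H where H [measurable]: "H \<in> borel_measurable \<T>"
  and H2: "(NN u. H u) <= ennreal (1025*K)"
  and H3: "\<And>A u z. 1 < A ==> cmod u = 1 ==> z \<in> stolz_region A u ==> ennreal (cmod (h z)) <= ennreal (nt_const A)*H u"
  using H1_maximal[OF h K] by blast
 have fin: "(NN u. H u) < \<infinity>" using H2 by (simp add: order_le_less_trans)
 hence ae: "AE u in \<T>. H u \<noteq> \<infinity>" by (intro nn_integral_PInf_AE H) simp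
 define v where "v u = nt_const 2*enn2real (H u)" for u
 have "integrable \<T> (%u. enn2real (H u))"
 proof (rule integrableI_bounded)
  have "(NN u. ennreal (norm (enn2real (H u)))) <= (NN u. H u)"
   by (intro nn_integral_mono) (simp add: ennreal_enn2real_if)
  thus "(NN u. ennreal (norm (enn2real (H u)))) < \<infinity>" using fin by (rule order_le_less_trans)
 qed measurable
 hence 1: "integrable \<T> v" unfolding v_def by simp
 have 2: "0 <= v u" for u by (simp add: v_def nt_const_def)
 have "AE u in \<T>. cmod u = 1" by (rule AE_I2) simp
 with ae have 3: "AE u in \<T>. \<forall>r. 0 <= r \<longrightarrow> r < 1 \<longrightarrow> cmod (h (of_real r*u)) <= v u"
 proof eventually_elim
  case (elim u)
  have *: "H u = ennreal (enn2real (H u))" using elim(1) by (simp add: less_top)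
  have "cmod (h (of_real r*u)) <= v u" if "0 <= r" "r < 1" for r
  proof -
   have "ennreal (cmod (h (of_real r*u))) <= ennreal (nt_const 2)*ennreal (enn2real (H u))"
    using H3[OF _ elim(2) radial_stolz[OF elim(2) that, of 2]] * by simp
   also have "... = ennreal (v u)" by (simp add: v_def ennreal_mult' nt_const_def)
   finally show ?thesis using 2[of u] by simp
  qed
  thus ?case by blast
 qed
 show ?thesis by (rule that[OF 1 2 3])
qed

text \<open>Dilations are subharmonic up to the boundary and lie below \<open>v\<close> there;
  continuity of \<open>h\<close> at \<open>z\<close> removes the dilation.\<close>

lemma hardy1_majorant:
 assumes h: "hol h" and v: "integrable \<T> v"
  and ae: "AE u in \<T>. \<forall>r. 0 <= r \<longrightarrow> r < 1 \<longrightarrow> cmod (h (of_real r*u)) <= v u"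
  and z: "cmod z < 1"
 shows "cmod (h z) <= poisson v z"
proof -
 have le: "cmod (h (of_real (rad n)*z)) <= poisson v z" for n
 proof -
  note r = rad(1,2)[of n]
  have c: "continuous_on (sphere 0 1) (%x. cmod (h (of_real (rad n)*x)))"
   by (rule continuous_on_norm[OF dilate_holomorphic(3)[OF h r]])
  have "cmod (h (of_real (rad n)*z)) powr 1 <= poisson (%x. cmod (h (of_real (rad n)*x)) powr 1) z"
   by (rule powr_subharmonic[OF dilate_holomorphic(1,2)[OF h r] z]) simp
  hence "cmod (h (of_real (rad n)*z)) <= poisson (%x. cmod (h (of_real (rad n)*x))) z" by simp
  also have "... <= poisson v z"
   unfolding poisson_def
  proof (rule integral_mono_AE)
   show "integrable \<T> (%x. pk z x*cmod (h (of_real (rad n)*x)))"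
    by (rule integrable_pk_mult[OF z circle_integrable[OF c]])
   show "integrable \<T> (%x. pk z x * v x)" by (rule integrable_pk_mult[OF z v])
   show "AE x in \<T>. pk z x*cmod (h (of_real (rad n)*x)) <= pk z x * v x"
    using ae by eventually_elim (use r z in "auto intro!: mult_left_mono pk_nonneg")
  qed
  finally show ?thesis .
 qed
 have "(%n. of_real (rad n)*z) ----> of_real 1*z" by (intro tendsto_intros rad_tendsto)
 moreover have "isCont h z"
  using holomorphic_on_imp_continuous_on[OF h] z by (simp add: continuous_on_eq_continuous_at)
 ultimately have "(%n. h (of_real (rad n)*z)) ----> h z" by (intro isCont_tendsto_compose[of z h]) simp_all
 hence "(%n. cmod (h (of_real (rad n)*z))) ----> cmod (h z)" by (rule tendsto_norm)
 thus ?thesis by (rule LIMSEQ_le_const2) (use le in blast)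
qed

text \<open>With \<open>V\<close> analytic and \<open>Re V \<ge> cmod h\<close>, the function \<open>h\<close> is the quotient of the bounded
 functions \<open>h / (1 + V)\<close> and \<open>1 / (1 + V)\<close>; the denominator has nonzero limits because
 \<open>csqrt (1 + V)\<close> has integrable maximal function.\<close>
lemma hardy1_nt_limit:
 assumes "h \<in> hardy 1"
 shows "AE u in \<T>. \<exists>L. has_nontangential_limit h u L"
proof -
 note h = hardy1D(1)[OF assms]
 obtain v where v: "integrable \<T> v" "\<And>u. 0 <= v u"
  "AE u in \<T>. \<forall>r. 0 <= r \<longrightarrow> r < 1 \<longrightarrow> cmod (h (of_real r*u)) <= v u"
  using hardy1_dominated[OF assms] by blast
 define V where "V z = 1 + schwarz v z" for z
 have hV: "hol V" unfolding V_def using holomorphic_schwarz[OF v(1)] by (intro holomorphic_intros)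
 have ReV: "1 + cmod (h z) <= Re (V z)" if "cmod z < 1" for z
  using hardy1_majorant[OF h v(1,3) that] Re_schwarz[OF v(1) that] by (simp add: V_def)
 have V0: "1 <= Re (V z)" "V z \<noteq> 0" "1 + cmod (h z) <= cmod (V z)" if "cmod z < 1" for z
 proof -
  show "1 <= Re (V z)" using ReV[OF that] norm_ge_zero[of "h z"] by linarith
  thus "V z \<noteq> 0" by auto
  show "1 + cmod (h z) <= cmod (V z)" using ReV[OF that] complex_Re_le_cmod[of "V z"] by linarith
 qed
 define g1 where "g1 z = h z/V z" for z
 define g2 where "g2 z = 1/V z" for z
 have hg: "hol g1" "hol g2"
  unfolding g1_def g2_def using h hV V0 by (auto intro!: holomorphic_intros)
 have b1: "cmod (g1 z) <= 1" if "cmod z < 1" for z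
  using V0[OF that] by (simp add: g1_def norm_divide divide_le_eq)
 have b2: "cmod (g2 z) <= 1" if "cmod z < 1" for z
 proof -
  have "1 <= cmod (V z)" using V0(3)[OF that] norm_ge_zero[of "h z"] by linarith
  thus ?thesis by (simp add: g2_def norm_divide divide_le_eq)
 qed
 \<comment> \<open>Since \<open>V\<close> has positive real part, \<open>S\<close> takes values with
   argument at most \<open>pi/4\<close>. Hence \<open>cmod (S z) <= 2*Re (S z)\<close>, and the mean
   value property bounds all its integral means.\<close>
 define S where "S z = csqrt (V z)" for z
 have hS: "hol S"
  unfolding S_def
 proof (rule holomorphic_on_csqrt'[OF hV])
  fix z :: complex assume "z \<in> ball 0 1"
  thus "V z \<notin> \<real>\<^sub>\<le>\<^sub>0" using V0(1)[of z] by (auto simp: complex_nonpos_Reals_iff)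
 qed
 have S2: "(S z)^2 = V z" for z by (simp add: S_def)
 have SRe: "cmod (S z) <= 2*Re (S z)" if "cmod z < 1" for z
 proof -
  have R0: "0 <= Re (S z)" using csqrt_principal[of "V z"] by (auto simp: S_def)
  have "Re ((S z)^2) \<ge> 0" using V0(1)[OF that] S2[of z] by simp
  hence "(Im (S z))^2 <= (Re (S z))^2" by (simp add: power2_eq_square)
  hence "\<bar>Im (S z)\<bar> <= Re (S z)" using R0 abs_le_square_iff[of "Im (S z)" "Re (S z)"] by simp
  thus ?thesis using cmod_le[of "S z"] R0 by simp
 qed
 have SK: "(MEAN u. cmod (S (of_real r*u))) <= 2*Re (S 0)" if r: "0 <= r" "r < 1" for r
 proof -
  note d = dilate_holomorphic[OF hS r]
  have "(MEAN u. cmod (S (of_real r*u))) <= (MEAN u. 2*Re (S (of_real r*u)))"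
  proof (rule integral_mono)
   show "integrable \<T> (%u. cmod (S (of_real r*u)))"
    by (rule circle_integrable[OF continuous_on_norm[OF d(3)]])
   show "integrable \<T> (%u. 2*Re (S (of_real r*u)))"
    by (intro integrable_mult_right integrable_Re circle_integrable[OF d(3)])
   show "cmod (S (of_real r*u)) <= 2*Re (S (of_real r*u))" if "u \<in> space \<T>" for u
    by (rule SRe) (use that r in "simp add: norm_mult")
  qed
  also have "... = 2*Re (MEAN u. S (of_real r*u))"
   using integral_Re[OF circle_integrable[OF d(3)]] by simp
  also have "(MEAN u. S (of_real r*u)) = S 0" using circle_mean_value[OF d(1,2)] by simp
  finally show ?thesis .
 qed
 obtain H where H [measurable]: "H \<in> borel_measurable \<T>"
  and H2: "(NN u. H u) <= ennreal (1025*(2*Re (S 0)))"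
  and H3: "\<And>A u z. 1 < A ==> cmod u = 1 ==> z \<in> stolz_region A u ==> ennreal (cmod (S z)) <= ennreal (nt_const A)*H u"
  using H1_maximal[OF hS SK] by blast
 have "(NN u. H u) < \<infinity>" using H2 by (simp add: order_le_less_trans)
 hence "AE u in \<T>. H u \<noteq> \<infinity>" by (intro nn_integral_PInf_AE H) simp
 moreover have "AE u in \<T>. \<exists>L. has_nontangential_limit g1 u L" by (rule bounded_nt_limit[OF hg(1) b1])
 moreover have "AE u in \<T>. \<exists>L. has_nontangential_limit g2 u L" by (rule bounded_nt_limit[OF hg(2) b2])
 moreover have "AE u in \<T>. cmod u = 1" by (rule AE_I2) simp
 ultimately show ?thesis
 proof eventually_elim
  case (elim u)
  obtain a b where a: "has_nontangential_limit g1 u a" and b: "has_nontangential_limit g2 u b"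
   using elim by blast
  have u: "cmod u = 1" by fact
  define T where "T = nt_const 2*enn2real (H u)"
  have T0: "0 <= T" by (simp add: T_def nt_const_def)
  have ST: "cmod (S z) <= T" if "z \<in> stolz_region 2 u" for z
  proof -
   have "H u = ennreal (enn2real (H u))" using elim(1) by (simp add: less_top)
   hence "ennreal (cmod (S z)) <= ennreal (nt_const 2)*ennreal (enn2real (H u))"
    using H3[OF _ u that] by simp
   also have "... = ennreal T" by (simp add: T_def ennreal_mult' nt_const_def)
   finally show ?thesis using T0 by simp
  qed
  \<comment> \<open>If \<open>b = 0\<close>, then \<open>V\<close> is unbounded near
    \<open>u\<close>, whereas the maximal function of \<open>S\<close> bounds it by
    \<open>T^2\<close> in the Stolz region.\<close>
  have "b \<noteq> 0"
  proof
   assume "b = 0"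
   hence "(g2 \<longlongrightarrow> 0) (at u within stolz_region 2 u)" using b by (auto simp: has_nontangential_limit_def)
   from tendstoD[OF this, of "1/(T^2 + 1)"]
   have "\<forall>\<^sub>F z in at u within stolz_region 2 u. cmod (g2 z) < 1/(T^2 + 1)"
    by (simp add: add_nonneg_pos)
   moreover have "\<forall>\<^sub>F z in at u within stolz_region 2 u. z \<in> stolz_region 2 u" by (simp add: eventually_at_filter)
   ultimately have "\<forall>\<^sub>F z in at u within stolz_region 2 u. False"
   proof eventually_elim
    case (elim z)
    have z1: "cmod z < 1" using elim(2) by (auto simp: stolz_region_def)
    have "cmod (V z) = (cmod (S z))^2" by (metis S2 norm_power)
    also have "... <= T^2" by (intro power_mono ST elim) simp
    finally have "cmod (V z) < T^2 + 1" by simp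
    hence "1/(T^2 + 1) < 1/cmod (V z)" using V0(2)[OF z1] by (intro divide_strict_left_mono mult_pos_pos) (auto intro: add_nonneg_pos)
    thus False using elim(1) by (simp add: g2_def norm_divide)
   qed
   thus False using stolz_nontrivial[of 2 u] u by (simp add: eventually_False)
  qed
  have "has_nontangential_limit h u (a/b)"
   unfolding has_nontangential_limit_def
  proof (intro allI impI)
   fix A :: real assume A: "1 < A"
   have "((%z. g1 z/g2 z) \<longlongrightarrow> a/b) (at u within stolz_region A u)"
    using a b A \<open>b \<noteq> 0\<close> by (intro tendsto_divide) (auto simp: has_nontangential_limit_def)
   moreover have "\<forall>\<^sub>F z in at u within stolz_region A u. g1 z/g2 z = h z"
    unfolding eventually_at_filter
   proof (intro always_eventually allI impI)
    fix z assume "z \<in> stolz_region A u"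
    hence "V z \<noteq> 0" using V0(2)[of z] by (auto simp: stolz_region_def)
    thus "g1 z/g2 z = h z" by (simp add: g1_def g2_def)
   qed
   ultimately show "(h \<longlongrightarrow> a/b) (at u within stolz_region A u)" by (rule Lim_transform_eventually)
  qed
  thus ?case ..
 qed
qed

lemma hardy1_boundary:
 assumes "h \<in> hardy 1"
 shows "AE u in \<T>. (%j. h (of_real (rad j)*u)) ----> boundary_fun h u"
  and "integrable \<T> (boundary_fun h)"
  and "taylor_seq h n = (MEAN u. boundary_fun h u*cnj u^n)"
proof -
 note h = hardy1D(1)[OF assms]
 note [measurable] = measurable_boundary_fun[OF h]
 have "AE u in \<T>. cmod u = 1" by (rule AE_I2) simp
 with hardy1_nt_limit[OF assms]
 show lim: "AE u in \<T>. (%j. h (of_real (rad j)*u)) ----> boundary_fun h u"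
 proof eventually_elim
  case (elim u)
  then obtain L where L: "has_nontangential_limit h u L" by blast
  show ?case using nt_limit_radial[OF L elim(2)] boundary_fun_eqI[OF L elim(2)] by simp
 qed
 obtain v where v: "integrable \<T> v" "\<And>u. 0 <= v u"
  "AE u in \<T>. \<forall>r. 0 <= r \<longrightarrow> r < 1 \<longrightarrow> cmod (h (of_real r*u)) <= v u"
  using hardy1_dominated[OF assms] by blast
 have m: "(%u. h (of_real (rad j)*u)) \<in> borel_measurable \<T>" for j
  by (intro circle_measurable dilate_holomorphic[OF h] rad)
 have dom: "AE u in \<T>. cmod (h (of_real (rad j)*u)) <= v u" for j
  using v(3) by eventually_elim (use rad in auto)
 show "integrable \<T> (boundary_fun h)"
  by (rule integrable_dominated_convergence[OF _ _ v(1) lim]) (use m dom in auto)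
 have mc: "(%u. cnj u^n) \<in> borel_measurable \<T>"
  by (intro circle_measurable continuous_intros)
 have "(%j. MEAN u. h (of_real (rad j)*u)*cnj u^n) ----> (MEAN u. boundary_fun h u*cnj u^n)"
 proof (rule integral_dominated_convergence[OF _ _ v(1)])
  show "AE u in \<T>. (%j. h (of_real (rad j)*u)*cnj u^n) ----> boundary_fun h u*cnj u^n"
   using lim by eventually_elim (intro tendsto_intros)
  have "AE u in \<T>. cmod u = 1" by (rule AE_I2) simp
  thus "AE u in \<T>. norm (h (of_real (rad j)*u)*cnj u^n) <= v u" for j
   using dom[of j] by eventually_elim (simp add: norm_mult norm_power)
 qed (use m mc in "auto intro!: borel_measurable_times")
 moreover have "(%j. MEAN u. h (of_real (rad j)*u)*cnj u^n) ----> taylor_seq h n * of_real 1^n"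
  unfolding coeff_integral[OF h rad(1,2)] by (intro tendsto_intros rad_tendsto)
 ultimately show "taylor_seq h n = (MEAN u. boundary_fun h u*cnj u^n)"
  using LIMSEQ_unique by fastforce
qed

section \<open>BMOA is contained in the Bloch space\<close>

lemma jordan_inequality_sin:
 assumes "0 <= y" "y <= pi/2"
 shows "2/pi*y <= sin y"
proof -
 have c: "concave_on {0..pi/2} (sin :: real => real)"
  by (rule f''_le0_imp_concave[where f' = cos and f'' = "%x. - sin x"])
   (auto intro!: derivative_eq_intros sin_ge_zero)
 have "(1 - 2*y/pi) * sin 0 + (2*y/pi) * sin (pi/2) <= sin ((1 - 2*y/pi) *\<^sub>R 0 + (2*y/pi) *\<^sub>R (pi/2))"
  by (rule concave_onD[OF c]) (use assms in "auto simp: field_simps")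
 thus ?thesis by simp
qed

lemma cmod_cis_diff: "cmod (cis a - cis b) = 2 * \<bar>sin ((a - b)/2)\<bar>"
proof -
 have "cis a - cis b = cis b*(cis (a - b) - 1)" by (simp add: algebra_simps cis_mult)
 hence "cmod (cis a - cis b) = cmod (exp (\<i> * of_real (a - b)) - 1)" by (simp add: norm_mult cis_conv_exp)
 thus ?thesis by (simp only: dist_exp_i_1)
qed

lemma cmod_cis_diff_ge:
 assumes "\<bar>a - b\<bar> <= pi"
 shows "2/pi * \<bar>a - b\<bar> <= cmod (cis a - cis b)"
proof -
 have "2/pi*(\<bar>a - b\<bar>/2) <= sin (\<bar>a - b\<bar>/2)" by (rule jordan_inequality_sin) (use assms in auto)
 also have "... = sin \<bar>(a - b)/2\<bar>" by simp
 also have "... <= \<bar>sin ((a - b)/2)\<bar>"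
 proof -
  have "sin \<bar>x\<bar> <= \<bar>sin x\<bar>" for x :: real by (cases "x \<ge> 0") simp_all
  thus ?thesis .
 qed
 finally show ?thesis unfolding cmod_cis_diff by simp
qed

lemma cmod_cis_diff_le: "cmod (cis a - cis b) <= \<bar>a - b\<bar>"
proof -
 have "\<bar>sin ((a - b)/2)\<bar> <= \<bar>(a - b)/2\<bar>" by (rule abs_sin_x_le_abs_x)
 thus ?thesis unfolding cmod_cis_diff by simp
qed

lemma ex_dyadic:
 assumes "0 < (d::real)" "d <= 1"
 obtains K :: nat where "(1/2)^K <= d" "d <= 2*(1/2)^K"
proof -
 have "(%j. (1/2::real)^j) ----> 0" by (rule LIMSEQ_realpow_zero) auto
 from order_tendstoD(2)[OF this assms(1)] have ex: "\<exists>j. (1/2)^j <= d"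
  by (meson eventually_sequentially less_imp_le order_refl)
 define j where "j = (LEAST j. (1/2)^j <= d)"
 have j1: "(1/2)^j <= d" unfolding j_def by (rule LeastI_ex[OF ex])
 have "d <= 2*(1/2)^j"
 proof (cases j)
  case (Suc i)
  have "\<not> (1/2)^i <= d" using not_less_Least[of i "%j. (1/2)^j <= d", folded j_def] Suc by simp
  thus ?thesis using Suc by simp
 qed (use assms in simp)
 with j1 show ?thesis by (rule that)
qed

text \<open>The kernel has mean 1 in \<open>w\<close>, so a constant can be subtracted from the
  boundary function and added back outside. It will be the mean over an arc adapted to
  \<open>z\<close>.\<close>

lemma frac_deriv1_boundary:
 assumes f: "f \<in> hardy 1" and z: "cmod z < 1"
 shows "frac_deriv1 f z = c + (MEAN w. (boundary_fun f w - c)/(1 - cnj w*z)^2)"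
proof -
 define g where "g = (%w. boundary_fun f w - c)"
 have g: "integrable \<T> g" unfolding g_def using hardy1_boundary(2)[OF f] by simp
 define F where "F n w = (of_nat (Suc n)*z^n)*(g w*cnj w^n)" for n w
 have mc: "(%u. cnj u^n) \<in> borel_measurable \<T>" for n
  by (intro circle_measurable continuous_intros)
 have i0: "integrable \<T> (%w. g w*cnj w^n)" for n
  by (rule Bochner_Integration.integrable_bound[OF g])
   (use g mc in "auto simp: norm_mult norm_power intro!: borel_measurable_times")
 have int: "integrable \<T> (F n)" for n unfolding F_def by (intro integrable_mult_right i0)
 have nF: "norm (F n w) = (real (Suc n)*cmod z^n)*cmod (g w)" if "cmod w = 1" for n w
  unfolding F_def norm_mult norm_power norm_of_nat using that by simp
 have "(%n. of_nat (Suc n)*(cmod z)^n) sums (1/(1 - cmod z)^2)" by (rule geometric_deriv_sums) (use z in simp)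
 hence gs: "summable (%n. real (Suc n)*cmod z^n*y)" for y by (intro summable_mult2) (simp add: sums_iff)
 have "(%i. integral\<^sup>L \<T> (F i)) sums (MEAN w. (\<Sum>i. F i w))"
 proof (rule sums_integral[OF int])
  show "AE w in \<T>. summable (%i. norm (F i w))"
  proof (rule AE_I2)
   fix w assume "w \<in> space \<T>"
   thus "summable (%i. norm (F i w))" using gs[of "cmod (g w)"] nF[of w] by simp
  qed
  have "(MEAN w. norm (F n w)) = (real (Suc n)*cmod z^n)*(MEAN w. cmod (g w))" for n
   unfolding integral_mult_right_zero[symmetric]
   by (rule Bochner_Integration.integral_cong) (use nF in auto)
  thus "summable (%i. MEAN w. norm (F i w))" using gs by simp
 qed
 also have "(MEAN w. (\<Sum>i. F i w)) = (MEAN w. g w/(1 - cnj w*z)^2)"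
 proof (rule Bochner_Integration.integral_cong)
  fix w assume "w \<in> space \<T>"
  hence x: "cmod w = 1" by simp
  have "(%n. of_nat (Suc n)*(cnj w*z)^n) sums (1/(1 - cnj w*z)^2)"
   by (rule geometric_deriv_sums) (use x z in "simp add: norm_mult")
  from sums_mult2[OF this, of "g w"] have "(%n. F n w) sums (g w/(1 - cnj w*z)^2)"
   by (simp add: F_def power_mult_distrib mult_ac)
  thus "(\<Sum>i. F i w) = g w/(1 - cnj w*z)^2" by (simp add: sums_iff)
 qed simp
 also have "(%i. integral\<^sup>L \<T> (F i)) = (%n. of_nat (Suc n)*taylor_seq f n*z^n - (if n = 0 then c else 0))"
 proof (rule ext)
  fix n
  have ic: "integrable \<T> (%w. c*cnj w^n)" by (intro circle_integrable continuous_intros)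
  have ib: "integrable \<T> (%w. boundary_fun f w*cnj w^n)"
   by (rule Bochner_Integration.integrable_bound[OF hardy1_boundary(2)[OF f]])
    (use hardy1_boundary(2)[OF f] mc in "auto simp: norm_mult norm_power intro!: borel_measurable_times")
  have "(MEAN w. g w*cnj w^n) = (MEAN w. boundary_fun f w*cnj w^n - c*cnj w^n)"
   by (simp add: g_def algebra_simps)
  also have "... = taylor_seq f n - c*(MEAN w. cnj w^n)"
   using ib ic by (simp add: hardy1_boundary(3)[OF f])
  also have "(MEAN w. cnj w^n) = (if n = 0 then 1 else 0)"
   using circle_orthogonal[of 0 n] by simp
  finally have E: "(MEAN w. g w*cnj w^n) = taylor_seq f n - c*(if n = 0 then 1 else 0)" .
  show "integral\<^sup>L \<T> (F n) = of_nat (Suc n)*taylor_seq f n*z^n - (if n = 0 then c else 0)"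
   unfolding F_def integral_mult_right_zero E by (cases "n = 0") (simp_all add: algebra_simps)
 qed
 finally have "(%n. of_nat (Suc n)*taylor_seq f n*z^n - (if n = 0 then c else 0)) sums (MEAN w. g w/(1 - cnj w*z)^2)" .
 from sums_add[OF this sums_single[of 0 "%_. c"]]
 have "(%n. of_nat (Suc n)*taylor_seq f n*z^n) sums ((MEAN w. g w/(1 - cnj w*z)^2) + c)"
  by (simp only: diff_add_cancel)
 thus ?thesis unfolding frac_deriv1_def g_def by (simp add: sums_iff add.commute)
qed

lemma set_integral_const_circle:
 fixes y :: "'b::{banach,second_countable_topology}"
 assumes "A \<in> sets \<T>"
 shows "(LINT x:A|\<T>. y) = measure \<T> A *\<^sub>R y"
proof -
 have "A \<inter> space \<T> = A" using sets.sets_into_space[OF assms] by blast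
 thus ?thesis using assms unfolding set_lebesgue_integral_def
  by (subst integral_scaleR_left) (auto simp: less_top[symmetric] simp del: space_circle intro!: integrable_real_indicator)
qed

text \<open>In \<open>BMOA_subset_bloch\<close>, \<open>2^k\<close> is the kernel size times the arc
  length at scale \<open>k\<close>, and \<open>K - k\<close> counts the arcs through which two means
  are compared.\<close>

lemma geometric_linear_sum: "(\<Sum>k\<le>K. 2^k*(1 + 2*(real K - real k))) <= 6*2^K"
proof (induction K)
 case (Suc K)
 have "(\<Sum>k\<le>Suc K. 2^k*(1 + 2*(real (Suc K) - real k))) = (\<Sum>k\<le>K. 2^k*(1 + 2*(real K - real k)) + 2*2^k) + 2^Suc K"
  by (simp add: algebra_simps)
 also have "... = (\<Sum>k\<le>K. 2^k*(1 + 2*(real K - real k))) + 2*(\<Sum>k\<le>K. 2^k) + 2^Suc K"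
  by (simp only: sum.distrib sum_distrib_left)
 also have "(\<Sum>k\<le>K. (2::real)^k) = 2^Suc K - 1" by (induction K) auto
 finally show ?case using Suc by simp
qed simp

text \<open>The arcs \<open>I k\<close> are centred at the direction of \<open>z\<close>, have
  measure \<open>(1/2)^k\<close>, and shrink to the scale \<open>(1/2)^K\<close> comparable to
  \<open>1 - cmod z\<close>. The oscillation around the mean \<open>c K\<close> of the smallest arc
  grows only linearly in \<open>K - k\<close>, while the kernel decays geometrically.\<close>

lemma BMOA_subset_bloch: "BMOA \<subseteq> bloch"
proof
 fix f assume fB: "f \<in> BMOA"
 hence f: "f \<in> hardy 1" and "bdd_above ((%I. arc_oscillation I (boundary_fun f)) ` arcs)" by (auto simp: BMOA_def)
 then obtain B0 where B0: "\<And>I. I \<in> arcs ==> arc_oscillation I (boundary_fun f) <= B0" unfolding bdd_above_def by blast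
 define B where "B = max B0 0"
 have B: "0 <= B" "\<And>I. I \<in> arcs ==> arc_oscillation I (boundary_fun f) <= B" using B0 by (auto simp: B_def intro: max.coboundedI1)
 define g where "g = boundary_fun f"
 have g: "integrable \<T> g" unfolding g_def by (rule hardy1_boundary(2)[OF f])
 define N where "N = (MEAN w. cmod (g w))"
 have N0: "0 <= N" by (simp add: N_def)
 have main: "(1 - cmod z)*cmod (frac_deriv1 f z) <= 2*N + 48*B" if z: "z \<in> ball 0 1" for z
 proof -
  have z1: "cmod z < 1" using z by simp
  obtain \<theta> where \<theta>: "z = of_real (cmod z)*cis \<theta>"
   using rcis_cmod_Arg[of z] by (metis rcis_def)
  obtain K where K: "(1/2)^K <= 1 - cmod z" "1 - cmod z <= 2*(1/2)^K"
   using ex_dyadic[of "1 - cmod z"] z1 by auto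
  have K2: "2^K <= 2/(1 - cmod z)" "0 < 1 - cmod z" using K z1 by (auto simp: field_simps power_divide)
  define I where "I k = cis ` {\<theta> - pi*(1/2)^k .. \<theta> + pi*(1/2)^k}" for k :: nat
  have pk1: "pi*(1/2)^k <= pi" for k :: nat using power_le_one[of "1/2::real" k] mult_left_mono[of "(1/2)^k" 1 pi] by simp
  have Im [measurable]: "I k \<in> sets \<T>" for k
   unfolding I_def by (rule measure_circle_arc) (use pk1[of k] in auto)
  have Imeas: "measure \<T> (I k) = (1/2)^k" for k
   unfolding I_def using pk1[of k] by (subst measure_circle_arc) auto
  have Iarc: "I k \<in> arcs" for k unfolding arcs_def I_def using pk1[of k] by (auto intro!: exI)
  have Isub: "I (Suc k) \<subseteq> I k" for k
   unfolding I_def by (intro image_mono) (auto simp: field_simps)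
  define c where "c k = arc_mean (I k) g" for k
  have si: "set_integrable \<T> (I k) (%w. cmod (g w - y))" for k y
   unfolding set_integrable_def by (rule integrable_mult_indicator) (use g in auto)
  have sg: "set_integrable \<T> (I k) g" for k
   unfolding set_integrable_def by (rule integrable_mult_indicator) (use g in auto)
  have osc: "(LINT w:I k|\<T>. cmod (g w - c k)) <= B*(1/2)^k" for k
   using B(2)[OF Iarc[of k]] unfolding arc_oscillation_def g_def[symmetric] c_def[symmetric] Imeas
   by (simp add: divide_le_eq)
  \<comment> \<open>The next arc has half the measure, so taking \<open>y = c k\<close> bounds the
    difference of consecutive means by \<open>2*B\<close>.\<close>
  have mean_diff: "cmod (c (Suc k) - y)*(1/2)^Suc k <= (LINT w:I k|\<T>. cmod (g w - y))" for k y
  proof -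
   have "(c (Suc k) - y)*(1/2)^Suc k = (LINT w:I (Suc k)|\<T>. g w) - y*(1/2)^Suc k"
    by (simp add: c_def arc_mean_def Imeas field_simps)
   also have "y*(1/2)^Suc k = (LINT w:I (Suc k)|\<T>. y)"
    unfolding set_integral_const_circle[OF Im] Imeas by (simp add: scaleR_conv_of_real mult.commute)
   also have "(LINT w:I (Suc k)|\<T>. g w) - ... = (LINT w:I (Suc k)|\<T>. g w - y)"
    by (rule set_integral_diff(2)[symmetric, OF sg]) (auto simp: set_integrable_def intro!: integrable_mult_indicator)
   finally have E: "(c (Suc k) - y)*(1/2)^Suc k = (LINT w:I (Suc k)|\<T>. g w - y)" .
   have "cmod (c (Suc k) - y)*(1/2)^Suc k = cmod ((c (Suc k) - y)*(1/2)^Suc k)"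
    unfolding norm_mult norm_power by simp
   also have "... = cmod (LINT w:I (Suc k)|\<T>. g w - y)" by (simp only: E)
   also have "... <= (LINT w:I (Suc k)|\<T>. cmod (g w - y))"
    unfolding set_lebesgue_integral_def
    by (rule order_trans[OF integral_norm_bound]) (simp add: norm_scaleR)
   also have "... <= (LINT w:I k|\<T>. cmod (g w - y))"
    unfolding set_lebesgue_integral_def
    using si[of "Suc k" y] si[of k y] unfolding set_integrable_def
    by (intro integral_mono) (use Isub[of k] in "auto split: split_indicator")
   finally show ?thesis .
  qed
  have step: "cmod (c (Suc k) - c k) <= 2*B" for k
   using order_trans[OF mean_diff[of k "c k"] osc[of k]] by (simp add: field_simps)
  have chain: "k <= K ==> cmod (c k - c K) <= 2*B*(real K - real k)" for k
  proof (induction "K - k" arbitrary: k)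
   case 0 thus ?case by simp
  next
   case (Suc j)
   hence k: "k < K" by simp
   have "cmod (c (Suc k) - c K) <= 2*B*(real K - real (Suc k))" using Suc(2) k by (intro Suc(1)) auto
   moreover have "cmod (c k - c K) <= cmod (c (Suc k) - c k) + cmod (c (Suc k) - c K)"
    using norm_triangle_ineq4[of "c (Suc k) - c K" "c (Suc k) - c k"] by simp
   ultimately show ?case using step[of k] by (simp add: algebra_simps)
  qed
  have osc2: "(LINT w:I k|\<T>. cmod (g w - c K)) <= B*(1/2)^k*(1 + 2*(real K - real k))" if "k <= K" for k
  proof -
   have "(LINT w:I k|\<T>. cmod (g w - c K)) <= (LINT w:I k|\<T>. cmod (g w - c k) + cmod (c k - c K))"
    unfolding set_lebesgue_integral_def
   proof (rule integral_mono)
    show "integrable \<T> (%w. indicat_real (I k) w *\<^sub>R cmod (g w - c K))" using si unfolding set_integrable_def .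
    show "integrable \<T> (%w. indicat_real (I k) w *\<^sub>R (cmod (g w - c k) + cmod (c k - c K)))"
     by (rule integrable_mult_indicator) (use g in auto)
    show "indicat_real (I k) w *\<^sub>R cmod (g w - c K) <= indicat_real (I k) w *\<^sub>R (cmod (g w - c k) + cmod (c k - c K))" for w
     using norm_triangle_ineq[of "g w - c k" "c k - c K"] by (auto split: split_indicator)
   qed
   also have "... = (LINT w:I k|\<T>. cmod (g w - c k)) + (LINT w:I k|\<T>. cmod (c k - c K))"
    by (rule set_integral_add(2)[OF si]) (simp add: set_integrable_def integrable_mult_indicator del: real_scaleR_def)
   also have "(LINT w:I k|\<T>. cmod (c k - c K)) = cmod (c k - c K)*(1/2)^k"
    unfolding set_integral_const_circle[OF Im] Imeas by simp
   also have "(LINT w:I k|\<T>. cmod (g w - c k)) + cmod (c k - c K)*(1/2)^k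
     <= B*(1/2)^k + (2*B*(real K - real k))*(1/2)^k"
    by (intro add_mono osc mult_right_mono chain that) simp
   finally show ?thesis by (simp add: algebra_simps)
  qed
  \<comment> \<open>On \<open>I k\<close> outside \<open>I (Suc k)\<close> the distance to
    \<open>z\<close> is at least \<open>(1/2)^Suc k\<close>; on the smallest arc
    \<open>1 - cmod z\<close> is a lower bound.\<close>
  have cover: "1/(cmod (w - z))^2 <= (\<Sum>k\<le>K. 4^Suc k*indicat_real (I k) w)" if x: "cmod w = 1" for w
  proof -
   define t where "t = Arg (w/cis \<theta>)"
   have q: "cmod (w/cis \<theta>) = 1" using x by (simp add: norm_divide)
   hence "cis t = w/cis \<theta>" unfolding t_def by (subst cis_Arg) (auto simp: sgn_div_norm)
   hence xt: "w = cis (\<theta> + t)" by (simp add: cis_mult[symmetric] field_simps)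
   have t: "\<bar>t\<bar> <= pi" using Arg_bounded[of "w/cis \<theta>"] unfolding t_def by (simp add: abs_le_iff)
   have mem: "w \<in> I k" if "\<bar>t\<bar> <= pi*(1/2)^k" for k
    unfolding I_def xt by (rule imageI) (use that in auto)
   have d1: "1 - cmod z <= cmod (w - z)" by (rule circle_dist_ge[OF x])
   have "z - cis \<theta> = - (of_real (1 - cmod z)*cis \<theta>)" by (subst (1) \<theta>) (simp add: algebra_simps)
   hence "cmod (z - cis \<theta>) = 1 - cmod z" using z1 by (simp only: norm_minus_cancel norm_mult norm_of_real) simp
   hence e1: "cmod (w - cis \<theta>) <= 2*cmod (w - z)"
    using norm_triangle_ineq[of "w - z" "z - cis \<theta>"] d1 by simp
   have e2: "2/pi * \<bar>t\<bar> <= cmod (w - cis \<theta>)"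
    using cmod_cis_diff_ge[of "\<theta> + t" \<theta>] t unfolding xt by simp
   have d2: "\<bar>t\<bar> <= pi*cmod (w - z)" using order_trans[OF e2 e1] by (simp add: field_simps)
   have dpos: "0 < cmod (w - z)" using d1 z1 by linarith
   have "\<exists>k\<le>K. w \<in> I k \<and> 1/(cmod (w - z))^2 <= 4^Suc k"
   proof (cases "\<bar>t\<bar> <= pi*(1/2)^K")
    case True
    have "((1/2)^K)^2 <= (cmod (w - z))^2" by (rule power_mono) (use K d1 in auto)
    hence "1/(cmod (w - z))^2 <= 1/((1/2)^K)^2" by (intro divide_left_mono mult_pos_pos zero_less_power dpos) auto
    also have "... = 4^K" by (simp add: power_divide power_mult[symmetric] mult.commute[of K]) (simp add: power_mult)
    also have "... <= 4^Suc K" by simp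
    finally show ?thesis using mem[OF True] by blast
   next
    case False
    define j where "j = (LEAST j. \<bar>t\<bar> > pi*(1/2)^j)"
    have j1: "\<bar>t\<bar> > pi*(1/2)^j" unfolding j_def by (rule LeastI[of _ K]) (use False in auto)
    have jK: "j <= K" unfolding j_def by (rule Least_le) (use False in auto)
    obtain k where k: "j = Suc k" using j1 t by (cases j) auto
    have "\<bar>t\<bar> <= pi*(1/2)^k" using not_less_Least[of k "%j. \<bar>t\<bar> > pi*(1/2)^j", folded j_def] k by simp
    hence 1: "w \<in> I k" by (rule mem)
    have "pi*(1/2)^Suc k < pi*cmod (w - z)" using j1 d2 unfolding k by linarith
    hence "(1/2)^Suc k <= cmod (w - z)" by (simp only: mult_less_cancel_left_pos[OF pi_gt_zero])
    hence "((1/2)^Suc k)^2 <= (cmod (w - z))^2" by (rule power_mono) simp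
    hence "1/(cmod (w - z))^2 <= 1/((1/2)^Suc k)^2" by (intro divide_left_mono mult_pos_pos zero_less_power dpos) auto
    also have "... = 4^Suc k" by (simp only: power_divide power_mult[symmetric] mult.commute[of "Suc k"]) (simp add: power_mult)
    finally show ?thesis using 1 k jK by (intro exI[of _ k]) auto
   qed
   then obtain k where k: "k <= K" "w \<in> I k" "1/(cmod (w - z))^2 <= 4^Suc k" by blast
   have "4^Suc k*indicat_real (I k) w <= (\<Sum>k\<le>K. 4^Suc k*indicat_real (I k) w)"
    by (rule member_le_sum) (use k in auto)
   thus ?thesis using k by simp
  qed
  define G where "G w = (\<Sum>k\<le>K. 4^Suc k*(indicat_real (I k) w *\<^sub>R cmod (g w - c K)))" for w
  have iG: "integrable \<T> G"
   unfolding G_def using si unfolding set_integrable_def by (intro Bochner_Integration.integrable_sum integrable_mult_right)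
  have ptw: "cmod ((g w - c K)/(1 - cnj w*z)^2) <= G w" if x: "cmod w = 1" for w
  proof -
   have "w \<noteq> 0" using x by auto
   hence "1 - cnj w*z = cnj w*(w - z)" using x by (simp add: cnj_circle algebra_simps)
   hence "cmod (1 - cnj w*z) = cmod (w - z)" using x by (simp add: norm_mult)
   hence "cmod ((g w - c K)/(1 - cnj w*z)^2) = cmod (g w - c K)*(1/(cmod (w - z))^2)"
    by (simp add: norm_divide norm_power)
   also have "... <= cmod (g w - c K)*(\<Sum>k\<le>K. 4^Suc k*indicat_real (I k) w)" by (intro mult_left_mono cover x) simp
   also have "... = G w" by (simp add: G_def sum_distrib_left mult_ac)
   finally show ?thesis .
  qed
  have meas: "(%w. (g w - c K)/(1 - cnj w*z)^2) \<in> borel_measurable \<T>"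
  proof -
   have "(%w. (1 - cnj w*z)^2) \<in> borel_measurable \<T>"
    by (intro circle_measurable continuous_intros)
   thus ?thesis using g by (intro borel_measurable_divide borel_measurable_diff) auto
  qed
  have iq: "integrable \<T> (%w. (g w - c K)/(1 - cnj w*z)^2)"
  proof (rule Bochner_Integration.integrable_bound[OF iG meas])
   show "AE w in \<T>. norm ((g w - c K)/(1 - cnj w*z)^2) <= norm (G w)"
   proof (rule AE_I2)
    fix w assume "w \<in> space \<T>"
    hence "cmod w = 1" by simp
    from ptw[OF this] show "norm ((g w - c K)/(1 - cnj w*z)^2) <= norm (G w)" by simp
   qed
  qed
  have "cmod (MEAN w. (g w - c K)/(1 - cnj w*z)^2) <= (MEAN w. G w)"
   by (rule Bochner_Integration.integral_norm_bound_integral[OF iq iG]) (use ptw in auto)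
  also have "... = (\<Sum>k\<le>K. MEAN w. 4^Suc k*(indicat_real (I k) w *\<^sub>R cmod (g w - c K)))"
   unfolding G_def
   by (rule Bochner_Integration.integral_sum) (rule integrable_mult_right, use si in "simp only: set_integrable_def")
  also have "... = (\<Sum>k\<le>K. 4^Suc k*(LINT w:I k|\<T>. cmod (g w - c K)))"
   by (simp only: integral_mult_right_zero set_lebesgue_integral_def)
  also have "... <= (\<Sum>k\<le>K. 4*B*(2^k*(1 + 2*(real K - real k))))"
  proof (rule sum_mono)
   fix k assume "k \<in> {..K}"
   hence "4^Suc k*(LINT w:I k|\<T>. cmod (g w - c K)) <= 4^Suc k*(B*(1/2)^k*(1 + 2*(real K - real k)))"
    by (intro mult_left_mono osc2) auto
   also have "... = 4*B*((4*(1/2))^k*(1 + 2*(real K - real k)))" by (simp only: power_mult_distrib power_Suc mult_ac)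
   finally show "4^Suc k*(LINT w:I k|\<T>. cmod (g w - c K)) <= 4*B*(2^k*(1 + 2*(real K - real k)))" by simp
  qed
  also have "... <= 4*B*(6*2^K)"
   unfolding sum_distrib_left[symmetric] by (intro mult_left_mono geometric_linear_sum) (use B in auto)
  also have "... <= 4*B*(6*(2/(1 - cmod z)))" by (intro mult_left_mono K2) (use B in auto)
  finally have A1: "cmod (MEAN w. (g w - c K)/(1 - cnj w*z)^2) <= 48*B/(1 - cmod z)" by simp
  \<comment> \<open>The mean over the smallest arc is bounded only by \<open>2^K\<close> times the
    \<open>L^1\<close> norm, which is compensated by the factor \<open>1 - cmod z\<close> of the
    Bloch condition.\<close>
  have "c K = (LINT w:I K|\<T>. g w)*2^K"
   by (simp add: c_def arc_mean_def Imeas power_divide)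
  hence "cmod (c K) = cmod (LINT w:I K|\<T>. g w)*2^K" by (simp add: norm_mult norm_power)
  also have "cmod (LINT w:I K|\<T>. g w) <= N"
   unfolding set_lebesgue_integral_def N_def
   by (rule Bochner_Integration.integral_norm_bound_integral) (use sg[of K] g in "auto simp: set_integrable_def split: split_indicator")
  also have "N*2^K <= N*(2/(1 - cmod z))" by (intro mult_left_mono K2 N0)
  finally have A2: "cmod (c K) <= 2*N/(1 - cmod z)" by (simp add: mult.commute)
  have "cmod (frac_deriv1 f z) <= cmod (c K) + cmod (MEAN w. (g w - c K)/(1 - cnj w*z)^2)"
   unfolding frac_deriv1_boundary[OF f z1, of "c K", folded g_def] by (rule norm_triangle_ineq)
  also have "... <= (2*N + 48*B)/(1 - cmod z)" using A1 A2 by (simp add: add_divide_distrib)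
  finally show ?thesis using K2(2) by (simp add: field_simps)
 qed
 thus "f \<in> bloch" using hardy1D(1)[OF f] by (auto simp: bloch_def H_disk_def intro!: bdd_aboveI2)
qed

section \<open>The Smirnov class\<close>

lemma log_plus_nonneg: "0 <= log_plus x"
 by (simp add: log_plus_def)

lemma continuous_log_plus: "continuous_on S g ==> continuous_on S (%x. log_plus (g x))"
 unfolding log_plus_def by (intro continuous_intros) (auto simp: max_def)

lemma log_plus_subharmonic:
 assumes cf: "continuous_on (cball 0 1) f" and hf: "hol f" and z: "cmod z < 1"
 shows "log_plus (cmod (f z)) <= poisson (%x. log_plus (cmod (f x))) z"
proof -
 have cs: "continuous_on (sphere 0 1) f" by (rule continuous_on_subset[OF cf]) auto
 have "cmod (f z) <= exp (poisson (%x. ln (max 1 (cmod (f x)))) z)"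
  by (rule log_subharmonic[OF cf hf z]) (use cs in "auto intro!: continuous_intros")
 moreover have "1 <= exp (poisson (%x. ln (max 1 (cmod (f x)))) z)"
  using poisson_nonneg[OF z, of "%x. ln (max 1 (cmod (f x)))"] by simp
 ultimately have "max 1 (cmod (f z)) <= exp (poisson (%x. ln (max 1 (cmod (f x)))) z)" by simp
 hence "ln (max 1 (cmod (f z))) <= ln (exp (poisson (%x. ln (max 1 (cmod (f x)))) z))"
  by (subst ln_le_cancel_iff) auto
 thus ?thesis by (simp add: log_plus_def)
qed

lemma rad_at_left: "filterlim rad (at_left 1) sequentially"
 unfolding filterlim_at using rad_tendsto rad(2) by (auto intro!: always_eventually simp: less_imp_neq)

text \<open>Only Fatou's lemma is used: applied to \<open>log_plus\<close> of the dilations times the nonnegative weight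
 \<open>2 / (1 - cmod z) - pk z\<close>, together with convergence of the unweighted means, it bounds the
 Poisson integrals from above. Points without nontangential limit do no harm.\<close>
lemma smirnov_log_plus:
 assumes f: "f \<in> smirnov" and z: "cmod z < 1"
 shows "integrable \<T> (%v. log_plus (cmod (boundary_fun f v)))"
  and "log_plus (cmod (f z)) <= poisson (%v. log_plus (cmod (boundary_fun f v))) z"
proof -
 have h: "hol f" using f by (auto simp: smirnov_def nevanlinna_def H_disk_def)
 define L where "L v = log_plus (cmod (boundary_fun f v))" for v
 define l where "l n v = log_plus (cmod (f (of_real (rad n) * v)))" for n v
 define a where "a = (MEAN v. L v)"
 have cl: "continuous_on (sphere 0 1) (l n)" for n
  unfolding l_def by (intro continuous_log_plus continuous_on_norm dilate_holomorphic[OF h] rad)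
 have il: "integrable \<T> (l n)" for n by (rule circle_integrable[OF cl])
 have [measurable]: "l n \<in> borel_measurable \<T>" for n by (rule circle_measurable[OF cl])
 have [measurable]: "L \<in> borel_measurable \<T>"
  unfolding L_def log_plus_def using measurable_boundary_fun[OF h] by measurable
 have nn: "0 <= L v" "0 <= l n v" for n v by (simp_all add: L_def l_def log_plus_nonneg)
 have "(nevanlinna_mean f \<longlongrightarrow> a) (at_left 1)" using f by (simp add: smirnov_def a_def L_def)
 from filterlim_compose[OF this rad_at_left]
 have lim: "(%n. MEAN v. l n v) ----> a" by (simp add: nevanlinna_mean_def l_def)
 have Ll: "ennreal (L v) <= liminf (%n. ennreal (l n v))" if "cmod v = 1" for v
 proof (cases "\<exists>y. has_nontangential_limit f v y")
  case True
  then obtain y where y: "has_nontangential_limit f v y" ..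
  have "(%n. f (of_real (rad n) * v)) ----> boundary_fun f v"
   using nt_limit_radial[OF y that] boundary_fun_eqI[OF y that] by simp
  hence "(%n. l n v) ----> L v" unfolding l_def L_def log_plus_def by (intro tendsto_intros) auto
  hence "(%n. ennreal (l n v)) ----> ennreal (L v)" by (rule tendsto_ennrealI)
  thus ?thesis using lim_imp_Liminf[OF sequentially_bot] by fastforce
 next
  case False
  hence "boundary_fun f v = 0" by (simp add: boundary_fun_def)
  thus ?thesis by (simp add: L_def log_plus_def)
 qed
 have "(NN v. ennreal (L v)) <= (NN v. liminf (%n. ennreal (l n v)))"
  by (rule nn_integral_mono) (use Ll in auto)
 also have "... <= liminf (%n. \<integral>\<^sup>+v. ennreal (l n v) \<partial>\<T>)"
  by (rule nn_integral_liminf) measurable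
 also have "... = liminf (%n. ennreal (MEAN v. l n v))"
  by (subst nn_integral_eq_integral[OF il]) (auto simp: nn)
 also have "... = ennreal a" by (rule lim_imp_Liminf[OF sequentially_bot tendsto_ennrealI[OF lim]])
 finally have "(NN v. ennreal (L v)) <= ennreal a" .
 hence "(NN v. ennreal (norm (L v))) < \<infinity>" by (simp add: nn order_le_less_trans)
 hence iL: "integrable \<T> L" by (intro integrableI_bounded) simp_all
 thus "integrable \<T> (%v. log_plus (cmod (boundary_fun f v)))" unfolding L_def .
 define c where "c = 2/(1 - cmod z)"
 define w where "w v = c - pk z v" for v
 have w0: "0 <= w v" if "cmod v = 1" for v using pk_le[OF z that] by (simp add: w_def c_def)
 have iw: "integrable \<T> (%v. w v * g v)"
  and ew: "(MEAN v. w v * g v) = c*(MEAN v. g v) - poisson g z"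
  if "integrable \<T> g" for g
  unfolding w_def left_diff_distrib poisson_def using that integrable_pk_mult[OF z that] by auto
 have le: "log_plus (cmod (f (of_real (rad n)*z))) <= poisson (l n) z" for n
  unfolding l_def by (rule log_plus_subharmonic[OF dilate_holomorphic(1,2)[OF h rad(1,2)] z])
 have "(%n. of_real (rad n)*z) ----> of_real 1*z" by (intro tendsto_intros rad_tendsto)
 moreover have "isCont f z"
  using holomorphic_on_imp_continuous_on[OF h] z by (simp add: continuous_on_eq_continuous_at)
 ultimately have "(%n. f (of_real (rad n)*z)) ----> f z" by (intro isCont_tendsto_compose[of z f]) simp_all
 hence "(%n. log_plus (cmod (f (of_real (rad n)*z)))) ----> log_plus (cmod (f z))"
  unfolding log_plus_def by (intro tendsto_intros) auto
 hence lim2: "(%n. c*(MEAN v. l n v) - log_plus (cmod (f (of_real (rad n)*z)))) ----> c*a - log_plus (cmod (f z))"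
  by (intro tendsto_intros lim)
 have "ennreal (MEAN v. w v * L v) = (NN v. ennreal (w v * L v))"
  by (rule nn_integral_eq_integral[OF iw[OF iL], symmetric]) (use w0 nn in auto)
 also have "... <= (NN v. liminf (%n. ennreal (w v * l n v)))"
 proof (rule nn_integral_mono)
  fix v assume "v \<in> space \<T>"
  hence x: "cmod v = 1" by simp
  have "continuous_on UNIV (%y. ennreal (w v)*y)" by (rule ennreal_continuous_on_cmult) auto
  moreover have "mono (%y. ennreal (w v)*y)" by (auto simp: mono_def intro!: mult_left_mono)
  ultimately have "liminf (%n. ennreal (w v)*ennreal (l n v)) = ennreal (w v)*liminf (%n. ennreal (l n v))"
   by (rule Liminf_compose_continuous_mono[OF _ _ sequentially_bot])
  thus "ennreal (w v * L v) <= liminf (%n. ennreal (w v * l n v))"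
   using w0[OF x] Ll[OF x] by (simp add: ennreal_mult' mult_left_mono)
 qed
 also have "... <= liminf (%n. \<integral>\<^sup>+v. ennreal (w v * l n v) \<partial>\<T>)"
  by (rule nn_integral_liminf) (use iw[OF il] in auto)
 also have "... = liminf (%n. ennreal (MEAN v. w v * l n v))"
  by (subst nn_integral_eq_integral[OF iw[OF il]]) (use w0 nn in auto)
 also have "... <= liminf (%n. ennreal (c*(MEAN v. l n v) - log_plus (cmod (f (of_real (rad n)*z)))))"
  unfolding ew[OF il] by (intro Liminf_mono always_eventually allI ennreal_leI diff_left_mono le)
 also have "... = ennreal (c*a - log_plus (cmod (f z)))"
  by (rule lim_imp_Liminf[OF sequentially_bot tendsto_ennrealI[OF lim2]])
 finally have E: "ennreal (MEAN v. w v * L v) <= ennreal (c*a - log_plus (cmod (f z)))" .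
 \<comment> \<open>Needed to leave \<open>ennreal\<close>, which truncates a negative right side to
   0.\<close>
 have "0 <= c*a - log_plus (cmod (f z))"
 proof (rule LIMSEQ_le_const[OF lim2], intro exI allI impI)
  fix n
  have "0 <= (MEAN v. w v * l n v)" by (rule integral_nonneg_AE) (use w0 nn in auto)
  thus "0 <= c*(MEAN v. l n v) - log_plus (cmod (f (of_real (rad n)*z)))"
   unfolding ew[OF il] using le[of n] by simp
 qed
 with E have "(MEAN v. w v * L v) <= c*a - log_plus (cmod (f z))" by (simp add: ennreal_le_iff)
 hence "log_plus (cmod (f z)) <= poisson L z" unfolding ew[OF iL] a_def by simp
 thus "log_plus (cmod (f z)) <= poisson (%v. log_plus (cmod (boundary_fun f v))) z" unfolding L_def .
qed

text \<open>Exponentiating \<open>s * log_plus\<close> gives \<open>max 1 x powr s\<close>, so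
  Jensen's inequality turns the logarithmic domination into one for powers; the maximum with 1 is
  the price of \<open>log_plus\<close>.\<close>

lemma smirnov_powr:
 assumes f: "f \<in> smirnov" and z: "cmod z < 1" and s: "0 < s"
  and int: "integrable \<T> (%x. max 1 (cmod (boundary_fun f x)) powr s)"
 shows "cmod (f z) powr s <= poisson (%x. max 1 (cmod (boundary_fun f x)) powr s) z"
proof -
 let ?L = "%x. log_plus (cmod (boundary_fun f x))"
 have e: "max 1 (cmod (boundary_fun f x)) powr s = exp (s*?L x)" for x
  by (auto simp: powr_def log_plus_def max_def)
 have "cmod (f z) <= exp (log_plus (cmod (f z)))" by (simp add: log_plus_def)
 also have "... <= exp (poisson ?L z)" using smirnov_log_plus(2)[OF f z] by simp
 finally have "cmod (f z) powr s <= exp (poisson ?L z) powr s" using s by (intro powr_mono2) auto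
 also have "... = exp (poisson (%x. s*?L x) z)" by (simp add: powr_def poisson_cmult)
 also have "... <= poisson (%x. exp (s*?L x)) z"
  by (rule poisson_jensen_exp[OF z]) (use smirnov_log_plus(1)[OF f z] int e in auto)
 finally show ?thesis by (simp only: e)
qed

section \<open>Integral means of functions dominated by Poisson integrals\<close>

text \<open>Convexity of \<open>x powr t\<close>, obtained from Young's inequality with weights
  \<open>1/t\<close> and \<open>1 - 1/t\<close>.\<close>

lemma powr_tangent:
 fixes x b t :: real
 assumes "0 <= x" "0 < b" "1 <= t"
 shows "b powr t + t*b powr (t - 1)*(x - b) <= x powr t"
proof -
 have bt: "b powr t = b*b powr (t - 1)" using assms by (simp add: powr_diff)
 have "t*(x*b powr (t - 1)) <= x powr t + (t - 1)*b powr t"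
 proof (cases "x = 0")
  case False
  hence x: "0 < x" using assms by simp
  have "(x powr t) powr (1/t)*(b powr t) powr (1 - 1/t) <= (1/t)*x powr t + (1 - 1/t)*b powr t"
   by (rule Youngs_inequality_0) (use assms x in auto)
  moreover have "(x powr t) powr (1/t) = x" using x assms by (simp add: powr_powr)
  moreover have "t*(1 - 1/t) = t - 1" using assms by (simp add: field_simps)
  hence "(b powr t) powr (1 - 1/t) = b powr (t - 1)" by (simp add: powr_powr)
  ultimately have "x*b powr (t - 1) <= (1/t)*x powr t + (1 - 1/t)*b powr t" by simp
  from mult_left_mono[OF this, of t] show ?thesis using assms by (simp add: algebra_simps)
 qed (use assms in simp)
 thus ?thesis by (simp add: bt algebra_simps)
qed

lemma poisson_mean:
 assumes "integrable \<T> v" "0 <= r" "r < 1"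
 shows "integrable \<T> (%u. poisson v (of_real r*u))"
  and "(MEAN u. poisson v (of_real r*u)) = (MEAN u. v u)"
  and "continuous_on (sphere 0 1) (%u. poisson v (of_real r*u))"
proof -
 note d = dilate_holomorphic[OF holomorphic_schwarz[OF assms(1)] assms(2,3)]
 have R: "poisson v (of_real r*u) = Re (schwarz v (of_real r*u))" if "cmod u = 1" for u
  using Re_schwarz[OF assms(1), of "of_real r*u"] that assms by (simp add: norm_mult)
 have "continuous_on (sphere 0 1) (%u. Re (schwarz v (of_real r*u)))" using d(3) by (intro continuous_intros)
 thus c: "continuous_on (sphere 0 1) (%u. poisson v (of_real r*u))"
  by (subst continuous_on_cong[OF refl R]) auto
 show "integrable \<T> (%u. poisson v (of_real r*u))" by (rule circle_integrable[OF c])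
 have "(MEAN u. poisson v (of_real r*u)) = (MEAN u. Re (schwarz v (of_real r*u)))"
  by (rule Bochner_Integration.integral_cong) (use R in auto)
 also have "... = Re (MEAN u. schwarz v (of_real r*u))"
  by (rule integral_Re[OF circle_integrable[OF d(3)]])
 also have "... = Re (schwarz v 0)" using circle_mean_value[OF d(1,2)] by simp
 also have "... = poisson v 0" by (rule Re_schwarz[OF assms(1)]) simp
 also have "... = (MEAN u. v u)" unfolding poisson_def
  by (rule Bochner_Integration.integral_cong) (auto simp: pk_def)
 finally show "(MEAN u. poisson v (of_real r*u)) = (MEAN u. v u)" .
qed

lemma poisson_jensen_powr:
 assumes z: "cmod z < 1" and t: "1 <= t" and u0: "\<And>x. 0 <= u x"
  and u: "integrable \<T> u" and ut: "integrable \<T> (%x. u x powr t)"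
 shows "poisson u z powr t <= poisson (%x. u x powr t) z"
proof (cases "poisson u z = 0")
 case True
 thus ?thesis using poisson_nonneg[OF z, of "%x. u x powr t"] by simp
next
 case False
 define b where "b = poisson u z"
 have b: "b > 0" using False poisson_nonneg[OF z, of u] u0 unfolding b_def by force
 have "poisson (%x. (b powr t - t*b powr (t - 1)*b) + (t*b powr (t - 1))*u x) z <= poisson (%x. u x powr t) z"
 proof (rule poisson_mono[OF z _ ut])
  show "integrable \<T> (%x. (b powr t - t*b powr (t - 1)*b) + (t*b powr (t - 1))*u x)" using u by auto
  show "(b powr t - t*b powr (t - 1)*b) + (t*b powr (t - 1))*u x <= u x powr t" for x
   using powr_tangent[OF u0[of x] b t] by (simp add: algebra_simps)
 qed
 also have "poisson (%x. (b powr t - t*b powr (t - 1)*b) + (t*b powr (t - 1))*u x) z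
   = (b powr t - t*b powr (t - 1)*b) + (t*b powr (t - 1))*b"
  using u by (subst poisson_add[OF z]) (auto simp: poisson_const[OF z] poisson_cmult b_def)
 finally show ?thesis by (simp add: b_def)
qed

text \<open>Write \<open>t = 1/s\<close> and cut \<open>u\<close> at the level \<open>k\<close>. For
  the low part Jensen's inequality moves the power \<open>t\<close> inside, where it restores
  \<open>u\<close>. For the high part the kernel bound \<open>2/(1 - r)\<close> estimates
  \<open>t - 1\<close> of the factors and the mean of the Poisson integral the last one.\<close>

lemma hardy_mean_split:
 assumes f: "hol f" and s: "0 < s" "s < 1" and u0: "\<And>y. 0 <= u y"
  and us: "integrable \<T> (%y. u y powr s)"
  and le: "\<And>z. cmod z < 1 ==> cmod (f z) powr s <= poisson (%y. u y powr s) z"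
  and um: "u \<in> borel_measurable \<T>" and k: "0 <= k" and r: "0 <= r" "r < 1"
 shows "(MEAN w. cmod (f (of_real r*w))) <= 2 powr (1/s) *
  ((MEAN w. (if u w <= k then u w else 0)) +
   (2/(1 - r)) powr (1/s - 1)*(MEAN w. (if u w <= k then 0 else u w powr s)) powr (1/s))"
proof -
 note [measurable] = um
 define t where "t = 1/s"
 have t: "1 < t" "s*t = 1" "t > 0" using s by (auto simp: t_def)
 define u1 where "u1 y = (if u y <= k then u y powr s else 0)" for y
 define u2 where "u2 y = (if u y <= k then 0 else u y powr s)" for y
 define X where "X = (MEAN w. u2 w)"
 have nn: "0 <= u1 y" "0 <= u2 y" for y by (auto simp: u1_def u2_def)
 have [measurable]: "u1 \<in> borel_measurable \<T>" "u2 \<in> borel_measurable \<T>"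
  unfolding u1_def[abs_def] u2_def[abs_def] by measurable
 have i1: "integrable \<T> u1" and i2: "integrable \<T> u2"
  by (rule Bochner_Integration.integrable_bound[OF us]; auto simp: u1_def u2_def)+
 have X0: "0 <= X" unfolding X_def by (rule integral_nonneg_AE) (use nn in auto)
 have u1t: "u1 y powr t = (if u y <= k then u y else 0)" for y
  using t u0[of y] by (auto simp: u1_def powr_powr)
 have i1t: "integrable \<T> (%y. u1 y powr t)"
  unfolding u1t by (rule circle.integrable_const_bound[of _ k]) (use u0 k in auto)
 define a where "a w = poisson u1 (of_real r*w)" for w
 define b where "b w = poisson u2 (of_real r*w)" for w
 have z: "cmod (of_real r*w) < 1" "cmod (of_real r*w) = r" if "cmod w = 1" for w using that r by (auto simp: norm_mult)
 have a0: "0 <= a w" and b0: "0 <= b w" if "cmod w = 1" for w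
  unfolding a_def b_def using nn z[OF that] by (auto intro!: poisson_nonneg)
 have bX: "b w <= 2/(1 - r)*X" if "cmod w = 1" for w
 proof -
  have "b w <= (MEAN y. 2/(1 - r)*u2 y)"
   unfolding b_def poisson_def
  proof (rule integral_mono)
   show "integrable \<T> (%y. pk (of_real r*w) y*u2 y)" by (rule integrable_pk_mult[OF z(1)[OF that] i2])
   show "pk (of_real r*w) y*u2 y <= 2/(1 - r)*u2 y" if "y \<in> space \<T>" for y
    using pk_le[of "of_real r*w" y] z[OF \<open>cmod w = 1\<close>] that nn by (intro mult_right_mono) auto
  qed (use i2 in simp)
  thus ?thesis by (simp add: X_def)
 qed
 have pt: "cmod (f (of_real r*w)) <= 2 powr t*(poisson (%y. u1 y powr t) (of_real r*w) + (2/(1 - r)*X) powr (t - 1)*b w)"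
  if x: "cmod w = 1" for w
 proof -
  have "cmod (f (of_real r*w)) powr s <= poisson (%y. u1 y + u2 y) (of_real r*w)"
   using le[OF z(1)[OF x]] by (simp add: u1_def u2_def if_distrib cong: if_cong)
  also have "... = a w + b w" unfolding a_def b_def by (rule poisson_add[OF z(1)[OF x] i1 i2])
  finally have "(cmod (f (of_real r*w)) powr s) powr t <= (a w + b w) powr t" using t by (intro powr_mono2) auto
  hence "cmod (f (of_real r*w)) <= (a w + b w) powr t" using t by (simp add: powr_powr)
  also have "... <= (2*max (a w) (b w)) powr t" using t a0[OF x] b0[OF x] by (intro powr_mono2) auto
  also have "... = 2 powr t*(max (a w) (b w)) powr t" using a0[OF x] by (simp add: powr_mult)
  also have "(max (a w) (b w)) powr t <= a w powr t + b w powr t" by (auto simp: max_def)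
  also have "a w powr t <= poisson (%y. u1 y powr t) (of_real r*w)"
   unfolding a_def by (rule poisson_jensen_powr[OF z(1)[OF x] _ nn(1) i1 i1t]) (use t in simp)
  also have "b w powr t <= (2/(1 - r)*X) powr (t - 1)*b w"
  proof (cases "b w = 0")
   case False
   hence b: "0 < b w" using b0[OF x] by simp
   have "b w powr t = b w powr (t - 1)*b w" using b by (simp add: powr_diff)
   also have "... <= (2/(1 - r)*X) powr (t - 1)*b w" using bX[OF x] b t by (intro mult_right_mono powr_mono2) auto
   finally show ?thesis .
  qed (use t in simp)
  finally show ?thesis by (simp add: mult_left_mono)
 qed
 note pm1 = poisson_mean[OF i1t r] and pm2 = poisson_mean[OF i2 r]
 have "(MEAN w. cmod (f (of_real r*w))) <=
  (MEAN w. 2 powr t*(poisson (%y. u1 y powr t) (of_real r*w) + (2/(1 - r)*X) powr (t - 1)*b w))"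
 proof (rule integral_mono)
  show "integrable \<T> (%w. cmod (f (of_real r*w)))"
   by (rule circle_integrable[OF continuous_on_norm[OF dilate_holomorphic(3)[OF f r]]])
  show "integrable \<T> (%w. 2 powr t*(poisson (%y. u1 y powr t) (of_real r*w) + (2/(1 - r)*X) powr (t - 1)*b w))"
   unfolding b_def by (intro integrable_mult_right Bochner_Integration.integrable_add pm1(1) pm2(1))
 qed (use pt in auto)
 also have "... = 2 powr t*((MEAN w. u1 w powr t) + (2/(1 - r)*X) powr (t - 1)*X)"
 proof -
  have ib: "integrable \<T> (%w. (2/(1 - r)*X) powr (t - 1)*b w)" unfolding b_def by (intro integrable_mult_right pm2(1))
  show ?thesis unfolding integral_mult_right_zero Bochner_Integration.integral_add[OF pm1(1) ib] pm1(2)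
   by (simp add: b_def pm2(2) X_def)
 qed
 also have "(2/(1 - r)*X) powr (t - 1)*X = (2/(1 - r)) powr (t - 1)*X powr t"
 proof (cases "X = 0")
  case False
  hence "X powr t = X powr (t - 1)*X" using X0 by (simp add: powr_diff)
  moreover have "(2/(1 - r)*X) powr (t - 1) = (2/(1 - r)) powr (t - 1)*X powr (t - 1)"
   by (rule powr_mult)
  ultimately show ?thesis by (simp only: mult.assoc)
 qed (use t in simp)
 finally show ?thesis unfolding u1t by (simp add: t_def X_def u2_def)
qed

text \<open>Jensen's inequality for weights of total mass \<open>suminf g\<close>, through the
  tangent line at the weighted mean.\<close>

lemma power_mean_suminf:
 fixes g x :: "nat => real"
 assumes g: "\<And>i. 0 <= g i" "summable g" "0 < suminf g" and x: "\<And>i. 0 <= x i" and t: "1 <= t"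
  and s1: "summable (%i. g i*x i)" and s2: "summable (%i. g i*x i powr t)"
 shows "(\<Sum>i. g i*x i) powr t <= suminf g powr (t - 1)*(\<Sum>i. g i*x i powr t)"
proof -
 define G where "G = suminf g"
 define S where "S = (\<Sum>i. g i*x i)"
 have S0: "0 <= S" unfolding S_def by (rule suminf_nonneg[OF s1]) (use g x in auto)
 have R0: "0 <= (\<Sum>i. g i*x i powr t)" by (rule suminf_nonneg[OF s2]) (use g in auto)
 show ?thesis
 proof (cases "S = 0")
  case True
  thus ?thesis using R0 t unfolding S_def[symmetric] by simp
 next
  case False
  hence S: "S > 0" using S0 by simp
  have G: "G > 0" using g by (simp add: G_def)
  define b where "b = S/G"
  have b: "b > 0" using S G by (simp add: b_def)
  have sg: "(%i. g i*(b powr t - t*b powr (t - 1)*b) + (t*b powr (t - 1))*(g i*x i)) sums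
    (G*(b powr t - t*b powr (t - 1)*b) + (t*b powr (t - 1))*S)"
   unfolding G_def S_def by (intro sums_add sums_mult2 sums_mult summable_sums g(2) s1)
  have "G*(b powr t - t*b powr (t - 1)*b) + (t*b powr (t - 1))*S <= (\<Sum>i. g i*x i powr t)"
  proof (rule sums_le[OF _ sg summable_sums[OF s2]])
   fix i
   have "g i*(b powr t + t*b powr (t - 1)*(x i - b)) <= g i*x i powr t"
    by (intro mult_left_mono powr_tangent x b t g)
   thus "g i*(b powr t - t*b powr (t - 1)*b) + (t*b powr (t - 1))*(g i*x i) <= g i*x i powr t"
    by (simp add: algebra_simps)
  qed
  moreover have "S = G*b" using G by (simp add: b_def)
  ultimately have "G*b powr t <= (\<Sum>i. g i*x i powr t)" by (simp add: algebra_simps)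
  hence "G powr (t - 1)*(G*b powr t) <= G powr (t - 1)*(\<Sum>i. g i*x i powr t)" by (rule mult_left_mono) simp
  moreover have "G powr (t - 1)*(G*b powr t) = S powr t"
  proof -
   have "G powr (t - 1)*(G*b powr t) = G powr t*b powr t" using G by (simp add: powr_diff)
   thus ?thesis using G S by (simp add: b_def powr_divide)
  qed
  ultimately show ?thesis by (simp add: G_def S_def)
 qed
qed

section \<open>Convolution of sequences with a two-sided geometric kernel\<close>

text \<open>With truncated subtraction on naturals, \<open>(i - j) + (j - i)\<close> is the distance
  of \<open>i\<close> and \<open>j\<close>.\<close>

definition gconv :: "real => (nat => real) => nat => real" where
 "gconv \<theta> v j = (\<Sum>i. \<theta>^((i - j) + (j - i)) * v i)"

context
 fixes \<theta> :: real
 assumes \<theta>: "0 < \<theta>" "\<theta> < 1"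
begin

lemma geometric_partial: "(\<Sum>k<N. \<theta>^k) <= 1/(1 - \<theta>)"
proof -
 have "(\<Sum>k<N. \<theta>^k) <= (\<Sum>k. \<theta>^k)" by (rule sum_le_suminf) (use \<theta> in auto)
 thus ?thesis using \<theta> by (simp add: suminf_geometric)
qed

lemma gkernel_sum: "(\<Sum>i<N. \<theta>^((i - j) + (j - i))) <= 2/(1 - \<theta>)"
proof -
 have "(\<Sum>i<N. \<theta>^((i - j) + (j - i))) <= (\<Sum>i\<in>{..<Suc j} \<union> {j..<j+N}. \<theta>^((i - j) + (j - i)))"
  by (rule sum_mono2) (use \<theta> in auto)
 also have "... <= (\<Sum>i<Suc j. \<theta>^((i - j) + (j - i))) + (\<Sum>i=j..<j+N. \<theta>^((i - j) + (j - i)))"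
  by (subst sum_Un) (use \<theta> in "auto intro!: sum_nonneg")
 also have "(\<Sum>i<Suc j. \<theta>^((i - j) + (j - i))) = (\<Sum>i<Suc j. \<theta>^(Suc j - Suc i))"
  by (rule sum.cong) auto
 also have "... = (\<Sum>k<Suc j. \<theta>^k)" by (rule sum.nat_diff_reindex)
 also have "(\<Sum>i=j..<j+N. \<theta>^((i - j) + (j - i))) = (\<Sum>k<N. \<theta>^k)"
  by (rule sum.reindex_bij_witness[of _ "%k. k + j" "%i. i - j"]) auto
 also have "(\<Sum>k<Suc j. \<theta>^k) + (\<Sum>k<N. \<theta>^k) <= 1/(1 - \<theta>) + 1/(1 - \<theta>)"
  by (intro add_mono geometric_partial)
 finally show ?thesis by simp
qed

lemma gkernel_summable: "summable (%i. \<theta>^((i - j) + (j - i)))"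
 by (rule summableI_nonneg_bounded[OF _ gkernel_sum]) (use \<theta> in auto)

lemma gkernel_suminf: "(\<Sum>i. \<theta>^((i - j) + (j - i))) <= 2/(1 - \<theta>)"
 by (rule suminf_le_const[OF gkernel_summable gkernel_sum])

lemma gkernel_suminf_pos: "0 < (\<Sum>i. \<theta>^((i - j) + (j - i)))"
 by (rule suminf_pos[OF gkernel_summable]) (use \<theta> in auto)

lemma gconv_summable:
 assumes "\<And>i. 0 <= v i" "\<And>i. v i <= V"
 shows "summable (%i. \<theta>^((i - j) + (j - i)) * v i)"
 by (rule summable_comparison_test'[OF summable_mult2[OF gkernel_summable[of j], of V], of 0])
  (use assms \<theta> in "auto intro!: mult_left_mono simp: abs_mult")

lemma gconv_nonneg:
 assumes "\<And>i. 0 <= v i" "\<And>i. v i <= V"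
 shows "0 <= gconv \<theta> v j"
 unfolding gconv_def by (rule suminf_nonneg[OF gconv_summable[OF assms]]) (use assms \<theta> in auto)

lemma gconv_bounded:
 assumes "\<And>i. 0 <= v i" "\<And>i. v i <= V"
 shows "gconv \<theta> v j <= 2/(1 - \<theta>)*V"
proof -
 have V: "0 <= V" using assms[of 0] by linarith
 have "gconv \<theta> v j <= (\<Sum>i. \<theta>^((i - j) + (j - i))*V)"
  unfolding gconv_def
  by (rule suminf_le[OF _ gconv_summable[OF assms] summable_mult2[OF gkernel_summable]]) (use assms \<theta> in "auto intro!: mult_left_mono")
 also have "... = (\<Sum>i. \<theta>^((i - j) + (j - i)))*V" by (rule suminf_mult2[OF gkernel_summable, symmetric])
 also have "... <= 2/(1 - \<theta>)*V" by (intro mult_right_mono gkernel_suminf V)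
 finally show ?thesis .
qed

text \<open>Summing over \<open>j\<close> first: by symmetry of the kernel its columns have the same
  mass bound as its rows.\<close>

lemma gconv_l1:
 assumes v: "\<And>i. 0 <= v i" "summable v"
 shows "summable (gconv \<theta> v)" "suminf (gconv \<theta> v) <= 2/(1 - \<theta>) * suminf v"
proof -
 have vV: "v i <= suminf v" for i using sum_le_suminf[OF v(2), of "{i}"] v(1) by auto
 have p: "(\<Sum>j<N. gconv \<theta> v j) <= 2/(1 - \<theta>) * suminf v" for N
 proof -
  have "(\<Sum>j<N. gconv \<theta> v j) = (\<Sum>i. \<Sum>j<N. \<theta>^((i - j) + (j - i)) * v i)"
   unfolding gconv_def by (rule suminf_sum[symmetric]) (rule gconv_summable[OF v(1) vV])
  also have "... <= (\<Sum>i. 2/(1 - \<theta>) * v i)"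
  proof (rule suminf_le)
   show "(\<Sum>j<N. \<theta>^((i - j) + (j - i)) * v i) <= 2/(1 - \<theta>) * v i" for i
    unfolding sum_distrib_right[symmetric] using gkernel_sum[where j=i and N=N] v(1)[of i]
    by (intro mult_right_mono) (simp_all add: add.commute)
  qed (use v(2) gconv_summable[OF v(1) vV] in "auto intro!: summable_sum summable_mult")
  also have "... = 2/(1 - \<theta>) * suminf v" by (rule suminf_mult[OF v(2)])
  finally show ?thesis .
 qed
 show s: "summable (gconv \<theta> v)"
  by (rule summableI_nonneg_bounded[OF _ p]) (rule gconv_nonneg[OF v(1) vV])
 show "suminf (gconv \<theta> v) <= 2/(1 - \<theta>) * suminf v" by (rule suminf_le_const[OF s p])
qed

lemma summable_sq_bounded:
 fixes v :: "nat => real"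
 assumes v: "\<And>i. 0 <= v i" "summable (%i. (v i)^2)"
 shows "v i <= sqrt (\<Sum>i. (v i)^2)"
proof -
 have "(v i)^2 <= (\<Sum>i. (v i)^2)" using sum_le_suminf[OF v(2), of "{i}"] by auto
 hence "sqrt ((v i)^2) <= sqrt (\<Sum>i. (v i)^2)" by (rule real_sqrt_le_mono)
 thus ?thesis using v(1) by simp
qed

text \<open>Jensen's inequality in each index bounds the square by a convolution of squares, to
  which the \<open>l^1\<close> bound applies.\<close>

lemma gconv_l2:
 assumes v: "\<And>i. 0 <= v i" "summable (%i. (v i)^2)"
 shows "summable (%j. (gconv \<theta> v j)^2)"
proof -
 note vV = summable_sq_bounded[OF v]
 have sq: "(v i)^2 <= (\<Sum>i. (v i)^2)" for i using sum_le_suminf[OF v(2), of "{i}"] by auto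
 have le: "(gconv \<theta> v j)^2 <= 2/(1 - \<theta>)*gconv \<theta> (%i. (v i)^2) j" for j
 proof -
  let ?k = "%i. \<theta>^((i - j) + (j - i))"
  have eq: "v i powr 2 = (v i)^2" for i using v(1)[of i] by (simp add: powr_numeral)
  have "(\<Sum>i. ?k i * v i) powr 2 <= suminf ?k powr (2 - 1)*(\<Sum>i. ?k i * v i powr 2)"
   by (rule power_mean_suminf)
    (use \<theta> v gkernel_summable gkernel_suminf_pos gconv_summable[OF v(1) vV] gconv_summable[OF _ sq] in "auto simp: eq")
  hence "(gconv \<theta> v j)^2 <= suminf ?k*gconv \<theta> (%i. (v i)^2) j"
   using gconv_nonneg[OF v(1) vV, where j = j] gkernel_suminf_pos[of j] by (simp add: gconv_def eq powr_numeral)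
  also have "... <= 2/(1 - \<theta>)*gconv \<theta> (%i. (v i)^2) j"
   by (intro mult_right_mono gkernel_suminf gconv_nonneg[OF _ sq]) simp
  finally show ?thesis .
 qed
 have "summable (%j. 2/(1 - \<theta>)*gconv \<theta> (%i. (v i)^2) j)" by (intro summable_mult gconv_l1(1) v(2)) simp
 thus ?thesis by (rule summable_comparison_test'[of _ 0]) (use le in auto)
qed

lemma gconv_ge_lower:
 assumes "\<And>i. 0 <= v i" "\<And>i. v i <= V"
 shows "(\<Sum>i\<le>j. \<theta>^(j - i) * v i) <= gconv \<theta> v j"
proof -
 have "(\<Sum>i\<le>j. \<theta>^(j - i) * v i) = (\<Sum>i\<le>j. \<theta>^((i - j) + (j - i)) * v i)" by (rule sum.cong) auto
 also have "... <= gconv \<theta> v j"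
  unfolding gconv_def by (rule sum_le_suminf[OF gconv_summable[OF assms]]) (use assms \<theta> in auto)
 finally show ?thesis .
qed

lemma gconv_ge_upper:
 assumes "\<And>i. 0 <= v i" "\<And>i. v i <= V"
 shows "summable (%i. \<theta>^i * v (i + j))" "(\<Sum>i. \<theta>^i * v (i + j)) <= gconv \<theta> v j"
proof -
 let ?F = "%i. \<theta>^((i - j) + (j - i)) * v i"
 have eq: "?F (i + j) = \<theta>^i * v (i + j)" for i by simp
 have s: "summable ?F" by (rule gconv_summable[OF assms])
 hence "summable (%i. ?F (i + j))" by (rule summable_ignore_initial_segment)
 thus "summable (%i. \<theta>^i * v (i + j))" by (simp only: eq)
 have "(\<Sum>i. \<theta>^i * v (i + j)) = (\<Sum>i. ?F (i + j))" by (simp only: eq)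
 also have "... = gconv \<theta> v j - (\<Sum>i<j. ?F i)"
  unfolding gconv_def using suminf_split_initial_segment[OF s, of j] by simp
 also have "... <= gconv \<theta> v j" using assms \<theta> by (auto intro!: sum_nonneg)
 finally show "(\<Sum>i. \<theta>^i * v (i + j)) <= gconv \<theta> v j" .
qed

end

section \<open>Dyadic form of the integral mean estimate\<close>

text \<open>The slower of two decay rates: \<open>2 powr (-(1/p - 1))\<close> from levels below the
  cut and \<open>2 powr (-1/2)\<close> from levels above it, where the latter reflects the exponent
  \<open>p/2\<close>.\<close>

definition mtheta :: "real => real" where
 "mtheta p = max (2 powr (-(1/p - 1))) (2 powr (-1/2))"

lemma mtheta:
 assumes "0 < p" "p < 1"
 shows "0 < mtheta p" "mtheta p < 1" "2 powr (-1/2) <= mtheta p" "2 powr (-(1/p - 1)) <= mtheta p" "1/2 <= mtheta p"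
proof -
 show "2 powr (-1/2) <= mtheta p" "2 powr (-(1/p - 1)) <= mtheta p" by (auto simp: mtheta_def)
 show "0 < mtheta p" by (auto simp: mtheta_def less_max_iff_disj)
 have "2 powr (-(1/p - 1)) < 2 powr 0" using assms by (intro powr_less_mono) auto
 moreover have "2 powr (-1/2) < (2::real) powr 0" by (intro powr_less_mono) auto
 ultimately show "mtheta p < 1" by (simp add: mtheta_def)
 have "(1/2::real) = 2 powr (-1)" by (simp add: powr_minus)
 also have "... <= 2 powr (-1/2)" by (intro powr_mono) auto
 also have "... <= mtheta p" by (auto simp: mtheta_def)
 finally show "1/2 <= mtheta p" .
qed

lemma half_power: "(1/2::real)^n = 2 powr (- real n)"
 by (simp add: powr_minus powr_realpow power_divide inverse_eq_divide)

lemma two_power: "(2::real)^n = 2 powr (real n)"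
 by (simp add: powr_realpow)

text \<open>If \<open>x\<close> lies between \<open>k i\<close> and \<open>k (Suc i)\<close>, the
  summand with index \<open>i\<close> alone already dominates \<open>x\<close>.\<close>

lemma split_low:
 fixes k :: "nat => real"
 assumes "\<And>i. 0 <= k i" "mono k"
 shows "(if x <= k j then x else 0) <= k 0 + (\<Sum>i<j. k (Suc i)*(if k i < x then 1 else 0))"
proof (induction j)
 case (Suc j)
 have nn: "0 <= k 0 + (\<Sum>i<j. k (Suc i)*(if k i < x then 1 else 0))"
  using assms by (auto intro!: add_nonneg_nonneg sum_nonneg)
 show ?case
 proof (cases "x <= k j")
  case True
  hence "x <= k (Suc j)" using assms(2) by (meson monoD le_SucI order_refl order_trans)
  thus ?thesis using Suc True assms(1)[of "Suc j"] by simp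
 next
  case False
  thus ?thesis using nn assms(1)[of "Suc j"] by auto
 qed
qed (use assms in auto)

text \<open>The sequence majorises the decreasing rearrangement of \<open>u\<close> at the arguments
  \<open>(1/2)^i\<close>.\<close>

definition dyadic_level :: "real => (complex => real) => (nat => real) => bool" where
 "dyadic_level p u \<kappa> \<longleftrightarrow> u \<in> borel_measurable \<T> \<and> (\<forall>\<xi>. 0 <= u \<xi>) \<and> mono \<kappa> \<and> (\<forall>i. 0 <= \<kappa> i) \<and>
  (\<forall>i. measure \<T> {\<zeta> \<in> sphere 0 1. \<kappa> i < u \<zeta>} <= (1/2)^i)"

text \<open>For the rearrangement itself these are the dyadic samples of
  \<open>rearrangement f s * s powr (1/p)\<close>, whose boundedness or \<open>q\<close>-summability
  discretises the Lorentz norms.\<close>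

definition wlevel :: "real => (nat => real) => nat => real" where
 "wlevel p \<kappa> i = \<kappa> i*2 powr (- (real i/p))"

text \<open>With \<open>t = 2/p\<close>, the two summands come from the low and the high part of
  \<open>dyadic_mean\<close>.\<close>

definition mean_const :: "real => real" where
 "mean_const p = 2 powr (2/p)*(2 + (2*2) powr (2/p)*(1/(1 - 2 powr (-1/2))) powr (2/p - 1)/mtheta p)"

lemma dyadic_low:
 assumes d: "dyadic_level p u k"
 shows "(MEAN z. (if u z <= k j then u z else 0)) <= (\<Sum>i\<le>j. 2*(k i*(1/2)^i))"
proof -
 have [measurable]: "u \<in> borel_measurable \<T>" and u0: "\<And>x. 0 <= u x" and mk: "mono k" and k0: "\<And>i. 0 <= k i"
  and m: "\<And>i. measure \<T> {z \<in> sphere 0 1. k i < u z} <= (1/2)^i"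
  using d by (auto simp: dyadic_level_def)
 have S: "{z \<in> sphere 0 1. k i < u z} \<in> sets \<T>" for i
 proof -
  have "{z \<in> space \<T>. k i < u z} \<in> sets \<T>" by measurable
  thus ?thesis by simp
 qed
 have ii: "integrable \<T> (%z. if k i < u z then 1 else 0 :: real)"
 and ie: "(MEAN z. (if k i < u z then 1 else 0 :: real)) <= (1/2)^i" for i
 proof -
  have "integrable \<T> (indicat_real {z \<in> sphere 0 1. k i < u z})"
   using S[of i] by (intro integrable_real_indicator) (auto simp: less_top[symmetric])
  moreover have "integrable \<T> (indicat_real {z \<in> sphere 0 1. k i < u z}) \<longleftrightarrow>
    integrable \<T> (%z. if k i < u z then 1 else 0 :: real)"
   by (rule Bochner_Integration.integrable_cong) (auto simp: indicator_def)
  ultimately show "integrable \<T> (%z. if k i < u z then 1 else 0 :: real)" by simp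
  have "(MEAN z. (if k i < u z then 1 else 0 :: real)) = (MEAN z. indicat_real {z \<in> sphere 0 1. k i < u z} z)"
   by (rule Bochner_Integration.integral_cong) (auto simp: indicator_def)
  also have "... = measure \<T> ({z \<in> sphere 0 1. k i < u z} \<inter> space \<T>)" by (rule Bochner_Integration.integral_indicator)
  also have "{z \<in> sphere 0 1. k i < u z} \<inter> space \<T> = {z \<in> sphere 0 1. k i < u z}" by auto
  finally show "(MEAN z. (if k i < u z then 1 else 0 :: real)) <= (1/2)^i" using m[of i] by simp
 qed
 have "(MEAN z. (if u z <= k j then u z else 0)) <=
  (MEAN z. k 0 + (\<Sum>i<j. k (Suc i)*(if k i < u z then 1 else 0)))"
 proof (rule integral_mono)
  show "integrable \<T> (%z. if u z <= k j then u z else 0)"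
   by (rule circle.integrable_const_bound[of _ "k j"]) (use u0 k0 in auto)
  show "integrable \<T> (%z. k 0 + (\<Sum>i<j. k (Suc i)*(if k i < u z then 1 else 0)))"
   by (intro Bochner_Integration.integrable_add Bochner_Integration.integrable_sum integrable_mult_right ii) simp
 qed (rule split_low[OF k0 mk])
 also have "... = k 0 + (MEAN z. (\<Sum>i<j. k (Suc i)*(if k i < u z then 1 else 0)))"
  using circle.prob_space
  by (subst Bochner_Integration.integral_add) (auto intro!: Bochner_Integration.integrable_sum integrable_mult_right ii)
 also have "(MEAN z. (\<Sum>i<j. k (Suc i)*(if k i < u z then 1 else 0))) =
   (\<Sum>i<j. MEAN z. k (Suc i)*(if k i < u z then 1 else 0))"
  by (rule Bochner_Integration.integral_sum) (intro integrable_mult_right ii)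
 also have "k 0 + ... <= 2*(k 0*(1/2)^0) + (\<Sum>i<j. 2*(k (Suc i)*(1/2)^Suc i))"
 proof (intro add_mono sum_mono)
  fix i
  have "(MEAN z. k (Suc i)*(if k i < u z then 1 else 0)) = k (Suc i)*(MEAN z. (if k i < u z then 1 else 0))"
   by (rule integral_mult_right_zero)
  also have "... <= k (Suc i)*(1/2)^i" by (intro mult_left_mono ie k0)
  finally show "(MEAN z. k (Suc i)*(if k i < u z then 1 else 0)) <= 2*(k (Suc i)*(1/2)^Suc i)" by simp
 qed (use k0[of 0] in simp)
 also have "... = (\<Sum>i\<le>j. 2*(k i*(1/2)^i))" by (rule sum.atMost_shift[symmetric])
 finally show ?thesis .
qed

lemma ennreal_le_suminf: "g i <= (\<Sum>i. g i)" for g :: "nat => ennreal"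
 using sum_le_suminf[OF summableI, of "{i}" g] by simp

text \<open>Between the levels \<open>k (i + j)\<close> and \<open>k (i + Suc j)\<close> the measure
  is at most \<open>(1/2)^(i + j)\<close>. Raising to \<open>p/2\<close> instead of \<open>p\<close>
  uses up only half of this decay; the other half is the factor \<open>q^i\<close>, which makes the
  series converge for merely bounded levels.\<close>

lemma dyadic_high:
 assumes d: "dyadic_level p u k" and p: "0 < p" and V: "\<And>i. wlevel p k i <= V"
 defines "q \<equiv> 2 powr (-1/2)"
 shows "integrable \<T> (%x. u x powr (p/2))"
  and "summable (%i. q^i*wlevel p k (i + Suc j) powr (p/2))"
  and "(MEAN z. (if u z <= k j then 0 else u z powr (p/2))) <= 2*q^Suc j*(\<Sum>i. q^i*wlevel p k (i + Suc j) powr (p/2))"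
proof -
 have [measurable]: "u \<in> borel_measurable \<T>" and u0: "\<And>x. 0 <= u x" and mk: "mono k" and k0: "\<And>i. 0 <= k i"
  and m: "\<And>i. measure \<T> {z \<in> sphere 0 1. k i < u z} <= (1/2)^i"
  using d by (auto simp: dyadic_level_def)
 define s where "s = p/2"
 have s: "0 < s" using p by (simp add: s_def)
 have q: "0 < q" "q < 1"
 proof -
  have "2 powr (-1/2) < (2::real) powr 0" by (intro powr_less_mono) auto
  thus "q < 1" by (simp add: q_def)
 qed (simp add: q_def)
 have v0: "0 <= wlevel p k i" for i using k0 by (simp add: wlevel_def)
 have sm: "summable (%i. q^i*wlevel p k (i + Suc j) powr s)" for j
 proof (rule summable_comparison_test'[of "%i. q^i*V powr s" 0])
  show "summable (%i. q^i*V powr s)" using q by (intro summable_mult2 summable_geometric) auto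
  show "norm (q^i*wlevel p k (i + Suc j) powr s) <= q^i*V powr s" for i
   using q s v0 V by (auto simp: abs_mult intro!: mult_left_mono powr_mono2)
 qed
 thus "summable (%i. q^i*wlevel p k (i + Suc j) powr (p/2))" unfolding s_def .
 define T where "T j = 2*q^Suc j*(\<Sum>i. q^i*wlevel p k (i + Suc j) powr s)" for j
 have T0: "0 <= T j" for j unfolding T_def using q by (intro mult_nonneg_nonneg suminf_nonneg[OF sm]) auto
 have S [measurable]: "{z \<in> space \<T>. k i < u z} \<in> sets \<T>" for i by measurable
 have em: "emeasure \<T> {z \<in> space \<T>. k i < u z} <= ennreal ((1/2)^i)" for i
  using m[of i] by (simp add: circle.emeasure_eq_measure ennreal_leI)
 \<comment> \<open>The set above all levels has measure at most \<open>(1/2)^i\<close> for every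
   \<open>i\<close>.\<close>
 have ae: "AE x in \<T>. \<exists>i. u x <= k i"
 proof (rule AE_I[of _ _ "{z \<in> space \<T>. \<forall>i. k i < u z}"])
  show "{z \<in> space \<T>. \<forall>i. k i < u z} \<in> sets \<T>" by measurable
  have le: "measure \<T> {z \<in> space \<T>. \<forall>i. k i < u z} <= (1/2)^i" for i
   using circle.finite_measure_mono[OF _ S[of i], of "{z \<in> space \<T>. \<forall>i. k i < u z}"] m[of i] by force
  have "measure \<T> {z \<in> space \<T>. \<forall>i. k i < u z} <= 0"
   by (rule LIMSEQ_le_const[OF LIMSEQ_realpow_zero[of "1/2"]]) (use le in auto)
  hence "measure \<T> {z \<in> space \<T>. \<forall>i. k i < u z} = 0"
   using measure_nonneg[of \<T> "{z \<in> space \<T>. \<forall>i. k i < u z}"] by linarith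
  thus "emeasure \<T> {z \<in> space \<T>. \<forall>i. k i < u z} = 0"
   by (simp add: circle.emeasure_eq_measure)
 qed (auto simp: not_le)
 have nn: "(NN z. ennreal (if u z <= k j then 0 else u z powr s)) <= ennreal (T j)" for j
 proof -
  have "(NN z. ennreal (if u z <= k j then 0 else u z powr s)) <=
   (NN z. (\<Sum>i. ennreal (k (i + Suc j) powr s)*indicator {z \<in> space \<T>. k (i + j) < u z} z))"
  proof (rule nn_integral_mono_AE)
   have "AE x in \<T>. x \<in> space \<T>" by (rule AE_space)
   with ae show "AE z in \<T>. ennreal (if u z <= k j then 0 else u z powr s) <=
    (\<Sum>i. ennreal (k (i + Suc j) powr s)*indicator {z \<in> space \<T>. k (i + j) < u z} z)"
   proof eventually_elim
    case (elim z)
    show ?case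
    proof (cases "u z <= k j")
     case False
     \<comment> \<open>The first level above \<open>u z\<close>; the term of the series belonging to
       it dominates on its own.\<close>
     define n where "n = (LEAST n. u z <= k n)"
     have n1: "u z <= k n" unfolding n_def by (rule LeastI_ex[OF elim(1)])
     have nj: "j < n"
     proof (rule ccontr)
      assume "\<not> j < n"
      hence "k n <= k j" using mk by (auto intro: monoD)
      thus False using n1 False by linarith
     qed
     define i where "i = n - Suc j"
     have ni: "n = i + Suc j" using nj by (simp add: i_def)
     have n2: "k (i + j) < u z" using not_less_Least[of "i + j" "%n. u z <= k n", folded n_def] ni by simp
     have "ennreal (u z powr s) <= ennreal (k (i + Suc j) powr s)*indicator {z \<in> space \<T>. k (i + j) < u z} z"
      using n1 n2 elim(2) s u0[of z] unfolding ni by (simp add: powr_mono2 ennreal_leI)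
     also have "... <= (\<Sum>i. ennreal (k (i + Suc j) powr s)*indicator {z \<in> space \<T>. k (i + j) < u z} z)"
      by (rule ennreal_le_suminf)
     finally show ?thesis using False by simp
    qed simp
   qed
  qed
  also have "... = (\<Sum>i. \<integral>\<^sup>+z. ennreal (k (i + Suc j) powr s)*indicator {z \<in> space \<T>. k (i + j) < u z} z \<partial>\<T>)"
   by (rule nn_integral_suminf) measurable
  also have "... <= (\<Sum>i. ennreal (2*q^Suc j*(q^i*wlevel p k (i + Suc j) powr s)))"
  proof (intro suminf_le summableI)
   fix i
   have "(NN z. ennreal (k (i + Suc j) powr s)*indicator {z \<in> space \<T>. k (i + j) < u z} z)
    = ennreal (k (i + Suc j) powr s)*emeasure \<T> {z \<in> space \<T>. k (i + j) < u z}"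
    by (rule nn_integral_cmult_indicator) measurable
   also have "... <= ennreal (k (i + Suc j) powr s)*ennreal ((1/2)^(i+j))" by (intro mult_left_mono em) simp
   also have "... = ennreal (k (i + Suc j) powr s*(1/2)^(i+j))" by (simp add: ennreal_mult')
   also have "k (i + Suc j) powr s*(1/2)^(i+j) = 2*q^Suc j*(q^i*wlevel p k (i + Suc j) powr s)"
   proof -
    define n where "n = i + Suc j"
    have "wlevel p k n powr s = k n powr s*(2 powr (- (real n/p))) powr s" unfolding wlevel_def by (rule powr_mult)
    also have "(2 powr (- (real n/p))) powr s = 2 powr (- (real n/2))" using p by (simp add: powr_powr s_def)
    finally have w: "wlevel p k n powr s = k n powr s*2 powr (- (real n/2))" .
    have "q^n = 2 powr (- (real n/2))" unfolding q_def by (simp add: powr_powr flip: powr_realpow)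
    hence "2*q^n*wlevel p k n powr s = k n powr s*(2*(2 powr (- (real n/2))*2 powr (- (real n/2))))" by (simp add: w)
    also have "2 powr (- (real n/2))*2 powr (- (real n/2)) = (2::real) powr (- real n)" by (simp flip: powr_add)
    also have "... = (1/2)^n" by (simp add: half_power)
    also have "2*(1/2::real)^n = (1/2)^(i+j)" by (simp add: n_def)
    finally show ?thesis unfolding n_def by (simp add: power_add mult_ac)
   qed
   finally show "(NN z. ennreal (k (i + Suc j) powr s)*indicator {z \<in> space \<T>. k (i + j) < u z} z)
    <= ennreal (2*q^Suc j*(q^i*wlevel p k (i + Suc j) powr s))" .
  qed
  also have "... = ennreal (T j)"
   unfolding T_def
  proof (rule suminf_ennreal_eq)
   show "0 <= 2*q^Suc j*(q^i*wlevel p k (i + Suc j) powr s)" for i using q by simp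
   show "(%i. 2*q^Suc j*(q^i*wlevel p k (i + Suc j) powr s)) sums (2*q^Suc j*(\<Sum>i. q^i*wlevel p k (i + Suc j) powr s))"
    by (rule sums_mult[OF summable_sums[OF sm]])
  qed
  finally show ?thesis .
 qed
 have "(NN z. ennreal (u z powr s)) <=
  (NN z. ennreal (k 0 powr s) + ennreal (if u z <= k 0 then 0 else u z powr s))"
  by (rule nn_integral_mono) (use u0 s in "auto intro!: ennreal_leI powr_mono2")
 also have "... = ennreal (k 0 powr s) + (NN z. ennreal (if u z <= k 0 then 0 else u z powr s))"
  by (subst nn_integral_add) (auto simp: circle.emeasure_space_1[simplified])
 also have "... <= ennreal (k 0 powr s) + ennreal (T 0)" by (intro add_left_mono nn)
 also have "... < \<infinity>" by (simp add: ennreal_add_eq_top less_top)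
 finally have "(NN z. ennreal (norm (u z powr s))) < \<infinity>" by simp
 hence int: "integrable \<T> (%x. u x powr s)" by (intro integrableI_bounded) measurable
 thus "integrable \<T> (%x. u x powr (p/2))" unfolding s_def .
 have i2: "integrable \<T> (%z. if u z <= k j then 0 else u z powr s)"
  by (rule Bochner_Integration.integrable_bound[OF int]) auto
 have "ennreal (MEAN z. (if u z <= k j then 0 else u z powr s)) <= ennreal (T j)"
  using nn[of j] by (subst nn_integral_eq_integral[OF i2, symmetric]) auto
 hence "(MEAN z. (if u z <= k j then 0 else u z powr s)) <= T j" using T0 by simp
 thus "(MEAN z. (if u z <= k j then 0 else u z powr (p/2))) <= 2*q^Suc j*(\<Sum>i. q^i*wlevel p k (i + Suc j) powr (p/2))"
  unfolding T_def s_def .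
qed

text \<open>At the radius with \<open>1 - rad j = (1/2)^j\<close> the split is made at level
  \<open>k j\<close>, so that the layer sums of both parts are geometric sums around the index
  \<open>j\<close>. The domination \<open>le\<close> presupposes integrability, which
  \<open>dyadic_high\<close> supplies.\<close>

lemma dyadic_mean:
 assumes f: "hol f" and p: "0 < p" "p < 1" and d: "dyadic_level p u k"
  and V: "\<And>i. wlevel p k i <= V"
  and le: "\<And>z. cmod z < 1 ==> integrable \<T> (%x. u x powr (p/2)) ==> cmod (f z) powr (p/2) <= poisson (%x. u x powr (p/2)) z"
 shows "2 powr (- (real j*(1/p - 1)))*(MEAN y. cmod (f (of_real (rad j)*y)))
  <= mean_const p*gconv (mtheta p) (wlevel p k) j"
proof -
 define q where "q = (2::real) powr (-1/2)"
 define t where "t = 2/p"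
 define v where "v = wlevel p k"
 define \<theta> where "\<theta> = mtheta p"
 note \<theta> = mtheta[OF p, folded \<theta>_def q_def]
 have q: "0 < q" "q < 1" using \<theta> by (auto simp: q_def)
 have k0: "\<And>i. 0 <= k i" and um: "u \<in> borel_measurable \<T>" and u0: "\<And>x. 0 <= u x"
  using d by (auto simp: dyadic_level_def)
 have v0: "0 <= v i" for i using k0 by (simp add: wlevel_def v_def)
 have vV: "v i <= V" for i using V by (simp add: v_def)
 have t: "2 < t" using p by (simp add: t_def less_divide_eq)
 note hi1 = dyadic_high(1)[OF d p(1) V]
 note hi2 = dyadic_high(2)[OF d p(1) V, where j = j, folded q_def v_def]
 note hi3 = dyadic_high(3)[OF d p(1) V, where j = j, folded q_def v_def]
 define X where "X = (MEAN y. (if u y <= k j then 0 else u y powr (p/2)))"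
 define A where "A = (MEAN y. (if u y <= k j then u y else 0))"
 define w where "w = (2::real) powr (- (real j*(1/p - 1)))"
 define B where "B = gconv \<theta> v j"
 have X0: "0 <= X" unfolding X_def by (rule integral_nonneg_AE) simp
 have M: "(MEAN y. cmod (f (of_real (rad j)*y))) <= 2 powr t*(A + (2/(1 - rad j)) powr (t - 1)*X powr t)"
  using hardy_mean_split[OF f _ _ u0 hi1 le[OF _ hi1] um k0[of j] rad(1,2)[of j]] p
  by (simp add: t_def A_def X_def)
 have T1: "w*A <= 2*B"
 proof -
  have "w*A <= w*(\<Sum>i\<le>j. 2*(k i*(1/2)^i))"
   unfolding A_def w_def by (intro mult_left_mono dyadic_low[OF d]) simp
  also have "... = 2*(\<Sum>i\<le>j. (2 powr (-(1/p - 1)))^(j - i) * v i)"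
   unfolding sum_distrib_left
  proof (rule sum.cong[OF refl])
   fix i assume "i \<in> {..j}"
   hence i: "i <= j" by simp
   have "k i = v i*2 powr (real i/p)" unfolding v_def wlevel_def by (simp add: mult.assoc flip: powr_add)
   hence "w*(2*(k i*(1/2)^i)) = 2*(v i*(2 powr (- (real j*(1/p - 1)))*2 powr (real i/p)*2 powr (- real i)))"
    by (simp add: w_def half_power)
   also have "2 powr (- (real j*(1/p - 1)))*2 powr (real i/p)*2 powr (- real i) = (2::real) powr (- (real j*(1/p - 1)) + real i/p + - real i)"
    by (simp only: powr_add)
   also have "- (real j*(1/p - 1)) + real i/p + - real i = -(1/p - 1)*real (j - i)"
    using i by (simp add: algebra_simps of_nat_diff)
   also have "2 powr (-(1/p - 1)*real (j - i)) = (2 powr (-(1/p - 1)))^(j - i)"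
    by (simp add: powr_powr[symmetric] powr_realpow)
   finally show "w*(2*(k i*(1/2)^i)) = 2*((2 powr (-(1/p - 1)))^(j - i) * v i)" by simp
  qed
  also have "... <= 2*(\<Sum>i\<le>j. \<theta>^(j - i) * v i)"
   using \<theta>(4) v0 by (intro mult_left_mono sum_mono mult_right_mono power_mono) auto
  also have "... <= 2*B" unfolding B_def by (intro mult_left_mono gconv_ge_lower[OF \<theta>(1,2) v0 vV]) simp
  finally show ?thesis .
 qed
 define G where "G = 1/(1 - q)"
 define S where "S = (\<Sum>i. q^i * v (i + Suc j) powr (p/2))"
 \<comment> \<open>The power \<open>t = 2/p\<close> is passed inside by Jensen's inequality and
   undoes the exponent \<open>p/2\<close> on the levels.\<close>
 have St: "S powr t <= G powr (t - 1)*(B / \<theta>)"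
 proof -
  have pt: "(v i powr (p/2)) powr t = v i" for i using p v0 by (simp add: powr_powr t_def)
  have sq: "suminf (%i. q^i) = G" using q by (simp add: G_def suminf_geometric)
  note up = gconv_ge_upper[where v = v and V = V and j = j, OF \<theta>(1,2) v0 vV]
  have su: "summable (%i. \<theta>^i * v (i + Suc j))" using gconv_ge_upper(1)[where v = v and V = V and j = "Suc j", OF \<theta>(1,2) v0 vV] by simp
  have s2: "summable (%i. q^i * v (i + Suc j))"
   by (rule summable_comparison_test'[OF su, of 0]) (use q \<theta>(3) v0 in "auto simp: abs_mult intro!: mult_right_mono power_mono")
  have "S powr t <= suminf (%i. q^i) powr (t - 1)*(\<Sum>i. q^i*(v (i + Suc j) powr (p/2)) powr t)"
   unfolding S_def
   by (rule power_mean_suminf) (use q t hi2 s2 pt in "auto simp: suminf_geometric")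
  also have "... = G powr (t - 1)*(\<Sum>i. q^i * v (i + Suc j))" by (simp only: sq pt)
  also have "(\<Sum>i. q^i * v (i + Suc j)) <= (\<Sum>i. \<theta>^i * v (i + Suc j))"
   by (rule suminf_le[OF _ s2 su]) (use q \<theta>(3) v0 in "auto intro!: mult_right_mono power_mono")
  also have "... <= B / \<theta>"
  proof -
   have "\<theta>*(\<Sum>i. \<theta>^i * v (i + Suc j)) = (\<Sum>i. \<theta>^Suc i * v (Suc i + j))"
    using suminf_mult[OF su, of \<theta>] by (simp add: mult_ac)
   also have "... = (\<Sum>i. \<theta>^i * v (i + j)) - \<theta>^0 * v (0 + j)" by (rule suminf_split_head[OF up(1)])
   also have "... <= B" using up(2) v0[of j] by (simp add: B_def)
   finally show ?thesis using \<theta>(1) by (simp add: le_divide_eq mult.commute)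
  qed
  finally show ?thesis by (simp add: mult_left_mono)
 qed
 have B0: "0 <= B" unfolding B_def by (rule gconv_nonneg[OF \<theta>(1,2) v0 vV])
 have T2: "w*((2/(1 - rad j)) powr (t - 1)*X powr t) <= (2*2) powr t*G powr (t - 1) / \<theta>*B"
 proof -
  have "X powr t <= (2*q^Suc j*S) powr t"
   using hi3 X0 t unfolding X_def S_def by (intro powr_mono2) auto
  also have "... = (2*q^Suc j) powr t*S powr t" by (rule powr_mult)
  also have "... <= (2*q^Suc j) powr t*(G powr (t - 1)*(B / \<theta>))" by (intro mult_left_mono St) simp
  finally have "w*((2/(1 - rad j)) powr (t - 1)*X powr t) <= w*((2/(1 - rad j)) powr (t - 1)*((2*q^Suc j) powr t*(G powr (t - 1)*(B / \<theta>))))"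
   unfolding w_def by (intro mult_left_mono) auto
  also have "... = (w*((2/(1 - rad j)) powr (t - 1)*(2*q^Suc j) powr t))*(G powr (t - 1)*(B / \<theta>))" by (simp only: mult_ac)
  also have "... <= (2*2) powr t*(G powr (t - 1)*(B / \<theta>))"
  proof (rule mult_right_mono)
   show "w*((2/(1 - rad j)) powr (t - 1)*(2*q^Suc j) powr t) <= (2*2) powr t"
   proof -
    have "2/(1 - rad j) = 2*2^j" by (simp add: rad power_divide)
    hence e1: "2/(1 - rad j) = 2 powr (1 + real j)" by (simp add: powr_add two_power)
    have "q^Suc j = 2 powr (- (1/2)*real (Suc j))" unfolding q_def by (simp only: powr_powr[symmetric] powr_realpow powr_gt_zero) (simp add: powr_realpow)
    hence e2: "2*q^Suc j = 2 powr (1 - (1/2)*real (Suc j))" by (simp add: powr_diff powr_minus_divide)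
    have "w*((2/(1 - rad j)) powr (t - 1)*(2*q^Suc j) powr t) =
      2 powr (- (real j*(1/p - 1)) + ((1 + real j)*(t - 1) + (1 - (1/2)*real (Suc j))*t))"
     unfolding e1 e2 w_def powr_powr by (simp only: powr_add[symmetric])
    \<comment> \<open>All multiples of \<open>j\<close> cancel: the normalising factor balances the
      kernel bound against the decay of the measures.\<close>
    also have "- (real j*(1/p - 1)) + ((1 + real j)*(t - 1) + (1 - (1/2)*real (Suc j))*t) = 3/2*t - 1"
     using p by (simp add: t_def field_simps)
    also have "2 powr (3/2*t - 1) <= 2 powr (2*t)" using t by (intro powr_mono) auto
    also have "... = (2*2) powr t" using powr_powr[of 2 2 t] by simp
    finally show ?thesis .
   qed
  qed (use B0 \<theta>(1) in simp)
  finally show ?thesis by simp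
 qed
 have "w*(MEAN y. cmod (f (of_real (rad j)*y))) <= w*(2 powr t*(A + (2/(1 - rad j)) powr (t - 1)*X powr t))"
  by (intro mult_left_mono M) (simp add: w_def)
 also have "... = 2 powr t*(w*A + w*((2/(1 - rad j)) powr (t - 1)*X powr t))" by (simp add: algebra_simps)
 also have "... <= 2 powr t*(2*B + (2*2) powr t*G powr (t - 1) / \<theta>*B)"
  by (intro mult_left_mono add_mono T1 T2) simp
 also have "... = mean_const p*B" by (simp add: mean_const_def t_def G_def q_def \<theta>_def algebra_simps)
 finally show ?thesis unfolding w_def B_def \<theta>_def v_def .
qed

section \<open>The coefficient class describing the dual\<close>

definition gam :: "nat => nat => real" where
 "gam m n = real (n + 1)*real ((n + m) choose m)"

definition lam_fun :: "nat => (nat => complex) => complex => complex" where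
 "lam_fun m l w = (\<Sum>n. of_real (gam m n)*l n*w^n)"

text \<open>Convergence is demanded explicitly since \<open>suminf\<close> has an arbitrary value on
  a divergent series. The exponent is the growth of the \<open>H^p\<close> size of the kernels in
  \<open>dual_subset_lam_class\<close>.\<close>

definition lam_class :: "nat => real => (nat => complex) set" where
 "lam_class m p = {l. (\<forall>w. cmod w < 1 \<longrightarrow> summable (%n. of_real (gam m n)*l n*w^n)) \<and>
  (\<exists>K. \<forall>w. cmod w < 1 \<longrightarrow> cmod (lam_fun m l w) <= K*(1 - cmod w) powr (1/p - real m - 2))}"

lemma product_summable_disk:
 fixes a b :: "nat => complex"
 assumes a: "\<And>z. cmod z < 1 ==> summable (%n. a n*z^n)"
  and b: "\<And>z. cmod z < 1 ==> summable (%n. b n*z^n)" and z: "cmod z < 1"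
 shows "summable (%n. a n*b n*z^n)"
proof -
 define R where "R = sqrt (cmod z)"
 have R: "0 <= R" "R < 1" "R*R = cmod z" using z by (auto simp: R_def)
 have sa: "summable (%n. cmod (a n)*R^n)" and sb: "summable (%n. cmod (b n)*R^n)"
  using abs_summable_disk[OF a R(1,2)] abs_summable_disk[OF b R(1,2)] by auto
 have "Bseq (%n. cmod (a n)*R^n)" using summable_LIMSEQ_zero[OF sa] convergent_imp_Bseq convergentI by blast
 then obtain M where M: "\<And>n. norm (cmod (a n)*R^n) <= M" unfolding Bseq_def by blast
 show ?thesis
 proof (rule summable_comparison_test'[OF summable_mult[OF sb, of M], of 0])
  fix n
  have "norm (a n*b n*z^n) = (cmod (a n)*R^n)*(cmod (b n)*R^n)"
   using R(3)[symmetric] by (simp add: norm_mult norm_power power_mult_distrib mult_ac)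
  also have "... <= M*(cmod (b n)*R^n)" using M[of n] R by (intro mult_right_mono) (auto simp: abs_mult)
  finally show "norm (a n*b n*z^n) <= M*(cmod (b n)*R^n)" .
 qed
qed

text \<open>On a point of modulus \<open>r*r\<close> the Hadamard product of two power series is the
  convolution of their values on the circle of radius \<open>r\<close>.\<close>

lemma hadamard_bound:
 fixes a :: "nat => complex"
 assumes a: "\<And>z. cmod z < 1 ==> summable (%n. a n*z^n)" and f: "hol f"
  and r: "0 <= r" "r < 1" and z: "cmod z = r*r" and B: "\<And>w. cmod w = r ==> cmod (\<Sum>n. a n*w^n) <= B"
 shows "cmod (\<Sum>n. a n*taylor_seq f n*z^n) <= B*(MEAN x. cmod (f (of_real r*x)))"
proof -
 obtain \<omega> where \<omega>: "cmod \<omega> = 1" "z = of_real (r*r) * \<omega>"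
 proof (cases "r = 0")
  case True thus ?thesis using z by (intro that[of 1]) auto
 next
  case False thus ?thesis using z r by (intro that[of "z/of_real (r*r)"]) (auto simp: norm_divide norm_mult)
 qed
 \<comment> \<open>The conjugated and rotated coefficients make \<open>v\<close>, the conjugate of
   an analytic function, have the moments \<open>a n * \<omega>^n * r^n\<close>, as
   \<open>coeff_integral\<close> computes them.\<close>
 define e where "e n = cnj (a n * \<omega>^n)" for n
 have se: "summable (%n. e n*w^n)" if "cmod w < 1" for w
 proof -
  have "summable (%n. a n*(\<omega>*cnj w)^n)" by (rule a) (use that \<omega> in "simp add: norm_mult")
  hence "(%n. cnj (a n*(\<omega>*cnj w)^n)) sums cnj (\<Sum>n. a n*(\<omega>*cnj w)^n)" by (simp only: sums_cnj summable_sums)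
  hence "summable (%n. cnj (a n*(\<omega>*cnj w)^n))" by (rule sums_summable)
  thus ?thesis by (simp add: e_def power_mult_distrib mult_ac)
 qed
 define E where "E w = (\<Sum>n. e n*w^n)" for w
 have E: "hol E" "taylor_seq E = e" using power_series_disk[OF se] unfolding E_def[abs_def] by auto
 have Ea: "cnj (E (of_real r*x)) = (\<Sum>n. a n*(of_real r * \<omega>*cnj x)^n)" if "cmod x = 1" for x
 proof -
  have "(%n. e n*(of_real r*x)^n) sums E (of_real r*x)"
   unfolding E_def by (rule summable_sums[OF se]) (use that r in "simp add: norm_mult")
  hence "(%n. cnj (e n*(of_real r*x)^n)) sums cnj (E (of_real r*x))" by (simp only: sums_cnj)
  hence "(%n. a n*(of_real r * \<omega>*cnj x)^n) sums cnj (E (of_real r*x))"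
   by (simp add: e_def power_mult_distrib mult_ac)
  thus ?thesis by (simp add: sums_iff)
 qed
 define v where "v x = cnj (E (of_real r*x))" for x
 have cv: "continuous_on (sphere 0 1) v" unfolding v_def by (intro continuous_on_cnj dilate_holomorphic(3)[OF E(1) r])
 have iv: "integrable \<T> v" by (rule circle_integrable[OF cv])
 have vB: "cmod (v x) <= B" if "cmod x = 1" for x
  unfolding v_def Ea[OF that] by (rule B) (use that r \<omega> in "simp add: norm_mult")
 have vn: "(MEAN x. x^n * v x) = a n * \<omega>^n * of_real r^n" for n
 proof -
  have "(MEAN x. x^n * v x) = (MEAN x. cnj (E (of_real r*x)*cnj x^n))"
   by (simp add: v_def mult.commute)
  also have "... = cnj (MEAN x. E (of_real r*x)*cnj x^n)" by (rule Bochner_Integration.integral_cnj)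
  also have "... = a n * \<omega>^n * of_real r^n" unfolding coeff_integral[OF E(1) r] E(2) by (simp add: e_def)
  finally show ?thesis .
 qed
 have "(%n. taylor_seq f n * of_real r^n*(a n * \<omega>^n * of_real r^n)) sums (MEAN x. f (of_real r*x) * v x)"
  using termwise_integral[OF f r iv] by (simp only: vn)
 hence "(%n. a n*taylor_seq f n*z^n) sums (MEAN x. f (of_real r*x) * v x)"
  by (simp add: \<omega>(2) power_mult_distrib mult_ac)
 hence "(\<Sum>n. a n*taylor_seq f n*z^n) = (MEAN x. f (of_real r*x) * v x)" by (simp add: sums_iff)
 also have "cmod ... <= (MEAN x. B*cmod (f (of_real r*x)))"
 proof (rule Bochner_Integration.integral_norm_bound_integral)
  show "integrable \<T> (%x. f (of_real r*x) * v x)"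
   by (rule circle_integrable[OF continuous_on_mult[OF dilate_holomorphic(3)[OF f r] cv]])
  show "integrable \<T> (%x. B*cmod (f (of_real r*x)))"
   by (intro integrable_mult_right circle_integrable continuous_on_norm dilate_holomorphic(3)[OF f r])
  show "cmod (f (of_real r*x) * v x) <= B*cmod (f (of_real r*x))" if "x \<in> space \<T>" for x
   using vB[of x] that by (simp add: norm_mult mult.commute mult_right_mono)
 qed
 finally show ?thesis by simp
qed

lemma beta_binomial:
 assumes m: "1 <= m"
 shows "(LBINT x:{0..1}. x^n*(1 - x)^(m - 1)) = 1/(real m*real ((n + m) choose m))"
proof -
 obtain k where k: "m = Suc k" using m by (cases m) auto
 have c: "continuous_on {0..1} (%x::real. x^n*(1 - x)^(m - 1))" by (intro continuous_intros)
 have si: "set_integrable lborel {0..1} (%x::real. x^n*(1 - x)^(m - 1))"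
  unfolding set_integrable_def by (rule borel_integrable_compact[OF _ c]) simp
 have "((%t::real. t powr (real (Suc n) - 1)*(1 - t) powr (real m - 1)) has_integral Beta (real (Suc n)) (real m)) {0..1}"
  by (rule has_integral_Beta_real) (use m in auto)
 hence "((%t::real. t^n*(1 - t)^(m - 1)) has_integral Beta (real (Suc n)) (real m)) {0..1}"
 proof (rule has_integral_spike_finite[where S = "{0,1}", rotated 2])
  fix t :: real assume "t \<in> {0..1} - {0,1}"
  hence "0 < t" "0 < 1 - t" by auto
  thus "t^n*(1 - t)^(m - 1) = t powr (real (Suc n) - 1)*(1 - t) powr (real m - 1)"
   by (simp add: k powr_realpow)
 qed simp
 hence "(LBINT x:{0..1}. x^n*(1 - x)^(m - 1)) = Beta (real (Suc n)) (real m)"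
  using set_borel_integral_eq_integral(2)[OF si] by (simp add: integral_unique)
 also have "... = fact n*fact k/fact (n + m)"
 proof -
  have "Gamma (real (Suc n)) = fact n" "Gamma (real m) = fact k" "Gamma (real (Suc n) + real m) = fact (n + m)"
   using Gamma_fact[of n, where 'a=real] Gamma_fact[of k, where 'a=real] Gamma_fact[of "n + m", where 'a=real]
   by (simp_all add: k add_ac)
  thus ?thesis by (simp add: Beta_def)
 qed
 also have "... = 1/(real m*real ((n + m) choose m))"
  by (subst binomial_fact) (simp_all add: k)
 finally show ?thesis .
qed

text \<open>By \<open>beta_binomial\<close>, multiplying by \<open>m * (1 - x)^(m - 1)\<close> and
  integrating along the radius divides the \<open>n\<close>-th coefficient by the binomial. The
  pointwise bound \<open>g\<close> is integrated in place of the series.\<close>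

lemma lower_order_bound:
 fixes c :: "nat => complex"
 assumes m: "1 <= m" and s: "\<And>w. cmod w < 1 ==> summable (%n. of_nat ((n + m) choose m)*c n*w^n)"
  and z: "cmod z < 1" and g: "integrable lborel g" "\<And>x. 0 <= g x"
  and le: "\<And>x. 0 <= x ==> x <= 1 ==> (1 - x)^(m - 1)*cmod (\<Sum>n. of_nat ((n + m) choose m)*c n*(of_real x*z)^n) <= g x"
 shows "cmod (\<Sum>n. c n*z^n) <= real m*(LBINT x. g x)"
proof -
 let ?b = "%n. complex_of_nat ((n + m) choose m)"
 define \<phi> where "\<phi> n x = indicator {0..1} x *\<^sub>R (x^n*(1 - x)^(m - 1))" for n and x :: real
 define F where "F n x = (?b n*c n*z^n)*complex_of_real (\<phi> n x)" for n x
 have c\<phi>: "continuous_on {0..1} (%x::real. x^n*(1 - x)^(m - 1))" for n by (intro continuous_intros)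
 have i\<phi>: "integrable lborel (\<phi> n)" for n unfolding \<phi>_def by (rule borel_integrable_compact[OF _ c\<phi>]) simp
 have e\<phi>: "(LBINT x. \<phi> n x) = 1/(real m*real ((n + m) choose m))" for n
  using beta_binomial[OF m, of n] by (simp add: \<phi>_def set_lebesgue_integral_def)
 have \<phi>0: "0 <= \<phi> n x" for n x by (auto simp: \<phi>_def split: split_indicator)
 have \<phi>1: "\<phi> n x <= 1" for n x by (auto simp: \<phi>_def split: split_indicator intro!: mult_le_one power_le_one)
 have iF: "integrable lborel (F n)" for n unfolding F_def using i\<phi> by auto
 have ab: "summable (%n. cmod (?b n*c n)*(cmod z)^n)" by (rule abs_summable_disk[OF s]) (use z in auto)
 have nF: "norm (F n x) = cmod (?b n*c n)*(cmod z)^n * \<phi> n x" for n x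
  using \<phi>0 by (simp add: F_def norm_mult norm_power)
 have "(%n. integral\<^sup>L lborel (F n)) sums (LBINT x. (\<Sum>n. F n x))"
 proof (rule sums_integral[OF iF])
  show "AE x in lborel. summable (%n. norm (F n x))"
   by (rule AE_I2, rule summable_comparison_test'[OF ab, of 0])
    (use \<phi>0 \<phi>1 in "auto simp: nF intro!: mult_left_le")
  have "(LBINT x. norm (F n x)) <= cmod (?b n*c n)*(cmod z)^n*1" for n
   unfolding nF integral_mult_right_zero e\<phi>
   by (intro mult_left_mono) (use m in "auto simp: divide_le_eq_1 Suc_le_eq intro!: mult_ge1_I")
  thus "summable (%n. LBINT x. norm (F n x))"
   by (intro summable_comparison_test'[OF ab, of 0]) simp
 qed
 also have "(%n. integral\<^sup>L lborel (F n)) = (%n. c n*z^n/of_nat m)"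
 proof (rule ext)
  fix n
  have "integral\<^sup>L lborel (F n) = (?b n*c n*z^n) * of_real (LBINT x. \<phi> n x)"
   unfolding F_def integral_mult_right_zero integral_complex_of_real ..
  thus "integral\<^sup>L lborel (F n) = c n*z^n/of_nat m" using m by (simp add: e\<phi>)
 qed
 finally have S: "(%n. c n*z^n/of_nat m) sums (LBINT x. (\<Sum>n. F n x))" .
 have "(%n. of_nat m*(c n*z^n/of_nat m)) sums (of_nat m*(LBINT x. (\<Sum>n. F n x)))" by (rule sums_mult[OF S])
 hence "(\<Sum>n. c n*z^n) = of_nat m*(LBINT x. (\<Sum>n. F n x))" using m by (simp add: sums_iff)
 hence "cmod (\<Sum>n. c n*z^n) = real m*cmod (LBINT x. (\<Sum>n. F n x))" by (simp add: norm_mult)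
 also have "cmod (LBINT x. (\<Sum>n. F n x)) <= (LBINT x. g x)"
 proof (rule Bochner_Integration.integral_norm_bound_integral[OF _ g(1)])
  show "integrable lborel (%x. \<Sum>n. F n x)"
  proof (rule integrable_suminf[OF iF])
   show "AE x in lborel. summable (%n. norm (F n x))"
    by (rule AE_I2, rule summable_comparison_test'[OF ab, of 0])
     (use \<phi>0 \<phi>1 in "auto simp: nF intro!: mult_left_le")
   have "(LBINT x. norm (F n x)) <= cmod (?b n*c n)*(cmod z)^n*1" for n
    unfolding nF integral_mult_right_zero e\<phi>
    by (intro mult_left_mono) (use m in "auto simp: divide_le_eq_1 Suc_le_eq intro!: mult_ge1_I")
   thus "summable (%n. LBINT x. norm (F n x))"
    by (intro summable_comparison_test'[OF ab, of 0]) simp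
  qed
  fix x :: real
  show "cmod (\<Sum>n. F n x) <= g x"
  proof (cases "x \<in> {0..1}")
   case True
   have "cmod (of_real x*z) < 1" using True z mult_right_mono[of x 1 "cmod z"] by (simp add: norm_mult)
   from sums_mult[OF summable_sums[OF s[OF this]], of "of_real ((1 - x)^(m - 1))"]
   have "(%n. F n x) sums (of_real ((1 - x)^(m - 1))*(\<Sum>n. ?b n*c n*(of_real x*z)^n))"
    using True by (simp add: F_def \<phi>_def power_mult_distrib mult_ac)
   hence "cmod (\<Sum>n. F n x) = cmod (of_real ((1 - x)^(m - 1))*(\<Sum>n. ?b n*c n*(of_real x*z)^n))" by (simp only: sums_iff)
   also have "... = (1 - x)^(m - 1)*cmod (\<Sum>n. ?b n*c n*(of_real x*z)^n)"
    using True unfolding norm_mult norm_of_real by simp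
   finally show ?thesis using le[of x] True by simp
  next
   case False
   hence "F n x = 0" for n by (simp add: F_def \<phi>_def)
   thus ?thesis using g(2) by simp
  qed
 qed
 finally show ?thesis using m by (simp add: mult_left_mono)
qed

text \<open>The Hadamard bound at radius \<open>rad i\<close> reaches only points of modulus
  \<open>(rad i)^2\<close>; one extra dyadic step compensates for the square.\<close>

lemma rad_sq_ge: "1 - (1/2)^i <= (rad (Suc i))^2"
proof -
 have "(rad (Suc i))^2 = 1 - (1/2)^i + ((1/2)^Suc i)^2" by (simp add: rad_def power2_eq_square algebra_simps)
 thus ?thesis by simp
qed

lemma rad_sq_le: "(rad i)^2 <= rad i" "(rad i)^2 < 1"
proof -
 show "(rad i)^2 <= rad i" using mult_left_le[of "rad i" "rad i"] rad[of i] by (simp add: power2_eq_square)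
 thus "(rad i)^2 < 1" using rad(2)[of i] by linarith
qed

text \<open>The Hadamard product with the full weight \<open>gam\<close> is bounded on each dyadic
  disk; integrating it along the segment from 0 to \<open>z\<close> removes the binomial part and
  leaves \<open>n + 1\<close>. The dyadic pieces of the segment give a geometric sum in
  \<open>D\<close>.\<close>

lemma deriv_coeff_bound:
 assumes m: "1 <= m" and f: "hol f" and K0: "0 <= K"
  and l: "\<And>w. cmod w < 1 ==> summable (%n. of_real (gam m n)*l n*w^n)"
  and K: "\<And>w. cmod w < 1 ==> cmod (lam_fun m l w) <= K*(1 - cmod w) powr (1/p - real m - 2)"
  and W: "\<And>i. 2 powr (- (real i*(1/p - 1)))*(MEAN u. cmod (f (of_real (rad i)*u))) <= D i"
  and DV: "\<And>i. D i <= V" and \<theta>: "1/2 <= \<theta>" "\<theta> < 1" and z: "cmod z <= (rad J)^2"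
 shows "cmod (\<Sum>n. of_nat (n + 1)*(l n*taylor_seq f n)*z^n) <= 2^J*(real m*4^(m + 1)*K*gconv \<theta> D (J + 2))"
proof -
 define a where "a n = of_real (gam m n)*l n" for n
 define H where "H y = (\<Sum>n. a n*taylor_seq f n*y^n)" for y
 have sa: "summable (%n. a n*w^n)" if "cmod w < 1" for w using l[OF that] by (simp add: a_def)
 have sf: "summable (%n. taylor_seq f n*w^n)" if "cmod w < 1" for w using hol_sums[OF f that] by (simp add: sums_iff)
 have sH: "summable (%n. a n*taylor_seq f n*w^n)" if "cmod w < 1" for w by (rule product_summable_disk[OF sa sf that])
 have hH: "hol H" unfolding H_def by (rule power_series_disk(1)[OF sH])
 have D0: "0 <= D i" for i
  by (rule order_trans[OF _ W[of i]]) (intro mult_nonneg_nonneg integral_nonneg_AE AE_I2, auto)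
 \<comment> \<open>The growth factor of \<open>lam_fun\<close> at \<open>1 - rad i\<close> equals
   \<open>2^(i*(m + 1))\<close> times the normalisation of the means in \<open>D i\<close>.\<close>
 define M where "M i = K*(2^(i*(m + 1))*D i)" for i
 have \<mu>0: "0 <= M i" for i using K0 D0 by (simp add: M_def)
 have circ: "cmod (H y) <= M i" if y: "cmod y = rad i*rad i" for y i
 proof -
  have "cmod (H y) <= K*(1 - rad i) powr (1/p - real m - 2)*(MEAN v. cmod (f (of_real (rad i) * v)))"
   unfolding H_def
  proof (rule hadamard_bound[OF sa f rad(1,2) y])
   show "cmod (\<Sum>n. a n*w^n) <= K*(1 - rad i) powr (1/p - real m - 2)" if "cmod w = rad i" for w
    using K[of w] that rad[of i] by (simp add: lam_fun_def a_def)
  qed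
  also have "(1 - rad i) powr (1/p - real m - 2) = 2^(i*(m + 1))*2 powr (- (real i*(1/p - 1)))"
   unfolding rad half_power two_power powr_powr by (simp add: algebra_simps flip: powr_add)
  also have "K*(2^(i*(m + 1))*2 powr (- (real i*(1/p - 1))))*(MEAN v. cmod (f (of_real (rad i) * v)))
   = K*(2^(i*(m + 1))*(2 powr (- (real i*(1/p - 1)))*(MEAN v. cmod (f (of_real (rad i) * v)))))" by (simp only: mult_ac)
  also have "... <= M i" unfolding M_def by (intro mult_left_mono W K0) simp
  finally show ?thesis .
 qed
 have disk: "cmod (H y) <= M i" if y: "cmod y <= (rad i)^2" for y i
 proof (cases "rad i = 0")
  case True thus ?thesis using circ[of y i] y by simp
 next
  case False
  hence r0: "0 < (rad i)^2" by simp
  show ?thesis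
  proof (rule maximum_modulus_frontier[of H "cball 0 ((rad i)^2)"])
   show "H holomorphic_on interior (cball 0 ((rad i)^2))" by (rule holomorphic_on_subset[OF hH]) (use rad_sq_le(2)[of i] in auto)
   show "continuous_on (closure (cball 0 ((rad i)^2))) H"
    by (rule holomorphic_on_imp_continuous_on, rule holomorphic_on_subset[OF hH]) (use rad_sq_le(2)[of i] in auto)
   show "cmod (H w) <= M i" if "w \<in> frontier (cball 0 ((rad i)^2))" for w
    by (rule circ) (use that r0 in "simp add: frontier_cball power2_eq_square")
  qed (use y in auto)
 qed
 have b_eq: "of_nat ((n + m) choose m)*(of_nat (n + 1)*(l n*taylor_seq f n))*w^n = a n*taylor_seq f n*w^n" for n and w :: complex
  by (simp add: a_def gam_def mult_ac)
 \<comment> \<open>A step function over nested intervals; adding all admissible steps avoids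
   choosing the index measurably.\<close>
 define g where "g x = (\<Sum>i\<le>J+2. ((4*(1/2)^i)^(m - 1)*M i)*indicat_real {1 - 4*(1/2)^i .. 1::real} x)" for x :: real
 have ig: "integrable lborel g" unfolding g_def by (intro Bochner_Integration.integrable_sum integrable_mult_right) (auto intro!: integrable_real_indicator)
 have g0: "0 <= g x" for x unfolding g_def by (intro sum_nonneg mult_nonneg_nonneg \<mu>0) auto
 have z1: "cmod z < 1" using z rad_sq_le(2)[of J] by linarith
 have ptw: "(1 - x)^(m - 1)*cmod (H (of_real x*z)) <= g x" if x: "0 <= x" "x <= 1" for x
 proof -
  \<comment> \<open>Close to the end of the segment the disk containing \<open>z\<close> is used.
    Elsewhere the index follows the size of \<open>1 - x\<close>, increased by one because of the
    squared radius.\<close>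
  have "\<exists>i\<le>J+2. 1 - x <= 4*(1/2)^i \<and> cmod (of_real x*z) <= (rad i)^2"
  proof (cases "1 - x <= (1/2)^J")
   case True
   have "cmod (of_real x*z) <= (rad J)^2" using x z mult_right_mono[of x 1 "cmod z"] by (simp add: norm_mult)
   moreover have "1 - x <= 4*(1/2)^J" using True zero_le_power[of "1/2::real" J] by linarith
   ultimately show ?thesis by (intro exI[of _ J]) auto
  next
   case False
   moreover have "0 < (1/2::real)^J" by simp
   ultimately have "0 < 1 - x" by linarith
   then obtain i where i: "(1/2)^i <= 1 - x" "1 - x <= 2*(1/2)^i" using ex_dyadic[of "1 - x"] x by auto
   have iJ: "i <= J + 1"
   proof (rule ccontr)
    assume "\<not> i <= J + 1"
    hence "(1/2::real)^i <= (1/2)^(J+2)" by (intro power_decreasing) auto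
    hence "1 - x <= (1/2)^J*(1/2)" using i by simp
    thus False using False x by simp
   qed
   have "cmod (of_real x*z) <= x" using x z1 mult_left_mono[of "cmod z" 1 x] by (simp add: norm_mult)
   also have "... <= (rad (Suc i))^2" using i rad_sq_ge[of i] by linarith
   finally show ?thesis using i iJ by (intro exI[of _ "Suc i"]) auto
  qed
  then obtain i where i: "i <= J+2" "1 - x <= 4*(1/2)^i" "cmod (of_real x*z) <= (rad i)^2" by blast
  have "(1 - x)^(m - 1)*cmod (H (of_real x*z)) <= (4*(1/2)^i)^(m - 1)*M i"
   using i x by (intro mult_mono power_mono disk) auto
  also have "... = ((4*(1/2)^i)^(m - 1)*M i)*indicat_real {1 - 4*(1/2)^i .. 1::real} x" using i x by simp
  also have "... <= g x" unfolding g_def by (rule member_le_sum) (use i \<mu>0 in auto)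
  finally show ?thesis .
 qed
 have "cmod (\<Sum>n. of_nat (n + 1)*(l n*taylor_seq f n)*z^n) <= real m*(LBINT x. g x)"
  by (rule lower_order_bound[OF m _ z1 ig g0]) (use sH ptw in "auto simp only: b_eq H_def")
 also have "(LBINT x. g x) = (\<Sum>i\<le>J+2. LBINT x. ((4*(1/2)^i)^(m - 1)*M i)*indicat_real {1 - 4*(1/2)^i .. 1::real} x)"
  unfolding g_def by (intro Bochner_Integration.integral_sum integrable_mult_right) (auto intro!: integrable_real_indicator)
 also have "... = (\<Sum>i\<le>J+2. ((4*(1/2)^i)^(m - 1)*M i)*(4*(1/2)^i))"
  by (intro sum.cong refl) (simp only: integral_mult_right_zero Bochner_Integration.integral_indicator, simp)
 also have "... = (\<Sum>i\<le>J+2. 4^m*K*2^(J + 2)*((1/2)^(J + 2 - i)*D i))"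
 proof (rule sum.cong[OF refl])
  fix i assume i: "i \<in> {..J+2}"
  obtain k where k: "m = Suc k" using m by (cases m) auto
  have "((4*(1/2)^i)^(m - 1)*M i)*(4*(1/2)^i) = (4*(1/2)^i)^m*M i" by (simp add: k)
  also have "... = 4^m*K*(((1/2)^(i*m)*2^(i*m))*2^i*D i)"
   by (simp add: M_def power_mult_distrib power_mult[symmetric] power_add)
  also have "(1/2::real)^(i*m)*2^(i*m) = 1" by (simp flip: power_mult_distrib)
  also have "(2::real)^i = 2^(J + 2)*(1/2)^(J + 2 - i)"
  proof -
   have "(2::real)^(J + 2) = 2^i*2^(J + 2 - i)" using i by (simp flip: power_add)
   thus ?thesis by (simp add: power_divide)
  qed
  finally show "((4*(1/2)^i)^(m - 1)*M i)*(4*(1/2)^i) = 4^m*K*2^(J + 2)*((1/2)^(J + 2 - i)*D i)" by simp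
 qed
 also have "... = 4^m*K*2^(J + 2)*(\<Sum>i\<le>J+2. (1/2)^(J + 2 - i)*D i)" by (rule sum_distrib_left[symmetric])
 also have "... <= 4^m*K*2^(J + 2)*gconv \<theta> D (J + 2)"
 proof (rule mult_left_mono)
  have "(\<Sum>i\<le>J+2. (1/2)^(J + 2 - i)*D i) <= (\<Sum>i\<le>J+2. \<theta>^(J + 2 - i)*D i)"
   using \<theta> D0 by (intro sum_mono mult_right_mono power_mono) auto
  also have "... <= gconv \<theta> D (J + 2)" by (rule gconv_ge_lower[OF _ _ D0 DV]) (use \<theta> in auto)
  finally show "(\<Sum>i\<le>J+2. (1/2)^(J + 2 - i)*D i) <= gconv \<theta> D (J + 2)" .
 qed (use K0 in simp)
 finally have "cmod (\<Sum>n. of_nat (n + 1)*(l n*taylor_seq f n)*z^n) <= real m*(4^m*K*2^(J + 2)*gconv \<theta> D (J + 2))"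
  by (simp add: mult_left_mono)
 also have "... = 2^J*(real m*4^(m + 1)*K*gconv \<theta> D (J + 2))" by simp
 finally show ?thesis .
qed

section \<open>Decreasing rearrangements\<close>

lemma level_set_measurable:
 assumes [measurable]: "g \<in> borel_measurable \<T>"
 shows "{u \<in> sphere 0 1. t < cmod (g u)} \<in> sets \<T>"
proof -
 have "{u \<in> space \<T>. t < cmod (g u)} \<in> sets \<T>" by measurable
 thus ?thesis by simp
qed

lemma distribution_antimono:
 assumes "g \<in> borel_measurable \<T>" "s <= t"
 shows "distribution_fun g t <= distribution_fun g s"
 unfolding distribution_fun_def
 by (rule circle.finite_measure_mono) (use assms level_set_measurable in auto)

lemma distribution_tendsto_0:
 assumes "g \<in> borel_measurable \<T>" "0 < s"
 shows "\<exists>t\<ge>0. distribution_fun g t <= s"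
proof -
 let ?A = "%n::nat. {u \<in> sphere 0 1. real n < cmod (g u)}"
 have "(%n. measure \<T> (?A n)) ----> measure \<T> (\<Inter>n. ?A n)"
  by (rule circle.finite_Lim_measure_decseq) (use level_set_measurable[OF assms(1)] in "auto simp: decseq_def")
 also have "(\<Inter>n. ?A n) = {}"
 proof -
  have "\<exists>n. \<not> real n < cmod (g u)" for u using real_arch_simple[of "cmod (g u)"] by (auto simp: not_less)
  thus ?thesis by blast
 qed
 finally have "\<forall>\<^sub>F n in sequentially. measure \<T> (?A n) < s" using assms(2) by (intro order_tendstoD(2)) auto
 then obtain n where "measure \<T> (?A n) < s" by (auto simp: eventually_sequentially)
 thus ?thesis by (intro exI[of _ "real n"]) (auto simp: distribution_fun_def)
qed

lemma rearrangement_nonneg: "g \<in> borel_measurable \<T> ==> 0 < s ==> 0 <= rearrangement g s"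
 unfolding rearrangement_def using distribution_tendsto_0[of g s] by (intro cInf_greatest) auto

lemma rearrangement_le: "0 <= t ==> distribution_fun g t <= s ==> rearrangement g s <= t"
 unfolding rearrangement_def by (intro cInf_lower bdd_belowI[of _ 0]) auto

lemma rearrangement_antimono:
 assumes "g \<in> borel_measurable \<T>" "0 < s" "s <= t"
 shows "rearrangement g t <= rearrangement g s"
 unfolding rearrangement_def
 by (rule cInf_superset_mono) (use distribution_tendsto_0[OF assms(1,2)] assms(3) in "auto intro!: bdd_belowI[of _ 0]")

text \<open>The infimum is attained: the level sets for \<open>a + 1/Suc n\<close> increase to the
  one for \<open>a\<close>, and measure is continuous from below.\<close>

lemma distribution_rearrangement:
 assumes g: "g \<in> borel_measurable \<T>" and s: "0 < s"
 shows "distribution_fun g (rearrangement g s) <= s"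
proof -
 let ?a = "rearrangement g s"
 let ?A = "%n::nat. {u \<in> sphere 0 1. ?a + 1/Suc n < cmod (g u)}"
 have le: "measure \<T> (?A n) <= s" for n
 proof -
  have ne: "{t. 0 <= t \<and> distribution_fun g t <= s} \<noteq> {}" using distribution_tendsto_0[OF g s] by auto
  have "Inf {t. 0 <= t \<and> distribution_fun g t <= s} < ?a + 1/Suc n" unfolding rearrangement_def[symmetric] by simp
  from cInf_lessD[OF ne this] obtain t where t: "distribution_fun g t <= s" "t < ?a + 1/Suc n" by auto
  have "distribution_fun g (?a + 1/Suc n) <= distribution_fun g t" by (rule distribution_antimono[OF g]) (use t in simp)
  thus ?thesis using t by (simp add: distribution_fun_def)
 qed
 have "(%n. measure \<T> (?A n)) ----> measure \<T> (\<Union>n. ?A n)"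
 proof (rule circle.finite_Lim_measure_incseq)
  show "range ?A \<subseteq> sets \<T>" using level_set_measurable[OF g] by auto
  show "incseq ?A"
  proof (rule incseq_SucI, rule subsetI)
   fix n u assume "u \<in> ?A n"
   moreover have "1/real (Suc (Suc n)) <= 1/real (Suc n)" by (rule divide_left_mono) auto
   ultimately show "u \<in> ?A (Suc n)" by auto
  qed
 qed
 moreover have "(\<Union>n. ?A n) = {u \<in> sphere 0 1. ?a < cmod (g u)}"
 proof (intro equalityI subsetI)
  fix u assume "u \<in> {u \<in> sphere 0 1. ?a < cmod (g u)}"
  moreover then obtain n where "1/real (Suc n) < cmod (g u) - ?a" using nat_approx_posE[of "cmod (g u) - ?a"] by auto
  ultimately show "u \<in> (\<Union>n. ?A n)" by (auto intro!: exI[of _ n] simp: algebra_simps)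
 next
  fix u assume "u \<in> (\<Union>n. ?A n)"
  then obtain n where n: "u \<in> sphere 0 1" "?a + 1/Suc n < cmod (g u)" by auto
  have "0 < 1/real (Suc n)" by simp
  hence "?a < cmod (g u)" using n(2) by linarith
  thus "u \<in> {u \<in> sphere 0 1. ?a < cmod (g u)}" using n(1) by simp
 qed
 ultimately have "(%n. measure \<T> (?A n)) ----> distribution_fun g ?a" by (simp add: distribution_fun_def)
 thus ?thesis by (rule LIMSEQ_le_const2) (use le in blast)
qed

section \<open>Multipliers of the coefficient class: estimate of the derivative\<close>

lemma gconv_cmult:
 assumes "0 < \<theta>" "\<theta> < 1" "\<And>i. 0 <= v i" "\<And>i. v i <= V"
 shows "gconv \<theta> (%i. c * v i) j = c*gconv \<theta> v j"
 unfolding gconv_def using suminf_mult[OF gconv_summable[OF assms], of c j] by (simp add: mult_ac)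

definition mult_fun :: "(nat => complex) => (complex => complex) => complex => complex" where
 "mult_fun l f z = (\<Sum>n. l n*taylor_seq f n*z^n)"

lemma gam_ge_1: "1 <= gam m n"
proof -
 have "1 <= (n + m) choose m" using zero_less_binomial[of m "n + m"] by linarith
 hence "1 <= real ((n + m) choose m)" by linarith
 hence "1*1 <= real (n + 1)*real ((n + m) choose m)" by (intro mult_mono) auto
 thus ?thesis by (simp add: gam_def)
qed

lemma lam_class_summable:
 assumes l: "l \<in> lam_class m p" and w: "cmod w < 1"
 shows "summable (%n. l n*w^n)"
proof -
 have s: "summable (%n. cmod (of_real (gam m n)*l n)*cmod w^n)"
  by (rule abs_summable_disk) (use l w in "auto simp: lam_class_def")
 show ?thesis
 proof (rule summable_comparison_test'[OF s, of 0])
  fix n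
  have "1*(cmod (l n)*cmod w^n) <= gam m n*(cmod (l n)*cmod w^n)"
   by (intro mult_right_mono gam_ge_1) simp
  thus "norm (l n*w^n) <= cmod (of_real (gam m n)*l n)*cmod w^n"
   using gam_ge_1[of m n] by (simp add: norm_mult norm_power)
 qed
qed

lemma mult_fun:
 assumes l: "\<And>w. cmod w < 1 ==> summable (%n. l n*w^n)" and f: "hol f"
 shows "hol (mult_fun l f)" "taylor_seq (mult_fun l f) = (%n. l n*taylor_seq f n)"
  "frac_deriv1 (mult_fun l f) z = (\<Sum>n. of_nat (n + 1)*(l n*taylor_seq f n)*z^n)"
proof -
 have sf: "summable (%n. taylor_seq f n*w^n)" if "cmod w < 1" for w using hol_sums[OF f that] by (simp add: sums_iff)
 note s = product_summable_disk[OF l sf]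
 show "hol (mult_fun l f)" and t: "taylor_seq (mult_fun l f) = (%n. l n*taylor_seq f n)"
  using power_series_disk[OF s] unfolding mult_fun_def[abs_def] by auto
 show "frac_deriv1 (mult_fun l f) z = (\<Sum>n. of_nat (n + 1)*(l n*taylor_seq f n)*z^n)"
  by (simp add: frac_deriv1_def t)
qed

lemma frac_deriv1_holomorphic:
 assumes h: "hol h"
 shows "hol (frac_deriv1 h)" "cmod z < 1 ==> summable (%n. of_nat (n + 1)*taylor_seq h n*z^n)"
  "taylor_seq (frac_deriv1 h) = (%n. of_nat (n + 1)*taylor_seq h n)"
proof -
 have a: "summable (%n. of_nat (n + 1)*w^n)" if "cmod w < 1" for w :: complex
  using geometric_deriv_sums[OF that] by (simp add: sums_iff)
 have b: "summable (%n. taylor_seq h n*w^n)" if "cmod w < 1" for w using hol_sums[OF h that] by (simp add: sums_iff)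
 note s = product_summable_disk[OF a b]
 show "hol (frac_deriv1 h)" "taylor_seq (frac_deriv1 h) = (%n. of_nat (n + 1)*taylor_seq h n)"
  using power_series_disk[OF s] unfolding frac_deriv1_def[abs_def] by auto
 show "cmod z < 1 ==> summable (%n. of_nat (n + 1)*taylor_seq h n*z^n)" by (rule s)
qed

text \<open>Integrability is a premise inside the condition because it depends on the level data,
  which are only supplied later by \<open>dyadic_high\<close>.\<close>

definition poisson_dominated :: "real => (complex => real) => (complex => complex) => bool" where
 "poisson_dominated p u f \<longleftrightarrow> f holomorphic_on ball 0 1 \<and>
  (\<forall>z. cmod z < 1 \<longrightarrow> integrable \<T> (%\<xi>. u \<xi> powr (p/2)) \<longrightarrow> cmod (f z) powr (p/2) <= poisson (%\<xi>. u \<xi> powr (p/2)) z)"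

lemma mean_const_nonneg: "0 < p ==> p < 1 ==> 0 <= mean_const p"
 unfolding mean_const_def using mtheta(1)[of p] by (intro mult_nonneg_nonneg add_nonneg_nonneg divide_nonneg_nonneg) auto

text \<open>One convolution passes from levels to integral means, the other comes from the radial
  integration. The constant depends neither on \<open>f\<close> nor on \<open>V\<close>, so the same
  bound serves all three target spaces.\<close>

lemma lam_deriv_bound:
 assumes l: "l \<in> lam_class m p" and m: "1 <= m" and p: "0 < p" "p < 1"
 obtains C where "0 <= C" "\<And>f u k V J z. poisson_dominated p u f ==> dyadic_level p u k ==> (\<And>i. wlevel p k i <= V) ==>
  cmod z <= (rad J)^2 ==> cmod (frac_deriv1 (mult_fun l f) z) <= 2^J*(C*gconv (mtheta p) (gconv (mtheta p) (wlevel p k)) (J + 2))"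
proof -
 obtain K0 where K0: "\<And>w. cmod w < 1 ==> cmod (lam_fun m l w) <= K0*(1 - cmod w) powr (1/p - real m - 2)"
  using l by (auto simp: lam_class_def)
 define K where "K = max K0 0"
 have K: "0 <= K" "\<And>w. cmod w < 1 ==> cmod (lam_fun m l w) <= K*(1 - cmod w) powr (1/p - real m - 2)"
 proof -
  fix w :: complex assume "cmod w < 1"
  from K0[OF this] show "cmod (lam_fun m l w) <= K*(1 - cmod w) powr (1/p - real m - 2)"
   by (rule order_trans) (auto simp: K_def intro!: mult_right_mono)
 qed (simp add: K_def)
 define C where "C = real m*4^(m + 1)*K*mean_const p"
 note th = mtheta[OF p]
 have C0: "0 <= C" using K mean_const_nonneg[OF p] by (simp add: C_def)
 show ?thesis
 proof (rule that[OF C0])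
  fix f u k V J z
  assume pd: "poisson_dominated p u f" and d: "dyadic_level p u k" and V: "\<And>i. wlevel p k i <= V" and z: "cmod z <= (rad J)^2"
  have f: "hol f" using pd by (simp add: poisson_dominated_def)
  have v0: "0 <= wlevel p k i" for i using d by (simp add: wlevel_def dyadic_level_def)
  define D where "D i = mean_const p*gconv (mtheta p) (wlevel p k) i" for i
  have gn: "0 <= gconv (mtheta p) (wlevel p k) i" and gb: "gconv (mtheta p) (wlevel p k) i <= 2/(1 - mtheta p)*V" for i
   by (rule gconv_nonneg[OF th(1,2) v0 V], rule gconv_bounded[OF th(1,2) v0 V])
  have DV: "D i <= mean_const p*(2/(1 - mtheta p)*V)" for i
   unfolding D_def by (intro mult_left_mono gb mean_const_nonneg p)
  have "cmod (\<Sum>n. of_nat (n + 1)*(l n*taylor_seq f n)*z^n) <= 2^J*(real m*4^(m + 1)*K*gconv (mtheta p) D (J + 2))"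
  proof (rule deriv_coeff_bound[OF m f K(1) _ K(2) _ DV th(5,2) z])
   show "summable (%n. of_real (gam m n)*l n*w^n)" if "cmod w < 1" for w using l that by (auto simp: lam_class_def)
   show "2 powr (- (real i*(1/p - 1)))*(MEAN y. cmod (f (of_real (rad i)*y))) <= D i" for i
    unfolding D_def by (rule dyadic_mean[OF f p d V]) (use pd in "simp add: poisson_dominated_def")
  qed
  also have "gconv (mtheta p) D (J + 2) = mean_const p*gconv (mtheta p) (gconv (mtheta p) (wlevel p k)) (J + 2)"
   unfolding D_def[abs_def] by (rule gconv_cmult[OF th(1,2) gn gb])
  finally have X: "cmod (\<Sum>n. of_nat (n + 1)*(l n*taylor_seq f n)*z^n) <=
   2^J*(real m*4^(m + 1)*K*(mean_const p*gconv (mtheta p) (gconv (mtheta p) (wlevel p k)) (J + 2)))" .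
  have e: "frac_deriv1 (mult_fun l f) z = (\<Sum>n. of_nat (n + 1)*(l n*taylor_seq f n)*z^n)"
   by (rule mult_fun(3)[OF lam_class_summable[OF l] f])
  show "cmod (frac_deriv1 (mult_fun l f) z) <= 2^J*(C*gconv (mtheta p) (gconv (mtheta p) (wlevel p k)) (J + 2))"
   using X unfolding e C_def by (simp only: mult.assoc)
 qed
qed

lemma smirnov_holomorphic: "f \<in> smirnov ==> f holomorphic_on ball 0 1"
 by (auto simp: smirnov_def nevanlinna_def H_disk_def)

text \<open>Replacing the modulus by its maximum with 1 shifts the normalised levels by the
  geometric term \<open>(2 powr (-1/p))^i\<close> only.\<close>

lemma smirnov_dyadic:
 assumes f: "f \<in> smirnov" and p: "0 < p"
 defines "u \<equiv> %x. max 1 (cmod (boundary_fun f x))" and "k \<equiv> %i. max 1 (rearrangement (boundary_fun f) ((1/2)^i))"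
 shows "poisson_dominated p u f" "dyadic_level p u k"
  "wlevel p k i <= (2 powr (-1/p))^i + rearrangement (boundary_fun f) ((1/2)^i)*((1/2)^i) powr (1/p)"
proof -
 note h = smirnov_holomorphic[OF f]
 note [measurable] = measurable_boundary_fun[OF h]
 note mb = measurable_boundary_fun[OF h]
 show "poisson_dominated p u f" unfolding poisson_dominated_def u_def
  using h smirnov_powr[OF f _ _ ] p by simp
 show "dyadic_level p u k"
  unfolding dyadic_level_def
 proof (intro conjI allI)
  show "u \<in> borel_measurable \<T>" unfolding u_def by measurable
  show "0 <= u x" for x by (simp add: u_def max_def)
  show "0 <= k i" for i by (simp add: k_def max_def)
  show "mono k"
  proof (rule monoI)
   fix i j :: nat assume ij: "i <= j"
   have "rearrangement (boundary_fun f) ((1/2)^i) <= rearrangement (boundary_fun f) ((1/2)^j)"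
    by (rule rearrangement_antimono[OF mb]) (use ij in "auto intro!: power_decreasing")
   thus "k i <= k j" by (auto simp: k_def max_def)
  qed
  fix i
  have "measure \<T> {z \<in> sphere 0 1. k i < u z} <= distribution_fun (boundary_fun f) (rearrangement (boundary_fun f) ((1/2)^i))"
   unfolding distribution_fun_def
   by (rule circle.finite_measure_mono) (use level_set_measurable[OF mb] in "auto simp: k_def u_def")
  also have "... <= (1/2)^i" by (rule distribution_rearrangement[OF mb]) simp
  finally show "measure \<T> {z \<in> sphere 0 1. k i < u z} <= (1/2)^i" .
 qed
 have r0: "0 <= rearrangement (boundary_fun f) ((1/2)^i)" by (rule rearrangement_nonneg[OF mb]) simp
 have e: "2 powr (- (real i/p)) = ((1/2::real)^i) powr (1/p)" by (simp add: half_power powr_powr)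
 have e2: "2 powr (- (real i/p)) = (2 powr (-1/p))^i" by (simp add: powr_powr flip: powr_realpow)
 have "wlevel p k i <= (1 + rearrangement (boundary_fun f) ((1/2)^i))*2 powr (- (real i/p))"
  unfolding wlevel_def k_def using r0 by (intro mult_right_mono) auto
 also have "... = 2 powr (- (real i/p)) + rearrangement (boundary_fun f) ((1/2)^i)*2 powr (- (real i/p))" by (simp add: algebra_simps)
 finally show "wlevel p k i <= (2 powr (-1/p))^i + rearrangement (boundary_fun f) ((1/2)^i)*((1/2)^i) powr (1/p)"
  by (simp only: e2[symmetric]) (simp only: e)
qed

lemma two_powr_lt_1: "0 < p ==> 2 powr (-1/p) < (1::real)"
 using powr_less_mono[of "-1/p" 0 2] by simp

lemma lam_class_bloch:
 assumes l: "l \<in> lam_class m p" and m: "1 <= m" and p: "0 < p" "p < 1"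
 shows "l \<in> multipliers (seq_space (hardy_lorentz p \<infinity>)) (seq_space bloch)"
 unfolding multipliers_def
proof (intro CollectI ballI)
 fix w assume "w \<in> seq_space (hardy_lorentz p \<infinity>)"
 then obtain f where f: "f \<in> hardy_lorentz p \<infinity>" "w = taylor_seq f" by (auto simp: seq_space_def)
 have fs: "f \<in> smirnov" using f by (simp add: hardy_lorentz_def)
 note h = smirnov_holomorphic[OF fs]
 have "(SUP s\<in>{0<..}. ennreal (rearrangement (boundary_fun f) s * s powr (1/p))) < \<infinity>"
  using f by (simp add: hardy_lorentz_def lorentz_norm_def)
 then obtain N where N: "0 <= N" "(SUP s\<in>{0<..}. ennreal (rearrangement (boundary_fun f) s * s powr (1/p))) = ennreal N"
  by (cases "SUP s\<in>{0<..}. ennreal (rearrangement (boundary_fun f) s * s powr (1/p))") auto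
 have rN: "rearrangement (boundary_fun f) s * s powr (1/p) <= N" if "0 < s" for s
 proof -
  have "ennreal (rearrangement (boundary_fun f) s * s powr (1/p)) <= ennreal N"
   unfolding N(2)[symmetric] by (rule SUP_upper) (use that in simp)
  thus ?thesis using N(1) by simp
 qed
 note sd = smirnov_dyadic[OF fs p(1)]
 define v where "v = wlevel p (%i. max 1 (rearrangement (boundary_fun f) ((1/2)^i)))"
 have V: "v i <= 1 + N" for i
 proof -
  have "(2 powr (-1/p))^i <= (1::real)" using two_powr_lt_1[OF p(1)] by (intro power_le_one) auto
  thus ?thesis using sd(3)[of i] rN[of "(1/2)^i"] unfolding v_def by simp
 qed
 have v0: "0 <= v i" for i by (simp add: v_def wlevel_def max_def)
 obtain C where C: "0 <= C" "\<And>f u K V J z. poisson_dominated p u f ==> dyadic_level p u K ==> (\<And>i. wlevel p K i <= V) ==>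
  cmod z <= (rad J)^2 ==> cmod (frac_deriv1 (mult_fun l f) z) <= 2^J*(C*gconv (mtheta p) (gconv (mtheta p) (wlevel p K)) (J + 2))"
  using lam_deriv_bound[OF l m p] by blast
 note th = mtheta[OF p]
 define B where "B = 2/(1 - mtheta p)*(2/(1 - mtheta p)*(1 + N))"
 have gB: "gconv (mtheta p) (gconv (mtheta p) v) j <= B" for j
  unfolding B_def by (intro gconv_bounded th gconv_nonneg[OF th(1,2) v0 V] gconv_bounded[OF th(1,2) v0 V])
 have "(1 - cmod z)*cmod (frac_deriv1 (mult_fun l f) z) <= 4*(C*B)" if z: "z \<in> ball 0 1" for z
 proof -
  have z1: "0 < 1 - cmod z" "1 - cmod z <= 1" using z by auto
  obtain k where k: "(1/2)^k <= 1 - cmod z" "1 - cmod z <= 2*(1/2)^k" using ex_dyadic[OF z1] by blast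
  have "cmod z <= (rad (Suc k))^2" using k rad_sq_ge[of k] by linarith
  from C(2)[OF sd(1,2) V[unfolded v_def] this]
  have "cmod (frac_deriv1 (mult_fun l f) z) <= 2^Suc k*(C*gconv (mtheta p) (gconv (mtheta p) v) (Suc k + 2))" by (simp only: v_def)
  also have "... <= 2^Suc k*(C*B)" by (intro mult_left_mono gB C) simp
  finally have "(1 - cmod z)*cmod (frac_deriv1 (mult_fun l f) z) <= (2*(1/2)^k)*(2^Suc k*(C*B))"
   using k z1 by (intro mult_mono) auto
  also have "... = 4*(C*B)" by (simp add: power_divide)
  finally show ?thesis .
 qed
 hence "bdd_above ((%z. (1 - cmod z)*cmod (frac_deriv1 (mult_fun l f) z)) ` ball 0 1)" by (intro bdd_aboveI2) auto
 hence "mult_fun l f \<in> bloch" using mult_fun(1)[OF lam_class_summable[OF l] h] by (simp add: bloch_def H_disk_def)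
 moreover have "(%n. l n*w n) = taylor_seq (mult_fun l f)"
  by (simp only: f(2) mult_fun(2)[OF lam_class_summable[OF l] h])
 ultimately show "(%n. l n*w n) \<in> seq_space bloch" unfolding seq_space_def by (metis imageI)
qed

section \<open>The coefficient class is contained in the dual\<close>

lemma rearrangement_1: "rearrangement g 1 = 0"
proof -
 have "rearrangement g 1 <= 0"
  by (rule rearrangement_le) (simp_all add: distribution_fun_def)
 moreover have "0 <= rearrangement g 1"
  unfolding rearrangement_def
  by (rule cInf_greatest) (auto simp: distribution_fun_def intro!: exI[of _ 0])
 ultimately show ?thesis by simp
qed

text \<open>Every nonnegative level below the rearrangement is exceeded on a set of measure larger
  than \<open>s\<close>; continuity from above passes to the closed level set.\<close>

lemma rearrangement_level_ge:
 assumes g: "g \<in> borel_measurable \<T>" and s: "0 < s" and pos: "0 < rearrangement g s"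
 shows "s <= measure \<T> {u \<in> space \<T>. rearrangement g s <= cmod (g u)}"
proof -
 let ?a = "rearrangement g s"
 let ?A = "%n::nat. {u \<in> sphere 0 1. ?a - ?a/Suc n < cmod (g u)}"
 have ge: "s <= measure \<T> (?A n)" for n
 proof (rule ccontr)
  assume "\<not> s <= measure \<T> (?A n)"
  hence "distribution_fun g (?a - ?a/Suc n) <= s" by (simp add: distribution_fun_def)
  moreover have "0 <= ?a - ?a/Suc n" using pos by (simp add: field_simps)
  ultimately have "?a <= ?a - ?a/Suc n" by (intro rearrangement_le)
  moreover have "0 < ?a/Suc n" using pos by simp
  ultimately show False by linarith
 qed
 have "(%n. measure \<T> (?A n)) ----> measure \<T> (\<Inter>n. ?A n)"
 proof (rule circle.finite_Lim_measure_decseq)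
  show "range ?A \<subseteq> sets \<T>" using level_set_measurable[OF g] by auto
  show "decseq ?A"
  proof (rule decseq_SucI, rule subsetI)
   fix n u assume "u \<in> ?A (Suc n)"
   moreover have "?a/real (Suc (Suc n)) <= ?a/real (Suc n)" by (rule divide_left_mono) (use pos in auto)
   ultimately show "u \<in> ?A n" by auto
  qed
 qed
 hence "s <= measure \<T> (\<Inter>n. ?A n)" by (rule LIMSEQ_le_const) (use ge in blast)
 also have "(\<Inter>n. ?A n) = {u \<in> space \<T>. ?a <= cmod (g u)}"
 proof (intro equalityI subsetI)
  fix u assume z: "u \<in> (\<Inter>n. ?A n)"
  have "(%n. ?a - ?a/real (Suc n)) ----> ?a - 0"
   by (intro tendsto_intros LIMSEQ_Suc[OF lim_const_over_n])
  hence "?a - 0 <= cmod (g u)" by (rule LIMSEQ_le_const2) (use z in "auto intro: less_imp_le")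
  thus "u \<in> {u \<in> space \<T>. ?a <= cmod (g u)}" using z by auto
 next
  fix u assume z: "u \<in> {u \<in> space \<T>. ?a <= cmod (g u)}"
  have "?a - ?a/real (Suc n) < ?a" for n using pos by simp
  hence "?a - ?a/real (Suc n) < cmod (g u)" for n using z by (blast intro: order_less_le_trans)
  thus "u \<in> (\<Inter>n. ?A n)" using z by simp
 qed
 finally show ?thesis .
qed

text \<open>A discrete layer-cake argument: Abel summation in the increments of \<open>a\<close>,
  which starts at 0 because the whole circle has measure 1, loses a factor 2.\<close>

lemma rearrangement_powr_sum:
 assumes g: "g \<in> borel_measurable \<T>" and p: "0 < p"
  and int: "integrable \<T> (%u. cmod (g u) powr p)"
 shows "(\<Sum>i<N. rearrangement g ((1/2)^i) powr p*(1/2)^i) <= 2*(MEAN u. cmod (g u) powr p)"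
proof -
 note [measurable] = g
 define k where "k i = rearrangement g ((1/2)^i)" for i
 define a where "a i = k i powr p" for i
 define e where "e i u = (if k i <= cmod (g u) then 1 else 0 :: real)" for i u
 have k0: "0 <= k i" for i unfolding k_def by (rule rearrangement_nonneg[OF g]) simp
 have ks: "k i <= k (Suc i)" for i unfolding k_def by (rule rearrangement_antimono[OF g]) auto
 have as: "a i <= a (Suc i)" for i unfolding a_def using ks k0 p by (intro powr_mono2) auto
 have a0: "a 0 = 0" by (simp add: a_def k_def rearrangement_1)
 have ie: "integrable \<T> (e i)" for i
  unfolding e_def by (rule circle.integrable_const_bound[of _ 1]) auto
 have le: "(MEAN u. e i u) = measure \<T> {u \<in> space \<T>. k i <= cmod (g u)}" for i
 proof -
  have "(MEAN u. e i u) = (MEAN u. indicat_real {u \<in> space \<T>. k i <= cmod (g u)} u)"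
   by (rule Bochner_Integration.integral_cong) (auto simp: indicator_def e_def)
  also have "... = measure \<T> ({u \<in> space \<T>. k i <= cmod (g u)} \<inter> space \<T>)"
   by (rule Bochner_Integration.integral_indicator)
  also have "{u \<in> space \<T>. k i <= cmod (g u)} \<inter> space \<T> = {u \<in> space \<T>. k i <= cmod (g u)}" by blast
  finally show ?thesis .
 qed
 have step: "(a (Suc i) - a i)*(1/2)^Suc i <= (a (Suc i) - a i)*(MEAN u. e (Suc i) u)" for i
 proof (cases "k (Suc i) = 0")
  case True
  hence "k i = 0" using ks[of i] k0[of i] by simp
  thus ?thesis using True by (simp add: a_def)
 next
  case False
  hence "0 < rearrangement g ((1/2)^Suc i)" using k0[of "Suc i"] by (simp add: k_def)
  from rearrangement_level_ge[OF g _ this] have "(1/2)^Suc i <= (MEAN u. e (Suc i) u)"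
   unfolding le k_def by simp
  thus ?thesis using as[of i] by (intro mult_left_mono) auto
 qed
 \<comment> \<open>The increments up to the last level not exceeding \<open>cmod (g u)\<close>
   telescope. The second bound is carried along so that the induction step can use it at a level
   that is reached.\<close>
 have pt: "(\<Sum>i<N. (a (Suc i) - a i)*e (Suc i) u) <= cmod (g u) powr p \<and> (\<Sum>i<N. (a (Suc i) - a i)*e (Suc i) u) <= a N" for u
 proof (induction N)
  case 0 thus ?case by (simp add: a0)
 next
  case (Suc N)
  show ?case
  proof (cases "k (Suc N) <= cmod (g u)")
   case True
   hence "a (Suc N) <= cmod (g u) powr p" unfolding a_def using k0 p by (intro powr_mono2) auto
   thus ?thesis using Suc True by (simp add: e_def)
  next
   case False
   thus ?thesis using Suc as[of N] by (simp add: e_def)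
  qed
 qed
 have abel: "(\<Sum>i<N. (a (Suc i) - a i)*(1/2)^Suc i) = (\<Sum>i<N. a i*(1/2)^i)/2 + a N*(1/2)^N"
  by (induction N) (simp_all add: a0 field_simps)
 have "(\<Sum>i<N. a i*(1/2)^i)/2 <= (\<Sum>i<N. (a (Suc i) - a i)*(1/2)^Suc i)"
  unfolding abel by (simp add: a_def)
 also have "... <= (\<Sum>i<N. (a (Suc i) - a i)*(MEAN u. e (Suc i) u))" by (rule sum_mono[OF step])
 also have "... = (MEAN u. (\<Sum>i<N. (a (Suc i) - a i)*e (Suc i) u))"
 proof -
  have "(MEAN u. (\<Sum>i<N. (a (Suc i) - a i)*e (Suc i) u)) = (\<Sum>i<N. MEAN u. (a (Suc i) - a i)*e (Suc i) u)"
   by (rule Bochner_Integration.integral_sum) (intro integrable_mult_right ie)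
  thus ?thesis by (simp only: integral_mult_right_zero)
 qed
 also have "... <= (MEAN u. cmod (g u) powr p)"
  by (rule integral_mono[OF _ int]) (use pt in "auto intro!: Bochner_Integration.integrable_sum integrable_mult_right ie")
 finally show ?thesis by (simp add: a_def k_def)
qed

lemma measurable_dyadic:
 assumes g: "g \<in> borel_measurable \<T>"
 shows "dyadic_level p (%x. cmod (g x)) (%i. rearrangement g ((1/2)^i))"
 unfolding dyadic_level_def
proof (intro conjI allI)
 note [measurable] = g
 show "(%x. cmod (g x)) \<in> borel_measurable \<T>" by measurable
 show "0 <= rearrangement g ((1/2)^i)" for i by (rule rearrangement_nonneg[OF g]) simp
 show "mono (%i. rearrangement g ((1/2)^i))"
  by (rule monoI, rule rearrangement_antimono[OF g]) (auto intro!: power_decreasing)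
 show "measure \<T> {u \<in> sphere 0 1. rearrangement g ((1/2)^i) < cmod (g u)} <= (1/2)^i" for i
  using distribution_rearrangement[OF g, of "(1/2)^i"] by (simp add: distribution_fun_def)
qed simp

text \<open>Each term of the \<open>p\<close>-sum is at most \<open>S\<close>, so
  \<open>v = v powr p * v powr (1 - p) <= v powr p * S powr (1/p - 1)\<close>.\<close>

lemma summable_lt_one:
 fixes v :: "nat => real"
 assumes p: "0 < p" "p < 1" and v: "\<And>i. 0 <= v i" and s: "\<And>N. (\<Sum>i<N. v i powr p) <= S"
 shows "summable v" "suminf v <= S powr (1/p)"
proof -
 have S0: "0 <= S" using s[of 0] by simp
 have vp: "v i powr p <= S" for i
 proof -
  have "v i powr p <= (\<Sum>i<Suc i. v i powr p)" by (rule member_le_sum) auto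
  thus ?thesis using s[of "Suc i"] by linarith
 qed
 have le: "v i <= v i powr p*S powr (1/p - 1)" for i
 proof (cases "v i = 0")
  case False
  hence vi: "0 < v i" using v[of i] by simp
  have "(v i powr p) powr (1/p - 1) <= S powr (1/p - 1)" using vp p by (intro powr_mono2) (auto simp: field_simps)
  moreover have "(v i powr p) powr (1/p - 1) = v i powr (1 - p)" using p by (simp add: powr_powr algebra_simps)
  ultimately have "v i powr p * v i powr (1 - p) <= v i powr p*S powr (1/p - 1)" by (intro mult_left_mono) auto
  thus ?thesis using vi by (simp flip: powr_add)
 qed simp
 have part: "(\<Sum>i<N. v i) <= S powr (1/p)" for N
 proof -
  have "(\<Sum>i<N. v i) <= (\<Sum>i<N. v i powr p)*S powr (1/p - 1)" unfolding sum_distrib_right by (rule sum_mono[OF le])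
  also have "... <= S*S powr (1/p - 1)" by (intro mult_right_mono s) simp
  also have "... = S powr (1/p)" using S0 p by (cases "S = 0") (auto simp: powr_diff)
  finally show ?thesis .
 qed
 show "summable v" by (rule summableI_nonneg_bounded[OF v part])
 thus "suminf v <= S powr (1/p)" by (rule suminf_le_const[OF _ part])
qed

lemma hardyD:
 assumes "f \<in> hardy p"
 shows "hol f" "bdd_above (hardy_mean p f ` {0..<1})"
  "0 <= r ==> r < 1 ==> hardy_mean p f r <= (SUP r\<in>{0..<1}. hardy_mean p f r)"
  "0 <= (SUP r\<in>{0..<1}. hardy_mean p f r)"
proof -
 show "hol f" and b: "bdd_above (hardy_mean p f ` {0..<1})" using assms by (auto simp: hardy_def H_disk_def)
 show *: "hardy_mean p f r <= (SUP r\<in>{0..<1}. hardy_mean p f r)" if "0 <= r" "r < 1" for r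
  by (rule cSUP_upper[OF _ b]) (use that in auto)
 have "0 <= hardy_mean p f 0" unfolding hardy_mean_def by (rule integral_nonneg_AE) auto
 thus "0 <= (SUP r\<in>{0..<1}. hardy_mean p f r)" using *[of 0] by simp
qed

lemma dilate_taylor:
 assumes h: "hol h" and r: "0 <= r" "r < 1"
 shows "taylor_seq (%z. h (of_real r*z)) = (%n. taylor_seq h n * of_real r^n)"
proof (rule taylor_seq_unique)
 fix z :: complex assume z: "cmod z < 1"
 have "cmod (of_real r*z) < 1" using z r mult_right_mono[of r 1 "cmod z"] by (simp add: norm_mult)
 from hol_sums[OF h this] show "(%n. taylor_seq h n * of_real r^n*z^n) sums h (of_real r*z)"
  by (simp add: power_mult_distrib mult_ac)
qed

text \<open>The part of the radius at distance about \<open>(1/2)^k\<close> from 1 has length of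
  that order and cancels the growth \<open>2^J\<close>; summability of \<open>B\<close> is all that
  remains.\<close>

lemma sum_deriv_integral:
 fixes H :: "complex => complex"
 assumes B: "\<And>j. 0 <= B j" "summable B"
  and le: "\<And>J z. cmod z <= (rad J)^2 ==> cmod (H z) <= 2^J*B J"
 shows "(\<integral>\<^sup>+y. indicator {0..<1} y*ennreal (cmod (H (of_real y))) \<partial>lborel) <= ennreal (4 * suminf B)"
proof -
 have sB: "summable (%k. B (Suc k))" using B(2) by (simp add: summable_Suc_iff)
 have "(\<integral>\<^sup>+y. indicator {0..<1} y*ennreal (cmod (H (of_real y))) \<partial>lborel) <=
  (\<integral>\<^sup>+y. (\<Sum>k. ennreal (2^Suc k*B (Suc k))*indicator {1 - 2*(1/2::real)^k .. 1} y) \<partial>lborel)"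
 proof (rule nn_integral_mono)
  fix y :: real
  show "indicator {0..<1} y*ennreal (cmod (H (of_real y))) <= (\<Sum>k. ennreal (2^Suc k*B (Suc k))*indicator {1 - 2*(1/2::real)^k .. 1} y)"
  proof (cases "y \<in> {0..<1}")
   case True
   then obtain k where k: "(1/2)^k <= 1 - y" "1 - y <= 2*(1/2)^k" using ex_dyadic[of "1 - y"] by auto
   have "cmod (of_real y) <= (rad (Suc k))^2" using True k rad_sq_ge[of k] by simp
   from le[OF this] have "ennreal (cmod (H (of_real y))) <= ennreal (2^Suc k*B (Suc k))*indicator {1 - 2*(1/2::real)^k .. 1} y"
    using k True by (simp add: ennreal_leI)
   also have "... <= (\<Sum>k. ennreal (2^Suc k*B (Suc k))*indicator {1 - 2*(1/2::real)^k .. 1} y)" by (rule ennreal_le_suminf)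
   finally show ?thesis using True by simp
  qed simp
 qed
 also have "... = (\<Sum>k. \<integral>\<^sup>+y. ennreal (2^Suc k*B (Suc k))*indicator {1 - 2*(1/2::real)^k .. 1} y \<partial>lborel)"
  by (rule nn_integral_suminf) measurable
 also have "... = (\<Sum>k. ennreal (4*B (Suc k)))"
 proof (rule suminf_cong)
  fix k
  have "(\<integral>\<^sup>+y. ennreal (2^Suc k*B (Suc k))*indicator {1 - 2*(1/2::real)^k .. 1} y \<partial>lborel) =
   ennreal (2^Suc k*B (Suc k))*ennreal (2*(1/2)^k)"
   by (subst nn_integral_cmult_indicator) auto
  also have "... = ennreal (2^Suc k*B (Suc k)*(2*(1/2)^k))" by (rule ennreal_mult[symmetric]) (use B(1) in auto)
  also have "2^Suc k*B (Suc k)*(2*(1/2)^k) = 4*B (Suc k)" by (simp add: power_divide)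
  finally show "(\<integral>\<^sup>+y. ennreal (2^Suc k*B (Suc k))*indicator {1 - 2*(1/2::real)^k .. 1} y \<partial>lborel) = ennreal (4*B (Suc k))" .
 qed
 also have "... = ennreal (4*(\<Sum>k. B (Suc k)))"
  by (rule suminf_ennreal_eq) (use B in "auto intro!: sums_mult summable_sums sB")
 also have "... <= ennreal (4 * suminf B)"
  using suminf_split_head[OF B(2)] B(1)[of 0] by (intro ennreal_leI) simp
 finally show ?thesis .
qed

lemma lam_mult_fun:
 assumes "l \<in> lam_class m p" "hol f"
 shows "hol (mult_fun l f)" "taylor_seq (mult_fun l f) = (%n. l n*taylor_seq f n)"
  "frac_deriv1 (mult_fun l f) z = (\<Sum>n. of_nat (n + 1)*(l n*taylor_seq f n)*z^n)"
 by (rule mult_fun[OF lam_class_summable[OF assms(1)] assms(2)], assumption)+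

lemma frac_deriv1_dilate:
 assumes l: "l \<in> lam_class m p" and h: "hol h" and r: "0 <= r" "r < 1"
 shows "frac_deriv1 (mult_fun l (%z. h (of_real r*z))) y = frac_deriv1 (mult_fun l h) (of_real r*y)"
 unfolding lam_mult_fun(3)[OF l h] lam_mult_fun(3)[OF l dilate_holomorphic(2)[OF h r]] dilate_taylor[OF h r]
 by (simp add: power_mult_distrib mult_ac)

text \<open>The estimate is made for dilations, which are continuous up to the circle and hence
  their own boundary data; Fatou's lemma along the radius returns to \<open>f\<close>. The
  \<open>p\<close>-th powers of the levels are summed by \<open>rearrangement_powr_sum\<close>, then
  \<open>l^p\<close> lies in \<open>l^1\<close>.\<close>

lemma lam_class_hardy_bound:
 assumes l: "l \<in> lam_class m p" and m: "1 <= m" and p: "0 < p" "p < 1"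
 obtains A where "0 <= A" "\<And>f. f \<in> hardy p ==>
  (\<integral>\<^sup>+y. indicator {0..<1} y*ennreal (cmod (frac_deriv1 (mult_fun l f) (of_real y))) \<partial>lborel) <= ennreal (A*hardy_norm p f)"
proof -
 obtain C where C: "0 <= C" "\<And>f u K V J z. poisson_dominated p u f ==> dyadic_level p u K ==> (\<And>i. wlevel p K i <= V) ==>
  cmod z <= (rad J)^2 ==> cmod (frac_deriv1 (mult_fun l f) z) <= 2^J*(C*gconv (mtheta p) (gconv (mtheta p) (wlevel p K)) (J + 2))"
  using lam_deriv_bound[OF l m p] by blast
 note th = mtheta[OF p]
 define T where "T = 2/(1 - mtheta p)"
 have T0: "0 <= T" using th by (simp add: T_def)
 define A where "A = 4*C*T*T*2 powr (1/p)"
 have A0: "0 <= A" using C(1) T0 by (simp add: A_def)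
 show ?thesis
 proof (rule that[OF A0])
  fix f assume f: "f \<in> hardy p"
  note h = hardyD(1)[OF f]
  define M where "M = (SUP r\<in>{0..<1}. hardy_mean p f r)"
  define F where "F = frac_deriv1 (mult_fun l f)"
  have hF: "hol F" unfolding F_def by (intro frac_deriv1_holomorphic lam_mult_fun(1)[OF l h])
  have dil: "(\<integral>\<^sup>+y. indicator {0..<1} y*ennreal (cmod (F (of_real (rad k) * of_real y))) \<partial>lborel) <= ennreal (A*hardy_norm p f)" for k
  proof -
   define g where "g z = f (of_real (rad k)*z)" for z
   note d = dilate_holomorphic[OF h rad(1,2)[of k]]
   have cg: "continuous_on (sphere 0 1) g" unfolding g_def by (rule d(3))
   have mg: "g \<in> borel_measurable \<T>" by (rule circle_measurable[OF cg])
   have pd: "poisson_dominated p (%x. cmod (g x)) g"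
    unfolding poisson_dominated_def g_def
    by (intro conjI allI impI d(2) powr_subharmonic[OF d(1,2)]) (use p in auto)
   note dl = measurable_dyadic[OF mg, of p]
   define v where "v = wlevel p (%i. rearrangement g ((1/2)^i))"
   have r0: "0 <= rearrangement g ((1/2)^i)" for i by (rule rearrangement_nonneg[OF mg]) simp
   have v0: "0 <= v i" for i using r0 by (simp add: v_def wlevel_def)
   have ig: "integrable \<T> (%w. cmod (g w) powr p)"
    by (rule circle_integrable[OF continuous_on_powr'[OF continuous_on_norm[OF cg] continuous_on_const]]) (use p in auto)
   have vp: "v i powr p = rearrangement g ((1/2)^i) powr p*(1/2)^i" for i
   proof -
    have "v i powr p = rearrangement g ((1/2)^i) powr p*(2 powr (- (real i/p))) powr p"
     unfolding v_def wlevel_def by (rule powr_mult)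
    thus ?thesis using p by (simp add: powr_powr half_power)
   qed
   have "(MEAN w. cmod (g w) powr p) = hardy_mean p f (rad k)" by (simp add: g_def hardy_mean_def)
   also have "... <= M" unfolding M_def by (rule hardyD(3)[OF f rad(1,2)])
   finally have "(\<Sum>i<N. v i powr p) <= 2*M" for N
    unfolding vp using rearrangement_powr_sum[OF mg p(1) ig, of N] by simp
   note sv = summable_lt_one[OF p v0 this]
   have V: "v i <= suminf v" for i using sum_le_suminf[OF sv(1), of "{i}"] v0 by auto
   have gl1: "summable (gconv (mtheta p) v)" "suminf (gconv (mtheta p) v) <= T * suminf v"
    using gconv_l1[OF th(1,2) v0 sv(1)] by (simp_all add: T_def)
   have gn: "0 <= gconv (mtheta p) v i" for i by (rule gconv_nonneg[OF th(1,2) v0 V])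
   have gl2: "summable (gconv (mtheta p) (gconv (mtheta p) v))" "suminf (gconv (mtheta p) (gconv (mtheta p) v)) <= T * suminf (gconv (mtheta p) v)"
    using gconv_l1[OF th(1,2) gn gl1(1)] by (simp_all add: T_def)
   have gV: "gconv (mtheta p) v i <= T * suminf v" for i
    unfolding T_def by (rule gconv_bounded[OF th(1,2) v0 V])
   have gn2: "0 <= gconv (mtheta p) (gconv (mtheta p) v) i" for i by (rule gconv_nonneg[OF th(1,2) gn gV])
   define B where "B J = C*gconv (mtheta p) (gconv (mtheta p) v) (J + 2)" for J
   have B0: "0 <= B J" for J using C(1) gn2 by (simp add: B_def)
   have s2: "summable (%J. gconv (mtheta p) (gconv (mtheta p) v) (J + 2))" by (rule summable_ignore_initial_segment[OF gl2(1)])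
   have sB: "summable B" unfolding B_def by (rule summable_mult[OF s2])
   have "suminf B = C*(\<Sum>J. gconv (mtheta p) (gconv (mtheta p) v) (J + 2))" unfolding B_def by (rule suminf_mult[OF s2])
   also have "(\<Sum>J. gconv (mtheta p) (gconv (mtheta p) v) (J + 2)) <= suminf (gconv (mtheta p) (gconv (mtheta p) v))"
    using suminf_split_initial_segment[OF gl2(1), of 2] gn2 by (simp add: sum_nonneg)
   also have "... <= T*(T * suminf v)" using gl2(2) mult_left_mono[OF gl1(2) T0] by linarith
   also have "... <= T*(T*(2*M) powr (1/p))" by (intro mult_left_mono sv T0)
   finally have "4 * suminf B <= 4*(C*(T*(T*(2*M) powr (1/p))))" using C(1) by (simp add: mult_left_mono)
   also have "(2*M) powr (1/p) = 2 powr (1/p)*M powr (1/p)" by (rule powr_mult)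
   also have "4*(C*(T*(T*(2 powr (1/p)*M powr (1/p))))) = A*hardy_norm p f" by (simp add: A_def hardy_norm_def M_def)
   finally have BA: "4 * suminf B <= A*hardy_norm p f" .
   have "(\<integral>\<^sup>+y. indicator {0..<1} y*ennreal (cmod (frac_deriv1 (mult_fun l g) (of_real y))) \<partial>lborel) <= ennreal (4 * suminf B)"
    by (rule sum_deriv_integral[OF B0 sB]) (use C(2)[OF pd dl V[unfolded v_def]] in "simp add: B_def v_def")
   also have "... <= ennreal (A*hardy_norm p f)" by (rule ennreal_leI[OF BA])
   finally show ?thesis unfolding g_def frac_deriv1_dilate[OF l h rad(1,2)] F_def .
  qed
  have cF: "isCont F (of_real y)" if "y \<in> {0..<1}" for y :: real
   using holomorphic_on_imp_continuous_on[OF hF] that by (simp add: continuous_on_eq_continuous_at)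
  have mF: "(%y. indicator {0..<1} y*ennreal (cmod (F (of_real (rad k) * of_real y)))) \<in> borel_measurable lborel" for k
  proof -
   have cn: "continuous_on {0..<1} (%y::real. cmod (F (of_real (rad k) * of_real y)))"
    by (intro continuous_on_norm continuous_on_compose2[OF dilate_holomorphic(1)[OF hF rad(1,2)[of k]]] continuous_intros) auto
   have "(%y::real. indicat_real {0..<1} y *\<^sub>R cmod (F (of_real (rad k) * of_real y))) \<in> borel_measurable borel"
    by (rule borel_measurable_continuous_on_indicator[OF _ cn]) simp
   hence "(%y::real. ennreal (indicat_real {0..<1} y *\<^sub>R cmod (F (of_real (rad k) * of_real y)))) \<in> borel_measurable lborel" by measurable
   moreover have "(%y::real. ennreal (indicat_real {0..<1} y *\<^sub>R cmod (F (of_real (rad k) * of_real y)))) =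
     (%y. indicator {0..<1} y*ennreal (cmod (F (of_real (rad k) * of_real y))))" by (auto simp: fun_eq_iff split: split_indicator)
   ultimately show ?thesis by (simp only:)
  qed
  have "(\<integral>\<^sup>+y. indicator {0..<1} y*ennreal (cmod (F (of_real y))) \<partial>lborel) <=
   (\<integral>\<^sup>+y. liminf (%k. indicator {0..<1} y*ennreal (cmod (F (of_real (rad k) * of_real y)))) \<partial>lborel)"
  proof (rule nn_integral_mono)
   fix y :: real
   show "indicator {0..<1} y*ennreal (cmod (F (of_real y))) <= liminf (%k. indicator {0..<1} y*ennreal (cmod (F (of_real (rad k) * of_real y))))"
   proof (cases "y \<in> {0..<1}")
    case True
    have "(%k. of_real (rad k) * of_real y) ----> of_real 1*complex_of_real y" by (intro tendsto_intros rad_tendsto)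
    hence "(%k. F (of_real (rad k) * of_real y)) ----> F (of_real y)" using cF[OF True] by (intro isCont_tendsto_compose[of _ F]) simp_all
    hence "(%k. ennreal (cmod (F (of_real (rad k) * of_real y)))) ----> ennreal (cmod (F (of_real y)))" by (intro tendsto_ennrealI tendsto_norm)
    from lim_imp_Liminf[OF sequentially_bot this] show ?thesis using True by simp
   qed simp
  qed
  also have "... <= liminf (%k. \<integral>\<^sup>+y. indicator {0..<1} y*ennreal (cmod (F (of_real (rad k) * of_real y))) \<partial>lborel)"
   by (rule nn_integral_liminf[OF mF])
  also have "... <= liminf (%k. ennreal (A*hardy_norm p f))" by (intro Liminf_mono always_eventually allI dil)
  also have "... = ennreal (A*hardy_norm p f)" by (simp add: Liminf_const)
  finally show "(\<integral>\<^sup>+y. indicator {0..<1} y*ennreal (cmod (frac_deriv1 (mult_fun l f) (of_real y))) \<partial>lborel) <= ennreal (A*hardy_norm p f)"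
   unfolding F_def .
 qed
qed

lemma powr_add_le:
 fixes x y p :: real
 assumes "0 <= x" "0 <= y" "0 < p"
 shows "(x + y) powr p <= 2 powr p*(x powr p + y powr p)"
proof -
 have "(x + y) powr p <= (2*max x y) powr p" using assms by (intro powr_mono2) auto
 also have "... = 2 powr p*max x y powr p" by (rule powr_mult)
 also have "max x y powr p <= x powr p + y powr p" by (auto simp: max_def)
 finally show ?thesis by (simp add: mult_left_mono)
qed

lemma continuous_dilate_powr:
 assumes "hol f" "0 < p" "0 <= r" "r < 1"
 shows "integrable \<T> (%u. cmod (f (of_real r*u)) powr p)"
 by (rule circle_integrable[OF continuous_on_powr'[OF continuous_on_norm[OF dilate_holomorphic(3)[OF assms(1,3,4)]] continuous_on_const]])
  (use assms in auto)

lemma hardy_add_cmult: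
 assumes p: "0 < p" and f: "f \<in> hardy p" and g: "g \<in> hardy p"
 shows "(%z. f z + c*g z) \<in> hardy p"
proof -
 note hf = hardyD(1)[OF f] and hg = hardyD(1)[OF g]
 have h: "hol (%z. f z + c*g z)" using hf hg by (intro holomorphic_intros)
 have "hardy_mean p (%z. f z + c*g z) r <= 2 powr p*((SUP r\<in>{0..<1}. hardy_mean p f r) + cmod c powr p*(SUP r\<in>{0..<1}. hardy_mean p g r))"
  if r: "r \<in> {0..<1}" for r
 proof -
  have r: "0 <= r" "r < 1" using that by auto
  have "hardy_mean p (%z. f z + c*g z) r <= (MEAN u. 2 powr p*(cmod (f (of_real r*u)) powr p + cmod c powr p*cmod (g (of_real r*u)) powr p))"
   unfolding hardy_mean_def
  proof (rule integral_mono)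
   show "integrable \<T> (%u. cmod (f (of_real r*u) + c*g (of_real r*u)) powr p)"
    by (rule continuous_dilate_powr[OF h p r])
   show "integrable \<T> (%u. 2 powr p*(cmod (f (of_real r*u)) powr p + cmod c powr p*cmod (g (of_real r*u)) powr p))"
    by (intro integrable_mult_right Bochner_Integration.integrable_add continuous_dilate_powr p r hf hg)
   fix u
   have "cmod (f (of_real r*u) + c*g (of_real r*u)) powr p <= (cmod (f (of_real r*u)) + cmod (c*g (of_real r*u))) powr p"
    using p by (intro powr_mono2 norm_triangle_ineq) auto
   also have "... <= 2 powr p*(cmod (f (of_real r*u)) powr p + cmod (c*g (of_real r*u)) powr p)"
    by (rule powr_add_le) (use p in auto)
   finally show "cmod (f (of_real r*u) + c*g (of_real r*u)) powr p <= 2 powr p*(cmod (f (of_real r*u)) powr p + cmod c powr p*cmod (g (of_real r*u)) powr p)"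
    by (simp only: norm_mult powr_mult)
  qed
  also have "... = 2 powr p*(hardy_mean p f r + cmod c powr p*hardy_mean p g r)"
   using continuous_dilate_powr[OF hf p r] continuous_dilate_powr[OF hg p r] by (simp add: hardy_mean_def)
  also have "... <= 2 powr p*((SUP r\<in>{0..<1}. hardy_mean p f r) + cmod c powr p*(SUP r\<in>{0..<1}. hardy_mean p g r))"
   by (intro mult_left_mono add_mono hardyD(3)[OF f r] hardyD(3)[OF g r]) auto
  finally show ?thesis .
 qed
 hence "bdd_above (hardy_mean p (%z. f z + c*g z) ` {0..<1})" by (intro bdd_aboveI2) auto
 thus ?thesis using h by (simp add: hardy_def H_disk_def)
qed

lemma taylor_seq_add_cmult:
 assumes "hol f" "hol g"
 shows "taylor_seq (%z. f z + c*g z) = (%n. taylor_seq f n + c*taylor_seq g n)"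
proof (rule taylor_seq_unique)
 fix z :: complex assume "cmod z < 1"
 from sums_add[OF hol_sums[OF assms(1) this] sums_mult[OF hol_sums[OF assms(2) this], of c]]
 show "(%n. (taylor_seq f n + c*taylor_seq g n)*z^n) sums (f z + c*g z)" by (simp add: algebra_simps)
qed

lemma taylor_seq_power: "taylor_seq (%z. z^k) = (%n. if n = k then 1 else 0)"
proof (rule taylor_seq_unique)
 fix z :: complex
 have "(%n. (if n = k then 1 else 0)*z^n) = (%n. if n = k then z^n else 0)" by (rule ext) simp
 thus "(%n. (if n = k then 1 else 0)*z^n) sums z^k" using sums_single[of k "%n. z^n"] by simp
qed

lemma hardy_power:
 assumes "0 < p"
 shows "(%z. z^n) \<in> hardy p"
proof -
 have h: "hol (%z::complex. z^n)" by (intro holomorphic_intros)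
 have "hardy_mean p (%z. z^n) r <= 1" if "r \<in> {0..<1}" for r
 proof -
  have r: "0 <= r" "r < 1" using that by auto
  have "hardy_mean p (%z. z^n) r <= (MEAN u. 1)"
   unfolding hardy_mean_def
  proof (rule integral_mono[OF continuous_dilate_powr[OF h assms r]])
   fix u assume "u \<in> space \<T>"
   thus "cmod ((of_real r*u)^n) powr p <= 1"
    using r assms by (intro powr_le1) (auto simp: norm_power norm_mult power_le_one)
  qed simp
  thus ?thesis using circle.prob_space by simp
 qed
 hence "bdd_above (hardy_mean p (%z. z^n) ` {0..<1})" by (intro bdd_aboveI2) auto
 thus ?thesis using h by (simp add: hardy_def H_disk_def)
qed

text \<open>On the monomial \<open>z^n\<close> the factor \<open>n + 1\<close> cancels the integral
  of \<open>y^n\<close> over the radius, so the functional takes the value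
  \<open>l n\<close>.\<close>

lemma lam_class_dual:
 assumes l: "l \<in> lam_class m p" and m: "1 <= m" and p: "0 < p" "p < 1"
 shows "l \<in> hardy_dual p"
proof -
 obtain A where A: "0 <= A" "\<And>f. f \<in> hardy p ==>
  (\<integral>\<^sup>+y. indicator {0..<1} y*ennreal (cmod (frac_deriv1 (mult_fun l f) (of_real y))) \<partial>lborel) <= ennreal (A*hardy_norm p f)"
  using lam_class_hardy_bound[OF l m p] by blast
 define F where "F f y = indicat_real {0..<1} y *\<^sub>R frac_deriv1 (mult_fun l f) (complex_of_real y)" for f and y :: real
 define \<phi> where "\<phi> f = (LBINT y. F f y)" for f
 have int: "integrable lborel (F f)" and bd: "cmod (\<phi> f) <= A*hardy_norm p f" if f: "f \<in> hardy p" for f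
 proof -
  note h = hardyD(1)[OF f]
  have hF: "hol (frac_deriv1 (mult_fun l f))" by (intro frac_deriv1_holomorphic lam_mult_fun(1)[OF l h])
  have cn: "continuous_on {0..<1} (%y::real. frac_deriv1 (mult_fun l f) (of_real y))"
   by (rule continuous_on_compose2[OF holomorphic_on_imp_continuous_on[OF hF]]) (auto intro!: continuous_intros)
  have mF: "F f \<in> borel_measurable lborel"
   unfolding F_def using borel_measurable_continuous_on_indicator[OF _ cn] by simp
  have eq: "ennreal (norm (F f y)) = indicator {0..<1} y*ennreal (cmod (frac_deriv1 (mult_fun l f) (of_real y)))" for y
   by (auto simp: F_def split: split_indicator)
  have le: "(\<integral>\<^sup>+y. ennreal (norm (F f y)) \<partial>lborel) <= ennreal (A*hardy_norm p f)" unfolding eq by (rule A(2)[OF f])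
  thus i: "integrable lborel (F f)" by (intro integrableI_bounded mF) (simp add: order_le_less_trans)
  have "cmod (\<phi> f) <= (LBINT y. norm (F f y))" unfolding \<phi>_def by (rule integral_norm_bound)
  moreover have "ennreal (LBINT y. norm (F f y)) <= ennreal (A*hardy_norm p f)"
   using le by (subst nn_integral_eq_integral[OF integrable_norm[OF i], symmetric]) auto
  moreover have "0 <= A*hardy_norm p f" using A(1) by (simp add: hardy_norm_def)
  ultimately show "cmod (\<phi> f) <= A*hardy_norm p f" by simp
 qed
 have lin: "\<phi> (%z. f z + c*g z) = \<phi> f + c * \<phi> g" if f: "f \<in> hardy p" and g: "g \<in> hardy p" for f g c
 proof -
  note hf = hardyD(1)[OF f] and hg = hardyD(1)[OF g] and hs = hardyD(1)[OF hardy_add_cmult[OF p(1) f g, of c]]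
  have "F (%z. f z + c*g z) y = F f y + c*F g y" for y
  proof (cases "y \<in> {0..<1}")
   case True
   hence y: "cmod (complex_of_real y) < 1" by simp
   have sf: "summable (%n. of_nat (n + 1)*(l n*taylor_seq f n) * of_real y^n)"
    using frac_deriv1_holomorphic(2)[OF lam_mult_fun(1)[OF l hf] y] by (simp only: lam_mult_fun(2)[OF l hf])
   have sg: "summable (%n. of_nat (n + 1)*(l n*taylor_seq g n) * of_real y^n)"
    using frac_deriv1_holomorphic(2)[OF lam_mult_fun(1)[OF l hg] y] by (simp only: lam_mult_fun(2)[OF l hg])
   have "frac_deriv1 (mult_fun l (%z. f z + c*g z)) (of_real y) =
    (\<Sum>n. of_nat (n + 1)*(l n*taylor_seq f n) * of_real y^n + c*(of_nat (n + 1)*(l n*taylor_seq g n) * of_real y^n))"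
    unfolding lam_mult_fun(3)[OF l hs] taylor_seq_add_cmult[OF hf hg] by (simp add: algebra_simps)
   also have "... = frac_deriv1 (mult_fun l f) (of_real y) + c*frac_deriv1 (mult_fun l g) (of_real y)"
    unfolding lam_mult_fun(3)[OF l hf] lam_mult_fun(3)[OF l hg]
    using suminf_add[OF sf summable_mult[OF sg, of c]] suminf_mult[OF sg, of c] by (simp only:)
   finally show ?thesis using True by (simp add: F_def)
  qed (simp add: F_def)
  hence "F (%z. f z + c*g z) = (%y. F f y + c*F g y)" by (rule ext)
  thus ?thesis unfolding \<phi>_def using int[OF f] int[OF g] by simp
 qed
 have zero: "(%z. 0) \<in> hardy p" using hardy_add_cmult[OF p(1) hardy_power[OF p(1), of 0] hardy_power[OF p(1), of 0], of "-1"] by simp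
 have \<phi>0: "\<phi> (%z. 0) = 0" using lin[OF zero zero, of 1] by simp
 have "hardy_functional p \<phi>"
  unfolding hardy_functional_def
 proof (intro conjI ballI allI impI)
  fix f g assume "f \<in> hardy p" "g \<in> hardy p"
  thus "\<phi> (%z. f z + g z) = \<phi> f + \<phi> g" using lin[of f g 1] by simp
 next
  fix c f assume "f \<in> hardy p"
  thus "\<phi> (%z. c*f z) = c * \<phi> f" using lin[OF zero, of f c] \<phi>0 by simp
 next
  fix f and \<epsilon> :: real assume f: "f \<in> hardy p" and e: "\<epsilon> > 0"
  show "\<exists>s>0. \<forall>g\<in>hardy p. hardy_norm p (%z. g z - f z) < s \<longrightarrow> cmod (\<phi> g - \<phi> f) < \<epsilon>"
  proof (intro exI[of _ "\<epsilon>/(A + 1)"] conjI ballI impI)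
   show "0 < \<epsilon>/(A + 1)" using e A(1) by simp
   fix g assume g: "g \<in> hardy p" and d: "hardy_norm p (%z. g z - f z) < \<epsilon>/(A + 1)"
   have "(%z. g z - f z) \<in> hardy p" using hardy_add_cmult[OF p(1) g f, of "-1"] by simp
   moreover have "\<phi> (%z. g z - f z) = \<phi> g - \<phi> f" using lin[OF g f, of "-1"] by simp
   ultimately have "cmod (\<phi> g - \<phi> f) <= A*hardy_norm p (%z. g z - f z)" using bd by metis
   also have "... <= A*(\<epsilon>/(A + 1))" using d A(1) by (intro mult_left_mono) auto
   also have "... < \<epsilon>" using A(1) e by (simp add: field_simps)
   finally show "cmod (\<phi> g - \<phi> f) < \<epsilon>" .
  qed
 qed
 moreover have "l = (%n. \<phi> (%z. z^n))"
 proof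
  fix n
  have h: "hol (%z::complex. z^n)" by (intro holomorphic_intros)
  have fd: "frac_deriv1 (mult_fun l (%z. z^n)) y = of_nat (n + 1)*l n*y^n" for y
  proof -
   have "(%k. of_nat (k + 1)*(l k*(if k = n then 1 else 0))*y^k) = (%k. if k = n then of_nat (k + 1)*l k*y^k else 0)"
    by (rule ext) simp
   thus ?thesis unfolding lam_mult_fun(3)[OF l h] taylor_seq_power using sums_single[of n "%k. of_nat (k + 1)*l k*y^k"]
    by (simp only: sums_iff)
  qed
  have "\<phi> (%z. z^n) = (LBINT y. (of_nat (n + 1)*l n)*complex_of_real (indicat_real {0..<1} y *\<^sub>R y^n))"
   unfolding \<phi>_def F_def fd by (rule Bochner_Integration.integral_cong) (auto split: split_indicator)
  also have "... = (of_nat (n + 1)*l n)*complex_of_real (LBINT y. indicat_real {0..<1} y *\<^sub>R (y::real)^n)"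
   unfolding integral_mult_right_zero integral_complex_of_real ..
  also have "(LBINT y. indicat_real {0..<1} y *\<^sub>R (y::real)^n) = (LBINT y:{0..1}. y^n*(1 - y)^(1 - 1))"
   unfolding set_lebesgue_integral_def
  proof (rule integral_cong_AE)
   show "AE y::real in lborel. indicat_real {0..<1} y *\<^sub>R y^n = indicat_real {0..1} y *\<^sub>R (y^n*(1 - y)^(1 - 1))"
    using AE_lborel_singleton[of 1] by eventually_elim (auto simp: indicator_def)
  qed measurable
  also have "... = 1/real (n + 1)" using beta_binomial[of 1 n] by simp
  finally show "l n = \<phi> (%z. z^n)" by (simp del: of_nat_add of_nat_Suc)
 qed
 ultimately show ?thesis unfolding hardy_dual_def by blast
qed

section \<open>The coefficient class multiplies Hardy--Lorentz functions into BMOA\<close>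

text \<open>This makes the chain and product rules and the mean value inequality available for
  \<open>frac_deriv1\<close>.\<close>

lemma frac_deriv1_has_derivative:
 assumes h: "hol h" and z: "cmod z < 1"
 shows "((%z. z*h z) has_field_derivative frac_deriv1 h z) (at z)"
proof -
 define c where "c n = (case n of 0 => 0 | Suc n => taylor_seq h n)" for n
 have s: "(%n. c n*w^n) sums (w*h w)" if "cmod w < 1" for w
 proof -
  have "(%n. c (Suc n)*w^Suc n) sums (w*h w)"
   using sums_mult[OF hol_sums[OF h that], of w] by (simp add: c_def mult_ac)
  thus ?thesis using sums_Suc_iff[of "%n. c n*w^n" "w*h w"] by (simp add: c_def)
 qed
 have "((%w. \<Sum>n. c n*w^n) has_field_derivative (\<Sum>n. diffs c n*z^n)) (at z)"
  by (rule termdiffs_strong'[of 1]) (use s z in "auto simp: sums_iff")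
 moreover have "(\<Sum>n. diffs c n*z^n) = frac_deriv1 h z" by (simp add: diffs_def c_def frac_deriv1_def)
 ultimately have "((%w. \<Sum>n. c n*w^n) has_field_derivative frac_deriv1 h z) (at z)" by simp
 thus ?thesis
  by (rule has_field_derivative_transform_within_open[where S = "ball 0 1"]) (use s z in "auto simp: sums_iff")
qed

lemma integral_sq_le_coeffs:
 assumes G: "hol G" and K: "\<And>N. (\<Sum>n<N. (cmod (taylor_seq G n))^2) <= K"
  and r: "0 <= r" "r < 1"
 shows "(MEAN u. (cmod (G (of_real r*u)))^2) <= K"
proof -
 note p = parseval[OF G r]
 have "(\<Sum>n<N. (cmod (taylor_seq G n))^2*r^(2*n)) <= K" for N
 proof -
  have "(\<Sum>n<N. (cmod (taylor_seq G n))^2*r^(2*n)) <= (\<Sum>n<N. (cmod (taylor_seq G n))^2*1)"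
   by (intro sum_mono mult_left_mono power_le_one) (use r in auto)
  thus ?thesis using K[of N] by simp
 qed
 hence "suminf (%n. (cmod (taylor_seq G n))^2*r^(2*n)) <= K" by (intro suminf_le_const) (use p in "auto simp: sums_iff")
 thus ?thesis using p by (simp add: sums_iff)
qed

section \<open>A Littlewood-Paley inequality\<close>

lemma beta_linear:
 "integrable lborel (%x. indicat_real {0..1} x*(x^n*(1 - x)))"
 "(LBINT x. indicat_real {0..1} x*(x^n*(1 - x))) = 1/((real n + 1)*(real n + 2))"
proof -
 show "integrable lborel (%x. indicat_real {0..1} x*(x^n*(1 - x)))"
  using borel_integrable_atLeastAtMost'[of 0 1 "%x::real. x^n*(1 - x)"]
  by (simp add: set_integrable_def continuous_intros)
 have "real ((n + 2) choose 2) = (real n + 2)*(real n + 1)/2"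
  by (induction n) (simp_all add: numeral_2_eq_2 field_simps)
 moreover have "(LBINT x. indicat_real {0..1} x*(x^n*(1 - x))) = 1/(2*real ((n + 2) choose 2))"
  using beta_binomial[of 2 n] by (simp add: set_lebesgue_integral_def)
 ultimately show "(LBINT x. indicat_real {0..1} x*(x^n*(1 - x))) = 1/((real n + 1)*(real n + 2))"
  by (simp add: mult.commute)
qed

text \<open>The variable \<open>x\<close> is the squared radius. By Parseval, integration against
  \<open>1 - x\<close> weighs the squared coefficient by \<open>(n + 1)/(n + 2)\<close>, which is at
  least 1/2.\<close>

lemma littlewood_paley:
 assumes G: "hol G"
  and le: "(\<integral>\<^sup>+x. indicator {0..1} x*ennreal ((1 - x)*(MEAN z. (cmod (frac_deriv1 G (of_real (sqrt x)*z)))^2)) \<partial>lborel) <= ennreal K"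
  and K: "0 <= K"
 shows "(\<Sum>n<N. (cmod (taylor_seq G n))^2) <= 2*K"
proof -
 define a where "a n = (cmod (taylor_seq G n))^2" for n
 define M where "M x = (MEAN z. (cmod (frac_deriv1 G (of_real (sqrt x)*z)))^2)" for x
 have low: "(\<Sum>n<N. (real n + 1)^2*a n*x^n) <= M x" if x: "0 <= x" "x < 1" for x
 proof -
  have s: "0 <= sqrt x" "sqrt x < 1" using x by auto
  have "(cmod (taylor_seq (frac_deriv1 G) n))^2 * sqrt x^(2*n) = (real n + 1)^2*a n*x^n" for n
  proof -
   have "cmod (of_nat (n + 1)) = real n + 1" by (simp only: norm_of_nat)
   thus ?thesis using x unfolding frac_deriv1_holomorphic(3)[OF G] a_def power_mult norm_mult power_mult_distrib by simp
  qed
  hence "(%n. (real n + 1)^2*a n*x^n) sums M x"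
   using parseval[OF frac_deriv1_holomorphic(1)[OF G] s] unfolding M_def by simp
  thus ?thesis
   using sum_le_suminf[of "%n. (real n + 1)^2*a n*x^n" "{..<N}"] x by (simp add: sums_iff a_def)
 qed
 define g where "g x = (\<Sum>n<N. ((real n + 1)^2*a n)*(indicat_real {0..1} x*(x^n*(1 - x))))" for x
 have gi: "integrable lborel g"
  unfolding g_def by (intro Bochner_Integration.integrable_sum integrable_mult_right beta_linear)
 have g0: "0 <= g x" for x unfolding g_def by (rule sum_nonneg) (cases "x \<in> {0..1}", auto simp: a_def)
 have "(\<Sum>n<N. a n)/2 <= (\<Sum>n<N. ((real n + 1)^2*a n)*(1/((real n + 1)*(real n + 2))))"
  unfolding sum_divide_distrib
 proof (rule sum_mono)
  fix n
  have "t^2*a n*(1/(t*u)) = a n*(t/u)" if "t \<noteq> 0" for t u :: real using that by (simp add: power2_eq_square)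
  from this[of "real n + 1"] have "((real n + 1)^2*a n)*(1/((real n + 1)*(real n + 2))) = a n*((real n + 1)/(real n + 2))"
   by simp
  moreover have "a n*(1/2) <= a n*((real n + 1)/(real n + 2))"
   by (rule mult_left_mono) (auto simp: a_def field_simps)
  ultimately show "a n/2 <= ((real n + 1)^2*a n)*(1/((real n + 1)*(real n + 2)))" by simp
 qed
 also have "... = (LBINT x. g x)"
  unfolding g_def by (subst Bochner_Integration.integral_sum) (auto simp: beta_linear)
 finally have "ennreal ((\<Sum>n<N. a n)/2) <= ennreal (LBINT x. g x)" by (rule ennreal_leI)
 also have "... = (\<integral>\<^sup>+x. ennreal (g x) \<partial>lborel)" by (rule nn_integral_eq_integral[symmetric, OF gi]) (simp add: g0)
 also have "... <= (\<integral>\<^sup>+x. indicator {0..1} x*ennreal ((1 - x)*M x) \<partial>lborel)"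
 proof (rule nn_integral_mono)
  fix x :: real
  show "ennreal (g x) <= indicator {0..1} x*ennreal ((1 - x)*M x)"
  proof (cases "x \<in> {0..<1}")
   case True
   have "g x = (1 - x)*(\<Sum>n<N. (real n + 1)^2*a n*x^n)"
    unfolding g_def sum_distrib_left using True by (intro sum.cong) auto
   also have "... <= (1 - x)*M x" using low[of x] True by (intro mult_left_mono) auto
   finally show ?thesis using True by (simp add: ennreal_leI)
  next
   case False
   hence "g x = 0" unfolding g_def by (intro sum.neutral) (auto simp: indicator_def)
   thus ?thesis by simp
  qed
 qed
 also have "... <= ennreal K" using le unfolding M_def .
 finally show ?thesis using K unfolding a_def by simp
qed

text \<open>Comparison with an arbitrary constant costs a factor 2, since the mean itself is at most
  one average deviation away from it.\<close>

lemma arc_oscillation_le: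
 assumes f: "integrable \<T> f" and I: "I \<in> sets \<T>" "0 < measure \<T> I"
 shows "arc_oscillation I f <= 2*(LINT u:I|\<T>. cmod (f u - c))/measure \<T> I"
proof -
 let ?m = "measure \<T> I"
 define y where "y = arc_mean I f"
 have si: "set_integrable \<T> I (%x. cmod (f x - y))" for y
  unfolding set_integrable_def by (rule integrable_mult_indicator) (use f I in auto)
 have sf: "set_integrable \<T> I f" "set_integrable \<T> I (%_. c)"
  unfolding set_integrable_def by (rule integrable_mult_indicator; use f I in auto)+
 have sc: "set_integrable \<T> I (%_. cmod (c - y))"
  unfolding set_integrable_def by (rule integrable_mult_indicator) (use I in auto)
 have "of_real ?m*(y - c) = (LINT u:I|\<T>. f u) - (LINT u:I|\<T>. c)"
  using I unfolding y_def arc_mean_def set_integral_const_circle[OF I(1)] by (simp add: scaleR_conv_of_real algebra_simps)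
 also have "... = (LINT u:I|\<T>. f u - c)" by (rule set_integral_diff(2)[symmetric, OF sf])
 finally have "of_real ?m*(y - c) = (LINT u:I|\<T>. f u - c)" .
 moreover have "cmod (LINT u:I|\<T>. f u - c) <= (LINT u:I|\<T>. cmod (f u - c))"
  unfolding set_lebesgue_integral_def by (rule order_trans[OF integral_norm_bound]) simp
 ultimately have "cmod (of_real ?m*(y - c)) <= (LINT u:I|\<T>. cmod (f u - c))" by (simp only:)
 hence 1: "?m*cmod (c - y) <= (LINT u:I|\<T>. cmod (f u - c))"
  by (simp add: norm_mult norm_minus_commute)
 have "(LINT u:I|\<T>. cmod (f u - y)) <= (LINT u:I|\<T>. cmod (f u - c) + cmod (c - y))"
  by (rule set_integral_mono[OF si set_integral_add(1)[OF si sc]]) (metis norm_triangle_ineq diff_add_cancel add_diff_eq)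
 also have "... = (LINT u:I|\<T>. cmod (f u - c)) + ?m*cmod (c - y)"
  unfolding set_integral_add(2)[OF si sc] set_integral_const_circle[OF I(1)] by simp
 finally have "(LINT u:I|\<T>. cmod (f u - y)) <= 2*(LINT u:I|\<T>. cmod (f u - c))" using 1 by simp
 thus ?thesis unfolding arc_oscillation_def y_def[symmetric] using I by (intro divide_right_mono) auto
qed

text \<open>The normalised Szego kernel \<open>d / (1 - cnj a * z)\<close>, where \<open>cmod a = 1 - d\<close>, is bounded below on an arc of
 length comparable to \<open>d\<close> around \<open>a / cmod a\<close>, and has small \<open>L\<^sup>2\<close> norm and bounded Dirichlet norm. It localises
 the Littlewood--Paley inequality to this arc.\<close>

lemma szego_kernel_mean:
 fixes a :: complex
 assumes d: "0 < d" "d <= 1" and a: "cmod a = 1 - d"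
 shows "0 <= x ==> x < 1 ==> (MEAN u. (cmod (of_real d/(1 - cnj a*(of_real (sqrt x)*u))))^2) <= d"
  and "\<exists>E\<in>borel_measurable borel. (\<forall>x. 0 <= x \<longrightarrow> x < 1 \<longrightarrow> ennreal (MEAN u. (cmod (of_real d/(1 - cnj a*(of_real (sqrt x)*u))^2))^2) <= E x) \<and> (\<integral>\<^sup>+x. E x \<partial>lborel) <= 1"
proof -
 define A where "A = (1 - d)^2"
 have "d*d <= d*1" using d by (intro mult_left_mono) auto
 hence "d <= 1 - A" by (simp add: A_def power2_eq_square algebra_simps)
 moreover have "0 <= A" by (simp add: A_def)
 ultimately have A: "0 <= A" "d <= 1 - A" "A < 1" using d by auto
 have small: "cmod (cnj a*z) < 1" if "cmod z < 1" for z
  using that a d mult_right_mono[of "1 - d" 1 "cmod z"] by (simp add: norm_mult)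
 have ne: "1 - cnj a*z \<noteq> 0" if "cmod z < 1" for z using small[OF that] by auto
 have Qs: "(%n. (of_real d*cnj a^n)*z^n) sums (of_real d/(1 - cnj a*z))" if "cmod z < 1" for z
  using sums_mult[OF geometric_sums[OF small[OF that]], of "of_real d"] by (simp add: power_mult_distrib mult_ac)
 have Ss: "(%n. (of_real d * of_nat (Suc n)*cnj a^n)*z^n) sums (of_real d/(1 - cnj a*z)^2)" if "cmod z < 1" for z
  using sums_mult[OF geometric_deriv_sums[OF small[OF that]], of "of_real d"] by (simp add: power_mult_distrib mult_ac)
 have tQ: "taylor_seq (%z. of_real d/(1 - cnj a*z)) = (%n. of_real d*cnj a^n)"
  by (rule taylor_seq_unique[OF Qs])
 have tS: "taylor_seq (%z. of_real d/(1 - cnj a*z)^2) = (%n. of_real d * of_nat (Suc n)*cnj a^n)"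
  by (rule taylor_seq_unique[OF Ss])
 have hQ: "hol (%z. of_real d/(1 - cnj a*z))"
  and hS: "hol (%z. of_real d/(1 - cnj a*z)^2)"
  by (intro holomorphic_intros; use ne in auto)+
 have Aa: "(cmod a^n)^2 = A^n" for n by (simp add: a A_def power_mult[symmetric] mult.commute)
 have sx: "sqrt x^(n*2) = x^n" if "0 <= x" for x and n :: nat using that by (simp add: power_mult mult.commute[of n])
 show "(MEAN u. (cmod (of_real d/(1 - cnj a*(of_real (sqrt x)*u))))^2) <= d" if x: "0 <= x" "x < 1"
 proof -
  have "0 <= sqrt x" "sqrt x < 1" using x by auto
  from parseval[OF hQ this] have "(%n. d^2*(A*x)^n) sums (MEAN u. (cmod (of_real d/(1 - cnj a*(of_real (sqrt x)*u))))^2)"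
   unfolding tQ using x by (simp add: norm_mult norm_power power_mult_distrib Aa sx mult_ac)
  moreover have Ax: "A*x <= A" "0 <= A*x" using A x mult_left_mono[of x 1 A] by auto
  hence "(%n. d^2*(A*x)^n) sums (d^2*(1/(1 - A*x)))" using A by (intro sums_mult geometric_sums) simp
  ultimately have "(MEAN u. (cmod (of_real d/(1 - cnj a*(of_real (sqrt x)*u))))^2) = d^2*(1/(1 - A*x))"
   by (rule sums_unique2)
  also have "... <= d^2*(1/d)" using A Ax d by (intro mult_left_mono divide_left_mono) auto
  also have "... = d" using d by (simp add: power2_eq_square)
  finally show ?thesis .
 qed
 define s where "s n = d^2*(real (Suc n))^2*A^n" for n
 have s0: "0 <= s n" for n using A by (simp add: s_def)
 have sm: "(%n. s n*x^n) sums (MEAN u. (cmod (of_real d/(1 - cnj a*(of_real (sqrt x)*u))^2))^2)" if x: "0 <= x" "x < 1" for x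
 proof -
  have "0 <= sqrt x" "sqrt x < 1" using x by auto
  thus ?thesis
   using parseval[OF hS, of "sqrt x"] x unfolding tS norm_mult power_mult_distrib
   by (simp add: norm_power Aa sx s_def mult_ac del: of_nat_Suc)
 qed
 have int: "(\<integral>\<^sup>+x. indicator {0..1} x*ennreal (x^n) \<partial>lborel) = ennreal (1/(real n + 1))" for n
 proof -
  have i: "integrable lborel (%x::real. indicat_real {0..1} x*x^n)"
   using borel_integrable_atLeastAtMost'[of 0 1 "%x::real. x^n"] by (simp add: set_integrable_def continuous_intros)
  have "(\<integral>\<^sup>+x. indicator {0..1} x*ennreal (x^n) \<partial>lborel) = (\<integral>\<^sup>+x. ennreal (indicat_real {0..1} x*x^n) \<partial>lborel)"
   by (rule nn_integral_cong) (auto split: split_indicator)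
  also have "... = ennreal (LBINT x. indicat_real {0..1} x*x^n)"
   by (rule nn_integral_eq_integral[OF i]) (auto split: split_indicator)
  also have "(LBINT x. indicat_real {0..1} x*x^n) = 1/(real n + 1)"
   using beta_binomial[of 1 n] by (simp add: set_lebesgue_integral_def add.commute)
  finally show ?thesis .
 qed
 \<comment> \<open>The Parseval series taken in \<open>ennreal\<close> is measurable in
   \<open>x\<close> by construction and integrates term by term.\<close>
 define E where "E x = (\<Sum>n. ennreal (s n)*(indicator {0..1} x*ennreal (x^n)))" for x
 have E1: "ennreal (MEAN u. (cmod (of_real d/(1 - cnj a*(of_real (sqrt x)*u))^2))^2) <= E x" if x: "0 <= x" "x < 1" for x
 proof -
  have "(\<Sum>n. ennreal (s n*x^n)) = ennreal (MEAN u. (cmod (of_real d/(1 - cnj a*(of_real (sqrt x)*u))^2))^2)"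
   by (rule suminf_ennreal_eq[OF _ sm[OF x]]) (use s0 x in simp)
  thus ?thesis using x s0 by (simp add: E_def ennreal_mult)
 qed
 have mE: "E \<in> borel_measurable borel" unfolding E_def[abs_def] by measurable
 have "(\<integral>\<^sup>+x. E x \<partial>lborel) = (\<Sum>n. \<integral>\<^sup>+x. ennreal (s n)*(indicator {0..1} x*ennreal (x^n)) \<partial>lborel)"
  unfolding E_def by (rule nn_integral_suminf) measurable
 also have "... = (\<Sum>n. ennreal (s n)*ennreal (1/(real n + 1)))"
  by (simp add: nn_integral_cmult int)
 also have "... = (\<Sum>n. ennreal (d^2*(of_nat (Suc n)*A^n)))"
 proof (rule suminf_cong)
  fix n
  have "ennreal (s n)*ennreal (1/(real n + 1)) = ennreal (s n*(1/(real n + 1)))"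
   by (rule ennreal_mult[symmetric]) (use s0 in auto)
  also have "s n*(1/(real n + 1)) = d^2*(of_nat (Suc n)*A^n)" by (simp add: s_def power2_eq_square field_simps)
  finally show "ennreal (s n)*ennreal (1/(real n + 1)) = ennreal (d^2*(of_nat (Suc n)*A^n))" .
 qed
 also have "... = ennreal (d^2*(1/(1 - A)^2))"
  by (rule suminf_ennreal_eq) (use A in simp, rule sums_mult[OF geometric_deriv_sums], use A in simp)
 also have "... <= ennreal (d^2*(1/d^2))"
  using A d by (intro ennreal_leI mult_left_mono divide_left_mono power_mono) auto
 finally have "(\<integral>\<^sup>+x. E x \<partial>lborel) <= 1" using d by simp
 thus "\<exists>E\<in>borel_measurable borel. (\<forall>x. 0 <= x \<longrightarrow> x < 1 \<longrightarrow> ennreal (MEAN u. (cmod (of_real d/(1 - cnj a*(of_real (sqrt x)*u))^2))^2) <= E x) \<and> (\<integral>\<^sup>+x. E x \<partial>lborel) <= 1"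
  using E1 mE by blast
qed

text \<open>A bound for the maximum of the derivative on each dyadic disk. It is stronger than a
  Carleson measure condition and is what square summable levels provide.\<close>

definition sq_dyadic :: "(nat => real) => (complex => complex) => bool" where
 "sq_dyadic B h \<longleftrightarrow> h holomorphic_on ball 0 1 \<and> (\<forall>J. 0 <= B J) \<and> summable (%J. (B J)^2) \<and>
  (\<forall>J z. cmod z <= (rad J)^2 \<longrightarrow> cmod (frac_deriv1 h z) <= 2^J*B J)"

text \<open>A measurable step majorant of \<open>1 - x\<close> times the squared maximal derivative
  at radius \<open>sqrt x\<close>; \<open>32*2^k\<close> is \<open>2*(1/2)^k\<close> times the
  square of \<open>2^(k + 2)\<close>.\<close>

definition sq_weight :: "(nat => real) => real => ennreal" where
 "sq_weight B x = (\<Sum>k. ennreal (32*2^k*(B (k + 2))^2)*indicator {1 - 2*(1/2::real)^k .. 1} x)"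

lemma measurable_sq_weight [measurable]: "sq_weight B \<in> borel_measurable borel"
 unfolding sq_weight_def[abs_def] by measurable

lemma sq_weight_integral:
 assumes "sq_dyadic B h"
 shows "(\<integral>\<^sup>+x. sq_weight B x \<partial>lborel) <= ennreal (64*(\<Sum>J. (B J)^2))"
proof -
 have B: "summable (%J. (B J)^2)" using assms by (simp add: sq_dyadic_def)
 have s2: "summable (%J. (B (J + 2))^2)" by (rule summable_ignore_initial_segment[OF B])
 have "(\<integral>\<^sup>+x. sq_weight B x \<partial>lborel) = (\<Sum>k. \<integral>\<^sup>+x. ennreal (32*2^k*(B (k + 2))^2)*indicator {1 - 2*(1/2::real)^k .. 1} x \<partial>lborel)"
  unfolding sq_weight_def by (rule nn_integral_suminf) measurable
 also have "... = (\<Sum>k. ennreal (64*(B (k + 2))^2))"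
 proof (rule suminf_cong)
  fix k
  have "(\<integral>\<^sup>+x. ennreal (32*2^k*(B (k + 2))^2)*indicator {1 - 2*(1/2::real)^k .. 1} x \<partial>lborel) =
   ennreal (32*2^k*(B (k + 2))^2)*ennreal (2*(1/2)^k)"
   by (subst nn_integral_cmult_indicator) auto
  also have "... = ennreal (32*2^k*(B (k + 2))^2*(2*(1/2)^k))" by (rule ennreal_mult[symmetric]) auto
  also have "32*2^k*(B (k + 2))^2*(2*(1/2)^k) = 64*(B (k + 2))^2" by (simp add: power_divide)
  finally show "(\<integral>\<^sup>+x. ennreal (32*2^k*(B (k + 2))^2)*indicator {1 - 2*(1/2::real)^k .. 1} x \<partial>lborel) = ennreal (64*(B (k + 2))^2)" .
 qed
 also have "... = ennreal (64*(\<Sum>k. (B (k + 2))^2))"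
  by (rule suminf_ennreal_eq) (simp, rule sums_mult[OF summable_sums[OF s2]])
 also have "... <= ennreal (64*(\<Sum>J. (B J)^2))"
  using suminf_split_initial_segment[OF B, of 2] by (intro ennreal_leI) (simp add: sum_nonneg)
 finally show ?thesis .
qed

lemma sq_weight_bound:
 assumes sd: "sq_dyadic B h" and x: "0 <= x" "x < 1"
 obtains c where "0 <= c" "ennreal c <= sq_weight B x" "\<And>z. cmod z <= sqrt x ==> (1 - x)*(cmod (frac_deriv1 h z))^2 <= c"
proof -
 have x1: "0 < 1 - x" "1 - x <= 1" using x by auto
 obtain k where k: "(1/2)^k <= 1 - x" "1 - x <= 2*(1/2)^k" using ex_dyadic[OF x1] by blast
 show ?thesis
 proof (rule that)
  show "0 <= 32*2^k*(B (k + 2))^2" by simp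
  have "ennreal (32*2^k*(B (k + 2))^2) = ennreal (32*2^k*(B (k + 2))^2)*indicator {1 - 2*(1/2::real)^k .. 1} x"
   using k x by simp
  also have "... <= sq_weight B x" unfolding sq_weight_def by (rule ennreal_le_suminf)
  finally show "ennreal (32*2^k*(B (k + 2))^2) <= sq_weight B x" .
  fix z assume z: "cmod z <= sqrt x"
  \<comment> \<open>Passing from \<open>x\<close> to its root halves the distance to 1, and the
    squared radius halves it again; hence the index \<open>k + 2\<close>.\<close>
  have "sqrt x <= 1 - (1 - x)/2"
   by (rule real_le_lsqrt) (use x zero_le_power2[of "1 - x"] in "auto simp: power2_eq_square field_simps")
  hence "cmod z <= 1 - (1/2)^Suc k" 
  proof -
   have "(1/2::real)^Suc k <= (1 - x)/2" using k(1) by simp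
   hence "1 - (1 - x)/2 <= 1 - (1/2::real)^Suc k" by (rule diff_left_mono)
   thus ?thesis using z \<open>sqrt x <= 1 - (1 - x) / 2\<close> by (meson order_trans)
  qed
  hence "cmod z <= (rad (k + 2))^2" using rad_sq_ge[of "Suc k"] by simp
  hence "cmod (frac_deriv1 h z) <= 2^(k + 2)*B (k + 2)" using sd unfolding sq_dyadic_def by blast
  hence "(cmod (frac_deriv1 h z))^2 <= (2^(k + 2)*B (k + 2))^2" by (intro power_mono) auto
  hence "(1 - x)*(cmod (frac_deriv1 h z))^2 <= (2*(1/2)^k)*(2^(k + 2)*B (k + 2))^2" using k x by (intro mult_mono) auto
  also have "... = 32*2^k*(B (k + 2))^2" by (simp add: power_mult_distrib power_divide power2_eq_square power_add)
  finally show "(1 - x)*(cmod (frac_deriv1 h z))^2 <= 32*2^k*(B (k + 2))^2" .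
 qed
qed

lemma sq_dyadic_bloch:
 assumes sd: "sq_dyadic B h" and z: "cmod z < 1"
 shows "(1 - cmod z)*cmod (frac_deriv1 h z) <= 4 * sqrt (\<Sum>J. (B J)^2)"
proof -
 have z1: "0 < 1 - cmod z" "1 - cmod z <= 1" using z by auto
 obtain k where k: "(1/2)^k <= 1 - cmod z" "1 - cmod z <= 2*(1/2)^k" using ex_dyadic[OF z1] by blast
 have "cmod z <= (rad (Suc k))^2" using k rad_sq_ge[of k] by linarith
 hence "cmod (frac_deriv1 h z) <= 2^Suc k*B (Suc k)" using sd unfolding sq_dyadic_def by blast
 also have "... <= 2^Suc k * sqrt (\<Sum>J. (B J)^2)"
  by (intro mult_left_mono summable_sq_bounded[where \<theta> = "1/2"]) (use sd in "auto simp: sq_dyadic_def")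
 finally have "(1 - cmod z)*cmod (frac_deriv1 h z) <= (2*(1/2)^k)*(2^Suc k * sqrt (\<Sum>J. (B J)^2))"
  using k z1 by (intro mult_mono) auto
 also have "... = 4 * sqrt (\<Sum>J. (B J)^2)" by (simp add: power_divide)
 finally show ?thesis .
qed

text \<open>All three integrate the derivative of \<open>z * h z\<close>. The third, for the
  difference with a dilation by \<open>1 - d\<close>, is as small as \<open>sqrt d\<close> and
  singular only like an inverse square root, so its square can be paired with the weight
  \<open>1 - x\<close>.\<close>

lemma bloch_integral_bounds:
 assumes h: "hol h" and b: "\<And>z. cmod z < 1 ==> (1 - cmod z)*cmod (frac_deriv1 h z) <= b"
 shows "cmod z < 1 ==> (1 - cmod z)*cmod (h z) <= b"
  and "cmod z <= R ==> cmod w <= R ==> R < 1 ==> (1 - R)*cmod (z*h z - w*h w) <= b*cmod (z - w)"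
  and "0 < d ==> d <= 1 ==> cmod z < 1 ==>
   cmod (h z - of_real (1 - d)*h (of_real (1 - d)*z)) <= 2*b * sqrt d/sqrt (1 - cmod z)"
proof -
 have b0: "0 <= b" using b[of 0] by (simp add: order_trans[OF norm_ge_zero])
 have h0: "frac_deriv1 h 0 = h 0"
 proof -
  have "frac_deriv1 h 0 = taylor_seq h 0"
   using powser_sums_zero[of "%n. of_nat (n + 1)*taylor_seq h n"] by (simp add: frac_deriv1_def sums_iff)
  also have "... = h 0" using sums_unique2[OF powser_sums_zero hol_sums[OF h, of 0]] by simp
  finally show ?thesis .
 qed
 have lip: "(1 - R)*cmod (z*h z - w*h w) <= b*cmod (z - w)" if zw: "cmod z <= R" "cmod w <= R" "R < 1" for z w R
 proof -
  have "cmod (z*h z - w*h w) <= b/(1 - R)*cmod (z - w)"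
  proof (rule field_differentiable_bound[of "cball 0 R" _ "frac_deriv1 h"])
   show "((%z. z*h z) has_field_derivative frac_deriv1 h y) (at y within cball 0 R)" if "y \<in> cball 0 R" for y
    by (rule has_field_derivative_at_within[OF frac_deriv1_has_derivative[OF h]]) (use that zw in auto)
   show "cmod (frac_deriv1 h y) <= b/(1 - R)" if "y \<in> cball 0 R" for y
   proof -
    have "(1 - R)*cmod (frac_deriv1 h y) <= (1 - cmod y)*cmod (frac_deriv1 h y)" using that by (intro mult_right_mono) auto
    also have "... <= b" by (rule b) (use that zw in auto)
    finally show ?thesis using zw by (simp add: field_simps)
   qed
  qed (use zw in auto)
  thus ?thesis using zw by (simp add: field_simps)
 qed
 show "(1 - R)*cmod (z*h z - w*h w) <= b*cmod (z - w)" if "cmod z <= R" "cmod w <= R" "R < 1"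
  by (rule lip[OF that])
 show hb: "(1 - cmod z)*cmod (h z) <= b" if z: "cmod z < 1"
 proof (cases "z = 0")
  case True thus ?thesis using b[of 0] h0 by simp
 next
  case False
  thus ?thesis using lip[of z "cmod z" 0] z by (simp add: norm_mult mult.left_commute)
 qed
 assume d: "0 < d" "d <= 1" and z: "cmod z < 1"
 have sd: "sqrt d * sqrt d = d" "sqrt d <= 1" using d by auto
 have s1: "0 < sqrt (1 - cmod z)" "sqrt (1 - cmod z) <= 1" using z by auto
 show "cmod (h z - of_real (1 - d)*h (of_real (1 - d)*z)) <= 2*b * sqrt d/sqrt (1 - cmod z)"
 proof (cases "z = 0")
  case True
  have "cmod (h z - of_real (1 - d)*h (of_real (1 - d)*z)) = d*cmod (h 0)"
   using True d by (simp add: algebra_simps norm_mult)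
  also have "... <= d*b" using b[of 0] h0 d by (intro mult_left_mono) auto
  also have "... = sqrt d*(sqrt d*b)" using sd by (simp flip: mult.assoc)
  also have "... <= 2*(sqrt d*b)"
  proof (rule mult_right_mono)
   show "sqrt d <= 2" using sd(2) by linarith
  qed (use d b0 in simp)
  finally show ?thesis using True by (simp add: mult_ac)
 next
  case False
  \<comment> \<open>The comparison function \<open>- 2*c * sqrt (1 - t)\<close> has the integrable
    derivative \<open>c/sqrt (1 - t)\<close>.\<close>
  define c where "c = cmod z*b/sqrt (1 - cmod z)"
  have tz: "cmod (of_real t*z) <= cmod z" "cmod (of_real t*z) < 1" if "1 - d <= t" "t <= 1" for t
   using that d z mult_right_mono[of t 1 "cmod z"] by (auto simp: norm_mult)
  have "norm ((of_real 1*z)*h (of_real 1*z) - (of_real (1 - d)*z)*h (of_real (1 - d)*z))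
   <= (- 2*c * sqrt (1 - 1)) - (- 2*c * sqrt (1 - (1 - d)))"
  proof (rule differentiable_bound_general[where f' = "%t. frac_deriv1 h (of_real t*z)*z" and \<phi>' = "%t. c/sqrt (1 - t)"])
   show "1 - d < 1" using d by simp
   have D: "((%t. (of_real t*z)*h (of_real t*z)) has_vector_derivative frac_deriv1 h (of_real t*z)*z) (at t)"
    if t: "1 - d <= t" "t <= 1" for t
   proof -
    have "((%t. of_real t*z) has_vector_derivative z) (at t)"
     by (auto intro!: derivative_eq_intros simp: has_vector_derivative_def scaleR_conv_of_real)
    from field_vector_diff_chain_at[OF this frac_deriv1_has_derivative[OF h tz(2)[OF t]]]
    show ?thesis by (simp add: o_def mult.commute)
   qed
   show "continuous_on {1 - d..1} (%t. (of_real t*z)*h (of_real t*z))"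
    using D by (intro continuous_at_imp_continuous_on ballI) (auto intro: has_vector_derivative_continuous)
   show "continuous_on {1 - d..1} (%t. - 2*c * sqrt (1 - t))" by (intro continuous_intros)
   fix t :: real assume t: "1 - d < t" "t < 1"
   show "((%t. (of_real t*z)*h (of_real t*z)) has_vector_derivative frac_deriv1 h (of_real t*z)*z) (at t)"
    using D t by simp
   show "((%t. - 2*c * sqrt (1 - t)) has_vector_derivative c/sqrt (1 - t)) (at t)"
    unfolding has_real_derivative_iff_has_vector_derivative[symmetric]
    using t by (auto intro!: derivative_eq_intros simp: field_simps)
   let ?s = "1 - cmod (of_real t*z)"
   have ts: "cmod (of_real t*z) = t*cmod z" using t d by (simp add: norm_mult)
   have le: "sqrt (1 - cmod z) <= sqrt ?s" "sqrt (1 - t) <= sqrt ?s"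
    using tz[of t] t z d mult_left_mono[of "cmod z" 1 t] unfolding ts by auto
   \<comment> \<open>The distance to the circle at \<open>t*z\<close> dominates both
     \<open>1 - cmod z\<close> and \<open>1 - t\<close>; taking their geometric mean splits the
     singularity evenly.\<close>
   have "sqrt (1 - cmod z) * sqrt (1 - t) <= sqrt ?s * sqrt ?s" using le t z by (intro mult_mono) auto
   also have "... = ?s" using tz(2)[of t] t by simp
   finally have m: "sqrt (1 - cmod z) * sqrt (1 - t) <= ?s" .
   have "sqrt (1 - cmod z) * sqrt (1 - t)*cmod (frac_deriv1 h (of_real t*z)) <= b"
    using mult_right_mono[OF m norm_ge_zero[of "frac_deriv1 h (of_real t*z)"]] b[OF tz(2)[of t]] t by linarith
   hence "cmod (frac_deriv1 h (of_real t*z)) <= b/(sqrt (1 - cmod z) * sqrt (1 - t))" using s1 t by (simp add: field_simps)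
   hence "cmod (frac_deriv1 h (of_real t*z))*cmod z <= b/(sqrt (1 - cmod z) * sqrt (1 - t))*cmod z" by (rule mult_right_mono) simp
   thus "norm (frac_deriv1 h (of_real t*z)*z) <= c/sqrt (1 - t)" by (simp add: norm_mult c_def mult_ac)
  qed
  hence "cmod (z*(h z - of_real (1 - d)*h (of_real (1 - d)*z))) <= cmod z*(2*b * sqrt d/sqrt (1 - cmod z))"
   by (simp add: c_def algebra_simps)
  hence "cmod z*cmod (h z - of_real (1 - d)*h (of_real (1 - d)*z)) <= cmod z*(2*b * sqrt d/sqrt (1 - cmod z))"
   by (simp only: norm_mult)
  thus ?thesis by (rule mult_left_le_imp_le) (use False in simp)
 qed
qed

text \<open>The product rule for kernel times difference gives two terms. The first has the maximal
  derivative against the mean square of the kernel, at most \<open>d\<close>. The second has the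
  derivative of the kernel against the square-root bound of the difference, and the Dirichlet
  integral of the kernel is bounded. The constant is \<open>8*64 + 256 = 768\<close>, doubled by
  Littlewood-Paley.\<close>

lemma sq_dyadic_local:
 fixes a :: complex
 assumes sd: "sq_dyadic B h" and d: "0 < d" "d <= 1" and a: "cmod a = 1 - d"
  and r: "0 <= r" "r < 1"
 shows "(MEAN w. (cmod (of_real d/(1 - cnj a*(of_real r*w)) *
   (h (of_real r*w) - of_real (1 - d)*h (of_real (1 - d)*(of_real r*w)))))^2) <= 2*(768*d*(\<Sum>J. (B J)^2))"
proof -
 define S where "S = (\<Sum>J. (B J)^2)"
 define b where "b = 4 * sqrt S"
 have S0: "0 <= S" unfolding S_def by (rule suminf_nonneg) (use sd in "auto simp: sq_dyadic_def")
 have h: "hol h" using sd by (simp add: sq_dyadic_def)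
 have bl: "(1 - cmod z)*cmod (frac_deriv1 h z) <= b" if "cmod z < 1" for z
  unfolding b_def S_def by (rule sq_dyadic_bloch[OF sd that])
 note bb = bloch_integral_bounds[OF h bl]
 have b2: "b^2 = 16*S" using S0 by (simp add: b_def power_mult_distrib)
 define Q where "Q z = of_real d/(1 - cnj a*z)" for z
 define T where "T z = of_real d/(1 - cnj a*z)^2" for z
 define g where "g z = h z - of_real (1 - d)*h (of_real (1 - d)*z)" for z
 define G where "G z = Q z*g z" for z
 have small: "cmod (cnj a*z) < 1" if "cmod z < 1" for z
  using that a d mult_right_mono[of "1 - d" 1 "cmod z"] by (simp add: norm_mult)
 have ne: "1 - cnj a*z \<noteq> 0" if "cmod z < 1" for z using small[OF that] by auto
 have hQ: "hol Q" and hT: "hol T"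
  unfolding Q_def T_def by (intro holomorphic_intros; use ne in auto)+
 have hg: "hol g"
  unfolding g_def by (intro holomorphic_intros h dilate_holomorphic(2)) (use d in auto)
 have hG: "hol G" unfolding G_def by (intro holomorphic_intros hQ hg)
 have dz: "cmod (of_real (1 - d)*z) <= cmod z" for z
  using d mult_right_mono[of "1 - d" 1 "cmod z"] by (simp add: norm_mult del: of_real_diff)
 have Dg: "frac_deriv1 g z = frac_deriv1 h z - of_real (1 - d)*frac_deriv1 h (of_real (1 - d)*z)" if z: "cmod z < 1" for z
 proof -
  have "((%z. z*h z) has_field_derivative frac_deriv1 h (of_real (1 - d)*z)) (at (of_real (1 - d)*z))"
   by (rule frac_deriv1_has_derivative[OF h]) (use dz[of z] z in linarith)
  moreover have "((%z. of_real (1 - d)*z) has_field_derivative of_real (1 - d)) (at z)"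
   by (auto intro!: derivative_eq_intros)
  ultimately have "((%z. (of_real (1 - d)*z)*h (of_real (1 - d)*z)) has_field_derivative
   frac_deriv1 h (of_real (1 - d)*z) * of_real (1 - d)) (at z)" by (rule DERIV_chain2)
  from DERIV_diff[OF frac_deriv1_has_derivative[OF h z] this]
  have "((%z. z*g z) has_field_derivative
   frac_deriv1 h z - frac_deriv1 h (of_real (1 - d)*z) * of_real (1 - d)) (at z)" by (simp add: g_def algebra_simps)
  from DERIV_unique[OF frac_deriv1_has_derivative[OF hg z] this] show ?thesis by (simp add: mult.commute)
 qed
 have DG: "frac_deriv1 G z = Q z*frac_deriv1 g z + (z*cnj a*T z)*g z" if z: "cmod z < 1" for z
 proof -
  have "(Q has_field_derivative cnj a*T z) (at z)"
   unfolding Q_def T_def using ne[OF z] by (auto intro!: derivative_eq_intros simp: power2_eq_square)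
  from DERIV_mult[OF frac_deriv1_has_derivative[OF hg z] this]
  have "((%z. z*G z) has_field_derivative Q z*frac_deriv1 g z + (z*cnj a*T z)*g z) (at z)"
   by (simp add: G_def mult_ac add.commute)
  from DERIV_unique[OF frac_deriv1_has_derivative[OF hG z] this] show ?thesis .
 qed
 have sz: "cmod (of_real (sqrt x)*w) = sqrt x" "cmod (of_real (sqrt x)*w) < 1" if "0 <= x" "x < 1" "cmod w = 1" for x w
  using that by (auto simp: norm_mult)
 define M where "M f x = (MEAN w. (cmod (f (of_real (sqrt x)*w)))^2)" for f :: "complex => complex" and x
 have im: "integrable \<T> (%w. (cmod (f (of_real (sqrt x)*w)))^2)"
  if "hol f" "0 <= x" "x < 1" for f :: "complex => complex" and x
  by (rule circle_integrable) (use that in "auto intro!: continuous_intros dilate_holomorphic(3)")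
 obtain E where E: "E \<in> borel_measurable borel" "\<And>x. 0 <= x ==> x < 1 ==> ennreal (M T x) <= E x" "(\<integral>\<^sup>+x. E x \<partial>lborel) <= 1"
  using szego_kernel_mean(2)[OF d a] unfolding M_def T_def by blast
 have M0: "0 <= M f x" for f x unfolding M_def by (rule integral_nonneg_AE) simp
 have main: "indicator {0..1} x*ennreal ((1 - x)*M (frac_deriv1 G) x) <= ennreal (8*d) * sq_weight B x + ennreal (256*S*d)*E x" for x
 proof (cases "x \<in> {0..<1}")
  case True
  hence x: "0 <= x" "x < 1" by auto
  obtain c where c: "0 <= c" "ennreal c <= sq_weight B x" "\<And>z. cmod z <= sqrt x ==> (1 - x)*(cmod (frac_deriv1 h z))^2 <= c"
   using sq_weight_bound[OF sd x] by blast
  have pt: "(1 - x)*(cmod (frac_deriv1 G (of_real (sqrt x)*w)))^2 <=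
   8*c*(cmod (Q (of_real (sqrt x)*w)))^2 + 256*S*d*(cmod (T (of_real (sqrt x)*w)))^2" if "cmod w = 1" for w
  proof -
   define z where "z = of_real (sqrt x)*w"
   have z: "cmod z = sqrt x" "cmod z < 1" using sz[OF x that] by (auto simp: z_def)
   have sq2: "(cmod (u + v))^2 <= 2*(cmod u)^2 + 2*(cmod v)^2" for u v
   proof -
    have "(cmod (u + v))^2 <= (cmod u + cmod v)^2" by (intro power_mono norm_triangle_ineq) simp
    also have "... <= 2*(cmod u)^2 + 2*(cmod v)^2" using sum_squares_bound[of "cmod u" "cmod v"] by (simp add: power2_sum)
    finally show ?thesis .
   qed
   have dg: "(1 - x)*(cmod (frac_deriv1 g z))^2 <= 4*c"
   proof -
    have "(cmod (frac_deriv1 g z))^2 <= 2*(cmod (frac_deriv1 h z))^2 + 2*(cmod (- of_real (1 - d)*frac_deriv1 h (of_real (1 - d)*z)))^2"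
    proof -
     have "frac_deriv1 g z = frac_deriv1 h z + - of_real (1 - d)*frac_deriv1 h (of_real (1 - d)*z)" unfolding Dg[OF z(2)] by (simp only: diff_conv_add_uminus mult_minus_left)
     thus ?thesis by (simp only: sq2)
    qed
    also have "(cmod (- of_real (1 - d)*frac_deriv1 h (of_real (1 - d)*z)))^2 <= (1*cmod (frac_deriv1 h (of_real (1 - d)*z)))^2"
     unfolding norm_mult by (intro power_mono mult_right_mono) (use d in "auto simp del: of_real_diff")
    finally have "(1 - x)*(cmod (frac_deriv1 g z))^2 <= (1 - x)*(2*(cmod (frac_deriv1 h z))^2 + 2*(cmod (frac_deriv1 h (of_real (1 - d)*z)))^2)"
     using x by (intro mult_left_mono) auto
    also have "... <= 4*c"
     using c(3)[of z] c(3)[of "of_real (1 - d)*z"] z dz[of z] by (simp add: algebra_simps)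
    finally show ?thesis .
   qed
   have gb: "(1 - x)*(cmod (g z))^2 <= 128*S*d"
   proof -
    have "(cmod (g z))^2 <= (2*b * sqrt d/sqrt (1 - cmod z))^2"
     unfolding g_def by (intro power_mono bb(3) d z) auto
    also have "... = 64*S*d/(1 - sqrt x)" using d z by (simp add: power_divide power_mult_distrib b2)
    finally have "(1 - x)*(cmod (g z))^2 <= (1 - x)*(64*S*d/(1 - sqrt x))" using x by (intro mult_left_mono) auto
    also have "... = (1 + sqrt x)*(64*S*d)"
    proof -
     have e: "1 - x = (1 + sqrt x)*(1 - sqrt x)" using x by (simp add: algebra_simps)
     show ?thesis unfolding e using z by simp
    qed
    also have "... <= 2*(64*S*d)" using z S0 d by (intro mult_right_mono) auto
    finally show ?thesis by simp
   qed
   have "(1 - x)*(cmod (frac_deriv1 G z))^2 <= (1 - x)*(2*(cmod (Q z*frac_deriv1 g z))^2 + 2*(cmod ((z*cnj a*T z)*g z))^2)"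
    unfolding DG[OF z(2)] using x by (intro mult_left_mono sq2) auto
   also have "(cmod ((z*cnj a*T z)*g z))^2 <= (1*cmod (T z)*cmod (g z))^2"
    unfolding norm_mult using z(2) a d by (intro power_mono mult_right_mono mult_le_one) auto
   also have "(1 - x)*(2*(cmod (Q z*frac_deriv1 g z))^2 + 2*(1*cmod (T z)*cmod (g z))^2) =
    2*(cmod (Q z))^2*((1 - x)*(cmod (frac_deriv1 g z))^2) + 2*(cmod (T z))^2*((1 - x)*(cmod (g z))^2)"
    by (simp add: norm_mult power_mult_distrib algebra_simps)
   also have "... <= 2*(cmod (Q z))^2*(4*c) + 2*(cmod (T z))^2*(128*S*d)"
    by (intro add_mono mult_left_mono dg gb) auto
   finally show ?thesis using x by (simp add: z_def mult_ac mult_left_mono)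
  qed
  have "(1 - x)*M (frac_deriv1 G) x = (MEAN w. (1 - x)*(cmod (frac_deriv1 G (of_real (sqrt x)*w)))^2)"
   by (simp add: M_def)
  also have "... <= (MEAN w. 8*c*(cmod (Q (of_real (sqrt x)*w)))^2 + 256*S*d*(cmod (T (of_real (sqrt x)*w)))^2)"
   by (rule integral_mono)
    (use pt in "auto intro!: integrable_mult_right Bochner_Integration.integrable_add im hQ hT frac_deriv1_holomorphic(1) hG x simp del: integrable_mult_right_iff")
  also have "... = 8*c*M Q x + 256*S*d*M T x"
   using im[OF hQ x] im[OF hT x] by (simp add: M_def)
  also have "... <= 8*d*c + 256*S*d*M T x"
  proof -
   have "M Q x <= d" using szego_kernel_mean(1)[OF d a x] by (simp add: M_def Q_def)
   from mult_left_mono[OF this, of "8*c"] show ?thesis using c(1) by (simp add: mult_ac)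
  qed
  finally have "(1 - x)*M (frac_deriv1 G) x <= 8*d*c + 256*S*d*M T x" .
  hence "ennreal ((1 - x)*M (frac_deriv1 G) x) <= ennreal (8*d*c + 256*S*d*M T x)" by (rule ennreal_leI)
  also have "... = ennreal (8*d)*ennreal c + ennreal (256*S*d)*ennreal (M T x)"
   using d c(1) S0 M0[of T x] by (subst ennreal_plus) (auto simp: ennreal_mult)
  also have "... <= ennreal (8*d) * sq_weight B x + ennreal (256*S*d)*E x"
   by (intro add_mono mult_left_mono c(2) E(2) x) auto
  finally show ?thesis using x by simp
 next
  case False
  thus ?thesis by (cases "x = 1") auto
 qed
 note [measurable] = E(1)
 have "(\<integral>\<^sup>+x. indicator {0..1} x*ennreal ((1 - x)*M (frac_deriv1 G) x) \<partial>lborel) <=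
  (\<integral>\<^sup>+x. ennreal (8*d) * sq_weight B x + ennreal (256*S*d)*E x \<partial>lborel)"
  by (rule nn_integral_mono) (rule main)
 also have "... = ennreal (8*d)*(\<integral>\<^sup>+x. sq_weight B x \<partial>lborel) + ennreal (256*S*d)*(\<integral>\<^sup>+x. E x \<partial>lborel)"
  by (simp add: nn_integral_add nn_integral_cmult)
 also have "... <= ennreal (8*d)*ennreal (64*S) + ennreal (256*S*d)*1"
  by (intro add_mono mult_left_mono) (use sq_weight_integral[OF sd] E(3) in "auto simp: S_def")
 also have "... = ennreal (8*d*(64*S) + 256*S*d)"
 proof -
  have "ennreal (8*d)*ennreal (64*S) = ennreal (8*d*(64*S))"
   by (rule ennreal_mult[symmetric]) (use d S0 in auto)
  thus ?thesis using d S0 by (subst ennreal_plus) auto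
 qed
 also have "8*d*(64*S) + 256*S*d = 768*d*S" by simp
 finally have LP: "(\<integral>\<^sup>+x. indicator {0..1} x*ennreal ((1 - x)*M (frac_deriv1 G) x) \<partial>lborel) <= ennreal (768*d*S)" .
 have "(MEAN w. (cmod (G (of_real r*w)))^2) <= 2*(768*d*S)"
  by (rule integral_sq_le_coeffs[OF hG littlewood_paley[OF hG LP[unfolded M_def]] r]) (use d S0 in auto)
 thus ?thesis unfolding G_def Q_def g_def S_def .
qed

text \<open>The Littlewood-Paley inequality without localisation bounds the \<open>L^2\<close>
  means, so boundary values exist before arcs are considered.\<close>

lemma sq_dyadic_hardy1:
 assumes sd: "sq_dyadic B h"
 shows "h \<in> hardy 1"
proof -
 define S where "S = (\<Sum>J. (B J)^2)"
 have S0: "0 <= S" unfolding S_def by (rule suminf_nonneg) (use sd in "auto simp: sq_dyadic_def")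
 have h: "hol h" using sd by (simp add: sq_dyadic_def)
 have "(\<integral>\<^sup>+x. indicator {0..1} x*ennreal ((1 - x)*(MEAN u. (cmod (frac_deriv1 h (of_real (sqrt x)*u)))^2)) \<partial>lborel) <= (\<integral>\<^sup>+x. sq_weight B x \<partial>lborel)"
 proof (rule nn_integral_mono)
  fix x :: real
  show "indicator {0..1} x*ennreal ((1 - x)*(MEAN u. (cmod (frac_deriv1 h (of_real (sqrt x)*u)))^2)) <= sq_weight B x"
  proof (cases "x \<in> {0..<1}")
   case True
   hence x: "0 <= x" "x < 1" by auto
   obtain c where c: "0 <= c" "ennreal c <= sq_weight B x" "\<And>z. cmod z <= sqrt x ==> (1 - x)*(cmod (frac_deriv1 h z))^2 <= c"
    using sq_weight_bound[OF sd x] by blast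
   have i: "integrable \<T> (%u. (1 - x)*(cmod (frac_deriv1 h (of_real (sqrt x)*u)))^2)"
    by (rule circle_integrable)
     (use x in "auto intro!: continuous_intros dilate_holomorphic(3) frac_deriv1_holomorphic(1) h")
   have "(1 - x)*(MEAN u. (cmod (frac_deriv1 h (of_real (sqrt x)*u)))^2) =
    (MEAN u. (1 - x)*(cmod (frac_deriv1 h (of_real (sqrt x)*u)))^2)" by simp
   also have "... <= (MEAN u. c)"
    by (rule integral_mono[OF i]) (use c(3) x in "auto simp: norm_mult")
   also have "... = c" using circle.prob_space by simp
   finally have "ennreal ((1 - x)*(MEAN u. (cmod (frac_deriv1 h (of_real (sqrt x)*u)))^2)) <= ennreal c" by (rule ennreal_leI)
   thus ?thesis using c(2) x by (auto intro: order_trans)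
  next
   case False
   thus ?thesis by (cases "x = 1") auto
  qed
 qed
 also have "... <= ennreal (64*S)" unfolding S_def by (rule sq_weight_integral[OF sd])
 finally have LP: "(\<integral>\<^sup>+x. indicator {0..1} x*ennreal ((1 - x)*(MEAN u. (cmod (frac_deriv1 h (of_real (sqrt x)*u)))^2)) \<partial>lborel) <= ennreal (64*S)" .
 show ?thesis
 proof (rule hardy1I[OF h])
  fix r :: real assume r: "0 <= r" "r < 1"
  have "(MEAN u. cmod (h (of_real r*u))) <= sqrt (MEAN u. (cmod (h (of_real r*u)))^2)"
   by (rule circle_L1_L2[OF dilate_holomorphic(3)[OF h r]])
  also have "... <= sqrt (2*(64*S))"
   by (intro real_sqrt_le_mono integral_sq_le_coeffs[OF h littlewood_paley[OF h LP] r]) (use S0 in simp)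
  finally show "(MEAN u. cmod (h (of_real r*u))) <= sqrt (2*(64*S))" .
 qed
qed

text \<open>On an arc of measure \<open>2 * \<delta>\<close> the boundary function is compared with
  \<open>v\<close>, a dilation by \<open>1 - \<delta>\<close>. The Bloch bound makes
  \<open>v\<close> nearly constant on the arc, and \<open>sq_dyadic_local\<close> controls the
  difference there in \<open>L^2\<close>.\<close>

lemma sq_dyadic_BMOA:
 assumes sd: "sq_dyadic B h"
 shows "h \<in> BMOA"
proof -
 define S where "S = (\<Sum>J. (B J)^2)"
 define b where "b = 4 * sqrt S"
 have S0: "0 <= S" unfolding S_def by (rule suminf_nonneg) (use sd in "auto simp: sq_dyadic_def")
 have b0: "0 <= b" using S0 by (simp add: b_def)
 have h: "hol h" using sd by (simp add: sq_dyadic_def)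
 have h1: "h \<in> hardy 1" by (rule sq_dyadic_hardy1[OF sd])
 have bl: "(1 - cmod z)*cmod (frac_deriv1 h z) <= b" if "cmod z < 1" for z
  unfolding b_def S_def by (rule sq_dyadic_bloch[OF sd that])
 define f where "f = boundary_fun h"
 have fi: "integrable \<T> f" unfolding f_def by (rule hardy1_boundary(2)[OF h1])
 note [measurable] = borel_measurable_integrable[OF fi]
 have osc: "arc_oscillation I f <= 153600*S + 2 + 32*b" if "I \<in> arcs" for I
 proof -
  from that obtain s t where I: "I = cis ` {s..t}" "s < t" "t <= s + 2*pi" by (auto simp: arcs_def)
  \<comment> \<open>Half the measure of the arc, so that \<open>\<delta> <= 1/2\<close> even for the
    full circle.\<close>
  define \<delta> where "\<delta> = (t - s)/(4*pi)"
  define \<rho> where "\<rho> = 1 - \<delta>"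
  have \<delta>: "0 < \<delta>" "\<delta> <= 1/2" "t - s = 4*pi * \<delta>" using I by (auto simp: \<delta>_def field_simps)
  have \<rho>: "0 <= \<rho>" "\<rho> < 1" using \<delta> by (auto simp: \<rho>_def)
  have Im [measurable]: "I \<in> sets \<T>" and mI: "measure \<T> I = 2 * \<delta>"
   unfolding I(1) using measure_circle_arc[of s t] I \<delta>(3) by auto
  define y where "y = cis ((s + t)/2)"
  define a where "a = of_real \<rho>*y"
  have x1: "cmod y = 1" by (simp add: y_def)
  have ca: "cmod a = 1 - \<delta>" unfolding a_def norm_mult x1 using \<rho> by (simp add: \<rho>_def del: of_real_diff)
  have I1: "cmod u = 1" if "u \<in> I" for u using that by (auto simp: I(1))
  have near: "cmod (u - y) <= 8 * \<delta>" if "u \<in> I" for u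
  proof -
   obtain x where x: "u = cis x" "s <= x" "x <= t" using \<open>u \<in> I\<close> by (auto simp: I(1))
   have "cmod (u - y) <= \<bar>x - (s + t)/2\<bar>" unfolding x(1) y_def by (rule cmod_cis_diff_le)
   also have "... <= (t - s)/2" unfolding abs_le_iff using x by (auto simp: field_simps)
   also have "... = 2*pi * \<delta>" using \<delta>(3) by simp
   also have "... <= 8 * \<delta>" using pi_less_4 \<delta> by (intro mult_right_mono) auto
   finally show ?thesis .
  qed
  define v where "v u = of_real \<rho>*h (of_real \<rho>*u)" for u
  \<comment> \<open>The Lipschitz bound concerns \<open>u * v u\<close>. Separating the factor
    \<open>u\<close> costs a second term of the same size; both are at most
    \<open>b/\<delta>\<close> times a distance of at most \<open>8 * \<delta>\<close>.\<close>
  have lip: "cmod (v u - v y) <= 16*b" if "u \<in> I" for u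
  proof -
   note z1 = I1[OF that]
   have in\<rho>: "cmod (of_real \<rho>*u) <= \<rho>" "cmod (of_real \<rho>*y) <= \<rho>" using \<rho> z1 x1 by (auto simp: norm_mult)
   have "(1 - \<rho>)*cmod ((of_real \<rho>*u)*h (of_real \<rho>*u) - (of_real \<rho>*y)*h (of_real \<rho>*y)) <= b*cmod (of_real \<rho>*u - of_real \<rho>*y)"
    by (rule bloch_integral_bounds(2)[OF h bl in\<rho> \<rho>(2)])
   also have "of_real \<rho>*u - of_real \<rho>*y = of_real \<rho>*(u - y)" by (simp add: algebra_simps)
   also have "cmod (of_real \<rho>*(u - y)) <= 1*cmod (u - y)" unfolding norm_mult using \<rho> by (intro mult_right_mono) auto
   also have "(of_real \<rho>*u)*h (of_real \<rho>*u) - (of_real \<rho>*y)*h (of_real \<rho>*y) = u * v u - y * v y" by (simp add: v_def)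
   finally have 1: "\<delta>*cmod (u * v u - y * v y) <= b*cmod (u - y)" using b0 by (simp add: \<rho>_def mult_left_mono)
   have "(1 - cmod (of_real \<rho>*y))*cmod (h (of_real \<rho>*y)) <= b"
    by (rule bloch_integral_bounds(1)[OF h bl order_le_less_trans[OF in\<rho>(2) \<rho>(2)]])
   hence "\<delta>*cmod (h (of_real \<rho>*y)) <= b" using \<rho> by (simp add: norm_mult x1 \<rho>_def del: of_real_diff)
   moreover have "\<delta>*cmod (v y) <= \<delta>*cmod (h (of_real \<rho>*y))"
    unfolding v_def norm_mult using \<rho> \<delta> by (intro mult_left_mono mult_left_le_one_le) auto
   ultimately have 2: "\<delta>*cmod (v y) <= b" by linarith
   have "u*(v u - v y) = (u * v u - y * v y) + (y - u) * v y" by (simp add: algebra_simps)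
   hence "cmod (u*(v u - v y)) <= cmod (u * v u - y * v y) + cmod ((y - u) * v y)" by (metis norm_triangle_ineq)
   hence "cmod (v u - v y) <= cmod (u * v u - y * v y) + cmod (u - y)*cmod (v y)"
    by (simp add: norm_mult z1 norm_minus_commute)
   hence "\<delta>*cmod (v u - v y) <= \<delta>*(cmod (u * v u - y * v y) + cmod (u - y)*cmod (v y))"
    using \<delta> by (intro mult_left_mono) auto
   also have "... = \<delta>*cmod (u * v u - y * v y) + cmod (u - y)*(\<delta>*cmod (v y))" by (simp add: algebra_simps)
   also have "... <= b*cmod (u - y) + cmod (u - y)*b" by (intro add_mono 1 mult_left_mono 2) simp
   also have "... = 2*b*cmod (u - y)" by simp
   also have "... <= 2*b*(8 * \<delta>)" using b0 by (intro mult_left_mono near[OF that]) simp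
   finally have "\<delta>*cmod (v u - v y) <= \<delta>*(16*b)" by (simp add: mult_ac)
   thus ?thesis by (rule mult_left_le_imp_le) (rule \<delta>(1))
  qed
  define g where "g z = h z - of_real (1 - \<delta>)*h (of_real (1 - \<delta>)*z)" for z
  have hg: "hol g"
   unfolding g_def by (intro holomorphic_intros h dilate_holomorphic(2)) (use \<delta> in auto)
  have gj: "(NN u. indicator I u*ennreal ((cmod (g (of_real (rad j)*u)))^2)) <= ennreal (153600 * \<delta>*S)"
   if j: "(1/2)^j <= \<delta>" for j
  proof -
   define q where "q u = (cmod (of_real \<delta>/(1 - cnj a*(of_real (rad j)*u))*g (of_real (rad j)*u)))^2" for u
   have ne: "1 - cnj a*(of_real (rad j)*u) \<noteq> 0" if "cmod u = 1" for u
   proof -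
    have "cmod (cnj a*(of_real (rad j)*u)) <= cmod a*1"
     unfolding norm_mult using rad[of j] that by (intro mult_mono) auto
    thus ?thesis using ca \<delta> by auto
   qed
   have c: "continuous_on (sphere 0 1) (%u. 1 - cnj a*(of_real (rad j)*u))" by (intro continuous_intros)
   have q0: "0 <= q u" for u by (simp add: q_def)
   have qi: "integrable \<T> q"
    unfolding q_def
    by (intro circle_integrable continuous_on_power continuous_on_norm
      continuous_on_mult[OF continuous_on_divide[OF continuous_on_const c] dilate_holomorphic(3)[OF hg rad(1,2)]])
     (use ne in auto)
   \<comment> \<open>On the arc the denominator of the kernel is at most
     \<open>8 * \<delta> + 2 * \<delta>\<close>, the second part because \<open>j\<close> is so
     large that \<open>1 - rad j <= \<delta>\<close>; hence the factor 100.\<close>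
   have low: "(cmod (g (of_real (rad j)*u)))^2 <= 100*q u" if z: "u \<in> I" for u
   proof -
    note z1 = I1[OF z]
    have "1 - cnj a*(of_real (rad j)*u) = cnj y*(y - u) + of_real (1 - \<rho>*rad j)*(cnj y*u)"
     using x1 complex_norm_square[of y] by (simp add: a_def algebra_simps)
    hence "cmod (1 - cnj a*(of_real (rad j)*u)) <= cmod (cnj y*(y - u)) + cmod (of_real (1 - \<rho>*rad j)*(cnj y*u))"
     by (metis norm_triangle_ineq)
    also have "... = cmod (u - y) + \<bar>1 - \<rho>*rad j\<bar>" by (simp add: norm_mult x1 z1 norm_minus_commute del: of_real_diff of_real_mult)
    also have "\<bar>1 - \<rho>*rad j\<bar> <= 2 * \<delta>"
    proof -
     have "\<rho>*rad j <= 1" using \<rho> rad[of j] by (intro mult_le_one) auto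
     moreover have "1 - \<rho>*rad j = (1 - rad j) + \<delta>*rad j" by (simp add: \<rho>_def algebra_simps)
     moreover have "\<delta>*rad j <= \<delta>*1" using rad[of j] \<delta> by (intro mult_left_mono) auto
     ultimately show ?thesis using rad(3)[of j] j by linarith
    qed
    finally have d: "cmod (1 - cnj a*(of_real (rad j)*u)) <= 10 * \<delta>" using near[OF z] by simp
    have "1 <= 10*cmod (of_real \<delta>/(1 - cnj a*(of_real (rad j)*u)))"
     using d ne[OF z1] \<delta> by (simp add: norm_divide field_simps)
    hence "1*cmod (g (of_real (rad j)*u)) <= 10*cmod (of_real \<delta>/(1 - cnj a*(of_real (rad j)*u)))*cmod (g (of_real (rad j)*u))"
     by (rule mult_right_mono) simp
    hence "cmod (g (of_real (rad j)*u)) <= 10*cmod (of_real \<delta>/(1 - cnj a*(of_real (rad j)*u))*g (of_real (rad j)*u))"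
     by (simp only: norm_mult mult.assoc mult_1)
    hence "(cmod (g (of_real (rad j)*u)))^2 <= (10*cmod (of_real \<delta>/(1 - cnj a*(of_real (rad j)*u))*g (of_real (rad j)*u)))^2"
     by (rule power_mono) simp
    thus ?thesis by (simp add: q_def power_mult_distrib)
   qed
   have "(NN u. indicator I u*ennreal ((cmod (g (of_real (rad j)*u)))^2)) <= (NN u. ennreal (100*q u))"
    by (rule nn_integral_mono) (use low in "auto intro!: ennreal_leI split: split_indicator")
   also have "... = ennreal (MEAN u. 100*q u)"
    by (rule nn_integral_eq_integral) (use qi q0 in auto)
   also have "... <= ennreal (100*(2*(768 * \<delta>*S)))"
    using sq_dyadic_local[OF sd \<delta>(1) _ ca rad(1,2)[of j]] \<delta> by (intro ennreal_leI) (simp add: q_def g_def S_def)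
   also have "100*(2*(768 * \<delta>*S)) = 153600 * \<delta>*S" by simp
   finally show ?thesis .
  qed
  have ev: "eventually (%j. (1/2::real)^j <= \<delta>) sequentially"
  proof -
   have "(%j. (1/2::real)^j) ----> 0" by (rule LIMSEQ_realpow_zero) auto
   from order_tendstoD(2)[OF this \<delta>(1)] show ?thesis by eventually_elim simp
  qed
  have cv: "continuous_on (sphere 0 1) v"
   unfolding v_def by (intro continuous_intros dilate_holomorphic(3) h \<rho>)
  note [measurable] = circle_measurable[OF cv]
  have lim: "AE u in \<T>. ennreal ((cmod (f u - v u))^2) = liminf (%j. ennreal ((cmod (g (of_real (rad j)*u)))^2))"
   using hardy1_boundary(1)[OF h1] AE_space
  proof eventually_elim
   case (elim u)
   have "cmod (of_real \<rho>*u) < 1" using elim \<rho> by (simp add: norm_mult)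
   hence c: "isCont h (of_real \<rho>*u)" using holomorphic_on_imp_continuous_on[OF h] by (simp add: continuous_on_eq_continuous_at)
   have "(%j. of_real \<rho>*(of_real (rad j)*u)) ----> of_real \<rho>*(of_real 1*u)" by (intro tendsto_intros rad_tendsto)
   hence "(%j. h (of_real \<rho>*(of_real (rad j)*u))) ----> h (of_real \<rho>*u)" using c by (intro isCont_tendsto_compose[of _ h]) auto
   hence "(%j. g (of_real (rad j)*u)) ----> f u - of_real \<rho>*h (of_real \<rho>*u)"
    unfolding g_def \<rho>_def[symmetric] f_def by (intro tendsto_intros elim(1))
   hence "(%j. ennreal ((cmod (g (of_real (rad j)*u)))^2)) ----> ennreal ((cmod (f u - v u))^2)"
    unfolding v_def by (intro tendsto_intros tendsto_ennrealI)
   from lim_imp_Liminf[OF sequentially_bot this] show ?case by simp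
  qed
  have mg: "(%u. g (of_real (rad j)*u)) \<in> borel_measurable \<T>" for j
   by (rule circle_measurable[OF dilate_holomorphic(3)[OF hg rad(1,2)]])
  note [measurable] = mg
  have "(NN u. indicator I u*ennreal ((cmod (f u - v u))^2)) =
   (NN u. liminf (%j. indicator I u*ennreal ((cmod (g (of_real (rad j)*u)))^2)))"
  proof (rule nn_integral_cong_AE)
   show "AE u in \<T>. indicator I u*ennreal ((cmod (f u - v u))^2) = liminf (%j. indicator I u*ennreal ((cmod (g (of_real (rad j)*u)))^2))"
    using lim by eventually_elim (auto split: split_indicator simp: Liminf_const)
  qed
  also have "... <= liminf (%j. \<integral>\<^sup>+u. indicator I u*ennreal ((cmod (g (of_real (rad j)*u)))^2) \<partial>\<T>)"
   by (rule nn_integral_liminf) measurable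
  also have "... <= liminf (%j. ennreal (153600 * \<delta>*S))"
   by (rule Liminf_mono) (use ev in "eventually_elim, auto intro: gj")
  also have "... = ennreal (153600 * \<delta>*S)" by (simp add: Liminf_const)
  finally have L2: "(NN u. indicator I u*ennreal ((cmod (f u - v u))^2)) <= ennreal (153600 * \<delta>*S)" .
  have pt: "indicator I u*ennreal (cmod (f u - v y)) <= indicator I u*ennreal ((cmod (f u - v u))^2) + ennreal (1 + 16*b)*indicator I u" for u
  proof (cases "u \<in> I")
   case True
   have "cmod (f u - v y) <= cmod (f u - v u) + cmod (v u - v y)" using norm_triangle_ineq[of "f u - v u" "v u - v y"] by simp
   \<comment> \<open>After normalisation the square is bounded on average by a constant, so this
     crude inequality can replace Cauchy-Schwarz.\<close>
   moreover have "cmod (f u - v u) <= (cmod (f u - v u))^2 + 1"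
    using sum_squares_bound[of "cmod (f u - v u)" 1] norm_ge_zero[of "f u - v u"]
    unfolding one_power2 mult_1_right by linarith
   ultimately have "cmod (f u - v y) <= (cmod (f u - v u))^2 + (1 + 16*b)" using lip[OF True] by linarith
   hence "ennreal (cmod (f u - v y)) <= ennreal ((cmod (f u - v u))^2 + (1 + 16*b))" by (rule ennreal_leI)
   also have "... = ennreal ((cmod (f u - v u))^2) + ennreal (1 + 16*b)" using b0 by (intro ennreal_plus) auto
   finally show ?thesis using True by simp
  qed simp
  have "(NN u. indicator I u*ennreal (cmod (f u - v y))) <=
   (NN u. indicator I u*ennreal ((cmod (f u - v u))^2) + ennreal (1 + 16*b)*indicator I u)"
   by (rule nn_integral_mono) (rule pt)
  also have "... = (NN u. indicator I u*ennreal ((cmod (f u - v u))^2)) + ennreal (1 + 16*b)*emeasure \<T> I"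
   by (subst nn_integral_add) (auto simp: nn_integral_cmult_indicator)
  also have "emeasure \<T> I = ennreal (2 * \<delta>)" by (simp add: circle.emeasure_eq_measure mI)
  also have "ennreal (1 + 16*b)*ennreal (2 * \<delta>) = ennreal ((1 + 16*b)*(2 * \<delta>))" by (rule ennreal_mult[symmetric]) (use b0 \<delta> in auto)
  also have "(NN u. indicator I u*ennreal ((cmod (f u - v u))^2)) + ennreal ((1 + 16*b)*(2 * \<delta>)) <=
   ennreal (153600 * \<delta>*S) + ennreal ((1 + 16*b)*(2 * \<delta>))" by (intro add_mono L2) simp
  also have "... = ennreal (153600 * \<delta>*S + (1 + 16*b)*(2 * \<delta>))" using b0 \<delta> S0 by (intro ennreal_plus[symmetric]) auto
  also have "153600 * \<delta>*S + (1 + 16*b)*(2 * \<delta>) = (153600*S + 2 + 32*b) * \<delta>" by (simp add: algebra_simps)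
  finally have nn: "(NN u. indicator I u*ennreal (cmod (f u - v y))) <= ennreal ((153600*S + 2 + 32*b) * \<delta>)" .
  have si: "integrable \<T> (%u. indicat_real I u *\<^sub>R cmod (f u - v y))"
   by (rule integrable_mult_indicator) (use fi in auto)
  have "ennreal (LINT u:I|\<T>. cmod (f u - v y)) = (NN u. ennreal (indicat_real I u *\<^sub>R cmod (f u - v y)))"
   unfolding set_lebesgue_integral_def by (rule nn_integral_eq_integral[OF si, symmetric]) auto
  also have "... = (NN u. indicator I u*ennreal (cmod (f u - v y)))"
   by (rule nn_integral_cong) (auto split: split_indicator)
  finally have e: "ennreal (LINT u:I|\<T>. cmod (f u - v y)) = (NN u. indicator I u*ennreal (cmod (f u - v y)))" .
  have K0: "0 <= (153600*S + 2 + 32*b) * \<delta>" using b0 \<delta>(1) S0 by simp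
  have "(LINT u:I|\<T>. cmod (f u - v y)) <= (153600*S + 2 + 32*b) * \<delta>"
   using nn unfolding e[symmetric] ennreal_le_iff[OF K0] .
  hence "2*(LINT u:I|\<T>. cmod (f u - v y))/measure \<T> I <= 153600*S + 2 + 32*b"
   unfolding mI using \<delta> by (simp add: field_simps)
  moreover have "arc_oscillation I f <= 2*(LINT u:I|\<T>. cmod (f u - v y))/measure \<T> I"
   by (rule arc_oscillation_le[OF fi Im]) (use mI \<delta> in simp)
  ultimately show ?thesis by linarith
 qed
 hence "bdd_above ((%I. arc_oscillation I (boundary_fun h)) ` arcs)" unfolding f_def by (intro bdd_aboveI2) auto
 thus ?thesis using h1 by (simp add: BMOA_def)
qed

text \<open>For \<open>s\<close> between \<open>(1/2)^Suc k\<close> and \<open>(1/2)^k\<close>,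
  monotonicity of the rearrangement bounds the integrand below by the \<open>k\<close>-th dyadic
  value, up to the factor \<open>2 powr (-1/p)\<close>.\<close>

lemma lorentz_dyadic_summable:
 assumes g: "g \<in> borel_measurable \<T>" and q: "0 < q" and p: "0 < p"
  and fin: "lorentz_norm p (ereal q) g < \<infinity>"
 shows "summable (%i. (rearrangement g ((1/2)^i)*((1/2)^i) powr (1/p)) powr q)"
proof -
 define x where "x i = rearrangement g ((1/2)^i)*((1/2)^i) powr (1/p)" for i
 define \<Phi> where "\<Phi> s = (rearrangement g s * s powr (1/p)) powr q/s" for s
 have r0: "0 <= rearrangement g s" if "0 < s" for s by (rule rearrangement_nonneg[OF g that])
 have x0: "0 <= x i" for i using r0 by (simp add: x_def)
 have I: "(\<integral>\<^sup>+ s\<in>{0<..<1}. ennreal (\<Phi> s) \<partial>lborel) \<noteq> \<infinity>"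
  using fin unfolding lorentz_norm_def \<Phi>_def by (auto simp: Let_def split: if_splits)
 define c where "c = (2 powr (-1/p)) powr q"
 have c0: "0 < c" by (simp add: c_def)
 \<comment> \<open>Open intervals are pairwise disjoint, so at most one summand is nonzero at each
   \<open>s\<close>.\<close>
 define E where "E i = {(1/2::real)^Suc i<..<(1/2)^i}" for i
 have pt: "(\<Sum>i. ennreal (c*x i powr q*2^i)*indicator (E i) s) <= ennreal (\<Phi> s)*indicator {0<..<1} s" for s
 proof (cases "\<exists>k. s \<in> E k")
  case True
  then obtain k where k: "s \<in> E k" by blast
  have ks: "(1/2)^Suc k < s" "s < (1/2)^k" using k by (auto simp: E_def)
  have s0: "0 < s" "s < 1"
  proof -
   have "(0::real) < (1/2)^Suc k" by simp
   thus "0 < s" using ks by linarith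
   have "(1/2::real)^k <= 1" by (rule power_le_one) auto
   thus "s < 1" using ks by linarith
  qed
  have other: "s \<notin> E i" if "i \<noteq> k" for i
  proof
   assume i: "s \<in> E i"
   have *: False if "a < b" "s \<in> E a" "s \<in> E b" for a b
   proof -
    have "(1/2::real)^b <= (1/2)^Suc a" using that by (intro power_decreasing) auto
    thus False using that unfolding E_def by (meson greaterThanLessThan_iff less_le_trans not_less_iff_gr_or_eq)
   qed
   show False using *[of i k] *[of k i] i k that by (metis nat_neq_iff)
  qed
  have "c*x k powr q*2^k <= \<Phi> s"
  proof -
   have "x k*2 powr (-1/p) <= rearrangement g s * s powr (1/p)"
   proof -
    have "x k*2 powr (-1/p) = rearrangement g ((1/2)^k)*((1/2)^Suc k) powr (1/p)"
     by (simp add: x_def powr_mult powr_divide powr_minus field_simps)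
    also have "... <= rearrangement g s * s powr (1/p)"
     by (intro mult_mono rearrangement_antimono[OF g] powr_mono2) (use ks s0 p r0 in auto)
    finally show ?thesis .
   qed
   hence "(x k*2 powr (-1/p)) powr q <= (rearrangement g s * s powr (1/p)) powr q"
    using q x0 by (intro powr_mono2) auto
   moreover have "(x k*2 powr (-1/p)) powr q = c*x k powr q" by (simp add: c_def powr_mult)
   moreover have "2^k <= 1/s" using ks s0 by (simp add: field_simps power_divide)
   ultimately have "(c*x k powr q)*2^k <= (rearrangement g s * s powr (1/p)) powr q*(1/s)"
    by (intro mult_mono) auto
   thus ?thesis by (simp add: \<Phi>_def)
  qed
  hence "ennreal (c*x k powr q*2^k) <= ennreal (\<Phi> s)" by (rule ennreal_leI)
  moreover have "(\<Sum>i. ennreal (c*x i powr q*2^i)*indicator (E i) s) = (\<Sum>i\<in>{k}. ennreal (c*x i powr q*2^i)*indicator (E i) s)"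
   by (rule suminf_finite) (use other in auto)
  ultimately show ?thesis using k s0 by simp
 next
  case False
  hence "(\<Sum>i. ennreal (c*x i powr q*2^i)*indicator (E i) s) = 0" by simp
  thus ?thesis by simp
 qed
 have "(\<Sum>i. ennreal (c/2*x i powr q)) = (\<Sum>i. \<integral>\<^sup>+s. ennreal (c*x i powr q*2^i)*indicator (E i) s \<partial>lborel)"
 proof (rule suminf_cong)
  fix i
  have "(\<integral>\<^sup>+s. ennreal (c*x i powr q*2^i)*indicator (E i) s \<partial>lborel) = ennreal (c*x i powr q*2^i)*ennreal ((1/2)^i - (1/2)^Suc i)"
   unfolding E_def by (subst nn_integral_cmult_indicator) auto
  also have "... = ennreal (c*x i powr q*2^i*((1/2)^i - (1/2)^Suc i))" by (rule ennreal_mult[symmetric]) (use c0 in auto)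
  also have "c*x i powr q*2^i*((1/2)^i - (1/2)^Suc i) = c/2*x i powr q" by (simp add: power_divide)
  finally show "ennreal (c/2*x i powr q) = (\<integral>\<^sup>+s. ennreal (c*x i powr q*2^i)*indicator (E i) s \<partial>lborel)" by simp
 qed
 also have "... = (\<integral>\<^sup>+s. (\<Sum>i. ennreal (c*x i powr q*2^i)*indicator (E i) s) \<partial>lborel)"
  by (rule nn_integral_suminf[symmetric]) (simp add: E_def)
 also have "... <= (\<integral>\<^sup>+ s\<in>{0<..<1}. ennreal (\<Phi> s) \<partial>lborel)" by (rule nn_integral_mono) (rule pt)
 finally have "(\<Sum>i. ennreal (c/2*x i powr q)) \<noteq> \<top>" using I by (auto simp: top_unique)
 hence "summable (%i. c/2*x i powr q)" by (intro summable_suminf_not_top) (use c0 in auto)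
 from summable_mult[OF this, of "2/c"] show ?thesis using c0 by (simp add: x_def)
qed

lemma lam_class_BMOA:
 assumes l: "l \<in> lam_class m p" and m: "1 <= m" and p: "0 < p" "p < 1" and q: "0 < q" "q <= 2"
 shows "l \<in> multipliers (seq_space (hardy_lorentz p (ereal q))) (seq_space BMOA)"
 unfolding multipliers_def
proof (intro CollectI ballI)
 fix w assume "w \<in> seq_space (hardy_lorentz p (ereal q))"
 then obtain f where f: "f \<in> hardy_lorentz p (ereal q)" "w = taylor_seq f" by (auto simp: seq_space_def)
 have fs: "f \<in> smirnov" using f by (simp add: hardy_lorentz_def)
 note h = smirnov_holomorphic[OF fs]
 define x where "x i = rearrangement (boundary_fun f) ((1/2)^i)*((1/2)^i) powr (1/p)" for i
 have mb: "boundary_fun f \<in> borel_measurable \<T>" by (rule measurable_boundary_fun[OF h])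
 have x0: "0 <= x i" for i unfolding x_def by (intro mult_nonneg_nonneg rearrangement_nonneg[OF mb]) auto
 have sq: "summable (%i. x i powr q)"
  unfolding x_def by (rule lorentz_dyadic_summable[OF mb q(1) p(1)]) (use f in "simp add: hardy_lorentz_def")
 \<comment> \<open>The terms are eventually at most 1, and then \<open>q <= 2\<close> makes the
   square the smaller power.\<close>
 have sx: "summable (%i. (x i)^2)"
 proof (rule summable_comparison_test_ev[OF _ sq])
  have "eventually (%i. x i powr q < 1) sequentially" by (rule order_tendstoD(2)[OF summable_LIMSEQ_zero[OF sq]]) simp
  thus "eventually (%i. norm ((x i)^2) <= x i powr q) sequentially"
  proof eventually_elim
   case (elim i)
   have "x i <= 1"
   proof (rule ccontr)
    assume "\<not> x i <= 1"
    hence "1 <= x i powr q" using q by (intro ge_one_powr_ge_zero) auto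
    thus False using elim by simp
   qed
   hence "x i powr 2 <= x i powr q" using x0 q by (intro powr_mono') auto
   thus ?case using x0[of i] by (cases "x i = 0") (auto simp: powr_numeral)
  qed
 qed
 note sd = smirnov_dyadic[OF fs p(1)]
 define v where "v = wlevel p (%i. max 1 (rearrangement (boundary_fun f) ((1/2)^i)))"
 define t where "t = 2 powr (-1/p)"
 have t: "0 <= t" "t < 1" using two_powr_lt_1[OF p(1)] by (auto simp: t_def)
 have v0: "0 <= v i" for i by (simp add: v_def wlevel_def max_def)
 have vle: "v i <= t^i + x i" for i using sd(3)[of i] unfolding v_def x_def t_def .
 have sv: "summable (%i. (v i)^2)"
 proof (rule summable_comparison_test')
  show "summable (%i. 2*(t^2)^i + 2*(x i)^2)"
   by (intro summable_add summable_mult sx summable_geometric) (use t in "auto simp: power_less_one_iff")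
  fix i
  have "(v i)^2 <= (t^i + x i)^2" using v0 vle by (intro power_mono) auto
  also have "... <= 2*(t^i)^2 + 2*(x i)^2" using sum_squares_bound[of "t^i" "x i"] by (simp add: power2_sum)
  finally show "norm ((v i)^2) <= 2*(t^2)^i + 2*(x i)^2" by (simp flip: power_mult add: mult.commute)
 qed
 obtain C where C: "0 <= C" "\<And>f u k V J z. poisson_dominated p u f ==> dyadic_level p u k ==> (\<And>i. wlevel p k i <= V) ==>
  cmod z <= (rad J)^2 ==> cmod (frac_deriv1 (mult_fun l f) z) <= 2^J*(C*gconv (mtheta p) (gconv (mtheta p) (wlevel p k)) (J + 2))"
  using lam_deriv_bound[OF l m p] by blast
 note th = mtheta[OF p]
 have V: "v i <= sqrt (\<Sum>i. (v i)^2)" for i by (rule summable_sq_bounded[OF th(1,2) v0 sv])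
 define G where "G = gconv (mtheta p) (gconv (mtheta p) v)"
 have g0: "0 <= gconv (mtheta p) v j" for j by (rule gconv_nonneg[OF th(1,2) v0 V])
 have sg: "summable (%j. (gconv (mtheta p) v j)^2)" by (rule gconv_l2[OF th(1,2) v0 sv])
 have G0: "0 <= G j" for j unfolding G_def by (rule gconv_nonneg[OF th(1,2) g0 summable_sq_bounded[OF th(1,2) g0 sg]])
 have sG: "summable (%j. (G j)^2)" unfolding G_def by (rule gconv_l2[OF th(1,2) g0 sg])
 have "sq_dyadic (%J. C*G (J + 2)) (mult_fun l f)"
  unfolding sq_dyadic_def
 proof (intro conjI allI impI)
  show "hol (mult_fun l f)" by (rule lam_mult_fun(1)[OF l h])
  show "0 <= C*G (J + 2)" for J using C(1) G0 by simp
  show "summable (%J. (C*G (J + 2))^2)"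
   unfolding power_mult_distrib by (intro summable_mult summable_ignore_initial_segment sG)
  show "cmod (frac_deriv1 (mult_fun l f) z) <= 2^J*(C*G (J + 2))" if "cmod z <= (rad J)^2" for J z
   using C(2)[OF sd(1,2) V[unfolded v_def] that] by (simp only: G_def v_def)
 qed
 hence "mult_fun l f \<in> BMOA" by (rule sq_dyadic_BMOA)
 moreover have "(%n. l n*w n) = taylor_seq (mult_fun l f)" by (simp only: f(2) lam_mult_fun(2)[OF l h])
 ultimately show "(%n. l n*w n) \<in> seq_space BMOA" unfolding seq_space_def by (metis imageI)
qed

section \<open>The dual is contained in the coefficient class\<close>

lemma binomial_series:
 fixes x :: complex
 assumes "cmod x < 1"
 shows "(%n. of_nat ((n + m) choose m)*x^n) sums (1/(1 - x)^(m + 1))"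
 using assms
proof (induction m arbitrary: x)
 case 0
 thus ?case using geometric_sums[of x] by simp
next
 case (Suc m)
 have s: "summable (%n. cmod (of_nat ((n + m) choose m))*cmod x^n)"
  by (rule abs_summable_disk) (use Suc in "auto simp: sums_iff")
 have g: "summable (%n. norm (x^n))" using Suc.prems by (simp add: norm_power summable_geometric)
 have "(%k. \<Sum>i\<le>k. (of_nat ((i + m) choose m)*x^i)*x^(k - i)) sums
  ((\<Sum>n. of_nat ((n + m) choose m)*x^n)*(\<Sum>n. x^n))"
  by (rule Cauchy_product_sums) (use s g in "simp_all add: norm_mult norm_power")
 moreover have "(\<Sum>i\<le>k. (of_nat ((i + m) choose m)*x^i)*x^(k - i)) = of_nat ((k + Suc m) choose Suc m)*x^k" for k
 proof -
  have "(\<Sum>i\<le>k. (of_nat ((i + m) choose m)*x^i)*x^(k - i)) = (\<Sum>i\<le>k. of_nat ((i + m) choose m)*x^k)"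
   by (intro sum.cong) (auto simp: mult.assoc simp flip: power_add)
  also have "... = of_nat (\<Sum>i\<le>k. (m + i) choose m)*x^k" by (simp add: sum_distrib_right add.commute)
  also have "(\<Sum>i\<le>k. (m + i) choose m) = (m + k + 1) choose (m + 1)" by (rule choose_rising_sum(1))
  finally show ?thesis by (simp add: add.commute)
 qed
 moreover have "(\<Sum>n. of_nat ((n + m) choose m)*x^n)*(\<Sum>n. x^n) = 1/(1 - x)^(Suc m + 1)"
  using Suc.IH[OF Suc.prems] geometric_sums[of x] Suc.prems by (simp add: sums_iff)
 ultimately show ?case by simp
qed

text \<open>From the identity expressing \<open>(n + 1)*((n + m) choose m)\<close> by the binomials
  of orders \<open>m + 1\<close> and \<open>m\<close>, so the generating function is a combination
  of two kernels.\<close>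

lemma gam_sums:
 assumes "cmod x < 1"
 shows "(%n. of_real (gam m n)*x^n) sums (of_nat (m + 1)/(1 - x)^(m + 2) - of_nat m/(1 - x)^(m + 1))"
proof -
 have e: "real (m + 1)*real ((n + (m + 1)) choose (m + 1)) - real m*real ((n + m) choose m) = gam m n" for n
 proof -
  have "Suc m*(Suc (n + m) choose Suc m) = Suc (n + m)*((n + m) choose m)" using Suc_times_binomial_eq[of "n + m" m] by (simp only: mult.commute)
  hence "real (Suc m)*real (Suc (n + m) choose Suc m) = real (Suc (n + m))*real ((n + m) choose m)"
   by (metis of_nat_mult)
  thus ?thesis by (simp add: gam_def algebra_simps)
 qed
 have "(%n. of_nat (m + 1)*(of_nat ((n + (m + 1)) choose (m + 1))*x^n) - of_nat m*(of_nat ((n + m) choose m)*x^n)) sums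
  (of_nat (m + 1)*(1/(1 - x)^(m + 1 + 1)) - of_nat m*(1/(1 - x)^(m + 1)))"
  by (intro sums_diff sums_mult binomial_series assms)
 moreover have "(%n. of_nat (m + 1)*(of_nat ((n + (m + 1)) choose (m + 1))*x^n) - of_nat m*(of_nat ((n + m) choose m)*x^n)) =
  (%n. of_real (gam m n)*x^n)"
 proof
  fix n
  have "complex_of_real (gam m n) = of_nat (m + 1) * of_nat ((n + (m + 1)) choose (m + 1)) - of_nat m * of_nat ((n + m) choose m)"
   unfolding e[symmetric] by simp
  thus "of_nat (m + 1)*(of_nat ((n + (m + 1)) choose (m + 1))*x^n) - of_nat m*(of_nat ((n + m) choose m)*x^n) = of_real (gam m n)*x^n"
   by (simp only: left_diff_distrib mult.assoc)
 qed
 ultimately show ?thesis by simp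
qed

lemma hardy_normI:
 assumes f: "hol f" and p: "0 < p" and K: "\<And>r. 0 <= r ==> r < 1 ==> hardy_mean p f r <= K"
 shows "f \<in> hardy p" "hardy_norm p f <= K powr (1/p)"
proof -
 show h: "f \<in> hardy p" unfolding hardy_def H_disk_def using f K by (auto intro!: bdd_aboveI2)
 have "(SUP r\<in>{0..<1}. hardy_mean p f r) <= K" by (rule cSUP_least) (use K in auto)
 thus "hardy_norm p f <= K powr (1/p)"
  unfolding hardy_norm_def using p hardyD(4)[OF h] by (intro powr_mono2) auto
qed

lemma hardy_norm_bounded:
 assumes f: "hol f" and p: "0 < p" and K: "0 <= K" "\<And>z. cmod z < 1 ==> cmod (f z) <= K"
 shows "f \<in> hardy p" "hardy_norm p f <= K"
proof -
 have m: "hardy_mean p f r <= K powr p" if r: "0 <= r" "r < 1" for r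
 proof -
  have "hardy_mean p f r <= (MEAN u. K powr p)"
   unfolding hardy_mean_def
  proof (rule integral_mono[OF continuous_dilate_powr[OF f p r]])
   fix u assume "u \<in> space \<T>"
   thus "cmod (f (of_real r*u)) powr p <= K powr p"
    using r p by (intro powr_mono2 K) (auto simp: norm_mult)
  qed simp
  thus ?thesis using circle.prob_space by simp
 qed
 show "f \<in> hardy p" by (rule hardy_normI(1)[OF f p m])
 have "hardy_norm p f <= (K powr p) powr (1/p)" by (rule hardy_normI(2)[OF f p m])
 thus "hardy_norm p f <= K" using K p by (simp add: powr_powr)
qed

text \<open>Continuity at 0 and scaling. A positive majorant \<open>N\<close> in place of the norm
  avoids dividing by a norm that may vanish.\<close>

lemma hardy_functional_bounded:
 assumes F: "hardy_functional p \<phi>" and p: "0 < p"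
 obtains C where "0 <= C" "\<And>f N. f \<in> hardy p ==> 0 < N ==> hardy_norm p f <= N ==> cmod (\<phi> f) <= C*N"
proof -
 have cm: "\<And>c f. f \<in> hardy p ==> \<phi> (%z. c*f z) = c * \<phi> f" using F by (simp add: hardy_functional_def)
 have one: "(%z. z^0) \<in> hardy p" by (rule hardy_power[OF p])
 have zero: "(%z. 0) \<in> hardy p" using hardy_add_cmult[OF p one one, of "-1"] by simp
 have z0: "\<phi> (%z. 0) = 0" using cm[OF zero, of 0] by simp
 have scale: "(%z. c*f z) \<in> hardy p" if "f \<in> hardy p" for c f using hardy_add_cmult[OF p zero that, of c] by simp
 have sn: "hardy_norm p (%z. of_real c*f z) <= c*hardy_norm p f" if f: "f \<in> hardy p" and c: "0 <= c" for c f
 proof -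
  define M where "M = (SUP r\<in>{0..<1}. hardy_mean p f r)"
  have "hardy_norm p (%z. of_real c*f z) <= (c powr p*M) powr (1/p)"
  proof (rule hardy_normI(2)[OF hardyD(1)[OF scale[OF f]] p])
   fix r :: real assume r: "0 <= r" "r < 1"
   have "hardy_mean p (%z. of_real c*f z) r = c powr p*hardy_mean p f r"
    using c by (simp add: hardy_mean_def norm_mult powr_mult)
   thus "hardy_mean p (%z. of_real c*f z) r <= c powr p*M"
    using hardyD(3)[OF f r] by (simp add: M_def mult_left_mono)
  qed
  also have "... = (c powr p) powr (1/p)*M powr (1/p)" by (rule powr_mult)
  also have "... = c*hardy_norm p f" using c p by (simp add: powr_powr hardy_norm_def M_def)
  finally show ?thesis .
 qed
 obtain d where d: "d > 0" "\<And>g. g \<in> hardy p ==> hardy_norm p (%z. g z - 0) < d ==> cmod (\<phi> g - \<phi> (%z. 0)) < 1"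
  using F zero unfolding hardy_functional_def by (meson zero_less_one)
 show ?thesis
 proof (rule that[of "2/d"])
  show "0 <= 2/d" using d by simp
  fix f N assume f: "f \<in> hardy p" and N: "0 < N" "hardy_norm p f <= N"
  define c where "c = d/(2*N)"
  have c: "0 < c" using d N by (simp add: c_def)
  have "hardy_norm p (%z. of_real c*f z) <= c*N" using sn[OF f, of c] c N mult_left_mono[OF N(2), of c] by linarith
  also have "... < d" using N d by (simp add: c_def)
  finally have "cmod (\<phi> (%z. of_real c*f z) - \<phi> (%z. 0)) < 1" by (intro d(2) scale f) simp
  hence "c*cmod (\<phi> f) < 1" using c by (simp add: cm[OF f] z0 norm_mult)
  thus "cmod (\<phi> f) <= 2/d*N" using N d by (simp add: c_def field_simps)
 qed
qed

text \<open>The excess power \<open>s - 2\<close> is estimated by the minimal distance, and the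
  remaining square is a Poisson kernel at \<open>cnj (w * r)\<close>, of mean 1.\<close>

lemma kernel_power_mean:
 assumes w: "cmod w < 1" and r: "0 <= r" "r < 1" and s: "2 <= s"
 shows "(MEAN u. cmod (1 - w*(of_real r*u)) powr (- s)) <= (1 - cmod w) powr (1 - s)"
proof -
 define y where "y = cnj (w * of_real r)"
 have yw: "cmod y <= cmod w" using r mult_left_mono[of r 1 "cmod w"] by (simp add: y_def norm_mult)
 hence y: "cmod y < 1" using w by simp
 have k: "cmod (1 - w*(of_real r*u)) = cmod (u - y)" if "cmod u = 1" for u
 proof -
  have "cnj (1 - w*(of_real r*u)) = cnj u*(u - y)"
   using that complex_norm_square[of u] by (simp add: y_def algebra_simps)
  hence "cmod (1 - w*(of_real r*u)) = cmod (cnj u*(u - y))" by (metis complex_mod_cnj)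
  thus ?thesis using that by (simp add: norm_mult)
 qed
 have D: "0 < 1 - (cmod y)^2" "1 - cmod w <= 1 - (cmod y)^2"
  using y yw one_minus_sq_ge[of "cmod y"] by auto
 have pt: "cmod (1 - w*(of_real r*u)) powr (- s) <= (1 - cmod w) powr (2 - s)*(1/(1 - (cmod y)^2))*pk y u" if z: "cmod u = 1" for u
 proof -
  have d: "1 - cmod w <= cmod (u - y)" using circle_dist_ge[OF z, of y] yw by linarith
  have d0: "0 < cmod (u - y)" using d w by linarith
  have "cmod (u - y) powr (- s) = cmod (u - y) powr (2 - s)*cmod (u - y) powr (-2)" by (simp flip: powr_add)
  also have "cmod (u - y) powr (2 - s) <= (1 - cmod w) powr (2 - s)" by (rule powr_mono2') (use d w s in auto)
  also have "cmod (u - y) powr (-2) = 1/(cmod (u - y))^2" using d0 by (simp add: powr_minus_divide powr_numeral)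
  also have "(1 - cmod w) powr (2 - s)*(1/(cmod (u - y))^2) = (1 - cmod w) powr (2 - s)*(1/(1 - (cmod y)^2))*pk y u"
   using D by (simp add: pk_def)
  finally show ?thesis unfolding k[OF z] by (simp add: mult_right_mono)
 qed
 have ne: "1 - w*(of_real r*u) \<noteq> 0" if "cmod u = 1" for u
  using k[OF that] circle_dist_ge[OF that, of y] y by auto
 have "(MEAN u. cmod (1 - w*(of_real r*u)) powr (- s)) <=
  (MEAN u. (1 - cmod w) powr (2 - s)*(1/(1 - (cmod y)^2))*pk y u)"
 proof (rule integral_mono)
  show "integrable \<T> (%u. cmod (1 - w*(of_real r*u)) powr (- s))"
   by (rule circle_integrable, rule continuous_on_powr) (use ne in "auto intro!: continuous_intros")
  show "integrable \<T> (%u. (1 - cmod w) powr (2 - s)*(1/(1 - (cmod y)^2))*pk y u)"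
   by (rule integrable_mult_right) (rule integrable_pk[OF y])
 qed (use pt in simp)
 also have "... = (1 - cmod w) powr (2 - s)*(1/(1 - (cmod y)^2))" using integral_pk[OF y] by simp
 also have "... <= (1 - cmod w) powr (2 - s)*(1/(1 - cmod w))" using D w by (intro mult_left_mono divide_left_mono) auto
 also have "... = (1 - cmod w) powr (1 - s)" using w by (simp add: powr_diff powr_minus divide_simps power2_eq_square)
 finally show ?thesis .
qed

text \<open>The kernel \<open>F w\<close> has Taylor coefficients \<open>gam m n * w^n\<close>, so
  the functional maps it to \<open>lam_fun m l w\<close>. Its leading power is \<open>m + 2\<close>,
  whence the condition \<open>(m + 2)*p >= 2\<close> for \<open>kernel_power_mean\<close>.\<close>

lemma dual_subset_lam_class:
 assumes p: "0 < p" and m: "2 <= (real m + 2)*p"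
 shows "hardy_dual p \<subseteq> lam_class m p"
proof
 fix l assume "l \<in> hardy_dual p"
 then obtain \<phi> where F: "hardy_functional p \<phi>" and l: "l = (%n. \<phi> (%z. z^n))" by (auto simp: hardy_dual_def)
 obtain C where C: "0 <= C" "\<And>f N. f \<in> hardy p ==> 0 < N ==> hardy_norm p f <= N ==> cmod (\<phi> f) <= C*N"
  using hardy_functional_bounded[OF F p] by blast
 have ad: "\<And>f g. f \<in> hardy p ==> g \<in> hardy p ==> \<phi> (%z. f z + g z) = \<phi> f + \<phi> g"
  and cm: "\<And>c f. f \<in> hardy p ==> \<phi> (%z. c*f z) = c * \<phi> f" using F by (auto simp: hardy_functional_def)
 have one: "(%z. z^0) \<in> hardy p" by (rule hardy_power[OF p])
 have zero: "(%z. 0) \<in> hardy p" using hardy_add_cmult[OF p one one, of "-1"] by simp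
 have scale: "(%z. c*f z) \<in> hardy p" if "f \<in> hardy p" for c f using hardy_add_cmult[OF p zero that, of c] by simp
 have lin: "\<phi> (%z. f z + c*g z) = \<phi> f + c * \<phi> g" if "f \<in> hardy p" "g \<in> hardy p" for f g c
  using ad[OF that(1) scale[OF that(2), of c]] cm[OF that(2), of c] by simp
 define F where "F w z = of_nat (m + 1)/(1 - w*z)^(m + 2) - of_nat m/(1 - w*z)^(m + 1)" for w z :: complex
 define P where "P w N z = (\<Sum>n<N. (of_real (gam m n)*w^n)*z^n)" for w z :: complex and N
 have wz: "cmod (w*z) < 1" if "cmod w < 1" "cmod z < 1" for w z
  using that mult_strict_mono[of "cmod w" 1 "cmod z" 1] by (simp add: norm_mult)
 have ne: "1 - w*z \<noteq> 0" if "cmod w < 1" "cmod z < 1" for w z using wz[OF that] by auto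
 have hF: "hol (F w)" if "cmod w < 1" for w
  unfolding F_def using ne[OF that] by (intro holomorphic_intros) auto
 have Fs: "(%n. (of_real (gam m n)*w^n)*z^n) sums F w z" if "cmod w < 1" "cmod z < 1" for w z
  using gam_sums[OF wz[OF that], of m] by (simp add: F_def power_mult_distrib mult.assoc)
 have bF: "F w \<in> hardy p \<and> hardy_norm p (F w) <= (3*real m + 1)*(1 - cmod w) powr (1/p - real m - 2)" if w: "cmod w < 1" for w
 proof -
  define s where "s = (real m + 2)*p"
  have mean: "hardy_mean p (F w) r <= (3*real m + 1) powr p*(1 - cmod w) powr (1 - s)" if r: "0 <= r" "r < 1" for r
  proof -
   have ne': "1 - w*(of_real r*u) \<noteq> 0" if "cmod u = 1" for u by (rule ne[OF w]) (use that r in "simp add: norm_mult")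
   have "hardy_mean p (F w) r <= (MEAN u. (3*real m + 1) powr p*cmod (1 - w*(of_real r*u)) powr (- s))"
    unfolding hardy_mean_def
   proof (rule integral_mono[OF continuous_dilate_powr[OF hF[OF w] p r]])
    show "integrable \<T> (%u. (3*real m + 1) powr p*cmod (1 - w*(of_real r*u)) powr (- s))"
     by (rule integrable_mult_right, rule circle_integrable, rule continuous_on_powr) (use ne' in "auto intro!: continuous_intros")
    fix u assume "u \<in> space \<T>"
    hence z: "cmod u = 1" by simp
    define x where "x = 1 - w*(of_real r*u)"
    have x0: "x \<noteq> 0" unfolding x_def by (rule ne'[OF z])
    have x2: "cmod x <= 2"
    proof -
     have "cmod (w*(of_real r*u)) < 1" by (rule wz[OF w]) (use z r in "simp add: norm_mult")
     thus ?thesis unfolding x_def using norm_triangle_ineq4[of 1 "w*(of_real r*u)"] by simp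
    qed
    have "F w (of_real r*u) = (of_nat (m + 1) - of_nat m*x)/x^(m + 2)"
     unfolding F_def x_def[symmetric] using x0 by (simp add: field_simps)
    hence "cmod (F w (of_real r*u)) = cmod (of_nat (m + 1) - of_nat m*x)/cmod x^(m + 2)" by (simp only: norm_divide norm_power)
    also have "cmod (of_nat (m + 1) - of_nat m*x) <= real (m + 1) + real m*cmod x"
     using norm_triangle_ineq4[of "of_nat (m + 1)" "of_nat m*x"] by (simp only: norm_mult norm_of_nat)
    also have "... <= 3*real m + 1" using mult_left_mono[OF x2, of "real m"] by simp
    also have "(3*real m + 1)/cmod x^(m + 2) = (3*real m + 1)*cmod x powr (- (real m + 2))"
    proof -
     have "cmod x powr (- (real m + 2)) = 1/cmod x powr (real (m + 2))"
      by (simp only: powr_minus_divide of_nat_add of_nat_numeral)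
     also have "cmod x powr (real (m + 2)) = cmod x^(m + 2)" using x0 by (intro powr_realpow) simp
     finally show ?thesis by simp
    qed
    finally have "cmod (F w (of_real r*u)) <= (3*real m + 1)*cmod x powr (- (real m + 2))"
     by (simp add: divide_right_mono)
    hence "cmod (F w (of_real r*u)) powr p <= ((3*real m + 1)*cmod x powr (- (real m + 2))) powr p"
     using p by (intro powr_mono2) auto
    also have "... = (3*real m + 1) powr p*(cmod x powr (- (real m + 2))) powr p" by (rule powr_mult)
    also have "(cmod x powr (- (real m + 2))) powr p = cmod x powr (- s)" by (simp add: powr_powr s_def algebra_simps)
    finally show "cmod (F w (of_real r*u)) powr p <= (3*real m + 1) powr p*cmod (1 - w*(of_real r*u)) powr (- s)"
     unfolding x_def .
   qed
   also have "... = (3*real m + 1) powr p*(MEAN u. cmod (1 - w*(of_real r*u)) powr (- s))" by simp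
   also have "... <= (3*real m + 1) powr p*(1 - cmod w) powr (1 - s)"
    by (intro mult_left_mono kernel_power_mean w r) (use m in "auto simp: s_def")
   finally show ?thesis .
  qed
  have "hardy_norm p (F w) <= ((3*real m + 1) powr p*(1 - cmod w) powr (1 - s)) powr (1/p)"
   by (rule hardy_normI(2)[OF hF[OF w] p mean])
  also have "... = ((3*real m + 1) powr p) powr (1/p)*((1 - cmod w) powr (1 - s)) powr (1/p)" by (rule powr_mult)
  also have "((3*real m + 1) powr p) powr (1/p) = 3*real m + 1" using p by (simp add: powr_powr)
  also have "((1 - cmod w) powr (1 - s)) powr (1/p) = (1 - cmod w) powr (1/p - real m - 2)"
   using p by (simp add: powr_powr s_def field_simps)
  finally show ?thesis using hardy_normI(1)[OF hF[OF w] p mean] by simp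
 qed
 have Pl: "P w N \<in> hardy p \<and> \<phi> (P w N) = (\<Sum>n<N. of_real (gam m n)*l n*w^n)" for w N
 proof (induction N)
  case 0
  have "P w 0 = (%z. 0)" by (simp add: P_def fun_eq_iff)
  thus ?case using zero cm[OF zero, of 0] by simp
 next
  case (Suc N)
  have e: "P w (Suc N) = (%z. P w N z + (of_real (gam m N)*w^N)*z^N)" by (simp add: P_def fun_eq_iff)
  have "P w (Suc N) \<in> hardy p" unfolding e by (rule hardy_add_cmult[OF p conjunct1[OF Suc] hardy_power[OF p]])
  moreover have "\<phi> (P w (Suc N)) = (\<Sum>n<Suc N. of_real (gam m n)*l n*w^n)"
   unfolding e lin[OF conjunct1[OF Suc] hardy_power[OF p]] using Suc by (simp add: l mult_ac)
  ultimately show ?case by blast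
 qed
 have ls: "(%n. of_real (gam m n)*l n*w^n) sums \<phi> (F w)" if w: "cmod w < 1" for w
 proof -
  have gs: "summable (%n. gam m n*cmod w^n)"
  proof -
   have "summable (%n. cmod (of_real (gam m n))*cmod w^n)"
    by (rule abs_summable_disk) (use gam_sums w in "auto simp: sums_iff")
   moreover have "cmod (of_real (gam m n)) = gam m n" for n using gam_ge_1[of m n] by simp
   ultimately show ?thesis by simp
  qed
  \<comment> \<open>The tail bounds the distance of \<open>F w\<close> to its Taylor polynomial
    uniformly on the disk, hence in \<open>H^p\<close>; therefore the functional may be applied term
    by term.\<close>
  define T where "T N = (\<Sum>n. gam m (n + N)*cmod w^(n + N))" for N
  have \<tau>0: "0 <= T N" for N
   unfolding T_def by (intro suminf_nonneg summable_ignore_initial_segment gs mult_nonneg_nonneg) (use gam_ge_1 in "auto intro: order_trans[OF zero_le_one]")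
  have \<tau>l: "T ----> 0"
  proof -
   have "(%N. suminf (%n. gam m n*cmod w^n) - (\<Sum>n<N. gam m n*cmod w^n)) ---->
    suminf (%n. gam m n*cmod w^n) - suminf (%n. gam m n*cmod w^n)"
    by (intro tendsto_intros summable_LIMSEQ gs)
   moreover have "T = (%N. suminf (%n. gam m n*cmod w^n) - (\<Sum>n<N. gam m n*cmod w^n))"
    unfolding T_def by (rule ext) (rule suminf_minus_initial_segment[OF gs])
   ultimately show ?thesis by simp
  qed
  have d: "cmod (\<phi> (F w) - \<phi> (P w N)) <= C*(T N + 1/real (Suc N))" for N
  proof -
   define D where "D = (%z. F w z + (-1)*P w N z)"
   have Dh: "D \<in> hardy p" unfolding D_def using bF[OF w] Pl[of w N] by (intro hardy_add_cmult p) auto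
   have "cmod (D z) <= T N" if z: "cmod z < 1" for z
   proof -
    have "(%n. (of_real (gam m (n + N))*w^(n + N))*z^(n + N)) sums D z"
     using sums_split_initial_segment[OF Fs[OF w z], of N] by (simp add: D_def P_def)
    hence "D z = (\<Sum>n. (of_real (gam m (n + N))*w^(n + N))*z^(n + N))" by (simp add: sums_iff)
    moreover have "cmod (\<Sum>n. (of_real (gam m (n + N))*w^(n + N))*z^(n + N)) <= T N"
     unfolding T_def
    proof (rule norm_suminf_le[OF _ summable_ignore_initial_segment[OF gs]])
     fix n
     have "cmod z^(n + N) <= 1" using z by (intro power_le_one) auto
     thus "cmod ((of_real (gam m (n + N))*w^(n + N))*z^(n + N)) <= gam m (n + N)*cmod w^(n + N)"
      using gam_ge_1[of m "n + N"] mult_left_mono[of "cmod z^(n + N)" 1 "gam m (n + N)*cmod w^(n + N)"]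
      by (simp add: norm_mult norm_power)
    qed
    ultimately show ?thesis by simp
   qed
   hence "hardy_norm p D <= T N" by (intro hardy_norm_bounded(2)[OF hardyD(1)[OF Dh] p \<tau>0])
   \<comment> \<open>The added reciprocal makes the majorant of the norm strictly positive, as the
     bound of the functional requires.\<close>
   moreover have "0 < 1/real (Suc N)" by simp
   ultimately have "cmod (\<phi> D) <= C*(T N + 1/real (Suc N))" using \<tau>0[of N] by (intro C(2) Dh) linarith+
   moreover have "\<phi> D = \<phi> (F w) - \<phi> (P w N)" unfolding D_def using lin[of "F w" "P w N" "-1"] bF[OF w] Pl[of w N] by simp
   ultimately show ?thesis by simp
  qed
  have "(%N. \<phi> (P w N)) ----> \<phi> (F w)"
  proof (rule Lim_null[THEN iffD2], rule Lim_null_comparison)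
   show "\<forall>\<^sub>F N in sequentially. norm (\<phi> (P w N) - \<phi> (F w)) <= C*(T N + 1/real (Suc N))"
    using d by (simp add: norm_minus_commute)
   have "(%N. C*(T N + 1/real (Suc N))) ----> C*(0 + 0)"
    by (intro tendsto_intros \<tau>l LIMSEQ_Suc[OF lim_const_over_n])
   thus "(%N. C*(T N + 1/real (Suc N))) ----> 0" by simp
  qed
  hence "(%N. \<Sum>n<N. of_real (gam m n)*l n*w^n) ----> \<phi> (F w)" using Pl by simp
  thus ?thesis by (simp add: sums_def)
 qed
 have "cmod (lam_fun m l w) <= C*(3*real m + 1)*(1 - cmod w) powr (1/p - real m - 2)" if w: "cmod w < 1" for w
 proof -
  have "lam_fun m l w = \<phi> (F w)" using ls[OF w] by (simp add: lam_fun_def sums_iff)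
  moreover have "0 < (3*real m + 1)*(1 - cmod w) powr (1/p - real m - 2)" using w by (intro mult_pos_pos) auto
  ultimately show ?thesis using C(2)[of "F w"] bF[OF w] by (simp add: mult.assoc)
 qed
 thus "l \<in> lam_class m p" unfolding lam_class_def using ls by (auto simp: sums_iff)
qed

section \<open>A gliding hump for the reverse inclusions\<close>

text \<open>A superposition of dilations multiplies the coefficients by the moments
  \<open>M n\<close>. It is used with the binomials for the hump itself and with the weighted
  multiplier for the derivative of its image.\<close>

lemma mixture_sums:
 fixes b :: "nat => complex" and c r :: "nat => real"
 assumes b: "summable (%n. cmod (b n*z^n))" and c: "\<And>k. 0 <= c k" "summable c" and r: "\<And>k. 0 <= r k" "\<And>k. r k <= 1"
 defines "M \<equiv> %n. \<Sum>k. c k*r k^n"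
 shows "summable (%n. b n * of_real (M n)*z^n)"
  and "(%k. of_real (c k)*(\<Sum>n. b n*(of_real (r k)*z)^n)) sums (\<Sum>n. b n * of_real (M n)*z^n)"
proof -
 have rn: "0 <= r k^n" "r k^n <= 1" for k n using r by (auto intro: power_le_one)
 have cr: "c k*r k^n <= c k" "0 <= c k*r k^n" for k n using mult_left_mono[OF rn(2) c(1)] c rn by auto
 have sm: "summable (%k. c k*r k^n)" for n
  by (rule summable_comparison_test'[OF c(2), of 0]) (use cr in auto)
 define T where "T N = (\<Sum>k. c (k + N))" for N
 have sc: "summable (%k. c (k + N))" for N by (rule summable_ignore_initial_segment[OF c(2)])
 have \<tau>l: "T ----> 0"
 proof -
  have "(%N. suminf c - (\<Sum>k<N. c k)) ----> suminf c - suminf c" by (intro tendsto_intros summable_LIMSEQ c)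
  moreover have "T = (%N. suminf c - (\<Sum>k<N. c k))" unfolding T_def by (rule ext) (rule suminf_minus_initial_segment[OF c(2)])
  ultimately show ?thesis by simp
 qed
 have tail: "0 <= M n - (\<Sum>k<N. c k*r k^n)" "M n - (\<Sum>k<N. c k*r k^n) <= T N" for n N
 proof -
  have e: "M n - (\<Sum>k<N. c k*r k^n) = (\<Sum>k. c (k + N)*r (k + N)^n)"
   unfolding M_def by (rule suminf_minus_initial_segment[OF sm, symmetric])
  have s: "summable (%k. c (k + N)*r (k + N)^n)" by (rule summable_ignore_initial_segment[OF sm])
  show "0 <= M n - (\<Sum>k<N. c k*r k^n)" unfolding e by (rule suminf_nonneg[OF s]) (use cr in auto)
  show "M n - (\<Sum>k<N. c k*r k^n) <= T N" unfolding e T_def by (rule suminf_le[OF _ s sc]) (use cr in auto)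
 qed
 have bnd: "cmod (b n * of_real y*z^n) <= cmod (b n*z^n)*t" if "0 <= y" "y <= t" for n y t
 proof -
  have "cmod (b n * of_real y*z^n) = cmod (b n*z^n)*y" using that by (simp add: norm_mult)
  also have "... <= cmod (b n*z^n)*t" using that by (intro mult_left_mono) auto
  finally show ?thesis .
 qed
 show sb: "summable (%n. b n * of_real (M n)*z^n)"
  by (rule summable_comparison_test'[OF summable_mult2[OF b, of "T 0"], of 0]) (use bnd[OF tail[of _ 0, simplified]] in simp)
 have sk: "summable (%n. b n * of_real (r k^n)*z^n)" for k
  by (rule summable_comparison_test'[OF summable_mult2[OF b, of 1], of 0]) (rule bnd[OF rn])
 have part: "cmod ((\<Sum>k<N. of_real (c k)*(\<Sum>n. b n*(of_real (r k)*z)^n)) - (\<Sum>n. b n * of_real (M n)*z^n)) <= (\<Sum>n. cmod (b n*z^n))*T N" for N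
 proof -
  have "(\<Sum>k<N. of_real (c k)*(\<Sum>n. b n*(of_real (r k)*z)^n)) = (\<Sum>k<N. \<Sum>n. of_real (c k)*(b n * of_real (r k^n)*z^n))"
   by (subst suminf_mult[OF sk]) (simp add: power_mult_distrib mult.assoc)
  also have "... = (\<Sum>n. \<Sum>k<N. of_real (c k)*(b n * of_real (r k^n)*z^n))"
   by (rule suminf_sum[symmetric]) (intro summable_mult sk)
  finally have e1: "(\<Sum>k<N. of_real (c k)*(\<Sum>n. b n*(of_real (r k)*z)^n)) = (\<Sum>n. \<Sum>k<N. of_real (c k)*(b n * of_real (r k^n)*z^n))" .
  have st: "summable (%n. \<Sum>k<N. of_real (c k)*(b n * of_real (r k^n)*z^n))" by (intro summable_sum summable_mult sk)
  have "(\<Sum>n. b n * of_real (M n)*z^n) - (\<Sum>k<N. of_real (c k)*(\<Sum>n. b n*(of_real (r k)*z)^n)) =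
   (\<Sum>n. b n * of_real (M n)*z^n - (\<Sum>k<N. of_real (c k)*(b n * of_real (r k^n)*z^n)))"
   unfolding e1 by (rule suminf_diff[OF sb st])
  also have "(%n. b n * of_real (M n)*z^n - (\<Sum>k<N. of_real (c k)*(b n * of_real (r k^n)*z^n))) =
    (%n. b n * of_real (M n - (\<Sum>k<N. c k*r k^n))*z^n)"
   by (simp add: fun_eq_iff algebra_simps sum_distrib_left)
  finally have e2: "(\<Sum>n. b n * of_real (M n)*z^n) - (\<Sum>k<N. of_real (c k)*(\<Sum>n. b n*(of_real (r k)*z)^n)) =
   (\<Sum>n. b n * of_real (M n - (\<Sum>k<N. c k*r k^n))*z^n)" .
  have e: "cmod ((\<Sum>k<N. of_real (c k)*(\<Sum>n. b n*(of_real (r k)*z)^n)) - (\<Sum>n. b n * of_real (M n)*z^n)) =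
   cmod (\<Sum>n. b n * of_real (M n - (\<Sum>k<N. c k*r k^n))*z^n)" by (subst norm_minus_commute) (simp only: e2)
  have "cmod (\<Sum>n. b n * of_real (M n - (\<Sum>k<N. c k*r k^n))*z^n) <= (\<Sum>n. cmod (b n*z^n)*T N)"
   by (rule norm_suminf_le[OF bnd[OF tail] summable_mult2[OF b]])
  also have "... = (\<Sum>n. cmod (b n*z^n))*T N" by (rule suminf_mult2[OF b, symmetric])
  finally show ?thesis unfolding e .
 qed
 show "(%k. of_real (c k)*(\<Sum>n. b n*(of_real (r k)*z)^n)) sums (\<Sum>n. b n * of_real (M n)*z^n)"
  unfolding sums_def
 proof (rule Lim_null[THEN iffD2], rule Lim_null_comparison)
  show "\<forall>\<^sub>F N in sequentially. norm ((\<Sum>k<N. of_real (c k)*(\<Sum>n. b n*(of_real (r k)*z)^n)) - (\<Sum>n. b n * of_real (M n)*z^n)) <= (\<Sum>n. cmod (b n*z^n))*T N"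
   using part by simp
  have "(%N. (\<Sum>n. cmod (b n*z^n))*T N) ----> (\<Sum>n. cmod (b n*z^n))*0" by (intro tendsto_intros \<tau>l)
  thus "(%N. (\<Sum>n. cmod (b n*z^n))*T N) ----> 0" by simp
 qed
qed

text \<open>The point \<open>s*z\<close> is within \<open>1 - s\<close> of \<open>z\<close>, and its
  distance to 1 is itself at least \<open>1 - s\<close>.\<close>

lemma segment_dist:
 assumes z: "cmod z <= 1" and s: "0 <= s" "s <= 1"
 shows "1 - s <= cmod (1 - of_real s*z)" "cmod (1 - z)/2 <= cmod (1 - of_real s*z)"
proof -
 have "s*cmod z <= s*1" using z s by (intro mult_left_mono) auto
 thus 1: "1 - s <= cmod (1 - of_real s*z)" using norm_triangle_ineq2[of 1 "of_real s*z"] s by (simp add: norm_mult)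
 have "1 - z = (1 - of_real s*z) - of_real (1 - s)*z" by (simp add: algebra_simps)
 hence "cmod (1 - z) <= cmod (1 - of_real s*z) + cmod (of_real (1 - s)*z)" by (metis norm_triangle_ineq4)
 also have "cmod (of_real (1 - s)*z) <= (1 - s)*1" unfolding norm_mult using z s by (intro mult_mono) (auto simp del: of_real_diff)
 finally show "cmod (1 - z)/2 <= cmod (1 - of_real s*z)" using 1 by simp
qed

text \<open>Jordan's inequality turns the chord bound \<open>x\<close> into the angle bound
  \<open>pi*x/2\<close>, an arc of measure \<open>x/2\<close>; for \<open>x > 2\<close> the total
  mass suffices.\<close>

lemma measure_near_one:
 assumes x: "0 < x"
 shows "{u \<in> sphere 0 1. cmod (1 - u) <= x} \<in> sets \<T>"
  and "measure \<T> {u \<in> sphere 0 1. cmod (1 - u) <= x} <= x"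
proof -
 have "{u \<in> space \<T>. cmod (1 - u) <= x} \<in> sets \<T>" by measurable
 thus m: "{u \<in> sphere 0 1. cmod (1 - u) <= x} \<in> sets \<T>" by simp
 show "measure \<T> {u \<in> sphere 0 1. cmod (1 - u) <= x} <= x"
 proof (cases "x <= 2")
  case True
  let ?a = "pi*x/2"
  have a: "0 <= ?a" "?a <= pi" using True x by auto
  have A: "cis ` {-?a..?a} \<in> sets \<T>" "measure \<T> (cis ` {-?a..?a}) = (?a - (-?a))/(2*pi)"
   by (rule measure_circle_arc; use a in linarith)+
  have "{u \<in> sphere 0 1. cmod (1 - u) <= x} \<subseteq> cis ` {-?a..?a}"
  proof
   fix u assume "u \<in> {u \<in> sphere 0 1. cmod (1 - u) <= x}"
   hence z: "cmod u = 1" "cmod (1 - u) <= x" by auto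
   have e: "u = cis (Arg u)" using z(1) by (metis cis_Arg_unique norm_zero zero_neq_one cis_Arg sgn_eq div_by_1 of_real_1)
   have "\<bar>0 - Arg u\<bar> <= pi" using Arg_bounded[of u] by auto
   from cmod_cis_diff_ge[OF this] have "2/pi * \<bar>Arg u\<bar> <= cmod (1 - u)" using e by simp
   hence "2/pi * \<bar>Arg u\<bar> <= x" using z(2) by linarith
   hence "\<bar>Arg u\<bar> <= ?a" by (simp add: field_simps)
   hence "cis (Arg u) \<in> cis ` {-?a..?a}" by (intro imageI) (auto simp: abs_le_iff)
   thus "u \<in> cis ` {-?a..?a}" by (simp only: e[symmetric])
  qed
  hence "measure \<T> {u \<in> sphere 0 1. cmod (1 - u) <= x} <= measure \<T> (cis ` {-?a..?a})"
   by (rule circle.finite_measure_mono[OF _ A(1)])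
  also have "... = x/2" unfolding A(2) by (simp add: field_simps)
  finally show ?thesis using x by simp
 next
  case False
  thus ?thesis using circle.prob_le_1[of "{u \<in> sphere 0 1. cmod (1 - u) <= x}"] by linarith
 qed
qed

text \<open>The mean value of \<open>Ln (1 - r*z)\<close> is 0, so all dilated integrals equal
  \<open>ln 2\<close>, and Fatou's lemma applies because the factor 2 makes the integrands
  nonnegative. At \<open>u = 1\<close> the default values give \<open>ln (2/0) = 0\<close>.\<close>

lemma log_integrable_near_one: "integrable \<T> (%u. ln (2/cmod (1 - u)))"
proof (rule integrableI_bounded)
 have pos: "0 < Re (1 - of_real (rad j)*z)" if "cmod z <= 1" for j z
 proof -
  have "cmod (of_real (rad j)*z) < 1" using rad[of j] that mult_left_mono[of "cmod z" 1 "rad j"] by (simp add: norm_mult)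
  thus ?thesis using complex_Re_le_cmod[of "of_real (rad j)*z"] by simp
 qed
 have ne: "1 - of_real (rad j)*z \<noteq> 0" if "cmod z <= 1" for j z using pos[OF that, of j] by force
 have le2: "cmod (1 - of_real (rad j)*z) <= 2" if "cmod z <= 1" for j z
 proof -
  have "cmod (of_real (rad j)*z) <= 1" using rad[of j] that by (auto simp: norm_mult intro!: mult_le_one)
  thus ?thesis using norm_triangle_ineq4[of 1 "of_real (rad j)*z"] by simp
 qed
 have np: "1 - of_real (rad j)*z \<notin> \<real>\<^sub>\<le>\<^sub>0" if "cmod z <= 1" for j z using pos[OF that, of j] by (auto simp: complex_nonpos_Reals_iff)
 have mv: "(MEAN u. ln (2/cmod (1 - of_real (rad j)*u))) = ln 2"
  and im: "integrable \<T> (%u. ln (2/cmod (1 - of_real (rad j)*u)))" for j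
 proof -
  have c: "continuous_on (cball 0 1) (%z. Ln (1 - of_real (rad j)*z))" by (intro continuous_intros) (use np in auto)
  have h: "hol (%z. Ln (1 - of_real (rad j)*z))" by (intro holomorphic_intros) (use np in auto)
  have cs: "continuous_on (sphere 0 1) (%z. Ln (1 - of_real (rad j)*z))" by (rule continuous_on_subset[OF c]) auto
  have e: "ln (2/cmod (1 - of_real (rad j)*u)) = ln 2 - Re (Ln (1 - of_real (rad j)*u))" if "cmod u = 1" for u
   using ne[of u j] that by (simp add: ln_div)
  have i: "integrable \<T> (%u. Re (Ln (1 - of_real (rad j)*u)))"
   by (rule integrable_Re[OF circle_integrable[OF cs]])
  have i2: "integrable \<T> (%u. ln 2 - Re (Ln (1 - of_real (rad j)*u)))" using i by simp
  show "integrable \<T> (%u. ln (2/cmod (1 - of_real (rad j)*u)))"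
   using i2 by (rule Bochner_Integration.integrable_cong[OF refl, THEN iffD2, rotated]) (use e in simp)
  have "(MEAN u. ln (2/cmod (1 - of_real (rad j)*u))) = (MEAN u. ln 2 - Re (Ln (1 - of_real (rad j)*u)))"
   by (rule Bochner_Integration.integral_cong) (use e in auto)
  also have "... = ln 2 - Re (MEAN u. Ln (1 - of_real (rad j)*u))"
   using i circle.prob_space integral_Re[OF circle_integrable[OF cs]] by simp
  also have "(MEAN u. Ln (1 - of_real (rad j)*u)) = 0" using circle_mean_value[OF c h] by simp
  finally show "(MEAN u. ln (2/cmod (1 - of_real (rad j)*u))) = ln 2" by simp
 qed
 have nn: "0 <= ln (2/cmod (1 - u))" if "cmod u = 1" for u
 proof (cases "u = 1")
  case False
  have "cmod (1 - u) <= 2" using norm_triangle_ineq4[of 1 u] that by simp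
  thus ?thesis using False by (simp add: ln_ge_zero)
 qed simp
 have "(NN u. ennreal (norm (ln (2/cmod (1 - u))))) <=
  (NN u. liminf (%j. ennreal (ln (2/cmod (1 - of_real (rad j)*u)))))"
 proof (rule nn_integral_mono)
  fix u assume "u \<in> space \<T>"
  hence z: "cmod u = 1" by simp
  show "ennreal (norm (ln (2/cmod (1 - u)))) <= liminf (%j. ennreal (ln (2/cmod (1 - of_real (rad j)*u))))"
  proof (cases "u = 1")
   case False
   have "(%j. cmod (1 - of_real (rad j)*u)) ----> cmod (1 - of_real 1*u)" by (intro tendsto_intros rad_tendsto)
   hence c: "(%j. cmod (1 - of_real (rad j)*u)) ----> cmod (1 - u)" by simp
   have "(%j. ln (2/cmod (1 - of_real (rad j)*u))) ----> ln (2/cmod (1 - u))"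
    by (rule tendsto_ln[OF tendsto_divide[OF tendsto_const c]]) (use False in auto)
   from lim_imp_Liminf[OF sequentially_bot tendsto_ennrealI[OF this]] show ?thesis using nn[OF z] by simp
  qed simp
 qed
 also have "... <= liminf (%j. \<integral>\<^sup>+u. ennreal (ln (2/cmod (1 - of_real (rad j)*u))) \<partial>\<T>)"
  by (rule nn_integral_liminf) measurable
 also have "... = liminf (%j. ennreal (ln 2))"
 proof -
  have "(NN u. ennreal (ln (2/cmod (1 - of_real (rad j)*u)))) = ennreal (ln 2)" for j
   unfolding mv[of j, symmetric]
  proof (rule nn_integral_eq_integral[OF im], rule AE_I2)
   fix u assume "u \<in> space \<T>"
   hence "cmod u <= 1" by simp
   from le2[OF this, of j] ne[OF this, of j] show "0 <= ln (2/cmod (1 - of_real (rad j)*u))"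
    by (intro ln_ge_zero) (simp add: le_divide_eq)
  qed
  thus ?thesis by simp
 qed
 also have "... = ennreal (ln 2)" by (simp add: Liminf_const)
 finally show "(NN u. ennreal (norm (ln (2/cmod (1 - u))))) < \<infinity>" by (simp add: order_le_less_trans)
qed measurable

text \<open>Valid also for \<open>q < 1\<close>: every term is bounded by the \<open>q\<close>-norm,
  and the geometric weights are summed.\<close>

lemma weighted_powr_sum:
 fixes Y :: "nat => real"
 assumes a: "0 < a" "a < 1" and q: "0 < q" and Y: "\<And>k. 0 <= Y k" "summable (%k. Y k powr q)"
 shows "(\<Sum>k. a^k*Y k) powr q <= (1/(1 - a)) powr q*(\<Sum>k. Y k powr q)"
proof -
 define V where "V = (\<Sum>k. Y k powr q)"
 have V0: "0 <= V" unfolding V_def by (rule suminf_nonneg[OF Y(2)]) simp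
 have YV: "Y k <= V powr (1/q)" for k
 proof -
  have "Y k powr q <= V" unfolding V_def using sum_le_suminf[OF Y(2), of "{k}"] by simp
  hence "(Y k powr q) powr (1/q) <= V powr (1/q)" using q by (intro powr_mono2) auto
  thus ?thesis using q Y(1) by (simp add: powr_powr)
 qed
 have g: "summable (%k. a^k*V powr (1/q))" using a by (intro summable_mult2 summable_geometric) auto
 have s: "summable (%k. a^k*Y k)"
  by (rule summable_comparison_test'[OF g, of 0]) (use a Y YV in "auto intro!: mult_left_mono simp: abs_mult")
 have "(\<Sum>k. a^k*Y k) <= (\<Sum>k. a^k*V powr (1/q))"
  by (rule suminf_le[OF _ s g]) (use a YV in "auto intro!: mult_left_mono")
 also have "... = 1/(1 - a)*V powr (1/q)" using a by (subst suminf_mult2[symmetric]) (auto simp: suminf_geometric)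
 finally have "(\<Sum>k. a^k*Y k) powr q <= (1/(1 - a)*V powr (1/q)) powr q"
  using q a Y by (intro powr_mono2 suminf_nonneg[OF s]) auto
 also have "... = (1/(1 - a)) powr q*(V powr (1/q)) powr q" by (rule powr_mult)
 finally show ?thesis using q V0 by (simp add: powr_powr V_def)
qed

section \<open>The hump function and its Lorentz norms\<close>

context
 fixes p :: real and m :: nat and r :: "nat => real"
 assumes p: "0 < p" and mp: "1/p < real m + 1" and r: "\<And>k. 0 < r k" "\<And>k. r k < 1"
begin

text \<open>The power of \<open>1 - r k\<close> gives every single kernel a Lorentz size bounded
  independently of \<open>r k\<close>; the factor \<open>(1/2)^k\<close> then makes the sum converge
  for arbitrary radii.\<close>

definition hump_coeff :: "nat => real" where
 "hump_coeff k = (1/2)^k*(1 - r k) powr (real m + 1 - 1/p)"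

definition hump :: "complex => complex" where
 "hump z = (\<Sum>k. of_real (hump_coeff k)/(1 - of_real (r k)*z)^(m + 1))"

text \<open>A majorant of the hump at distance \<open>t\<close> from 1: each kernel is bounded both
  at its peak and by the distance to 1.\<close>

definition hump_bound :: "real => real" where
 "hump_bound t = (\<Sum>k. hump_coeff k*min ((1/(1 - r k))^(m + 1)) ((2/t)^(m + 1)))"

lemma hump_coeff: "0 < hump_coeff k" "hump_coeff k <= (1/2)^k" "summable hump_coeff"
proof -
 show 0: "0 < hump_coeff k" for k using r[of k] by (simp add: hump_coeff_def)
 show 1: "hump_coeff k <= (1/2)^k" for k
  using r[of k] mp powr_mono2[of "real m + 1 - 1/p" "1 - r k" 1] by (simp add: hump_coeff_def mult_left_le)
 show "summable hump_coeff"
  by (rule summable_comparison_test'[of "%k. (1/2)^k" 0]) (use 0 1 less_imp_le[OF 0] in "auto intro!: summable_geometric")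
qed

lemma hump_term_le:
 assumes z: "cmod z <= 1" "z \<noteq> 1"
 shows "cmod (of_real (hump_coeff k)/(1 - of_real (r k)*z)^(m + 1)) <=
  hump_coeff k*min ((1/(1 - r k))^(m + 1)) ((2/cmod (1 - z))^(m + 1))"
proof -
 note d = segment_dist[OF z(1) less_imp_le[OF r(1)[of k]] less_imp_le[OF r(2)[of k]]]
 have z0: "0 < cmod (1 - z)" using z by simp
 have d0: "0 < cmod (1 - of_real (r k)*z)" using d(1) r[of k] by linarith
 have "1/cmod (1 - of_real (r k)*z) <= 1/(1 - r k)" using d(1) d0 r[of k] by (intro divide_left_mono mult_pos_pos) auto
 moreover have "1/cmod (1 - of_real (r k)*z) <= 2/cmod (1 - z)"
  using d(2) d0 z0 by (simp add: field_simps)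
 ultimately have "(1/cmod (1 - of_real (r k)*z))^(m + 1) <= min ((1/(1 - r k))^(m + 1)) ((2/cmod (1 - z))^(m + 1))"
  by (intro min.boundedI power_mono) auto
 hence "hump_coeff k*(1/cmod (1 - of_real (r k)*z))^(m + 1) <= hump_coeff k*min ((1/(1 - r k))^(m + 1)) ((2/cmod (1 - z))^(m + 1))"
  using hump_coeff(1)[of k] by (intro mult_left_mono) auto
 moreover have "cmod (of_real (hump_coeff k)/(1 - of_real (r k)*z)^(m + 1)) = hump_coeff k*(1/cmod (1 - of_real (r k)*z))^(m + 1)"
  using hump_coeff(1)[of k] by (simp add: norm_divide norm_power power_divide del: power_Suc)
 ultimately show ?thesis by simp
qed

lemma hump_bound_summable:
 assumes "0 < t"
 shows "summable (%k. hump_coeff k*min ((1/(1 - r k))^(m + 1)) ((2/t)^(m + 1)))"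
  "hump_bound t <= 2*(2/t)^(m + 1)" "0 <= hump_bound t"
proof -
 let ?u = "%k. hump_coeff k*min ((1/(1 - r k))^(m + 1)) ((2/t)^(m + 1))"
 have g: "summable (%k. (1/2)^k*(2/t)^(m + 1))" by (intro summable_mult2 summable_geometric) auto
 have le: "0 <= ?u k" "?u k <= (1/2)^k*(2/t)^(m + 1)" for k
 proof -
  show "0 <= ?u k" using hump_coeff(1)[of k] r[of k] assms by (intro mult_nonneg_nonneg min.boundedI zero_le_power) auto
  show "?u k <= (1/2)^k*(2/t)^(m + 1)" using hump_coeff(1,2)[of k] r[of k] assms by (intro mult_mono min.cobounded2 min.boundedI zero_le_power) auto
 qed
 show s: "summable ?u" by (rule summable_comparison_test'[OF g, of 0]) (use le in auto)
 show "0 <= hump_bound t" unfolding hump_bound_def by (rule suminf_nonneg[OF s le(1)])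
 have "hump_bound t <= (\<Sum>k. (1/2)^k*(2/t)^(m + 1))" unfolding hump_bound_def by (rule suminf_le[OF le(2) s g])
 also have "... = 2*(2/t)^(m + 1)" by (subst suminf_mult2[symmetric]) (auto simp: suminf_geometric)
 finally show "hump_bound t <= 2*(2/t)^(m + 1)" .
qed

lemma hump_le:
 assumes z: "cmod z <= 1" "z \<noteq> 1"
 shows "cmod (hump z) <= hump_bound (cmod (1 - z))"
 unfolding hump_def hump_bound_def
 by (rule norm_suminf_le[OF hump_term_le[OF z] hump_bound_summable(1)]) (use z in simp)

lemma hump_bound_antimono:
 assumes "0 < s" "s <= t"
 shows "hump_bound t <= hump_bound s"
proof -
 have "(2/t)^(m + 1) <= (2/s)^(m + 1)" using assms by (intro power_mono divide_left_mono) auto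
 thus ?thesis unfolding hump_bound_def using assms hump_coeff(1)
  by (intro suminf_le hump_bound_summable(1) mult_left_mono min.mono) (auto intro: less_imp_le)
qed

lemma hump_tendsto:
 assumes z: "cmod u = 1" "u \<noteq> 1" and g: "(g \<longlongrightarrow> u) F" "eventually (%x. cmod (g x) <= 1) F" and F: "F \<noteq> bot"
 shows "((%x. hump (g x)) \<longlongrightarrow> hump u) F"
proof -
 define t where "t = cmod (1 - u)/2"
 have t: "0 < t" using z by (simp add: t_def)
 have "((%x. cmod (1 - g x)) \<longlongrightarrow> cmod (1 - u)) F" by (intro tendsto_intros g)
 moreover have "t < cmod (1 - u)" using z by (simp add: t_def)
 ultimately have "eventually (%x. t < cmod (1 - g x)) F" by (rule order_tendstoD(1))
 with g(2) have ev: "eventually (%x. \<forall>k. norm (of_real (hump_coeff k)/(1 - of_real (r k)*g x)^(m + 1)) <=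
   hump_coeff k*min ((1/(1 - r k))^(m + 1)) ((2/t)^(m + 1))) F"
 proof eventually_elim
  case (elim x)
  hence "g x \<noteq> 1" using t by auto
  have "0 < cmod (1 - g x)*t" using elim t by (intro mult_pos_pos) auto
  hence "(2/cmod (1 - g x))^(m + 1) <= (2/t)^(m + 1)" using elim t by (intro power_mono divide_left_mono) auto
  hence "hump_coeff k*min ((1/(1 - r k))^(m + 1)) ((2/cmod (1 - g x))^(m + 1)) <=
   hump_coeff k*min ((1/(1 - r k))^(m + 1)) ((2/t)^(m + 1))" for k
   using hump_coeff(1)[of k] by (intro mult_left_mono min.mono) auto
  thus ?case using hump_term_le[OF elim(1) \<open>g x \<noteq> 1\<close>] by (meson order_trans)
 qed
 have lim: "((%x. of_real (hump_coeff k)/(1 - of_real (r k)*g x)^(m + 1)) \<longlongrightarrow> of_real (hump_coeff k)/(1 - of_real (r k)*u)^(m + 1)) F" for k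
 proof -
  have "1 - of_real (r k)*u \<noteq> 0" using segment_dist(1)[of u "r k"] z r[of k] by auto
  thus ?thesis by (intro tendsto_intros g) auto
 qed
 have "eventually (%(k, x). norm (of_real (hump_coeff k)/(1 - of_real (r k)*g x)^(m + 1)) <=
   hump_coeff k*min ((1/(1 - r k))^(m + 1)) ((2/t)^(m + 1))) (at_top \<times>\<^sub>F F)"
  unfolding eventually_prod_filter using ev by (intro exI[of _ "%_. True"] exI[of _ "%x. \<forall>k. _ k x"] conjI) auto
 from tannerys_theorem[OF lim this hump_bound_summable(1)[OF t] F] show ?thesis unfolding hump_def by blast
qed

lemma hump_taylor:
 "hol hump"
 "taylor_seq hump = (%n. of_nat ((n + m) choose m) * of_real (\<Sum>k. hump_coeff k*r k^n))"
proof -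
 define M where "M n = (\<Sum>k. hump_coeff k*r k^n)" for n
 have b: "summable (%n. cmod (of_nat ((n + m) choose m)*z^n))" if "cmod z < 1" for z :: complex
 proof -
  have "summable (%n. cmod (of_nat ((n + m) choose m))*cmod z^n)"
   by (rule abs_summable_disk) (use binomial_series that in "auto simp: sums_iff")
  thus ?thesis by (simp add: norm_mult norm_power)
 qed
 note mix = mixture_sums[where r = r and c = hump_coeff, OF b less_imp_le[OF hump_coeff(1)] hump_coeff(3) less_imp_le[OF r(1)] less_imp_le[OF r(2)], folded M_def]
 have eq: "hump z = (\<Sum>n. of_nat ((n + m) choose m) * of_real (M n)*z^n)" if z: "cmod z < 1" for z
 proof -
  have "(\<Sum>n. of_nat ((n + m) choose m)*(of_real (r k)*z)^n) = 1/(1 - of_real (r k)*z)^(m + 1)" for k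
  proof -
   have "cmod (of_real (r k)*z) < 1" using r[of k] z mult_strict_mono[of "r k" 1 "cmod z" 1] by (simp add: norm_mult)
   from binomial_series[OF this, of m] show ?thesis by (simp add: sums_iff)
  qed
  thus ?thesis using mix(2)[OF z] unfolding hump_def by (simp add: sums_iff)
 qed
 note ps = power_series_disk[of "%n. of_nat ((n + m) choose m) * of_real (M n)", OF mix(1)]
 show "hol hump"
  by (rule holomorphic_transform[OF ps(1)]) (use eq in auto)
 show "taylor_seq hump = (%n. of_nat ((n + m) choose m) * of_real (\<Sum>k. hump_coeff k*r k^n))"
  unfolding M_def[symmetric] by (rule taylor_seq_unique) (use eq mix(1) in "auto simp: summable_sums")
qed

lemma hump_boundary:
 assumes z: "cmod u = 1" "u \<noteq> 1"
 shows "boundary_fun hump u = hump u"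
proof (rule boundary_fun_eqI[OF _ z(1)])
 show "has_nontangential_limit hump u (hump u)"
  unfolding has_nontangential_limit_def
 proof (intro allI impI)
  fix A :: real assume a: "1 < A"
  have "eventually (%x. x \<in> stolz_region A u) (at u within stolz_region A u)" by (simp add: eventually_at_filter)
  hence "eventually (%x. cmod x <= 1) (at u within stolz_region A u)" by eventually_elim (auto simp: stolz_region_def)
  thus "(hump \<longlongrightarrow> hump u) (at u within stolz_region A u)"
   by (rule hump_tendsto[OF z tendsto_ident_at]) (use stolz_nontrivial a z in auto)
 qed
qed

text \<open>Uniformly in the radius, the logarithm is dominated by an integrable multiple of
  \<open>ln (2/cmod (1 - u))\<close>. This bounds the Nevanlinna means and gives their convergence
  by dominated convergence.\<close>

lemma hump_smirnov: "hump \<in> smirnov"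
proof -
 define D where "D u = ln 2 + (real m + 1)*ln (2/cmod (1 - u))" for u
 have Di: "integrable \<T> D"
  unfolding D_def using log_integrable_near_one by simp
 have ne1: "AE u in \<T>. u \<noteq> 1"
 proof (rule AE_I)
  show "{u \<in> space \<T>. \<not> u \<noteq> 1} \<subseteq> cis ` {0..0}" by (auto simp: image_iff)
  show "cis ` {0..0} \<in> sets \<T>" by (rule measure_circle_arc) auto
  show "emeasure \<T> (cis ` {0..0}) = 0"
   unfolding circle.emeasure_eq_measure by (subst measure_circle_arc(2)) auto
 qed
 have lp: "log_plus (cmod (hump (of_real s*u))) <= D u" if z: "cmod u = 1" "u \<noteq> 1" and s: "0 <= s" "s < 1" for s u
 proof -
  let ?t = "cmod (1 - u)"
  have t: "0 < ?t" "?t <= 2" using z norm_triangle_ineq4[of 1 u] by auto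
  have "cmod (hump (of_real s*u)) <= (\<Sum>k. hump_coeff k*(2 / ?t)^(m + 1))"
   unfolding hump_def
  proof (rule norm_suminf_le[OF _ summable_mult2[OF hump_coeff(3)]])
   fix k
   have "of_real (r k)*(of_real s*u) = of_real (r k * s)*u" by simp
   moreover have "?t/2 <= cmod (1 - of_real (r k * s)*u)"
    by (rule segment_dist(2)) (use r[of k] s z in "auto intro!: mult_le_one")
   ultimately have d: "?t/2 <= cmod (1 - of_real (r k)*(of_real s*u))" by (simp only:)
   have "0 < cmod (1 - of_real (r k)*(of_real s*u))" using d t by linarith
   hence "1/cmod (1 - of_real (r k)*(of_real s*u)) <= 2 / ?t" using d t by (simp add: field_simps)
   hence "hump_coeff k*(1/cmod (1 - of_real (r k)*(of_real s*u)))^(m + 1) <= hump_coeff k*(2 / ?t)^(m + 1)"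
    using hump_coeff(1)[of k] by (intro mult_left_mono power_mono) auto
   thus "cmod (of_real (hump_coeff k)/(1 - of_real (r k)*(of_real s*u))^(m + 1)) <= hump_coeff k*(2 / ?t)^(m + 1)"
    using hump_coeff(1)[of k] by (simp add: norm_divide norm_power power_divide del: power_Suc)
  qed
  also have "... = suminf hump_coeff*(2 / ?t)^(m + 1)" by (rule suminf_mult2[OF hump_coeff(3), symmetric])
  also have "... <= 2*(2 / ?t)^(m + 1)"
  proof (rule mult_right_mono)
   have "suminf hump_coeff <= (\<Sum>k. (1/2)^k)" by (rule suminf_le[OF hump_coeff(2,3)]) (simp add: summable_geometric)
   thus "suminf hump_coeff <= 2" by (simp add: suminf_geometric)
  qed simp
  finally have b: "cmod (hump (of_real s*u)) <= 2*(2 / ?t)^(m + 1)" .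
  have t2: "1 <= 2 / ?t" using t by simp
  have one: "1 <= 2*(2 / ?t)^(m + 1)" using one_le_power[OF t2, of "m + 1"] by linarith
  have "log_plus (cmod (hump (of_real s*u))) <= ln (2*(2 / ?t)^(m + 1))"
   unfolding log_plus_def using b one by (intro ln_mono) auto
  also have "... = D u" using t by (subst ln_mult_pos) (auto simp: D_def ln_realpow simp del: power_Suc)
  finally show ?thesis .
 qed
 have meas: "(%u. log_plus (cmod (hump (of_real s*u)))) \<in> borel_measurable \<T>" if "0 <= s" "s < 1" for s
  by (rule circle_measurable) (intro continuous_log_plus continuous_on_norm dilate_holomorphic(3) hump_taylor(1) that)
 have bd: "norm (log_plus (cmod (hump (of_real s*u)))) <= D u" if "cmod u = 1" "u \<noteq> 1" "0 <= s" "s < 1" for s u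
  using lp[OF that] log_plus_nonneg by simp
 have "nevanlinna_mean hump s <= (MEAN u. D u)" if s: "0 <= s" "s < 1" for s
  unfolding nevanlinna_mean_def
 proof (rule integral_mono_AE)
  show "integrable \<T> (%u. log_plus (cmod (hump (of_real s*u))))"
   by (rule circle_integrable) (intro continuous_log_plus continuous_on_norm dilate_holomorphic(3) hump_taylor(1) s)
  show "integrable \<T> D" by (rule Di)
  show "AE u in \<T>. log_plus (cmod (hump (of_real s*u))) <= D u"
   using ne1 AE_space by eventually_elim (use lp s in auto)
 qed
 hence nev: "hump \<in> nevanlinna" using hump_taylor(1) by (auto simp: nevanlinna_def H_disk_def intro!: bdd_aboveI2)
 have "(nevanlinna_mean hump \<longlongrightarrow> (MEAN u. log_plus (cmod (boundary_fun hump u)))) (at_left 1)"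
 proof (rule tendsto_at_left_sequentially[of 0])
  fix S :: "nat => real" assume S: "\<And>n. S n < 1" "\<And>n. 0 < S n" "S ----> 1"
  have S': "0 <= S n" for n using S(2)[of n] by simp
  show "(%n. nevanlinna_mean hump (S n)) ----> (MEAN u. log_plus (cmod (boundary_fun hump u)))"
   unfolding nevanlinna_mean_def
  proof (rule integral_dominated_convergence[OF _ _ Di])
   have [measurable]: "boundary_fun hump \<in> borel_measurable \<T>" by (rule measurable_boundary_fun[OF hump_taylor(1)])
   show "(%u. log_plus (cmod (boundary_fun hump u))) \<in> borel_measurable \<T>"
    unfolding log_plus_def by measurable
   show "(%u. log_plus (cmod (hump (of_real (S n)*u)))) \<in> borel_measurable \<T>" for n by (rule meas[OF S' S(1)])
   show "AE u in \<T>. norm (log_plus (cmod (hump (of_real (S n)*u)))) <= D u" for n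
    using ne1 AE_space by eventually_elim (use bd S(1) S' in auto)
   show "AE u in \<T>. (%n. log_plus (cmod (hump (of_real (S n)*u)))) ----> log_plus (cmod (boundary_fun hump u))"
    using ne1 AE_space
   proof eventually_elim
    case (elim u)
    hence z: "cmod u = 1" "u \<noteq> 1" by auto
    have "(%n. of_real (S n)*u) ----> of_real 1*u" by (intro tendsto_intros S)
    hence "(%n. hump (of_real (S n)*u)) ----> hump u"
     using S(1) S' z by (intro hump_tendsto z) (auto simp: norm_mult less_imp_le)
    thus ?case unfolding hump_boundary[OF z] log_plus_def by (intro tendsto_intros) auto
   qed
  qed
 qed simp
 thus ?thesis using nev by (simp add: smirnov_def)
qed

text \<open>The majorant decreases with the distance to 1, and the points within distance
  \<open>x\<close> of 1 have measure at most \<open>x\<close>.\<close>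

lemma hump_rearrangement:
 assumes x: "0 < x"
 shows "0 <= rearrangement (boundary_fun hump) x" "rearrangement (boundary_fun hump) x <= hump_bound x"
proof -
 have mb: "boundary_fun hump \<in> borel_measurable \<T>" by (rule measurable_boundary_fun[OF hump_taylor(1)])
 show "0 <= rearrangement (boundary_fun hump) x" by (rule rearrangement_nonneg[OF mb x])
 show "rearrangement (boundary_fun hump) x <= hump_bound x"
 proof (rule rearrangement_le[OF hump_bound_summable(3)[OF x]])
  have "{u \<in> sphere 0 1. hump_bound x < cmod (boundary_fun hump u)} \<subseteq> {u \<in> sphere 0 1. cmod (1 - u) <= x}"
  proof
   fix u assume "u \<in> {u \<in> sphere 0 1. hump_bound x < cmod (boundary_fun hump u)}"
   hence z: "cmod u = 1" "hump_bound x < cmod (boundary_fun hump u)" by auto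
   have "cmod (1 - u) <= x"
   proof (rule ccontr)
    assume n: "\<not> cmod (1 - u) <= x"
    hence z1: "u \<noteq> 1" using x by auto
    have "cmod (boundary_fun hump u) <= hump_bound (cmod (1 - u))" unfolding hump_boundary[OF z(1) z1] using hump_le z z1 by simp
    also have "... <= hump_bound x" by (rule hump_bound_antimono[OF x]) (use n in simp)
    finally show False using z by simp
   qed
   thus "u \<in> {u \<in> sphere 0 1. cmod (1 - u) <= x}" using z by simp
  qed
  hence "distribution_fun (boundary_fun hump) (hump_bound x) <= measure \<T> {u \<in> sphere 0 1. cmod (1 - u) <= x}"
   unfolding distribution_fun_def by (rule circle.finite_measure_mono[OF _ measure_near_one(1)[OF x]])
  thus "distribution_fun (boundary_fun hump) (hump_bound x) <= x" using measure_near_one(2)[OF x] by linarith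
 qed
qed

text \<open>Up to constants a function of \<open>x/(1 - r k)\<close> alone, rising like the power
  \<open>1/p\<close> and then falling like the power \<open>-(m + 1 - 1/p)\<close>; so its integral
  against \<open>dx/x\<close> does not depend on the radius.\<close>

definition hump_term :: "nat => real => real" where
 "hump_term k x = (1 - r k) powr (real m + 1 - 1/p)*min ((1/(1 - r k))^(m + 1)) ((2/x)^(m + 1))*x powr (1/p)"

lemma hump_term:
 assumes x: "0 < x"
 shows "0 <= hump_term k x"
  and "hump_term k x <= (1 - r k) powr (-1/p)*x powr (1/p)"
  and "hump_term k x <= 2^(m + 1)*(1 - r k) powr (real m + 1 - 1/p)*x powr (- (real m + 1 - 1/p))"
  and "hump_term k x <= 2^(m + 1)"
  and "hump_bound x*x powr (1/p) = (\<Sum>k. (1/2)^k*hump_term k x)"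
proof -
 define d where "d = 1 - r k"
 define e where "e = real m + 1 - 1/p"
 have d: "0 < d" using r[of k] by (simp add: d_def)
 have e: "0 < e" using mp by (simp add: e_def)
 have ht: "hump_term k x = d powr e*min ((1/d)^(m + 1)) ((2/x)^(m + 1))*x powr (1/p)"
  by (simp add: hump_term_def d_def e_def)
 show "0 <= hump_term k x" unfolding ht using d x by (intro mult_nonneg_nonneg min.boundedI zero_le_power) auto
 have pm: "y powr (- (real m + 1)) = 1/y^(m + 1)" if "0 < y" for y
 proof -
  have "y powr (- (real m + 1)) = 1/y powr (real (m + 1))" by (simp only: powr_minus_divide of_nat_add of_nat_1)
  thus ?thesis by (simp only: powr_realpow[OF that])
 qed
 have "hump_term k x <= d powr e*(1/d)^(m + 1)*x powr (1/p)" unfolding ht by (intro mult_right_mono mult_left_mono) auto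
 also have "(1/d)^(m + 1) = d powr (- (real m + 1))"
  unfolding pm[OF d] by (simp only: power_divide power_one)
 also have "d powr e*d powr (- (real m + 1)) = d powr (-1/p)" by (simp add: e_def flip: powr_add)
 finally show 1: "hump_term k x <= (1 - r k) powr (-1/p)*x powr (1/p)" by (simp add: d_def)
 have "hump_term k x <= d powr e*(2/x)^(m + 1)*x powr (1/p)" unfolding ht by (intro mult_right_mono mult_left_mono) auto
 also have "(2/x)^(m + 1) = 2^(m + 1)*x powr (- (real m + 1))"
  unfolding pm[OF x] by (simp only: power_divide mult_1_right times_divide_eq_right)
 also have "d powr e*(2^(m + 1)*x powr (- (real m + 1)))*x powr (1/p) = 2^(m + 1)*d powr e*(x powr (- (real m + 1))*x powr (1/p))"
  by simp
 also have "x powr (- (real m + 1))*x powr (1/p) = x powr (- e)"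
 proof -
  have "- (real m + 1) + 1/p = - e" by (simp add: e_def)
  thus ?thesis by (simp only: powr_add[symmetric])
 qed
 finally have 2: "hump_term k x <= 2^(m + 1)*d powr e*x powr (- e)" .
 thus "hump_term k x <= 2^(m + 1)*(1 - r k) powr (real m + 1 - 1/p)*x powr (- (real m + 1 - 1/p))"
  by (simp only: d_def e_def)
 show "hump_term k x <= 2^(m + 1)"
 proof (cases "x <= d")
  case True
  have "d powr (-1/p)*x powr (1/p) <= d powr (-1/p)*d powr (1/p)" using True x p by (intro mult_left_mono powr_mono2) auto
  also have "... = 1" using d by (simp flip: powr_add)
  also have "(1::real) <= 2^(m + 1)" by (rule one_le_power) simp
  finally show ?thesis using 1 by (simp add: d_def)
 next
  case False
  have "d powr e*x powr (- e) <= x powr e*x powr (- e)" using False d e by (intro mult_right_mono powr_mono2) auto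
  also have "... = 1" using x by (simp flip: powr_add)
  finally have "2^(m + 1)*(d powr e*x powr (- e)) <= 2^(m + 1)*(1::real)" by (intro mult_left_mono) auto
  thus ?thesis using 2 by (simp only: mult.assoc mult_1_right)
 qed
 have "hump_bound x*x powr (1/p) = (\<Sum>k. hump_coeff k*min ((1/(1 - r k))^(m + 1)) ((2/x)^(m + 1))*x powr (1/p))"
  unfolding hump_bound_def by (rule suminf_mult2[OF hump_bound_summable(1)[OF x]])
 also have "... = (\<Sum>k. (1/2)^k*hump_term k x)"
  by (simp only: hump_coeff_def hump_term_def mult.assoc)
 finally show "hump_bound x*x powr (1/p) = (\<Sum>k. (1/2)^k*hump_term k x)" .
qed

lemma hump_lorentz_infinity: "hump \<in> hardy_lorentz p \<infinity>"
proof -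
 have "ennreal (rearrangement (boundary_fun hump) s * s powr (1/p)) <= ennreal (2*2^(m + 1))" if s: "0 < s" for s
 proof (rule ennreal_leI)
  have g: "summable (%k. (1/2)^k*(2^(m + 1)::real))" by (intro summable_mult2 summable_geometric) auto
  have le: "(1/2)^k*hump_term k s <= (1/2)^k*(2^(m + 1)::real)" for k by (intro mult_left_mono hump_term(4)[OF s]) simp
  have sm: "summable (%k. (1/2)^k*hump_term k s)"
   by (rule summable_comparison_test'[OF g, of 0]) (use le hump_term(1)[OF s] in auto)
  have "rearrangement (boundary_fun hump) s * s powr (1/p) <= hump_bound s * s powr (1/p)"
   by (intro mult_right_mono hump_rearrangement s) simp
  also have "... = (\<Sum>k. (1/2)^k*hump_term k s)" by (rule hump_term(5)[OF s])
  also have "... <= (\<Sum>k. (1/2)^k*(2^(m + 1)::real))" by (rule suminf_le[OF le sm g])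
  also have "... = 2*2^(m + 1)" by (subst suminf_mult2[symmetric]) (auto simp: suminf_geometric)
  finally show "rearrangement (boundary_fun hump) s * s powr (1/p) <= 2*2^(m + 1)" .
 qed
 hence "(SUP s\<in>{0<..}. ennreal (rearrangement (boundary_fun hump) s * s powr (1/p))) <= ennreal (2*2^(m + 1))"
  by (intro SUP_least) auto
 also have "... < \<infinity>" by simp
 finally show ?thesis using hump_smirnov by (simp add: hardy_lorentz_def lorentz_norm_def)
qed

lemma nn_integral_powr_pieces:
 fixes A B d :: real
 assumes "0 < A" "0 < B" "0 < d"
 shows "(\<integral>\<^sup>+x. ennreal (indicator {0..d} x*(d powr (-A)*x powr (A - 1))) \<partial>lborel) = ennreal (1/A)"
  "(\<integral>\<^sup>+x. ennreal (indicator {d..} x*(d powr B*x powr (-B - 1))) \<partial>lborel) = ennreal (1/B)"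
proof -
 have "((%x. d powr (-A)*x powr (A - 1)) has_integral d powr (-A)*(d powr (A - 1 + 1)/(A - 1 + 1))) {0..d}"
  by (intro has_integral_mult_right has_integral_powr_from_0) (use assms in auto)
 moreover have "d powr (-A)*(d powr (A - 1 + 1)/(A - 1 + 1)) = 1/A" using assms by (simp add: powr_minus)
 ultimately have "((%x. d powr (-A)*x powr (A - 1)) has_integral 1/A) {0..d}" by (simp only:)
 from nn_integral_has_integral_lebesgue[OF _ this]
 show "(\<integral>\<^sup>+x. ennreal (indicator {0..d} x*(d powr (-A)*x powr (A - 1))) \<partial>lborel) = ennreal (1/A)" by simp
 have "((%x. d powr B*x powr (-B - 1)) has_integral d powr B*(- (d powr (-B - 1 + 1))/(-B - 1 + 1))) {d..}"
  by (intro has_integral_mult_right has_integral_powr_to_inf) (use assms in auto)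
 moreover have "d powr B*(- (d powr (-B - 1 + 1))/(-B - 1 + 1)) = 1/B" using assms by (simp add: powr_minus)
 ultimately have "((%x. d powr B*x powr (-B - 1)) has_integral 1/B) {d..}" by (simp only:)
 from nn_integral_has_integral_lebesgue[OF _ this]
 show "(\<integral>\<^sup>+x. ennreal (indicator {d..} x*(d powr B*x powr (-B - 1))) \<partial>lborel) = ennreal (1/B)" by simp
qed

lemma hump_lorentz:
 assumes q: "0 < q"
 shows "hump \<in> hardy_lorentz p (ereal q)"
proof -
 define e where "e = real m + 1 - 1/p"
 have e: "0 < e" using mp by (simp add: e_def)
 define M where "M = (2^(m + 1) :: real)"
 \<comment> \<open>The weight \<open>(1/2)^k\<close> is divided in two: one factor
   \<open>a^k\<close> is spent in \<open>weighted_powr_sum\<close>, the other keeps the sum over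
   \<open>k\<close> convergent.\<close>
 define a where "a = (1/2::real) powr (1/2)"
 have a: "0 < a" "a < 1" "a*a = 1/2"
 proof -
  show "0 < a" by (simp add: a_def)
  show aa: "a*a = 1/2" unfolding a_def by (simp flip: powr_add)
  show "a < 1"
  proof (rule ccontr)
   assume "\<not> a < 1"
   hence "1*1 <= a*a" by (intro mult_mono) auto
   thus False using aa by simp
  qed
 qed
 have aq: "0 < a powr q" "a powr q < 1" using a q powr_less_mono2[of q a 1] by auto
 define D where "D = (1/(1 - a)) powr q"
 \<comment> \<open>The rising and the falling branch of the \<open>k\<close>-th term, which meet at
   \<open>1 - r k\<close>.\<close>
 define U where "U k x = ennreal (indicator {0..1 - r k} x*((1 - r k) powr (-(q/p))*x powr (q/p - 1))) +
  ennreal (M powr q)*ennreal (indicator {1 - r k..} x*((1 - r k) powr (e*q)*x powr (-(e*q) - 1)))" for k x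
 have Um [measurable]: "U k \<in> borel_measurable borel" for k unfolding U_def by measurable
 have UI: "(\<integral>\<^sup>+x. U k x \<partial>lborel) = ennreal (p/q + M powr q*(1/(e*q)))" for k
 proof -
  have "(\<integral>\<^sup>+x. U k x \<partial>lborel) = ennreal (1/(q/p)) + ennreal (M powr q)*ennreal (1/(e*q))"
   unfolding U_def by (subst nn_integral_add) (use nn_integral_powr_pieces[of "q/p" "e*q" "1 - r k"] q p e r[of k] in "simp_all add: nn_integral_cmult")
  also have "ennreal (M powr q)*ennreal (1/(e*q)) = ennreal (M powr q*(1/(e*q)))"
   by (rule ennreal_mult[symmetric]) (use q e in auto)
  also have "ennreal (1/(q/p)) + ennreal (M powr q*(1/(e*q))) = ennreal (p/q + M powr q*(1/(e*q)))"
   using q p e by (subst ennreal_plus) auto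
  finally show ?thesis .
 qed
 have tm: "ennreal (hump_term k x powr q/x) <= U k x" if x: "0 < x" for k x
 proof (cases "x <= 1 - r k")
  case True
  have "hump_term k x powr q <= ((1 - r k) powr (-1/p)*x powr (1/p)) powr q"
   using hump_term(1,2)[OF x, of k] q by (intro powr_mono2) auto
  also have "... = (1 - r k) powr (-(q/p))*x powr (q/p)" by (simp add: powr_mult powr_powr)
  finally have "hump_term k x powr q/x <= (1 - r k) powr (-(q/p))*x powr (q/p)/x" using x by (intro divide_right_mono) auto
  also have "... = (1 - r k) powr (-(q/p))*x powr (q/p - 1)" using x by (simp add: powr_diff)
  finally have "ennreal (hump_term k x powr q/x) <= ennreal (indicator {0..1 - r k} x*((1 - r k) powr (-(q/p))*x powr (q/p - 1)))"
   using True x by (simp add: ennreal_leI)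
  thus ?thesis unfolding U_def by (rule order_trans) simp
 next
  case False
  have "hump_term k x powr q <= (M*(1 - r k) powr e*x powr (- e)) powr q"
   using hump_term(1)[OF x, of k] hump_term(3)[OF x, of k, folded e_def M_def] q by (intro powr_mono2) auto
  also have "... = M powr q*((1 - r k) powr (e*q)*x powr (-(e*q)))" by (simp add: powr_mult powr_powr mult.assoc)
  finally have "hump_term k x powr q/x <= M powr q*((1 - r k) powr (e*q)*x powr (-(e*q)))/x" using x by (intro divide_right_mono) auto
  also have "... = M powr q*((1 - r k) powr (e*q)*x powr (-(e*q) - 1))" using x by (simp add: powr_diff)
  finally have "ennreal (hump_term k x powr q/x) <= ennreal (M powr q*(indicator {1 - r k..} x*((1 - r k) powr (e*q)*x powr (-(e*q) - 1))))"
   using False by (simp add: ennreal_leI)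
  also have "... = ennreal (M powr q)*ennreal (indicator {1 - r k..} x*((1 - r k) powr (e*q)*x powr (-(e*q) - 1)))"
   by (rule ennreal_mult) auto
  finally show ?thesis unfolding U_def by (rule order_trans) simp
 qed
 have pt: "ennreal ((rearrangement (boundary_fun hump) x*x powr (1/p)) powr q/x) <= (\<Sum>k. ennreal (D*(a powr q)^k)*U k x)" if x: "0 < x" for x
 proof -
  define Y where "Y k = a^k*hump_term k x" for k
  have Y0: "0 <= Y k" for k using a hump_term(1)[OF x] by (simp add: Y_def)
  have Yq: "Y k powr q = (a powr q)^k*hump_term k x powr q" for k
   using a by (simp add: Y_def powr_mult powr_powr powr_realpow[symmetric] mult.commute)
  have Ys: "summable (%k. Y k powr q)"
  proof (rule summable_comparison_test')
   show "summable (%k. (a powr q)^k*M powr q)" using aq by (intro summable_mult2 summable_geometric) auto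
   fix k
   have "hump_term k x powr q <= M powr q" using hump_term(1,4)[OF x, of k] q unfolding M_def by (intro powr_mono2) auto
   thus "norm (Y k powr q) <= (a powr q)^k*M powr q" using aq by (simp add: Yq mult_left_mono)
  qed
  have "rearrangement (boundary_fun hump) x*x powr (1/p) <= hump_bound x*x powr (1/p)"
   by (intro mult_right_mono hump_rearrangement x) simp
  also have "... = (\<Sum>k. (1/2)^k*hump_term k x)" by (rule hump_term(5)[OF x])
  also have "... = (\<Sum>k. a^k*Y k)" unfolding Y_def a(3)[symmetric] by (simp add: power_mult_distrib mult.assoc)
  finally have "(rearrangement (boundary_fun hump) x*x powr (1/p)) powr q <= (\<Sum>k. a^k*Y k) powr q"
   using q hump_rearrangement(1)[OF x] by (intro powr_mono2) auto
  also have "... <= D*(\<Sum>k. Y k powr q)" unfolding D_def by (rule weighted_powr_sum[OF a(1,2) q Y0 Ys])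
  finally have "(rearrangement (boundary_fun hump) x*x powr (1/p)) powr q/x <= D*(\<Sum>k. Y k powr q)/x" using x by (intro divide_right_mono) auto
  hence "ennreal ((rearrangement (boundary_fun hump) x*x powr (1/p)) powr q/x) <= ennreal (D/x*(\<Sum>k. Y k powr q))"
   by (intro ennreal_leI) simp
  also have "... = (\<Sum>k. ennreal (D/x*Y k powr q))"
   by (rule suminf_ennreal_eq[symmetric]) (use x in \<open>simp add: D_def\<close>, rule sums_mult[OF summable_sums[OF Ys]])
  also have "... <= (\<Sum>k. ennreal (D*(a powr q)^k)*U k x)"
  proof (intro suminf_le)
   fix k
   have "ennreal (D/x*Y k powr q) = ennreal ((D*(a powr q)^k)*(hump_term k x powr q/x))" by (simp add: Yq mult.assoc)
   also have "... = ennreal (D*(a powr q)^k)*ennreal (hump_term k x powr q/x)" by (rule ennreal_mult) (use x in "auto simp: D_def")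
   also have "... <= ennreal (D*(a powr q)^k)*U k x" by (intro mult_left_mono tm[OF x]) simp
   finally show "ennreal (D/x*Y k powr q) <= ennreal (D*(a powr q)^k)*U k x" .
  qed auto
  finally show ?thesis .
 qed
 have "(\<integral>\<^sup>+ s\<in>{0<..<1}. ennreal ((rearrangement (boundary_fun hump) s * s powr (1/p)) powr q/s) \<partial>lborel) <=
  (\<integral>\<^sup>+x. (\<Sum>k. ennreal (D*(a powr q)^k)*U k x) \<partial>lborel)"
  by (rule nn_integral_mono) (use pt in "auto split: split_indicator")
 also have "... = (\<Sum>k. \<integral>\<^sup>+x. ennreal (D*(a powr q)^k)*U k x \<partial>lborel)" by (rule nn_integral_suminf) measurable
 also have "... = (\<Sum>k. ennreal (D*(a powr q)^k*(p/q + M powr q*(1/(e*q)))))"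
 proof (rule suminf_cong)
  fix k
  have "(\<integral>\<^sup>+x. ennreal (D*(a powr q)^k)*U k x \<partial>lborel) = ennreal (D*(a powr q)^k)*ennreal (p/q + M powr q*(1/(e*q)))"
   by (subst nn_integral_cmult) (simp_all add: UI)
  also have "... = ennreal (D*(a powr q)^k*(p/q + M powr q*(1/(e*q))))"
   by (rule ennreal_mult[symmetric]) (use p q e in "auto simp: D_def")
  finally show "(\<integral>\<^sup>+x. ennreal (D*(a powr q)^k)*U k x \<partial>lborel) = ennreal (D*(a powr q)^k*(p/q + M powr q*(1/(e*q))))" .
 qed
 also have "... = ennreal (\<Sum>k. D*(a powr q)^k*(p/q + M powr q*(1/(e*q))))"
  by (rule suminf_ennreal_eq) (use p q e aq in "auto simp: D_def intro!: summable_sums summable_mult summable_mult2 summable_geometric")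
 also have "... < \<infinity>" by simp
 finally have "(\<integral>\<^sup>+ s\<in>{0<..<1}. ennreal ((rearrangement (boundary_fun hump) s * s powr (1/p)) powr q/s) \<partial>lborel) < \<infinity>" .
 thus ?thesis using hump_smirnov by (simp add: hardy_lorentz_def lorentz_norm_def Let_def)
qed

lemma hump_multiplier:
 assumes l: "l \<in> multipliers (seq_space H) (seq_space bloch)" and H: "hump \<in> H"
 obtains h K where "hol h"
  "\<And>n. taylor_seq h n = l n*(of_nat ((n + m) choose m) * of_real (\<Sum>k. hump_coeff k*r k^n))"
  "\<And>z. cmod z < 1 ==> (1 - cmod z)*cmod (frac_deriv1 h z) <= K"
proof -
 have "taylor_seq hump \<in> seq_space H" using H by (simp add: seq_space_def)
 hence "(%n. l n*taylor_seq hump n) \<in> seq_space bloch" using l by (auto simp: multipliers_def)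
 then obtain h where h: "h \<in> bloch" "(%n. l n*taylor_seq hump n) = taylor_seq h" by (auto simp: seq_space_def)
 have "bdd_above ((%z. (1 - cmod z)*cmod (frac_deriv1 h z)) ` ball 0 1)" using h(1) by (simp add: bloch_def)
 then obtain K where K: "\<And>z. z \<in> ball 0 1 ==> (1 - cmod z)*cmod (frac_deriv1 h z) <= K" unfolding bdd_above_def by blast
 show ?thesis
 proof (rule that)
  show "hol h" using h(1) by (simp add: bloch_def H_disk_def)
  show "taylor_seq h n = l n*(of_nat ((n + m) choose m) * of_real (\<Sum>k. hump_coeff k*r k^n))" for n
   by (simp add: h(2)[symmetric] hump_taylor(2))
  show "(1 - cmod z)*cmod (frac_deriv1 h z) <= K" if "cmod z < 1" for z using K[of z] that by simp
 qed
qed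

end

text \<open>With all radii equal to \<open>t\<close> the hump is a multiple of one kernel, and its
  image, being analytic in the disk, forces convergence at \<open>w\<close> since
  \<open>cmod w < t\<close>.\<close>

lemma multiplier_radius:
 assumes p: "0 < p" and mp: "1/p < real m + 1"
  and H: "\<And>r. (\<And>k. 0 < r k) ==> (\<And>k. r k < 1) ==> hump p m r \<in> H"
  and l: "l \<in> multipliers (seq_space H) (seq_space bloch)" and w: "cmod w < 1"
 shows "summable (%n. of_real (gam m n)*l n*w^n)"
proof -
 define t where "t = (1 + cmod w)/2"
 have t: "0 < t" "t < 1" "cmod w < t" using w by (auto simp: t_def add_pos_nonneg)
 define r where "r k = t" for k :: nat
 have r: "0 < r k" "r k < 1" for k using t by (auto simp: r_def)
 obtain h K where h: "hol h"
  "\<And>n. taylor_seq h n = l n*(of_nat ((n + m) choose m) * of_real (\<Sum>k. hump_coeff p m r k*r k^n))"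
  "\<And>z. cmod z < 1 ==> (1 - cmod z)*cmod (frac_deriv1 h z) <= K"
  by (rule hump_multiplier[where r = r, OF p mp r l H[OF r]]) blast
 define c where "c = suminf (hump_coeff p m r)"
 note hc = hump_coeff[where r = r, OF p mp r]
 have c: "0 < c" unfolding c_def by (rule suminf_pos[OF hc(3,1)])
 have "(\<Sum>k. hump_coeff p m r k*r k^n) = c*t^n" for n
  unfolding c_def r_def by (rule suminf_mult2[OF hc(3)[unfolded r_def], symmetric])
 hence th: "taylor_seq h n = l n*(of_nat ((n + m) choose m) * of_real (c*t^n))" for n using h(2) by simp
 define z where "z = w/of_real t"
 have z: "cmod z < 1" "of_real t*z = w" using t by (auto simp: z_def norm_divide)
 have e: "of_nat (n + 1)*taylor_seq h n*z^n = of_real c*(of_real (gam m n)*l n*w^n)" for n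
 proof -
  have "w^n = of_real t^n*z^n" unfolding z(2)[symmetric] by (rule power_mult_distrib)
  thus ?thesis unfolding th gam_def by (simp add: mult_ac)
 qed
 have "summable (%n. of_real c*(of_real (gam m n)*l n*w^n))"
  using frac_deriv1_holomorphic(2)[OF h(1) z(1)] unfolding e .
 from summable_mult[OF this, of "1/of_real c"] show ?thesis using c by simp
qed

text \<open>The derivative of the image of the hump is the superposition of
  \<open>G (r k * z)\<close>. If \<open>G\<close> is too large along a sequence, the radii can be
  chosen so sparsely that one summand dominates at a suitable point and breaks the Bloch
  bound.\<close>

lemma multipliers_bloch_subset:
 assumes p: "0 < p" and mp: "1/p < real m + 1"
  and H: "\<And>r. (\<And>k. 0 < r k) ==> (\<And>k. r k < 1) ==> hump p m r \<in> H"
 shows "multipliers (seq_space H) (seq_space bloch) \<subseteq> lam_class m p"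
proof
 fix l assume l: "l \<in> multipliers (seq_space H) (seq_space bloch)"
 note sl = multiplier_radius[OF p mp H l]
 define e where "e = real m + 1 - 1/p"
 have e: "0 < e" using mp by (simp add: e_def)
 define G where "G = lam_fun m l"
 define b where "b n = of_real (gam m n)*l n" for n
 have sb: "summable (%n. cmod (b n)*t^n)" if "0 <= t" "t < 1" for t
  by (rule abs_summable_disk[OF _ that]) (simp add: b_def sl)
 define S where "S t = (\<Sum>n. cmod (b n)*t^n)" for t
 have S0: "0 <= S t" if "0 <= t" "t < 1" for t unfolding S_def by (rule suminf_nonneg[OF sb[OF that]]) (use that in auto)
 have Smono: "S t <= S t'" if "0 <= t" "t <= t'" "t' < 1" for t t'
  unfolding S_def by (rule suminf_le) (use that in "auto intro!: sb mult_left_mono power_mono")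
 have GS: "cmod (G w) <= S t" if "cmod w <= t" "t < 1" for w t
 proof -
  have r0: "0 <= t" using that norm_ge_zero[of w] by linarith
  have "cmod (\<Sum>n. b n*w^n) <= (\<Sum>n. cmod (b n)*t^n)"
   by (rule norm_suminf_le[OF _ sb[OF r0 that(2)]]) (use that in "auto simp: norm_mult norm_power intro!: mult_left_mono power_mono")
  thus ?thesis by (simp add: G_def lam_fun_def b_def S_def)
 qed
 \<comment> \<open>Boundedness of \<open>X\<close> is exactly the growth condition of
   \<open>lam_class\<close>, since \<open>e + 1 = m + 2 - 1/p\<close>.\<close>
 define X where "X w = cmod (G w)*(1 - cmod w) powr (e + 1)" for w
 show "l \<in> lam_class m p"
 proof (rule ccontr)
  assume nl: "l \<notin> lam_class m p"
  have unb: "\<exists>w. cmod w < 1 \<and> K < X w" for K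
  proof (rule ccontr)
   assume n: "\<nexists>w. cmod w < 1 \<and> K < X w"
   have "cmod (G w) <= K*(1 - cmod w) powr (1/p - real m - 2)" if w: "cmod w < 1" for w
   proof -
    have "X w <= K" using n w by force
    moreover have "(1 - cmod w) powr (e + 1)*(1 - cmod w) powr (1/p - real m - 2) = 1"
     using w by (simp add: e_def flip: powr_add)
    hence "cmod (G w) = X w*(1 - cmod w) powr (1/p - real m - 2)" by (simp add: X_def mult.assoc)
    ultimately show ?thesis by (simp add: mult_right_mono)
   qed
   thus False using nl sl unfolding lam_class_def G_def by blast
  qed
  \<comment> \<open>Requirements on the next point: radii do not decrease; the coefficient of the
    new hump is small against all values of \<open>G\<close> on the previous disk; and
    \<open>X\<close> is large enough to beat the coefficient and all other humps.\<close>
  define ok where "ok k w w' \<longleftrightarrow> sqrt (cmod w) <= sqrt (cmod w') \<and> (1 - sqrt (cmod w')) powr e*S (sqrt (cmod w)) <= 1 \<and>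
   2^Suc k*2 powr (e + 1)*(real k + 2 + 2*S (sqrt (cmod w))) <= X w'" for k w w'
  have "\<exists>w. \<forall>k. (0 < cmod (w k) \<and> cmod (w k) < 1) \<and> ok k (w k) (w (Suc k))"
  proof (rule dependent_nat_choice[where P = "%k w. 0 < cmod w \<and> cmod w < 1"])
   show "\<exists>x::complex. 0 < cmod x \<and> cmod x < 1" by (rule exI[of _ "1/2"]) (simp add: norm_divide)
   fix w :: complex and k assume w: "0 < cmod w \<and> cmod w < 1"
   define t where "t = sqrt (cmod w)"
   have t: "0 < t" "t < 1" using w by (auto simp: t_def)
   define \<eta> where "\<eta> = min (1 - t) ((1/(S t + 1)) powr (1/e))"
   have s0: "0 <= S t" using S0 t by simp
   have \<eta>: "0 < \<eta>" "\<eta> <= 1 - t" using t s0 by (auto simp: \<eta>_def)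
   have \<eta>S: "\<eta> powr e*S t <= 1"
   proof -
    have "\<eta> powr e <= ((1/(S t + 1)) powr (1/e)) powr e" using \<eta> e by (intro powr_mono2) (auto simp: \<eta>_def)
    also have "... = 1/(S t + 1)" using e s0 by (simp add: powr_powr)
    finally have "\<eta> powr e*S t <= 1/(S t + 1)*S t" using s0 by (rule mult_right_mono)
    also have "... <= 1" using s0 by (simp add: field_simps)
    finally show ?thesis .
   qed
   define R where "R = (1 - \<eta>)^2"
   have R: "0 <= R" "R < 1" using \<eta> t by (auto simp: R_def power_less_one_iff abs_square_less_1)
   \<comment> \<open>Exceeding \<open>S R\<close> forces \<open>w'\<close> out of the disk of radius
     \<open>R\<close>, which yields the first two requirements through
     \<open>\<eta>\<close>.\<close>
   obtain w' where w': "cmod w' < 1" "max (S R) (2^Suc k*2 powr (e + 1)*(real k + 2 + 2*S t)) < X w'" using unb by blast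
   have Rw: "R < cmod w'"
   proof (rule ccontr)
    assume "\<not> R < cmod w'"
    hence "cmod (G w') <= S R" by (intro GS R) simp
    moreover have "(1 - cmod w') powr (e + 1) <= 1" using w'(1) e by (intro powr_le1) auto
    ultimately have "X w' <= S R*1" unfolding X_def using S0[OF R] by (intro mult_mono) auto
    thus False using w'(2) by simp
   qed
   have "1 - \<eta> = sqrt R" using \<eta> t by (simp add: R_def)
   also have "... <= sqrt (cmod w')" using Rw by simp
   finally have q: "1 - \<eta> <= sqrt (cmod w')" .
   have "(1 - sqrt (cmod w')) powr e <= \<eta> powr e" using q w'(1) e by (intro powr_mono2) auto
   hence "(1 - sqrt (cmod w')) powr e*S t <= 1" using \<eta>S mult_right_mono[OF _ s0] by (meson order_trans)
   moreover have "t <= sqrt (cmod w')" using q \<eta> by linarith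
   moreover have "0 < cmod w'" using Rw R by linarith
   ultimately show "\<exists>y. (0 < cmod y \<and> cmod y < 1) \<and> ok k w y"
    using w' by (intro exI[of _ w']) (auto simp: ok_def t_def)
  qed
  then obtain w where w: "\<And>k. 0 < cmod (w k)" "\<And>k. cmod (w k) < 1" and ok: "\<And>k. ok k (w k) (w (Suc k))" by blast
  \<comment> \<open>With the square root, the test point \<open>w N/r N\<close> has modulus
    \<open>r N\<close> and is mapped by the dilation \<open>r N\<close> exactly onto
    \<open>w N\<close>.\<close>
  define r where "r k = sqrt (cmod (w k))" for k
  have r: "0 < r k" "r k < 1" for k using w[of k] by (auto simp: r_def)
  have rs: "r k <= r (Suc k)" for k using ok[of k] by (simp add: ok_def r_def)
  have rm: "r i <= r j" if "i <= j" for i j using that rs by (rule lift_Suc_mono_le[rotated])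
  have \<delta>S: "(1 - r (Suc k)) powr e*S (r k) <= 1" for k using ok[of k] by (simp add: ok_def r_def)
  have XS: "2^Suc k*2 powr (e + 1)*(real k + 2 + 2*S (r k)) <= X (w (Suc k))" for k using ok[of k] by (simp add: ok_def r_def)
  obtain h K where h: "hol h"
   "\<And>n. taylor_seq h n = l n*(of_nat ((n + m) choose m) * of_real (\<Sum>k. hump_coeff p m r k*r k^n))"
   and K: "\<And>z. cmod z < 1 ==> (1 - cmod z)*cmod (frac_deriv1 h z) <= K"
   by (rule hump_multiplier[where r = r, OF p mp r l H[OF r]]) blast
  note hc = hump_coeff[where r = r, OF p mp r]
  define c where "c = hump_coeff p m r"
  have ce: "c k = (1/2)^k*(1 - r k) powr e" for k by (simp add: c_def hump_coeff_def[where r = r, OF p mp r] e_def)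
  have c: "0 < c k" "c k <= (1/2)^k" "summable c" for k using hc by (simp_all add: c_def)
  have Fs: "(%k. of_real (c k)*G (of_real (r k)*z)) sums frac_deriv1 h z" if z: "cmod z < 1" for z
  proof -
   have "summable (%n. cmod (b n*z^n))" using sb[of "cmod z"] z by (simp add: norm_mult norm_power)
   from mixture_sums(2)[where r = r and c = c, OF this less_imp_le[OF c(1)] c(3) less_imp_le[OF r(1)] less_imp_le[OF r(2)]]
   have "(%k. of_real (c k)*G (of_real (r k)*z)) sums (\<Sum>n. b n * of_real (\<Sum>k. c k*r k^n)*z^n)"
    by (simp add: G_def lam_fun_def b_def)
   also have "(%n. b n * of_real (\<Sum>k. c k*r k^n)*z^n) = (%n. of_nat (n + 1)*taylor_seq h n*z^n)"
    by (simp add: fun_eq_iff h(2) b_def gam_def c_def mult_ac)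
   finally show ?thesis by (simp only: frac_deriv1_def)
  qed
  have "real k <= K" for k
  proof -
   define N where "N = Suc k"
   define z where "z = w N/of_real (r N)"
   have rr: "r N*r N = cmod (w N)" by (simp add: r_def)
   have z: "cmod z = r N" "of_real (r N)*z = w N" using r[of N] rr by (auto simp: z_def norm_divide field_simps)
   define A where "A = S (r k) + 1"
   have A: "1 <= A" using S0[of "r k"] r[of k] by (simp add: A_def)
   \<comment> \<open>Earlier humps evaluate \<open>G\<close> inside a disk already controlled by
     \<open>S (r k)\<close>. For later ones the argument stays in the disk of an earlier radius, and
     the power of \<open>1 - r j\<close> in the coefficient absorbs \<open>S\<close> there.\<close>
   have other: "cmod (if j = N then 0 else of_real (c j)*G (of_real (r j)*z)) <= (1/2)^j*A" for j
   proof (cases "j = N")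
    case True thus ?thesis using A by simp
   next
    case False
    have "cmod (of_real (c j)*G (of_real (r j)*z)) <= (1/2)^j*A"
    proof (cases "j < N")
     case True
     have "cmod (of_real (r j)*z) <= r j" using r[of j] r[of N] z by (simp add: norm_mult mult_left_le)
     hence "cmod (G (of_real (r j)*z)) <= S (r j)" by (rule GS) (rule r(2))
     also have "... <= S (r k)" using True r rm[of j k] by (intro Smono) (auto simp: N_def less_imp_le)
     also have "... <= A" by (simp add: A_def)
     finally have "c j*cmod (G (of_real (r j)*z)) <= (1/2)^j*A" using c(1,2)[of j] by (intro mult_mono) auto
     thus ?thesis using c(1)[of j] by (simp add: norm_mult)
    next
     case jN: False
     then obtain i where i: "j = Suc i" "N <= i" using False by (cases j) (auto simp: N_def)
     have "cmod (of_real (r j)*z) <= r N" using r[of j] r[of N] z by (simp add: norm_mult mult_left_le_one_le)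
     hence "cmod (G (of_real (r j)*z)) <= S (r N)" by (rule GS) (rule r(2))
     also have "... <= S (r i)" using r rm[OF i(2)] by (intro Smono) (auto simp: less_imp_le)
     finally have "(1 - r j) powr e*cmod (G (of_real (r j)*z)) <= (1 - r j) powr e*S (r i)" by (intro mult_left_mono) auto
     also have "... <= 1" using \<delta>S[of i] by (simp add: i)
     finally have "(1/2)^j*((1 - r j) powr e*cmod (G (of_real (r j)*z))) <= (1/2)^j*A" using A by (intro mult_left_mono) auto
     moreover have "cmod (of_real (c j)*G (of_real (r j)*z)) = c j*cmod (G (of_real (r j)*z))" using c(1)[of j] by (simp add: norm_mult)
     ultimately show ?thesis by (simp only: ce mult.assoc)
    qed
    thus ?thesis using False by simp
   qed
   have zN: "cmod z < 1" using z r[of N] by simp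
   have d1: "(%j. of_real (c j)*G (of_real (r j)*z) - (if j = N then of_real (c j)*G (of_real (r j)*z) else 0)) sums
    (frac_deriv1 h z - of_real (c N)*G (of_real (r N)*z))"
    by (rule sums_diff[OF Fs[OF zN] sums_single])
   moreover have "(%j. of_real (c j)*G (of_real (r j)*z) - (if j = N then of_real (c j)*G (of_real (r j)*z) else 0)) =
    (%j. if j = N then 0 else of_real (c j)*G (of_real (r j)*z))" by auto
   ultimately have "(%j. if j = N then 0 else of_real (c j)*G (of_real (r j)*z)) sums (frac_deriv1 h z - of_real (c N)*G (w N))"
    by (simp only: z(2))
   hence "frac_deriv1 h z - of_real (c N)*G (w N) = (\<Sum>j. if j = N then 0 else of_real (c j)*G (of_real (r j)*z))" by (simp only: sums_iff)
   moreover have "cmod (\<Sum>j. if j = N then 0 else of_real (c j)*G (of_real (r j)*z)) <= (\<Sum>j. (1/2)^j*A)"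
    by (rule norm_suminf_le[OF other]) (intro summable_mult2 summable_geometric, simp)
   moreover have "(\<Sum>j. (1/2)^j*A) = 2*A" by (subst suminf_mult2[symmetric]) (auto simp: suminf_geometric)
   ultimately have tail: "cmod (frac_deriv1 h z - of_real (c N)*G (w N)) <= 2*A" by simp
   have "c N*cmod (G (w N)) = cmod (of_real (c N)*G (w N))" using c(1)[of N] by (simp add: norm_mult)
   also have "... <= cmod (frac_deriv1 h z) + 2*A"
    using norm_triangle_ineq4[of "frac_deriv1 h z" "frac_deriv1 h z - of_real (c N)*G (w N)"] tail by simp
   finally have "(1 - r N)*(c N*cmod (G (w N))) <= (1 - r N)*(cmod (frac_deriv1 h z) + 2*A)" using r[of N] by (intro mult_left_mono) auto
   also have "... = (1 - cmod z)*cmod (frac_deriv1 h z) + (1 - r N)*(2*A)" using z by (simp add: algebra_simps)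
   also have "... <= K + 1*(2*A)" using r[of N] A by (intro add_mono K zN mult_right_mono) auto
   finally have up: "(1 - r N)*(c N*cmod (G (w N))) <= K + 2*A" by simp
   \<comment> \<open>Since \<open>1 - cmod (w N)\<close> is \<open>(1 - r N)*(1 + r N)\<close>; this
     loss is the factor \<open>2 powr (e + 1)\<close> provided for in \<open>ok\<close>.\<close>
   have half: "(1 - cmod (w N))/2 <= 1 - r N" 
   proof -
    have "2*r N <= 1 + cmod (w N)" using zero_le_power2[of "1 - r N"] rr by (simp add: power2_eq_square algebra_simps)
    thus ?thesis by (simp add: field_simps)
   qed
   have "(1 - r N)*(c N*cmod (G (w N))) = (1/2)^N*((1 - r N) powr (e + 1)*cmod (G (w N)))"
    using r[of N] by (simp add: ce powr_add)
   also have "... \<ge> (1/2)^N*(((1 - cmod (w N))/2) powr (e + 1)*cmod (G (w N)))"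
    using half w(2)[of N] e by (intro mult_left_mono mult_right_mono powr_mono2) auto
   also have "(1/2)^N*(((1 - cmod (w N))/2) powr (e + 1)*cmod (G (w N))) = (1/2)^N*(X (w N)/2 powr (e + 1))"
    using w(2)[of N] by (simp add: X_def powr_divide)
   also have "... \<ge> (1/2)^N*((2^N*2 powr (e + 1)*(real k + 2 + 2*S (r k)))/2 powr (e + 1))"
    using XS[of k] unfolding N_def by (intro mult_left_mono divide_right_mono) auto
   also have "(1/2)^N*((2^N*2 powr (e + 1)*(real k + 2 + 2*S (r k)))/2 powr (e + 1)) = real k + 2 + 2*S (r k)"
    by (simp add: power_divide)
   finally show "real k <= K" using up by (simp add: A_def)
  qed
  thus False using reals_Archimedean2[of K] by (meson not_le)
 qed
qed

theorem theorem8p2: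
  fixes p q :: real
  assumes "0 < p" "p < 1" "0 < q" "q \<le> 2"
  shows "multipliers (seq_space (hardy_lorentz p (ereal q))) (seq_space BMOA) = hardy_dual p \<and>
         hardy_dual p = multipliers (seq_space (hardy_lorentz p \<infinity>)) (seq_space bloch)"
proof -
 note p = assms(1,2) and q = assms(3,4)
 obtain m :: nat where m: "2/p <= real m" using real_arch_simple by blast
 have "0 < 2/p" using p by simp
 hence m1: "1 <= m" using m by (cases m) auto
 have mp: "1/p < real m + 1" using m p divide_right_mono[of 1 2 p] by simp
 have "2 <= real m*p" using m p by (simp add: field_simps)
 hence m2: "2 <= (real m + 2)*p" using p by (simp add: distrib_right)
 have "multipliers (seq_space (hardy_lorentz p (ereal q))) (seq_space BMOA) \<subseteq> multipliers (seq_space (hardy_lorentz p (ereal q))) (seq_space bloch)"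
  using BMOA_subset_bloch unfolding multipliers_def seq_space_def by blast
 also have "... \<subseteq> lam_class m p"
  by (rule multipliers_bloch_subset[OF p(1) mp hump_lorentz[OF p(1) mp _ _ q(1)]])
 finally have 1: "multipliers (seq_space (hardy_lorentz p (ereal q))) (seq_space BMOA) = lam_class m p"
  using lam_class_BMOA[OF _ m1 p q] by blast
 have 2: "hardy_dual p = lam_class m p" using dual_subset_lam_class[OF p(1) m2] lam_class_dual[OF _ m1 p] by blast
 have "multipliers (seq_space (hardy_lorentz p \<infinity>)) (seq_space bloch) \<subseteq> lam_class m p"
  by (rule multipliers_bloch_subset[OF p(1) mp hump_lorentz_infinity[OF p(1) mp]])
 hence 3: "multipliers (seq_space (hardy_lorentz p \<infinity>)) (seq_space bloch) = lam_class m p"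
  using lam_class_bloch[OF _ m1 p] by blast
 show ?thesis unfolding 1 2 3 by simp
qed

end
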